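(* Let $k$ be a field of characteristic $p$ (possibly $p=0$), and let $$A=k\langle X,Y\rangle/(X^a,\ XY-qYX,\ Y^b)$$ be a quantum complete intersection with $a,b\ge2$ and $q\in k$ nonzero and not a root of unity in $k$. Then $$\dim_k\widehat{\mathrm{HH}}_n(A,A)=\begin{cases}a+b-2 & \text{if } n=0,-1 \text{ and } p\nmid a,\ p\nmid b\\ a+b-1 & \text{if } n=0,-1 \text{ and } p\mid a \text{ or } p\mid b\\ a+b-2 & \text{if } n\neq0,-1 \text{ and } p\nmid a,\ p\nmid b\\ a+b-1 & \text{if } n\ne0,-1 \text{ and exactly one of } p\mid a,\ p\mid b \text{ holds}\\ a+b & \text{if } n\neq0,-1 \text{ and } p\mid a,\ p\mid b.\end{cases}$$
   Context: $n$ ranges over all of $\mathbb{Z}$. If $p=0$ then $p$ divides neither $a$ nor $b$. $A^e=A\otimes_kA^{op}$ is the enveloping algebra, which is selfinjective here; a bimodule $B$ is a left $A^e$-module via $(\lambda\otimes\lambda')b=\lambda b\lambda'$ and a right $A^e$-module via $b(\lambda\otimes\lambda')=\lambda'b\lambda$. A complete resolution of $A$ over $A^e$ is an acyclic complex $\mathbb{T}$ of finitely generated projective left $A^e$-modules, indexed by $\mathbb{Z}$, such that $\mathrm{Hom}_{A^e}(\mathbb{T},A^e)$ is acyclic and such that there are a projective resolution $\mathbb{P}$ of $A$ and a chain map $f\colon\mathbb{T}\to\mathbb{P}$ with $f_n$ bijective for $n\ge 0$. For $n\in\mathbb{Z}$ and a bimodule $B$, Tate-Hochschild homology is $\widehat{\mathrm{HH}}_n(A,B)=\widehat{\mathrm{Tor}}^{A^e}_n(B,A)=H_n(B\otimes_{A^e}\mathbb{T})$.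 *)

theory Defs
  imports
    "Jordan_Normal_Form.Missing_VectorSpace"
    "HOL-Algebra.Free_Abelian_Groups"
    "HOL-Algebra.QuotRing"
begin

text \<open>
  Structures are records with explicit carriers, as in HOL-Algebra. A record of type
  \<open>('r, 'm) module\<close> also has the fields \<open>mult\<close> and \<open>one\<close>; they carry no information (and are set
  to \<open>undefined\<close> or to leftover values) unless the record stands for an algebra.
\<close>

section \<open>Modules over a noncommutative ring\<close>

text \<open>The library locale \<open>module\<close> requires a commutative ring of scalars.\<close>

locale left_module = R?: ring R + M?: abelian_group M
  for R :: "('r, 'e) ring_scheme" (structure) and M :: "('r, 'm, 'f) module_scheme" (structure) +
  assumes lsmult_closed: "\<lbrakk>r \<in> carrier R; x \<in> carrier M\<rbrakk> \<Longrightarrow> r \<odot>\<^bsub>M\<^esub> x \<in> carrier M"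
    and lsmult_l_distr: "\<lbrakk>r \<in> carrier R; s \<in> carrier R; x \<in> carrier M\<rbrakk>
      \<Longrightarrow> (r \<oplus> s) \<odot>\<^bsub>M\<^esub> x = r \<odot>\<^bsub>M\<^esub> x \<oplus>\<^bsub>M\<^esub> s \<odot>\<^bsub>M\<^esub> x"
    and lsmult_r_distr: "\<lbrakk>r \<in> carrier R; x \<in> carrier M; y \<in> carrier M\<rbrakk>
      \<Longrightarrow> r \<odot>\<^bsub>M\<^esub> (x \<oplus>\<^bsub>M\<^esub> y) = r \<odot>\<^bsub>M\<^esub> x \<oplus>\<^bsub>M\<^esub> r \<odot>\<^bsub>M\<^esub> y"
    and lsmult_assoc: "\<lbrakk>r \<in> carrier R; s \<in> carrier R; x \<in> carrier M\<rbrakk>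
      \<Longrightarrow> (r \<otimes> s) \<odot>\<^bsub>M\<^esub> x = r \<odot>\<^bsub>M\<^esub> (s \<odot>\<^bsub>M\<^esub> x)"
    and lsmult_one: "x \<in> carrier M \<Longrightarrow> \<one> \<odot>\<^bsub>M\<^esub> x = x"

text \<open>A right \<open>R\<close>-module is a left module over the opposite ring: \<open>r \<odot> x\<close> stands for \<open>x r\<close>.\<close>

definition opposite :: "('k, 'a) module \<Rightarrow> ('k, 'a) module"
  where "opposite A = A\<lparr>mult := \<lambda>x y. y \<otimes>\<^bsub>A\<^esub> x\<rparr>"

definition left_regular :: "('r, 'e) ring_scheme \<Rightarrow> ('r, 'r) module"
  where "left_regular R =
    \<lparr>carrier = carrier R, mult = mult R, one = one R, ring.zero = ring.zero R, add = add R,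
     smult = mult R\<rparr>"

definition free_module :: "('r, 'e) ring_scheme \<Rightarrow> 'i set \<Rightarrow> ('r, 'i \<Rightarrow> 'r) module"
  where "free_module R I =
    \<lparr>carrier = {f. range f \<subseteq> carrier R \<and> finite {i. f i \<noteq> \<zero>\<^bsub>R\<^esub>} \<and> {i. f i \<noteq> \<zero>\<^bsub>R\<^esub>} \<subseteq> I},
     mult = undefined, one = undefined,
     ring.zero = (\<lambda>i. \<zero>\<^bsub>R\<^esub>), add = (\<lambda>f g i. f i \<oplus>\<^bsub>R\<^esub> g i), smult = (\<lambda>r f i. r \<otimes>\<^bsub>R\<^esub> f i)\<rparr>"

definition finitely_generated :: "('r, 'e) ring_scheme \<Rightarrow> ('r, 'm) module \<Rightarrow> bool"
  where "finitely_generated R M \<longleftrightarrow>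
    (\<exists>S. finite S \<and> S \<subseteq> carrier M \<and>
      (\<forall>x \<in> carrier M. \<exists>c \<in> S \<rightarrow> carrier R. x = (\<Oplus>\<^bsub>M\<^esub>s\<in>S. c s \<odot>\<^bsub>M\<^esub> s)))"

text \<open>
  Projective: a direct summand of a free module. Taking the rank from subsets of the element type
  loses nothing, since every module is a quotient of the free module on its carrier.
\<close>

definition projective :: "('r, 'e) ring_scheme \<Rightarrow> ('r, 'm) module \<Rightarrow> bool"
  where "projective R M \<longleftrightarrow>
    left_module R M \<and>
    (\<exists>(I :: 'm set) s. \<exists>t \<in> module_hom R (free_module R I) M.
      s \<in> module_hom R M (free_module R I) \<and> (\<forall>x \<in> carrier M. t (s x) = x))"

definition quotient_module :: "('k, 'v, 'e) module_scheme \<Rightarrow> 'v set \<Rightarrow> ('k, 'v set) module"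
  where "quotient_module V W =
    \<lparr>carrier = carrier (V Quot W), mult = mult (V Quot W), one = one (V Quot W),
     ring.zero = ring.zero (V Quot W), add = add (V Quot W),
     smult = (\<lambda>c U. \<Union>u\<in>U. W +>\<^bsub>V\<^esub> (c \<odot>\<^bsub>V\<^esub> u))\<rparr>"

text \<open>The library's \<open>dim\<close> is only meaningful for finite-dimensional spaces.\<close>

definition has_dimension :: "('k, 'e) ring_scheme \<Rightarrow> ('k, 'v) module \<Rightarrow> nat \<Rightarrow> bool"
  where "has_dimension K V m \<longleftrightarrow>
    vectorspace K V \<and> vectorspace.fin_dim K V \<and> vectorspace.dim K V = m"

definition has_characteristic :: "('k, 'e) ring_scheme \<Rightarrow> nat \<Rightarrow> bool"
  where "has_characteristic K p \<longleftrightarrow> (\<forall>m :: nat. [m] \<cdot>\<^bsub>K\<^esub> \<one>\<^bsub>K\<^esub> = \<zero>\<^bsub>K\<^esub> \<longleftrightarrow> p dvd m)"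


section \<open>Tensor products\<close>

text \<open>
  \<open>M \<otimes>\<^sub>R N\<close>, for \<open>M\<close> a right and \<open>N\<close> a left \<open>R\<close>-module, is the free abelian group on
  \<open>M \<times> N\<close> modulo the usual relations.
\<close>

definition tensor_relations ::
  "('r, 'e) ring_scheme \<Rightarrow> ('r, 'm, 'f) module_scheme \<Rightarrow> ('r, 'n, 'g) module_scheme
    \<Rightarrow> ('m \<times> 'n \<Rightarrow>\<^sub>0 int) set"
  where "tensor_relations R M N =
    {frag_of (x \<oplus>\<^bsub>M\<^esub> x', y) - frag_of (x, y) - frag_of (x', y) | x x' y.
       x \<in> carrier M \<and> x' \<in> carrier M \<and> y \<in> carrier N} \<union>
    {frag_of (x, y \<oplus>\<^bsub>N\<^esub> y') - frag_of (x, y) - frag_of (x, y') | x y y'.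
       x \<in> carrier M \<and> y \<in> carrier N \<and> y' \<in> carrier N} \<union>
    {frag_of (r \<odot>\<^bsub>M\<^esub> x, y) - frag_of (x, r \<odot>\<^bsub>N\<^esub> y) | r x y.
       r \<in> carrier R \<and> x \<in> carrier M \<and> y \<in> carrier N}"

definition tensor_kernel ::
  "('r, 'e) ring_scheme \<Rightarrow> ('r, 'm, 'f) module_scheme \<Rightarrow> ('r, 'n, 'g) module_scheme
    \<Rightarrow> ('m \<times> 'n \<Rightarrow>\<^sub>0 int) set"
  where "tensor_kernel R M N =
    generate (free_Abelian_group (carrier M \<times> carrier N)) (tensor_relations R M N)"

definition tensor_group ::
  "('r, 'e) ring_scheme \<Rightarrow> ('r, 'm, 'f) module_scheme \<Rightarrow> ('r, 'n, 'g) module_scheme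
    \<Rightarrow> ('m \<times> 'n \<Rightarrow>\<^sub>0 int) set monoid"
  where "tensor_group R M N =
    free_Abelian_group (carrier M \<times> carrier N) Mod tensor_kernel R M N"

definition tensor_class ::
  "('r, 'e) ring_scheme \<Rightarrow> ('r, 'm, 'f) module_scheme \<Rightarrow> ('r, 'n, 'g) module_scheme
    \<Rightarrow> ('m \<times> 'n \<Rightarrow>\<^sub>0 int) \<Rightarrow> ('m \<times> 'n \<Rightarrow>\<^sub>0 int) set"
  where "tensor_class R M N u =
    tensor_kernel R M N #>\<^bsub>free_Abelian_group (carrier M \<times> carrier N)\<^esub> u"

text \<open>
  \<open>M \<otimes>\<^sub>R N\<close> as a \<open>k\<close>-space, where \<open>sc\<close> is the action of \<open>k\<close> on \<open>M\<close>: \<open>c (x \<otimes> y) = (c x) \<otimes> y\<close>.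
  Here and below, operations on classes are unions over representatives, as in the library's
  \<open>rcoset_mult\<close>; all the cosets united coincide.
\<close>

definition tensor_space ::
  "('r, 'e) ring_scheme \<Rightarrow> ('k \<Rightarrow> 'm \<Rightarrow> 'm) \<Rightarrow> ('r, 'm, 'f) module_scheme
    \<Rightarrow> ('r, 'n, 'g) module_scheme \<Rightarrow> ('k, ('m \<times> 'n \<Rightarrow>\<^sub>0 int) set) module"
  where "tensor_space R sc M N =
    \<lparr>carrier = carrier (tensor_group R M N), mult = undefined, one = undefined,
     ring.zero = one (tensor_group R M N), add = mult (tensor_group R M N),
     smult = (\<lambda>c U. \<Union>u\<in>U. tensor_class R M N (frag_extend (\<lambda>(x, y). frag_of (sc c x, y)) u))\<rparr>"

text \<open>\<open>(x \<otimes> y) (x' \<otimes> y') = x x' \<otimes> y y'\<close>\<close>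

definition tensor_algebra ::
  "('k, 'e) ring_scheme \<Rightarrow> ('k, 'a) module \<Rightarrow> ('k, 'b) module
    \<Rightarrow> ('k, ('a \<times> 'b \<Rightarrow>\<^sub>0 int) set) module"
  where "tensor_algebra K A B = (tensor_space K (smult A) A B)
    \<lparr>mult := (\<lambda>U V. \<Union>u\<in>U. \<Union>v\<in>V. tensor_class K A B
        (frag_extend (\<lambda>(x, y). frag_extend (\<lambda>(x', y'). frag_of (x \<otimes>\<^bsub>A\<^esub> x', y \<otimes>\<^bsub>B\<^esub> y')) v) u)),
     one := tensor_class K A B (frag_of (\<one>\<^bsub>A\<^esub>, \<one>\<^bsub>B\<^esub>))\<rparr>"

definition tensor_map_right ::
  "('r, 'e) ring_scheme \<Rightarrow> ('r, 'm, 'f) module_scheme \<Rightarrow> ('r, 'n, 'g) module_scheme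
    \<Rightarrow> ('n' \<Rightarrow> 'n) \<Rightarrow> ('m \<times> 'n' \<Rightarrow>\<^sub>0 int) set \<Rightarrow> ('m \<times> 'n \<Rightarrow>\<^sub>0 int) set"
  where "tensor_map_right R M N h U =
    (\<Union>u\<in>U. tensor_class R M N (frag_extend (\<lambda>(x, y). frag_of (x, h y)) u))"

text \<open>The map \<open>M \<otimes>\<^sub>R N \<rightarrow> B\<close> induced by a balanced map \<open>g\<close> on \<open>M \<times> N\<close>: \<open>x \<otimes> y \<mapsto> g (x, y)\<close>.\<close>

definition tensor_induced ::
  "('b, 'e) ring_scheme \<Rightarrow> ('m \<times> 'n \<Rightarrow> 'b) \<Rightarrow> ('m \<times> 'n \<Rightarrow>\<^sub>0 int) set \<Rightarrow> 'b"
  where "tensor_induced B g U =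
    (THE w. \<exists>u\<in>U. w = (\<Oplus>\<^bsub>B\<^esub>z\<in>Poly_Mapping.keys u. [Poly_Mapping.lookup u z] \<cdot>\<^bsub>B\<^esub> g z))"


section \<open>Bimodules and the enveloping algebra\<close>

type_synonym 'a env = "('a \<times> 'a \<Rightarrow>\<^sub>0 int) set"

record ('a, 'b) bimodule = "('a, 'b) module" +
  rsmult :: "'b \<Rightarrow> 'a \<Rightarrow> 'b"

definition regular_bimodule :: "('k, 'a) module \<Rightarrow> ('a, 'a) bimodule"
  where "regular_bimodule A =
    \<lparr>carrier = carrier A, mult = mult A, one = one A, ring.zero = ring.zero A, add = add A,
     smult = mult A, rsmult = mult A\<rparr>"

definition enveloping :: "('k, 'e) ring_scheme \<Rightarrow> ('k, 'a) module
    \<Rightarrow> ('k, 'a env) module"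
  where "enveloping K A = tensor_algebra K A (opposite A)"

definition env_left :: "('a, 'b) bimodule \<Rightarrow> ('a env, 'b) module"
  where "env_left B =
    \<lparr>carrier = carrier B, mult = mult B, one = one B, ring.zero = ring.zero B, add = add B,
     smult = (\<lambda>U b. tensor_induced B (\<lambda>(l, l'). rsmult B (l \<odot>\<^bsub>B\<^esub> b) l') U)\<rparr>"

text \<open>The right module structure \<open>b (l \<otimes> l') = l' b l\<close>, with the scalar written on the left.\<close>

definition env_right :: "('a, 'b) bimodule \<Rightarrow> ('a env, 'b) module"
  where "env_right B =
    \<lparr>carrier = carrier B, mult = mult B, one = one B, ring.zero = ring.zero B, add = add B,
     smult = (\<lambda>U b. tensor_induced B (\<lambda>(l, l'). rsmult B (l' \<odot>\<^bsub>B\<^esub> b) l) U)\<rparr>"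


section \<open>Complexes and complete resolutions\<close>

text \<open>A complex is a family of modules indexed by the integers, with differentials
  \<open>d n : C n \<rightarrow> C (n - 1)\<close>.\<close>

definition chain_complex ::
  "('r, 'e) ring_scheme \<Rightarrow> (int \<Rightarrow> ('r, 'm) module) \<Rightarrow> (int \<Rightarrow> 'm \<Rightarrow> 'm) \<Rightarrow> bool"
  where "chain_complex R C d \<longleftrightarrow>
    (\<forall>n. left_module R (C n) \<and> d n \<in> module_hom R (C n) (C (n - 1)) \<and>
      (\<forall>x \<in> carrier (C n). d (n - 1) (d n x) = \<zero>\<^bsub>C (n - 2)\<^esub>))"

definition cycles :: "(int \<Rightarrow> ('m, 'f) ring_scheme) \<Rightarrow> (int \<Rightarrow> 'm \<Rightarrow> 'm) \<Rightarrow> int \<Rightarrow> 'm set"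
  where "cycles C d n = {x \<in> carrier (C n). d n x = \<zero>\<^bsub>C (n - 1)\<^esub>}"

definition boundaries :: "(int \<Rightarrow> ('m, 'f) ring_scheme) \<Rightarrow> (int \<Rightarrow> 'm \<Rightarrow> 'm) \<Rightarrow> int \<Rightarrow> 'm set"
  where "boundaries C d n = d (n + 1) ` carrier (C (n + 1))"

definition exact_at :: "(int \<Rightarrow> ('m, 'f) ring_scheme) \<Rightarrow> (int \<Rightarrow> 'm \<Rightarrow> 'm) \<Rightarrow> int \<Rightarrow> bool"
  where "exact_at C d n \<longleftrightarrow> cycles C d n = boundaries C d n"

definition acyclic_complex :: "(int \<Rightarrow> ('m, 'f) ring_scheme) \<Rightarrow> (int \<Rightarrow> 'm \<Rightarrow> 'm) \<Rightarrow> bool"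
  where "acyclic_complex C d \<longleftrightarrow> (\<forall>n. exact_at C d n)"

definition homology ::
  "(int \<Rightarrow> ('k, 'v) module) \<Rightarrow> (int \<Rightarrow> 'v \<Rightarrow> 'v) \<Rightarrow> int \<Rightarrow> ('k, 'v set) module"
  where "homology C d n = quotient_module ((C n)\<lparr>carrier := cycles C d n\<rparr>) (boundaries C d n)"

text \<open>Homomorphisms are made extensional, so that equal homomorphisms are equal functions.\<close>

definition hom_group ::
  "('r, 'e) ring_scheme \<Rightarrow> ('r, 'm) module \<Rightarrow> ('r, 'n) module \<Rightarrow> ('m \<Rightarrow> 'n) ring"
  where "hom_group R M N =
    \<lparr>carrier = module_hom R M N \<inter> extensional (carrier M), mult = undefined, one = undefined,
     ring.zero = (\<lambda>x\<in>carrier M. \<zero>\<^bsub>N\<^esub>), add = (\<lambda>f g. \<lambda>x\<in>carrier M. f x \<oplus>\<^bsub>N\<^esub> g x)\<rparr>"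

text \<open>\<open>Hom\<^sub>R (C, N)\<close> has \<open>Hom\<^sub>R (C (- n), N)\<close> in degree \<open>n\<close>, so that its differential,
  precomposition with \<open>d\<close>, again lowers the degree.\<close>

definition hom_complex ::
  "('r, 'e) ring_scheme \<Rightarrow> (int \<Rightarrow> ('r, 'm) module) \<Rightarrow> ('r, 'n) module \<Rightarrow> int \<Rightarrow> ('m \<Rightarrow> 'n) ring"
  where "hom_complex R C N n = hom_group R (C (- n)) N"

definition hom_differential ::
  "(int \<Rightarrow> ('r, 'm) module) \<Rightarrow> (int \<Rightarrow> 'm \<Rightarrow> 'm) \<Rightarrow> int \<Rightarrow> ('m \<Rightarrow> 'n) \<Rightarrow> 'm \<Rightarrow> 'n"
  where "hom_differential C d n f = restrict (f \<circ> d (1 - n)) (carrier (C (1 - n)))"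

definition chain_map ::
  "('r, 'e) ring_scheme \<Rightarrow> (int \<Rightarrow> ('r, 'm) module) \<Rightarrow> (int \<Rightarrow> 'm \<Rightarrow> 'm)
    \<Rightarrow> (int \<Rightarrow> ('r, 'n) module) \<Rightarrow> (int \<Rightarrow> 'n \<Rightarrow> 'n) \<Rightarrow> (int \<Rightarrow> 'm \<Rightarrow> 'n) \<Rightarrow> bool"
  where "chain_map R C d C' d' f \<longleftrightarrow>
    (\<forall>n. f n \<in> module_hom R (C n) (C' n) \<and>
      (\<forall>x \<in> carrier (C n). f (n - 1) (d n x) = d' n (f n x)))"

definition projective_resolution ::
  "('r, 'e) ring_scheme \<Rightarrow> ('r, 'b) module \<Rightarrow> (int \<Rightarrow> ('r, 'm) module) \<Rightarrow> (int \<Rightarrow> 'm \<Rightarrow> 'm)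
    \<Rightarrow> ('m \<Rightarrow> 'b) \<Rightarrow> bool"
  where "projective_resolution R M P d \<epsilon> \<longleftrightarrow>
    chain_complex R P d \<and> (\<forall>n. projective R (P n)) \<and>
    (\<forall>n < 0. carrier (P n) = {\<zero>\<^bsub>P n\<^esub>}) \<and> (\<forall>n > 0. exact_at P d n) \<and>
    \<epsilon> \<in> module_hom R (P 0) M \<and> \<epsilon> ` carrier (P 0) = carrier M \<and>
    {x \<in> carrier (P 0). \<epsilon> x = \<zero>\<^bsub>M\<^esub>} = boundaries P d 0"

text \<open>The elements of \<open>P\<close> may be given the same type as those of \<open>T\<close> without loss of generality,
  because \<open>P n\<close> is isomorphic to \<open>T n\<close> for \<open>n \<ge> 0\<close> and zero otherwise.\<close>

definition complete_resolution ::
  "('r, 'e) ring_scheme \<Rightarrow> ('r, 'b) module \<Rightarrow> (int \<Rightarrow> ('r, 'm) module) \<Rightarrow> (int \<Rightarrow> 'm \<Rightarrow> 'm) \<Rightarrow> bool"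
  where "complete_resolution R M T d \<longleftrightarrow>
    chain_complex R T d \<and> (\<forall>n. finitely_generated R (T n) \<and> projective R (T n)) \<and>
    acyclic_complex T d \<and>
    acyclic_complex (hom_complex R T (left_regular R))
      (hom_differential T d :: int \<Rightarrow> ('m \<Rightarrow> 'r) \<Rightarrow> 'm \<Rightarrow> 'r) \<and>
    (\<exists>(P :: int \<Rightarrow> ('r, 'm) module) \<delta> \<epsilon> f.
      projective_resolution R M P \<delta> \<epsilon> \<and> chain_map R T d P \<delta> f \<and>
      (\<forall>n \<ge> 0. bij_betw (f n) (carrier (T n)) (carrier (P n))))"


section \<open>Tate-Hochschild homology\<close>

text \<open>\<open>H\<^sub>n (B \<otimes> T)\<close> over the enveloping algebra of \<open>A\<close>, as a vector space over \<open>k\<close>; here \<open>k\<close> acts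
  on the bimodule \<open>B\<close> through \<open>k \<rightarrow> A\<close>. To be used with \<open>T\<close> a complete resolution of \<open>A\<close>.\<close>

definition tate_hochschild_homology ::
  "('k, 'e) ring_scheme \<Rightarrow> ('k, 'a) module \<Rightarrow> ('a, 'b) bimodule
    \<Rightarrow> (int \<Rightarrow> ('a env, 't) module) \<Rightarrow> (int \<Rightarrow> 't \<Rightarrow> 't) \<Rightarrow> int
    \<Rightarrow> ('k, ('b \<times> 't \<Rightarrow>\<^sub>0 int) set set) module"
  where "tate_hochschild_homology K A B T d =
    homology
      (\<lambda>n. tensor_space (enveloping K A) (\<lambda>c b. (c \<odot>\<^bsub>A\<^esub> \<one>\<^bsub>A\<^esub>) \<odot>\<^bsub>B\<^esub> b) (env_right B) (T n))
      (\<lambda>n. tensor_map_right (enveloping K A) (env_right B) (T (n - 1)) (d n))"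


section \<open>Quantum complete intersections\<close>

text \<open>The free algebra on a set of generators: finitely supported functions on words,
  multiplied by convolution.\<close>

definition free_algebra :: "('k, 'e) ring_scheme \<Rightarrow> ('k, 'g list \<Rightarrow> 'k) module"
  where "free_algebra K = (free_module K UNIV)
    \<lparr>mult := (\<lambda>f g w. \<Oplus>\<^bsub>K\<^esub>i\<in>{..length w}. f (take i w) \<otimes>\<^bsub>K\<^esub> g (drop i w)),
     one := (\<lambda>w. if w = [] then \<one>\<^bsub>K\<^esub> else \<zero>\<^bsub>K\<^esub>)\<rparr>"

definition word_monomial :: "('k, 'e) ring_scheme \<Rightarrow> 'g list \<Rightarrow> 'g list \<Rightarrow> 'k"
  where "word_monomial K w = (\<lambda>v. if v = w then \<one>\<^bsub>K\<^esub> else \<zero>\<^bsub>K\<^esub>)"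

datatype xy = GenX | GenY

type_synonym 'k qci = "(xy list \<Rightarrow> 'k) set"

definition qci_relations :: "('k, 'e) ring_scheme \<Rightarrow> nat \<Rightarrow> nat \<Rightarrow> 'k \<Rightarrow> (xy list \<Rightarrow> 'k) set"
  where "qci_relations K a b q =
    {word_monomial K (replicate a GenX),
     word_monomial K [GenX, GenY]
       \<ominus>\<^bsub>free_algebra K\<^esub> q \<odot>\<^bsub>free_algebra K\<^esub> word_monomial K [GenY, GenX],
     word_monomial K (replicate b GenY)}"

definition quantum_complete_intersection ::
  "('k, 'e) ring_scheme \<Rightarrow> nat \<Rightarrow> nat \<Rightarrow> 'k \<Rightarrow> ('k, 'k qci) module"
  where "quantum_complete_intersection K a b q =
    quotient_module (free_algebra K) (Idl\<^bsub>free_algebra K\<^esub> (qci_relations K a b q))"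

end

theory Submission imports Defs begin

text \<open>
  For a Frobenius algebra \<open>A\<close>, a free resolution over the enveloping algebra, continued to the left by
  its transposed matrices twisted by the Nakayama automorphism and glued by the Casimir element
  \<open>\<Delta>\<close>, is a complete resolution. Here the resolution is the tensor product of the periodic resolutions
  of \<open>k[x]/(x\<^sup>a)\<close> and \<open>k[y]/(y\<^sup>b)\<close>, twisted by powers of \<open>q\<close>. Tensored with \<open>A\<close> it becomes, in the
  monomial basis, a product of two families of arrows. In weight \<open>(s, t)\<close> the coefficients of the first
  are \<open>1 - q\<^sup>t\<close> and \<open>1 + q\<^sup>t + \<dots> + q\<^sup>(\<^sup>a\<^sup>-\<^sup>1\<^sup>)\<^sup>t\<close>, those of the second are similar in \<open>s\<close>. Since \<open>q\<close> is not a
  root of unity, they vanish only for \<open>t = 0\<close> (resp. \<open>s = 0\<close>), where they are \<open>0\<close> and \<open>a\<close> (resp. \<open>b\<close>), so the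
  homology lives on the two axes and can be counted there. Between degrees \<open>0\<close> and \<open>-1\<close>, \<open>\<Delta>\<close> maps \<open>1\<close> to
  \<open>ab\<close> times the socle element and kills the other monomials.
\<close>

\<comment> \<open>The theorem concerns every complete resolution, so the explicit one has to be
  compared with an arbitrary one. In positive degrees this is the usual lifting of chain maps. In
  negative degrees maps must be extended along differentials, which is possible because Hom into the
  ring is acyclic and the terms of the target are summands of finite free modules. The comparison
  runs outwards from degree 0 and carries an invariant that serves both directions.

  The other obstacle is acyclicity of Hom for the explicit complex, a statement about columns
  instead of rows. The contraction of the positive half is linear over \<open>k\<close> only and
  cannot simply be dualised over the enveloping algebra. But that algebra is Frobenius too, so every
  \<open>k\<close>-linear functional is a multiplication followed by the form, and this converts the
  contraction into a statement about columns. The same duality explains the negative half after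
  tensoring with \<open>A\<close>: in dual coordinates its differential is the transpose of the
  positive one. Arrows are reversed, coefficients and survivors stay, and one count serves degrees
  \<open>n\<close> and \<open>-1 - n\<close>.\<close>
syntax (input) "_index" :: "logic \<Rightarrow> index" ("\<^sub>_" [1000])

abbreviation (input) carrier_mem (infix ".:" 50) where "x .: M \<equiv> x \<in> carrier M"

section \<open>Additive maps between abelian groups\<close>

lemma (in abelian_monoid) finsum_eqI:
  assumes "!!i. i \<in> A ==> f i = g i" and "!!i. i \<in> A ==> g i .: G" shows "finsum G f A = finsum G g A" using assms by (intro finsum_cong') auto

text \<open>Formulated for bare functions that are additive on carriers, so that the same facts
  serve module homomorphisms, either argument of an action, coordinate functionals and maps out of
  tensor products.\<close>

lemma additive_zero:
  assumes M: "abelian_group M" and N: "abelian_group N" and c: "!!x. x .: M ==> f x .: N"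
    and a: "!!x y. [|x .: M; y .: M|] ==> f (x \<oplus>\<^sub>M y) = f x \<oplus>\<^sub>N f y" shows "f \<zero>\<^sub>M = \<zero>\<^sub>N"
proof -
  interpret M: abelian_group M by fact
  interpret N: abelian_group N by fact
  have "f \<zero>\<^sub>M \<oplus>\<^sub>N f \<zero>\<^sub>M = f \<zero>\<^sub>M" using a[of "\<zero>\<^sub>M" "\<zero>\<^sub>M"] by simp
  then show ?thesis using c[of "\<zero>\<^sub>M"] by (simp add: N.add.l_cancel_one)
qed

lemma additive_neg:
  assumes M: "abelian_group M" and N: "abelian_group N" and c: "!!x. x .: M ==> f x .: N"
    and a: "!!x y. [|x .: M; y .: M|] ==> f (x \<oplus>\<^sub>M y) = f x \<oplus>\<^sub>N f y" and x: "x .: M"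
  shows "f (\<ominus>\<^sub>M x) = \<ominus>\<^sub>N f x"
proof -
  interpret M: abelian_group M by fact
  interpret N: abelian_group N by fact
  have "f (\<ominus>\<^sub>M x) \<oplus>\<^sub>N f x = \<zero>\<^sub>N" using a[of "\<ominus>\<^sub>M x" x] additive_zero[OF M N c a] x by (simp add: M.l_neg)
  then show ?thesis using c x by (metis M.a_inv_closed N.minus_equality)
qed

lemma additive_diff:
  assumes M: "abelian_group M" and N: "abelian_group N" and c: "!!x. x .: M ==> f x .: N"
    and a: "!!x y. [|x .: M; y .: M|] ==> f (x \<oplus>\<^sub>M y) = f x \<oplus>\<^sub>N f y" and x: "x .: M" and y: "y .: M"
  shows "f (x \<ominus>\<^sub>M y) = f x \<ominus>\<^sub>N f y" using assms additive_neg[OF M N c a y] abelian_group.a_inv_closed[OF M y]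
  by (simp add: a_minus_def)

lemma additive_finsum:
  assumes M: "abelian_group M" and N: "abelian_group N" and c: "!!x. x .: M ==> f x .: N"
    and a: "!!x y. [|x .: M; y .: M|] ==> f (x \<oplus>\<^sub>M y) = f x \<oplus>\<^sub>N f y" and u: "!!i. i \<in> I ==> u i .: M"
  shows "f (\<Oplus>\<^sub>M i\<in>I. u i) = (\<Oplus>\<^sub>N i\<in>I. f (u i))"
proof -
  interpret M: abelian_group M by fact
  interpret N: abelian_group N by fact
  show ?thesis
  proof (cases "finite I")
    case True
    then show ?thesis using u
    proof (induction I rule: finite_induct)
      case empty
      then show ?case using additive_zero[OF M N c a] by simp
    next
      case (insert i I)
      have "u \<in> I \<rightarrow> carrier M" "u i .: M" using insert.prems by auto
      moreover have "(%j. f (u j)) \<in> I \<rightarrow> carrier N" "f (u i) .: N" using insert.prems c by auto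
      moreover have "(\<Oplus>\<^sub>M j\<in>I. u j) .: M" using insert.prems by (intro M.finsum_closed) auto
      ultimately show ?case using insert a by (simp)
    qed
  next
    case False
    then show ?thesis using additive_zero[OF M N c a] by (simp add: M.finsum_infinite N.finsum_infinite)
  qed
qed

section \<open>Homomorphisms of left modules\<close>

lemma module_homI:
  assumes "!!x. x .: M ==> f x .: N" and "!!x y. [|x .: M; y .: M|] ==> f (x \<oplus>\<^sub>M y) = f x \<oplus>\<^sub>N f y"
    and "!!r x. [|r .: R; x .: M|] ==> f (r \<odot>\<^sub>M x) = r \<odot>\<^sub>N f x" shows "f \<in> module_hom R M N"
  using assms by (auto simp: module_hom_def)

lemma module_hom_mem: "[|f \<in> module_hom R M N; x .: M|] ==> f x .: N"
  by (auto simp: module_hom_def)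

lemma module_hom_compose:
  assumes "f \<in> module_hom R L M" "g \<in> module_hom R M N" shows "(%x. g (f x)) \<in> module_hom R L N" using assms by (auto simp: module_hom_def Pi_iff)

text \<open>Homomorphisms are constrained only on the carrier, so a function may be changed outside
  it, for instance to make it extensional as \<open>hom_group\<close> demands.\<close>

lemma module_hom_cong:
  assumes f: "f \<in> module_hom R M N" and M: "left_module R M" and e: "!!x. x .: M ==> g x = f x" shows "g \<in> module_hom R M N"
proof -
  interpret M: left_module R M by fact
  show ?thesis using f e by (intro module_homI)
      (auto simp: module_hom_mem module_hom_add module_hom_smult M.lsmult_closed)
qed

lemma (in left_module) abelian_group_M: "abelian_group M" ..

lemma left_module_abelian: "left_module R M ==> abelian_group M"
  by (simp add: left_module.abelian_group_M)

lemma left_module_ring: "left_module R M ==> ring R"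
  by (simp add: left_module_def)

lemma (in left_module) lsmult_r_null: "r .: R ==> r \<odot>\<^sub>M \<zero>\<^sub>M = \<zero>\<^sub>M"
  by (rule additive_zero[OF abelian_group_M abelian_group_M])
    (auto simp: lsmult_closed lsmult_r_distr)

lemma (in left_module) lsmult_l_null: "x .: M ==> \<zero>\<^sub>R \<odot>\<^sub>M x = \<zero>\<^sub>M"
  by (rule additive_zero[OF R.is_abelian_group abelian_group_M, of "%r. r \<odot>\<^sub>M x"])
    (auto simp: lsmult_closed lsmult_l_distr)

lemma (in left_module) lsmult_r_minus:
  "[|r .: R; x .: M; y .: M|] ==> r \<odot>\<^sub>M (x \<ominus>\<^sub>M y) = r \<odot>\<^sub>M x \<ominus>\<^sub>M r \<odot>\<^sub>M y"
  by (rule additive_diff[OF abelian_group_M abelian_group_M])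
    (auto simp: lsmult_closed lsmult_r_distr)

lemma (in left_module) lsmult_finsum:
  "[|r .: R; !!i. i \<in> I ==> u i .: M|]
    ==> r \<odot>\<^sub>M (\<Oplus>\<^sub>M i\<in>I. u i) = (\<Oplus>\<^sub>M i\<in>I. r \<odot>\<^sub>M u i)"
  by (rule additive_finsum[OF abelian_group_M abelian_group_M])
    (auto simp: lsmult_closed lsmult_r_distr)

context
  fixes R :: "('r, 'e) ring_scheme" and M :: "('r, 'm, 'f) module_scheme" and N :: "('r, 'n, 'g) module_scheme" and f
  assumes M: "left_module R M" and N: "left_module R N" and f: "f \<in> module_hom R M N"
begin

lemma module_hom_zero: "f \<zero>\<^sub>M = \<zero>\<^sub>N"
  using additive_zero[OF left_module_abelian[OF M] left_module_abelian[OF N]] f by (auto simp: module_hom_def)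

lemma module_hom_minus:
  "[|x .: M; y .: M|] ==> f (x \<ominus>\<^sub>M y) = f x \<ominus>\<^sub>N f y"
  using f by (intro additive_diff[OF left_module_abelian[OF M] left_module_abelian[OF N]])
    (auto simp: module_hom_def)

lemma module_hom_finsum:
  "(!!i. i \<in> I ==> u i .: M) ==> f (\<Oplus>\<^sub>M i\<in>I. u i) = (\<Oplus>\<^sub>N i\<in>I. f (u i))"
  using f by (intro additive_finsum[OF left_module_abelian[OF M] left_module_abelian[OF N]])
    (auto simp: module_hom_def)

lemma module_hom_diff:
  assumes g: "g \<in> module_hom R M N" shows "(%x. f x \<ominus>\<^sub>N g x) \<in> module_hom R M N"
proof -
  interpret N: left_module R N by fact
  have 1: "(p \<oplus>\<^sub>N q) \<ominus>\<^sub>N (r \<oplus>\<^sub>N s) = (p \<ominus>\<^sub>N r) \<oplus>\<^sub>N (q \<ominus>\<^sub>N s)"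
    if "p .: N" "q .: N" "r .: N" "s .: N" for p q r s using that by (simp add: a_minus_def N.minus_add N.a_ac)
  show ?thesis using f g by (intro module_homI)
      (auto simp: module_hom_mem module_hom_add module_hom_smult 1 N.lsmult_r_minus)
qed

end

lemma module_hom_id: "(%x. x) \<in> module_hom R M M"
  by (auto simp: module_hom_def)

lemma module_hom_const_zero:
  assumes N: "left_module R N" shows "(%x. \<zero>\<^sub>N) \<in> module_hom R M N"
proof -
  interpret N: left_module R N by fact
  show ?thesis by (intro module_homI) (auto simp: N.lsmult_r_null)
qed

lemma left_module_regular:
  assumes "ring R" shows "left_module R (left_regular R)"
proof -
  interpret R: ring R by fact
  have "abelian_group (left_regular R)" by (rule abelian_groupI) (auto simp: left_regular_def R.a_ac intro: R.add.l_inv_ex)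
  then show ?thesis by (intro left_module.intro left_module_axioms.intro assms)
      (auto simp: left_regular_def R.l_distr R.r_distr R.m_assoc)
qed

section \<open>Free modules\<close>

definition unit_vector :: "('r, 'e) ring_scheme => 'i => 'i => 'r" where "unit_vector R i = (%j. if j = i then \<one>\<^sub>R else \<zero>\<^sub>R)"

lemma free_module_carrier:
  "f .: (free_module R I) \<longleftrightarrow>
    (\<forall>i. f i .: R) & finite {i. f i ~= \<zero>\<^sub>R} & (\<forall>i. i \<notin> I --> f i = \<zero>\<^sub>R)" by (auto simp: free_module_def)

lemma free_module_simps:
  "\<zero>\<^sub>(free_module R I) = (%i. \<zero>\<^sub>R)"
  "f \<oplus>\<^sub>(free_module R I) g = (%i. f i \<oplus>\<^sub>R g i)"
  "r \<odot>\<^sub>(free_module R I) f = (%i. r \<otimes>\<^sub>R f i)" by (auto simp: free_module_def)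

lemma left_module_free:
  assumes "ring R" shows "left_module R (free_module R I)"
proof -
  interpret R: ring R by fact
  let ?F = "free_module R I"
  have cadd: "f \<oplus>\<^sub>?F g .: ?F" if "f .: ?F" "g .: ?F" for f g
  proof -
    have "{i. f i \<oplus>\<^sub>R g i ~= \<zero>\<^sub>R} \<subseteq> {i. f i ~= \<zero>\<^sub>R} \<union> {i. g i ~= \<zero>\<^sub>R}" by auto
    from finite_subset[OF this] show ?thesis using that by (auto simp: free_module_carrier free_module_simps)
  qed
  have csm: "r \<odot>\<^sub>?F f .: ?F" if "f .: ?F" "r .: R" for f r
  proof -
    have "{i. r \<otimes>\<^sub>R f i ~= \<zero>\<^sub>R} \<subseteq> {i. f i ~= \<zero>\<^sub>R}" using that by auto
    from finite_subset[OF this] show ?thesis using that by (auto simp: free_module_carrier free_module_simps)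
  qed
  have "abelian_group ?F"
  proof (rule abelian_groupI)
    fix f assume f: "f .: ?F"
    show "\<exists>g\<in>carrier ?F. g \<oplus>\<^sub>?F f = \<zero>\<^sub>?F"
    proof
      show "(%i. \<ominus>\<^sub>R f i) \<oplus>\<^sub>?F f = \<zero>\<^sub>?F" using f by (auto simp: free_module_carrier free_module_simps R.l_neg)
      have "{i. \<ominus>\<^sub>R f i ~= \<zero>\<^sub>R} = {i. f i ~= \<zero>\<^sub>R}" using f by (auto simp: free_module_carrier)
      then show "(%i. \<ominus>\<^sub>R f i) .: ?F" using f by (auto simp: free_module_carrier)
    qed
  next
    show "\<zero>\<^sub>?F .: ?F" by (auto simp: free_module_carrier free_module_simps)
  qed (use cadd in \<open>auto simp: free_module_carrier free_module_simps R.a_ac fun_eq_iff\<close>)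
  then show ?thesis using csm by (intro left_module.intro left_module_axioms.intro assms)
      (auto simp: free_module_carrier free_module_simps fun_eq_iff R.l_distr R.r_distr R.m_assoc)
qed

lemma unit_vector_closed:
  assumes "ring R" "i \<in> I" shows "unit_vector R i .: (free_module R I)"
proof -
  interpret R: ring R by fact
  have "{j. unit_vector R i j ~= \<zero>\<^sub>R} \<subseteq> {i}" by (simp add: unit_vector_def subset_iff)
  from finite_subset[OF this] have "finite {j. unit_vector R i j ~= \<zero>\<^sub>R}" by simp
  moreover have "\<forall>j. unit_vector R i j .: R" "\<forall>j. j \<notin> I --> unit_vector R i j = \<zero>\<^sub>R"
    using assms(2) by (auto simp: unit_vector_def)
  ultimately show ?thesis unfolding free_module_carrier by blast
qed

text \<open>The summation set \<open>A\<close> is any finite set containing the support. This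
  freedom drives the induction on \<open>A\<close> and later allows sums over all of
  \<open>{..<r}\<close>.\<close>

lemma free_module_hom_expansion:
  assumes R: "ring R" and N: "left_module R N" and u: "u \<in> module_hom R (free_module R I) N"
    and f: "f .: (free_module R I)" and A: "finite A" "A \<subseteq> I" "{i. f i ~= \<zero>\<^sub>R} \<subseteq> A"
  shows "u f = (\<Oplus>\<^sub>N i\<in>A. f i \<odot>\<^sub>N u (unit_vector R i))"
proof -
  interpret R: ring R by fact
  interpret N: left_module R N by fact
  interpret F: left_module R "free_module R I" by (rule left_module_free[OF R])
  have uu: "i \<in> I ==> u (unit_vector R i) .: N" for i by (rule module_hom_mem[OF u unit_vector_closed[OF R]])
  show ?thesis using A f
  proof (induction A arbitrary: f rule: finite_induct)
    case empty
    then have "f = \<zero>\<^sub>(free_module R I)" by (auto simp: free_module_simps)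
    then show ?case using module_hom_zero[OF F.left_module_axioms N u] by simp
  next
    case (insert a A)
    \<comment> \<open>Clearing the coordinate \<open>a\<close> moves the support into the smaller
      set.\<close>
    define g where "g = f(a := \<zero>\<^sub>R)"
    have g: "g .: (free_module R I)"
    proof -
      have "{i. g i ~= \<zero>\<^sub>R} \<subseteq> {i. f i ~= \<zero>\<^sub>R}" by (auto simp: g_def)
      from finite_subset[OF this] have "finite {i. g i ~= \<zero>\<^sub>R}" using insert.prems by (simp add: free_module_carrier)
      then show ?thesis using insert.prems unfolding free_module_carrier by (simp add: g_def)
    qed
    have fc: "f i .: R" for i using insert.prems by (auto simp: free_module_carrier)
    have ua: "unit_vector R a .: (free_module R I)" using insert.prems unit_vector_closed[OF R] by auto
    have sm: "f a \<odot>\<^sub>(free_module R I) unit_vector R a .: (free_module R I)" using F.lsmult_closed[OF fc ua] .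
    have fg: "f = f a \<odot>\<^sub>(free_module R I) unit_vector R a \<oplus>\<^sub>(free_module R I) g"
      using fc by (auto simp: free_module_simps g_def unit_vector_def fun_eq_iff)
    have "u f = f a \<odot>\<^sub>N u (unit_vector R a) \<oplus>\<^sub>N u g" using arg_cong[OF fg, of u]
      by (simp only: module_hom_add[OF u sm g] module_hom_smult[OF u fc ua])
    also have "u g = (\<Oplus>\<^sub>N i\<in>A. g i \<odot>\<^sub>N u (unit_vector R i))" using insert.prems by (intro insert.IH g) (auto simp: g_def)
    also have "... = (\<Oplus>\<^sub>N i\<in>A. f i \<odot>\<^sub>N u (unit_vector R i))" using insert.hyps insert.prems fc uu
      by (intro N.finsum_cong') (auto simp: g_def intro!: N.lsmult_closed)
    finally show ?case using insert fc uu by (subst N.finsum_insert) (auto intro!: N.lsmult_closed)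
  qed
qed

definition free_lift ::
  "('r, 'e) ring_scheme => ('r, 'n, 'f) module_scheme => ('i => 'n) => ('i => 'r) => 'n"
  where "free_lift R N b f = (\<Oplus>\<^sub>N i\<in>{i. f i ~= \<zero>\<^sub>R}. f i \<odot>\<^sub>N b i)"

context
  fixes R :: "('r, 'e) ring_scheme" and N :: "('r, 'n, 'f) module_scheme" and b :: "'i => 'n" and I
  assumes R: "ring R" and N: "left_module R N" and b: "b \<in> I \<rightarrow> carrier N"
begin

interpretation R: ring R by (rule R)
interpretation N: left_module R N by (rule N)

text \<open>\<open>free_lift\<close> sums over the support, which changes under addition; a common
  superset makes the sums for two vectors comparable.\<close>

lemma free_lift_superset:
  assumes "f .: (free_module R I)" "finite A" "A \<subseteq> I" "{i. f i ~= \<zero>\<^sub>R} \<subseteq> A"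
  shows "free_lift R N b f = (\<Oplus>\<^sub>N i\<in>A. f i \<odot>\<^sub>N b i)" unfolding free_lift_def using assms b
  by (intro N.add.finprod_mono_neutral_cong_left)
    (auto simp: free_module_carrier Pi_iff subset_iff N.lsmult_closed N.lsmult_l_null)

lemma free_lift_hom: "free_lift R N b \<in> module_hom R (free_module R I) N"
proof (rule module_homI)
  fix f g assume f: "f .: (free_module R I)" and g: "g .: (free_module R I)"
  interpret F: left_module R "free_module R I" by (rule left_module_free[OF R])
  let ?A = "{i. f i ~= \<zero>\<^sub>R} \<union> {i. g i ~= \<zero>\<^sub>R}"
  have A: "finite ?A" "?A \<subseteq> I" using f g by (auto simp: free_module_carrier)
  have c: "i \<in> ?A ==> f i \<odot>\<^sub>N b i .: N & g i \<odot>\<^sub>N b i .: N" for i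
    using f g b A by (auto simp: free_module_carrier intro!: N.lsmult_closed)
  have "free_lift R N b (f \<oplus>\<^sub>(free_module R I) g)
    = (\<Oplus>\<^sub>N i\<in>?A. (f \<oplus>\<^sub>(free_module R I) g) i \<odot>\<^sub>N b i)"
    using A f g F.add.m_closed[OF f g] by (intro free_lift_superset) (auto simp: free_module_simps)
  also have "... = (\<Oplus>\<^sub>N i\<in>?A. f i \<odot>\<^sub>N b i \<oplus>\<^sub>N g i \<odot>\<^sub>N b i)"
  proof (rule N.finsum_eqI)
    fix i assume i: "i \<in> ?A"
    then have "b i .: N" "f i .: R" "g i .: R" using A b f g by (auto simp: free_module_carrier)
    then show "(f \<oplus>\<^sub>(free_module R I) g) i \<odot>\<^sub>N b i = f i \<odot>\<^sub>N b i \<oplus>\<^sub>N g i \<odot>\<^sub>N b i"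
      by (simp only: free_module_simps N.lsmult_l_distr)
    show "f i \<odot>\<^sub>N b i \<oplus>\<^sub>N g i \<odot>\<^sub>N b i .: N" using c[OF i] by simp
  qed
  also have "... = (\<Oplus>\<^sub>N i\<in>?A. f i \<odot>\<^sub>N b i) \<oplus>\<^sub>N (\<Oplus>\<^sub>N i\<in>?A. g i \<odot>\<^sub>N b i)"
    using c by (intro N.finsum_addf) auto
  finally show "free_lift R N b (f \<oplus>\<^sub>(free_module R I) g) = free_lift R N b f \<oplus>\<^sub>N free_lift R N b g"
    by (simp only: free_lift_superset[OF f A Un_upper1] free_lift_superset[OF g A Un_upper2])
next
  fix r f assume r: "r .: R" and f: "f .: (free_module R I)"
  interpret F: left_module R "free_module R I" by (rule left_module_free[OF R])
  let ?A = "{i. f i ~= \<zero>\<^sub>R}"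
  have A: "finite ?A" "?A \<subseteq> I" using f by (auto simp: free_module_carrier)
  have c: "i \<in> ?A ==> f i \<odot>\<^sub>N b i .: N" for i using f b A by (auto simp: free_module_carrier intro!: N.lsmult_closed)
  have "free_lift R N b (r \<odot>\<^sub>(free_module R I) f) = (\<Oplus>\<^sub>N i\<in>?A. (r \<otimes>\<^sub>R f i) \<odot>\<^sub>N b i)"
    using A r f F.lsmult_closed[OF r f] by (subst free_lift_superset[of _ ?A]) (auto simp: free_module_simps)
  also have "... = (\<Oplus>\<^sub>N i\<in>?A. r \<odot>\<^sub>N (f i \<odot>\<^sub>N b i))" using A b f r c
    by (intro N.finsum_cong') (auto simp: free_module_carrier N.lsmult_assoc N.lsmult_closed Pi_iff subset_iff)
  also have "... = r \<odot>\<^sub>N free_lift R N b f" unfolding free_lift_def using c r by (subst N.lsmult_finsum) auto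
  finally show "free_lift R N b (r \<odot>\<^sub>(free_module R I) f) = r \<odot>\<^sub>N free_lift R N b f" .
next
  fix f assume f: "f .: (free_module R I)"
  then have "i \<in> {i. f i ~= \<zero>\<^sub>R} ==> f i \<odot>\<^sub>N b i .: N" for i using b by (auto simp: free_module_carrier intro!: N.lsmult_closed)
  then show "free_lift R N b f .: N" unfolding free_lift_def by (intro N.finsum_closed) auto
qed

lemma free_lift_unit:
  assumes "i \<in> I" shows "free_lift R N b (unit_vector R i) = b i"
proof -
  have "free_lift R N b (unit_vector R i) = (\<Oplus>\<^sub>N j\<in>{i}. unit_vector R i j \<odot>\<^sub>N b j)"
    using assms by (intro free_lift_superset unit_vector_closed R) (auto simp: unit_vector_def)
  also have "... = b i"
  proof -
    have "b i .: N" using assms b by auto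
    then show ?thesis by (subst N.finsum_insert) (auto simp: unit_vector_def N.lsmult_one)
  qed
  finally show ?thesis .
qed

end

lemma free_module_hom_eqI:
  assumes R: "ring R" and N: "left_module R N" and u: "u \<in> module_hom R (free_module R I) N" and v: "v \<in> module_hom R (free_module R I) N"
    and e: "!!i. i \<in> I ==> u (unit_vector R i) = v (unit_vector R i)" and f: "f .: (free_module R I)" shows "u f = v f"
proof -
  interpret N: left_module R N by fact
  let ?A = "{i. f i ~= \<zero>\<^sub>R}"
  have A: "finite ?A" "?A \<subseteq> I" "?A \<subseteq> ?A" using f by (auto simp: free_module_carrier)
  show ?thesis unfolding free_module_hom_expansion[OF R N u f A] free_module_hom_expansion[OF R N v f A]
  proof (rule N.finsum_eqI)
    fix i assume "i \<in> ?A"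
    then have i: "i \<in> I" using A by blast
    show "f i \<odot>\<^sub>N u (unit_vector R i) = f i \<odot>\<^sub>N v (unit_vector R i)" by (simp only: e[OF i])
    show "f i \<odot>\<^sub>N v (unit_vector R i) .: N" using f by (intro N.lsmult_closed module_hom_mem[OF v] unit_vector_closed R i)
        (simp add: free_module_carrier)
  qed
qed

section \<open>Lifting and extension properties\<close>

text \<open>A lift is chosen on the basis of the free module of which \<open>P\<close> is a summand,
  extended linearly and restricted along the section \<open>s\<close>. The hypothesis is on images,
  not on surjectivity of \<open>g\<close>, because exactness at a single place supplies just
  this.\<close>

lemma projective_lift:
  fixes P :: "('r, 'p) module"
  assumes P: "projective R P" and M: "left_module R M" and N: "left_module R N" and g: "g \<in> module_hom R M N" and f: "f \<in> module_hom R P N"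
    and im: "!!x. x .: P ==> f x \<in> g ` carrier M" shows "\<exists>h \<in> module_hom R P M. \<forall>x \<in> carrier P. g (h x) = f x"
proof -
  from P obtain I :: "'p set" and s t where t: "t \<in> module_hom R (free_module R I) P"
    and s: "s \<in> module_hom R P (free_module R I)" and ts: "!!x. x .: P ==> t (s x) = x"
    using P unfolding projective_def by (elim conjE exE bexE) (erule that, assumption, simp)
  have R: "ring R" using M by (rule left_module_ring)
  have "\<forall>i\<in>I. \<exists>m. m .: M & g m = f (t (unit_vector R i))"
  proof
    fix i assume "i \<in> I"
    from im[OF module_hom_mem[OF t unit_vector_closed[OF R this]]]
    show "\<exists>m. m .: M & g m = f (t (unit_vector R i))" by (auto simp: image_iff)
  qed
  from bchoice[OF this] obtain b where b: "!!i. i \<in> I ==> b i .: M & g (b i) = f (t (unit_vector R i))" by blast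
  then have b': "b \<in> I \<rightarrow> carrier M" by auto
  note L = free_lift_hom[OF R M b']
  have "g (free_lift R M b y) = f (t y)" if "y .: (free_module R I)" for y
    by (rule free_module_hom_eqI[OF R N module_hom_compose[OF L g] module_hom_compose[OF t f] _ that])
      (auto simp: free_lift_unit[OF R M b'] b)
  then have "\<forall>x \<in> carrier P. g (free_lift R M b (s x)) = f x" using ts module_hom_mem[OF s] by simp
  then show ?thesis by (intro bexI[of _ "%x. free_lift R M b (s x)"] module_hom_compose[OF s L])
qed

text \<open>The counterpart of lifting, towards lower degrees: what extends into the ring extends
  into \<open>N\<close>, one coordinate of the ambient free module at a time. This is where
  acyclicity of the Hom complex enters the comparison. Finite generation confines \<open>N\<close>
  to finitely many coordinates; otherwise the separately chosen extensions might not assemble to a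
  finitely supported vector.\<close>

lemma fg_projective_extend:
  fixes N :: "('r, 'n) module"
  assumes N: "projective R N" "finitely_generated R N" and T1: "left_module R T1" and T0: "left_module R T0" and T2: "left_module R T2"
    and d1: "d1 \<in> module_hom R T1 T0" and d2: "d2 \<in> module_hom R T2 T1"
    and ext: "!!f. [|f \<in> module_hom R T1 (left_regular R); !!x. x .: T2 ==> f (d2 x) = \<zero>\<^sub>R|]
      ==> \<exists>g \<in> module_hom R T0 (left_regular R). \<forall>x \<in> carrier T1. g (d1 x) = f x"
    and f: "f \<in> module_hom R T1 N" and fd: "!!x. x .: T2 ==> f (d2 x) = \<zero>\<^sub>N"
  shows "\<exists>g \<in> module_hom R T0 N. \<forall>x \<in> carrier T1. g (d1 x) = f x"
proof -
  from N obtain I :: "'n set" and s t where t: "t \<in> module_hom R (free_module R I) N"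
    and s: "s \<in> module_hom R N (free_module R I)" and ts: "!!x. x .: N ==> t (s x) = x" and lN: "left_module R N" unfolding projective_def by blast
  interpret N: left_module R N by fact
  have R: "ring R" using lN by (rule left_module_ring)
  interpret R: ring R by fact
  interpret F: left_module R "free_module R I" by (rule left_module_free[OF R])
  interpret T1: left_module R T1 by fact
  interpret T0: left_module R T0 by fact
  from N(2) obtain G where G: "finite G" "G \<subseteq> carrier N"
    and gen: "!!x. x .: N ==> \<exists>c \<in> G \<rightarrow> carrier R. x = (\<Oplus>\<^sub>N s\<in>G. c s \<odot>\<^sub>N s)"
    unfolding finitely_generated_def by blast
  \<comment> \<open>The finitely many coordinates met by the generators; by linearity all others
    vanish on the whole of \<open>N\<close>.\<close>
  define J where "J = (\<Union>x\<in>G. {i. s x i ~= \<zero>\<^sub>R})"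
  have sG: "x .: N ==> s x .: (free_module R I)" for x using module_hom_mem[OF s] .
  have J: "finite J" "J \<subseteq> I" using G sG by (auto simp: J_def free_module_carrier subset_iff)
  have proj: "(%y. y i) \<in> module_hom R (free_module R I) (left_regular R)" for i
    by (rule module_homI) (auto simp: free_module_carrier free_module_simps left_regular_def)
  note si = module_hom_compose[OF s proj]
  have sJ: "s x i = \<zero>\<^sub>R" if x: "x .: N" and i: "i \<notin> J" for x i
  proof -
    obtain c where c: "c \<in> G \<rightarrow> carrier R" and xe: "x = (\<Oplus>\<^sub>N s\<in>G. c s \<odot>\<^sub>N s)" using gen[OF x] by blast
    have z: "g \<in> G ==> s (c g \<odot>\<^sub>N g) i = \<zero>\<^sub>R" for g
      using i funcset_mem[OF c] G by (subst module_hom_smult[OF s]) (auto simp: J_def free_module_simps)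
    have "s x i = (\<Oplus>\<^sub>(left_regular R)g\<in>G. s (c g \<odot>\<^sub>N g) i)" unfolding xe using c G
      by (intro module_hom_finsum[OF lN left_module_regular[OF R] si]) (auto intro!: N.lsmult_closed)
    also have "... = (\<Oplus>\<^sub>(left_regular R)g\<in>G. \<zero>\<^sub>(left_regular R))"
      using z by (intro abelian_monoid.finsum_cong'[OF abelian_group.axioms(1)[OF left_module_abelian[OF left_module_regular[OF R]]]])
        (auto simp: left_regular_def)
    also have "... = \<zero>\<^sub>R" by (subst abelian_monoid.finsum_zero[OF abelian_group.axioms(1)[OF left_module_abelian[OF left_module_regular[OF R]]]])
        (auto simp: left_regular_def)
    finally show ?thesis .
  qed
  have "\<exists>g \<in> module_hom R T0 (left_regular R). \<forall>x \<in> carrier T1. g (d1 x) = s (f x) i" for i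
  proof (rule ext)
    show "(%x. s (f x) i) \<in> module_hom R T1 (left_regular R)" by (rule module_hom_compose[OF f si])
    show "s (f (d2 x)) i = \<zero>\<^sub>R" if "x .: T2" for x
      using fd[OF that] module_hom_zero[OF lN F.left_module_axioms s] by (simp add: free_module_simps)
  qed
  then have "\<forall>i. \<exists>g. g \<in> module_hom R T0 (left_regular R) & (\<forall>x \<in> carrier T1. g (d1 x) = s (f x) i)" by blast
  from choice[OF this] obtain g where g: "!!i. g i \<in> module_hom R T0 (left_regular R)" and gd: "!!i x. x .: T1 ==> g i (d1 x) = s (f x) i" by blast
  \<comment> \<open>Outside \<open>J\<close> the extensions \<open>g i\<close> are uncontrolled, so
    they are cut off to keep the support finite.\<close>
  define G' where "G' x = (%i. if i \<in> J then g i x else \<zero>\<^sub>R)" for x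
  have gm: "x .: T0 ==> g i x .: R" for i x using module_hom_mem[OF g[of i], of x] by (simp add: left_regular_def)
  have G': "G' \<in> module_hom R T0 (free_module R I)"
  proof (rule module_homI)
    fix x assume x: "x .: T0"
    have "{i. G' x i ~= \<zero>\<^sub>R} \<subseteq> J" by (auto simp: G'_def)
    from finite_subset[OF this J(1)] show "G' x .: (free_module R I)" using J gm[OF x] by (auto simp: free_module_carrier G'_def)
  next
    fix x y assume "x .: T0" "y .: T0"
    then show "G' (x \<oplus>\<^sub>T0 y) = G' x \<oplus>\<^sub>(free_module R I) G' y"
      using module_hom_add[OF g] by (auto simp: G'_def free_module_simps left_regular_def)
  next
    fix r x assume "r .: R" "x .: T0"
    then show "G' (r \<odot>\<^sub>T0 x) = r \<odot>\<^sub>(free_module R I) G' x"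
      using module_hom_smult[OF g] by (auto simp: G'_def free_module_simps left_regular_def)
  qed
  have "t (G' (d1 x)) = f x" if x: "x .: T1" for x
  proof -
    have "G' (d1 x) = s (f x)" using gd[OF x] sJ module_hom_mem[OF f x] by (auto simp: G'_def fun_eq_iff)
    then show ?thesis using ts module_hom_mem[OF f x] by simp
  qed
  then show ?thesis by (intro bexI[of _ "%x. t (G' x)"] module_hom_compose[OF G' t]) auto
qed


section \<open>Comparison of complete resolutions\<close>

text \<open>A complete resolution in terms of elements. The auxiliary resolution \<open>P\<close>
  has disappeared: its augmentation is transported to \<open>T 0\<close>, where \<open>eta\<close>
  presents \<open>M\<close> as the cokernel of \<open>d 1\<close>. Acyclicity of Hom becomes an
  extension property for maps on \<open>T n\<close>.\<close>

locale cres =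
  fixes R :: "('r, 'e) ring_scheme" and M :: "('r, 'b) module" and T :: "int => ('r, 't) module" and d :: "int => 't => 't" and eta :: "'t => 'b"
  assumes M: "left_module R M" and T: "left_module R (T n)" and d: "d n \<in> module_hom R (T n) (T (n - 1))"
    and dd: "x .: (T (n + 1)) ==> d n (d (n + 1) x) = \<zero>\<^sub>(T (n - 1))" and fg: "finitely_generated R (T n)" and proj: "projective R (T n)"
    and exact: "[|x .: (T n); d n x = \<zero>\<^sub>(T (n - 1))|] ==> x \<in> d (n + 1) ` carrier (T (n + 1))"
    and hom_exact: "[|f \<in> module_hom R (T n) (left_regular R);
        !!x. x .: (T (n + 1)) ==> f (d (n + 1) x) = \<zero>\<^sub>R|]
      ==> \<exists>g \<in> module_hom R (T (n - 1)) (left_regular R). \<forall>x \<in> carrier (T n). g (d n x) = f x"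
    and eps: "eta \<in> module_hom R (T 0) M" and eps_surj: "eta ` carrier (T 0) = carrier M"
    and eps_ker: "x .: (T 0) ==> eta x = \<zero>\<^sub>M \<longleftrightarrow> x \<in> d 1 ` carrier (T 1)"
begin

lemma d': "d (n + 1) \<in> module_hom R (T (n + 1)) (T n)"
  using d[of "n + 1"] by simp

lemma d_mem: "x .: (T n) ==> d n x .: (T (n - 1))"
  by (rule module_hom_mem[OF d])

lemma d_mem': "x .: (T (n + 1)) ==> d (n + 1) x .: (T n)"
  by (rule module_hom_mem[OF d'])

end

lemma complete_resolution_cres:
  assumes M: "left_module R M" and C: "complete_resolution R M T d" shows "\<exists>eta. cres R M T d eta"
proof -
  have T: "left_module R (T n)" and d: "d n \<in> module_hom R (T n) (T (n - 1))" for n using C by (auto simp: complete_resolution_def chain_complex_def)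
  have dd: "x .: (T n) ==> d (n - 1) (d n x) = \<zero>\<^sub>(T (n - 2))" for n x using C by (auto simp: complete_resolution_def chain_complex_def)
  have fg: "finitely_generated R (T n)" and proj: "projective R (T n)" for n using C by (auto simp: complete_resolution_def)
  have exact: "cycles T d n = boundaries T d n" for n using C by (auto simp: complete_resolution_def acyclic_complex_def exact_at_def)
  have hexact: "cycles (hom_complex R T (left_regular R)) (hom_differential T d) n
      = boundaries (hom_complex R T (left_regular R)) (hom_differential T d) n" for n
    using C by (simp add: complete_resolution_def acyclic_complex_def exact_at_def)
  obtain P :: "int => ('a, 'd) module" and \<delta> eta f where
    P: "projective_resolution R M P \<delta> eta" and f: "chain_map R T d P \<delta> f"
    and bij: "!!n. n >= 0 ==> bij_betw (f n) (carrier (T n)) (carrier (P n))" using C by (auto simp: complete_resolution_def)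
  have lP: "left_module R (P n)" for n using P by (auto simp: projective_resolution_def chain_complex_def)
  have eta: "eta \<in> module_hom R (P 0) M" "eta ` carrier (P 0) = carrier M"
    and ker: "{x \<in> carrier (P 0). eta x = \<zero>\<^sub>M} = boundaries P \<delta> 0" using P by (auto simp: projective_resolution_def)
  have fh: "f n \<in> module_hom R (T n) (P n)" for n using f by (auto simp: chain_map_def)
  have fc: "x .: (T n) ==> f (n - 1) (d n x) = \<delta> n (f n x)" for n x using f by (auto simp: chain_map_def)
  have im: "f n ` carrier (T n) = carrier (P n)" if "n >= 0" for n using bij[OF that] by (rule bij_betw_imp_surj_on)
  have "cres R M T d (%x. eta (f 0 x))"
  proof (rule cres.intro)
    show "left_module R M" by (rule M)
    show "left_module R (T n)" for n by (rule T)
    show "d n \<in> module_hom R (T n) (T (n - 1))" for n by (rule d)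
    show "d n (d (n + 1) x) = \<zero>\<^sub>(T (n - 1))" if "x .: (T (n + 1))" for x n using dd[OF that] by simp
    show "finitely_generated R (T n)" for n by (rule fg)
    show "projective R (T n)" for n by (rule proj)
    show "x \<in> d (n + 1) ` carrier (T (n + 1))" if "x .: (T n)" "d n x = \<zero>\<^sub>(T (n - 1))" for x n
      using exact[of n] that by (auto simp: cycles_def boundaries_def)
    show "(%x. eta (f 0 x)) \<in> module_hom R (T 0) M" by (rule module_hom_compose[OF fh eta(1)])
    show "(%x. eta (f 0 x)) ` carrier (T 0) = carrier M" using im[of 0] eta(2) by (simp add: image_comp[symmetric, unfolded comp_def] image_image[symmetric])
    show "eta (f 0 x) = \<zero>\<^sub>M \<longleftrightarrow> x \<in> d 1 ` carrier (T 1)" if x: "x .: (T 0)" for x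
    proof -
      have fx: "f 0 x .: (P 0)" by (rule module_hom_mem[OF fh x])
      have "eta (f 0 x) = \<zero>\<^sub>M \<longleftrightarrow> f 0 x \<in> boundaries P \<delta> 0" using fx by (simp add: ker[symmetric])
      also have "... \<longleftrightarrow> f 0 x \<in> \<delta> 1 ` f 1 ` carrier (T 1)" by (simp add: boundaries_def im)
      also have "... \<longleftrightarrow> f 0 x \<in> f 0 ` d 1 ` carrier (T 1)" using fc[of _ 1] by (simp add: image_image)
      also have "... \<longleftrightarrow> x \<in> d 1 ` carrier (T 1)" using module_hom_mem[OF d[of 1]] bij_betw_imp_inj_on[OF bij[of 0]] x
        by (intro inj_on_image_mem_iff) auto
      finally show ?thesis .
    qed
    show "\<exists>g \<in> module_hom R (T (n - 1)) (left_regular R). \<forall>x \<in> carrier (T n). g (d n x) = u x"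
      if u: "u \<in> module_hom R (T n) (left_regular R)" and ud: "!!x. x .: (T (n + 1)) ==> u (d (n + 1) x) = \<zero>\<^sub>R" for u n
    proof -
      interpret Tn: left_module R "T n" by (rule T)
      \<comment> \<open>The Hom complex consists of extensional functions and is indexed in reverse,
        so exactness at \<open>T n\<close> is read off in degree \<open>- n\<close>.\<close>
      let ?u = "restrict u (carrier (T n))"
      have "?u \<in> module_hom R (T n) (left_regular R)" by (rule module_hom_cong[OF u T]) simp
      moreover have "hom_differential T d (- n) ?u = (\<lambda>x\<in>carrier (T (n + 1)). \<zero>\<^sub>R)" using module_hom_mem[OF d[of "n + 1"]] ud
        by (auto simp: hom_differential_def fun_eq_iff restrict_def add.commute)
      ultimately have "?u \<in> cycles (hom_complex R T (left_regular R)) (hom_differential T d) (- n)"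
        by (simp add: cycles_def hom_complex_def hom_group_def left_regular_def add.commute)
      then obtain g where g: "g \<in> module_hom R (T (n - 1)) (left_regular R)" and ug: "?u = restrict (g \<circ> d n) (carrier (T n))"
        unfolding hexact by (auto simp: boundaries_def hom_complex_def hom_group_def hom_differential_def)
      have "\<forall>x \<in> carrier (T n). g (d n x) = u x"
      proof
        fix x assume "x .: (T n)"
        then show "g (d n x) = u x" using fun_cong[OF ug, of x] by simp
      qed
      with g show ?thesis by blast
    qed
  qed
  then show ?thesis by blast
qed

text \<open>Recursion outwards from 0 in both directions. \<open>R n\<close> always compares the
  values at \<open>n\<close> and \<open>n + 1\<close>, so a downward step has to establish
  \<open>R (n - 1) y x\<close>.\<close>

lemma int_dependent_choice:
  fixes P :: "int => 'x => bool" and R :: "int => 'x => 'x => bool"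
  assumes P0: "P 0 x0" and up: "!!n x. P n x ==> \<exists>y. P (n + 1) y & R n x y" and down: "!!n x. P n x ==> \<exists>y. P (n - 1) y & R (n - 1) y x"
  shows "\<exists>f. f 0 = x0 & (\<forall>n. P n (f n) & R n (f n) (f (n + 1)))"
proof -
  \<comment> \<open>The clause on \<open>k = 0\<close> fixes the first term, so that the two
    half-sequences agree at 0.\<close>
  have "\<exists>F. \<forall>k. (P (int k) (F k) & (k = 0 --> F k = x0)) & R (int k) (F k) (F (Suc k))"
  proof (rule dependent_nat_choice)
    show "\<exists>x. P (int 0) x & (0 = (0::nat) --> x = x0)" using P0 by auto
    fix x k assume "P (int k) x & (k = 0 --> x = x0)"
    then show "\<exists>y. (P (int (Suc k)) y & (Suc k = 0 --> y = x0)) & R (int k) x y" using up[of "int k" x] by (simp add: add.commute)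
  qed
  then obtain F where F: "!!k. P (int k) (F k)" "F 0 = x0" "!!k. R (int k) (F k) (F (Suc k))" by blast
  have "\<exists>G. \<forall>k. (P (- int k) (G k) & (k = 0 --> G k = x0)) & R (- int k - 1) (G (Suc k)) (G k)"
  proof (rule dependent_nat_choice)
    show "\<exists>x. P (- int 0) x & (0 = (0::nat) --> x = x0)" using P0 by auto
    fix x k assume "P (- int k) x & (k = 0 --> x = x0)"
    then obtain y where y: "P (- int k - 1) y" "R (- int k - 1) y x" using down by blast
    have e: "- int (Suc k) = - int k - 1" by simp
    show "\<exists>y. (P (- int (Suc k)) y & (Suc k = 0 --> y = x0)) & R (- int k - 1) y x" unfolding e using y by auto
  qed
  then obtain G where G: "!!k. P (- int k) (G k)" "G 0 = x0" "!!k. R (- int k - 1) (G (Suc k)) (G k)" by blast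
  define f where "f n = (if n >= 0 then F (nat n) else G (nat (- n)))" for n
  have f: "f (int k) = F k" "f (- int k) = G k" for k using F(2) G(2) by (cases k; simp add: f_def nat_add_distrib)+
  have "P n (f n) & R n (f n) (f (n + 1))" for n
  proof (cases "n >= 0")
    case True
    then obtain k where "n = int k" using nonneg_int_cases by blast
    then show ?thesis using F(1,3)[of k] f(1)[of k] f(1)[of "Suc k"] by (simp add: add.commute)
  next
    case False
    define k where "k = nat (- n - 1)"
    have n: "n + 1 = - int k" "n = - int (Suc k)" "n = - int k - 1" using False by (auto simp: k_def)
    have "f n = G (Suc k)" "f (n + 1) = G k" by (subst n(2), rule f) (subst n(1), rule f)
    moreover have "P n (G (Suc k))" using G(1)[of "Suc k"] unfolding n(2) .
    ultimately show ?thesis using G(3)[of k] n(3) by simp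
  qed
  then show ?thesis using f(1)[of 0] F(2) by (intro exI[of _ f]) simp
qed

locale cres_pair = T: cres R M T d eta + S: cres R M S d' eta'
  for R :: "('r, 'e) ring_scheme" and M :: "('r, 'b) module" and T :: "int => ('r, 't) module" and d eta and S :: "int => ('r, 's) module" and d' eta'
begin

text \<open>The upward step of the constructions below, by projectivity of \<open>T m\<close> and
  exactness of \<open>S\<close>. Its downward companion \<open>extend\<close> relies instead on
  Hom-exactness of \<open>T\<close> and on \<open>S m\<close> being finitely generated
  projective.\<close>

lemma lift:
  assumes f: "f \<in> module_hom R (T m) (S n)" and z: "!!x. x .: (T m) ==> d' n (f x) = \<zero>\<^sub>(S (n - 1))"
  shows "\<exists>g. g \<in> module_hom R (T m) (S (n + 1)) & (\<forall>x \<in> carrier (T m). d' (n + 1) (g x) = f x)"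
  using projective_lift[OF T.proj S.T S.T S.d' f] S.exact[OF module_hom_mem[OF f] z] by blast

lemma extend:
  assumes f: "f \<in> module_hom R (T n) (S m)" and z: "!!x. x .: (T (n + 1)) ==> f (d (n + 1) x) = \<zero>\<^sub>(S m)"
  shows "\<exists>g. g \<in> module_hom R (T (n - 1)) (S m) & (\<forall>x \<in> carrier (T n). g (d n x) = f x)"
proof -
  have "\<exists>g \<in> module_hom R (T (n - 1)) (S m). \<forall>x \<in> carrier (T n). g (d n x) = f x"
    by (rule fg_projective_extend[OF S.proj S.fg T.T T.T T.T T.d T.d' T.hom_exact f z])
  then show ?thesis by blast
qed

lemma chain_map_start:
  "\<exists>f. f \<in> module_hom R (T 0) (S 0) & (\<forall>x \<in> carrier (T 0). eta' (f x) = eta x)"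
proof -
  have "\<exists>f \<in> module_hom R (T 0) (S 0). \<forall>x \<in> carrier (T 0). eta' (f x) = eta x" using T.eps_surj S.eps_surj
    by (intro projective_lift[OF T.proj S.T S.M S.eps T.eps]) auto
  then show ?thesis by blast
qed

lemma chain_map_exists:
  "\<exists>f. (\<forall>n. f n \<in> module_hom R (T n) (S n)) \<and>
    (\<forall>n. \<forall>x \<in> carrier (T (n + 1)). f n (d (n + 1) x) = d' (n + 1) (f (n + 1) x)) \<and>
    (\<forall>x \<in> carrier (T 0). eta' (f 0 x) = eta x)"
proof -
  obtain f0 where f0: "f0 \<in> module_hom R (T 0) (S 0)" and e0: "!!x. x .: (T 0) ==> eta' (f0 x) = eta x" using chain_map_start by blast
  \<comment> \<open>\<open>f0\<close> respects the augmentations, so it sends the image of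
    \<open>d 1\<close> into the kernel of \<open>eta'\<close>, which is the image of
    \<open>d' 1\<close>.\<close>
  have z0: "d' 0 (f0 (d 1 x)) = \<zero>\<^sub>(S (- 1))" if x: "x .: (T 1)" for x
  proof -
    have dx: "d 1 x .: (T 0)" using T.d_mem[OF x] by simp
    then have "eta' (f0 (d 1 x)) = \<zero>\<^sub>M" using e0 T.eps_ker x by simp
    then obtain y where "y .: (S 1)" "f0 (d 1 x) = d' 1 y" using S.eps_ker[OF module_hom_mem[OF f0 dx]] by blast
    then show ?thesis using S.dd[of y 0] by simp
  qed
  \<comment> \<open>One invariant for both directions: \<open>d' n\<close> after \<open>f\<close>
    after \<open>d (n + 1)\<close> vanishes. It says that \<open>f d\<close> can be lifted to degree
    \<open>n + 1\<close> and also that \<open>d' f\<close> can be extended to degree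
    \<open>n - 1\<close>.\<close>
  let ?P = "%n f. f \<in> module_hom R (T n) (S n) \<and>
    (\<forall>x \<in> carrier (T (n + 1)). d' n (f (d (n + 1) x)) = \<zero>\<^sub>(S (n - 1)))"
  have "\<exists>f. f 0 = f0 & (\<forall>n. ?P n (f n) & (\<forall>x \<in> carrier (T (n + 1)). f n (d (n + 1) x) = d' (n + 1) (f (n + 1) x)))"
  proof (rule int_dependent_choice)
    show "?P 0 f0" using f0 z0 by simp
    fix n f assume f: "?P n f"
    obtain g where g: "g \<in> module_hom R (T (n + 1)) (S (n + 1))" and gd: "!!x. x .: (T (n + 1)) ==> d' (n + 1) (g x) = f (d (n + 1) x)"
      using lift[OF module_hom_compose[OF T.d' conjunct1[OF f]]] f by blast
    have "d' (n + 1) (g (d (n + 1 + 1) x)) = \<zero>\<^sub>(S (n + 1 - 1))" if x: "x .: (T (n + 1 + 1))" for x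
      using gd[OF T.d_mem'[OF x]] T.dd[OF x] module_hom_zero[OF T.T S.T conjunct1[OF f]] by simp
    then show "\<exists>g. ?P (n + 1) g & (\<forall>x \<in> carrier (T (n + 1)). f (d (n + 1) x) = d' (n + 1) (g x))" using g gd by auto
  next
    fix n f assume f: "?P n f"
    obtain g where g: "g \<in> module_hom R (T (n - 1)) (S (n - 1))" and gd: "!!x. x .: (T n) ==> g (d n x) = d' n (f x)"
      using extend[OF module_hom_compose[OF conjunct1[OF f] S.d]] f by blast
    have "d' (n - 1) (g (d n x)) = \<zero>\<^sub>(S (n - 1 - 1))" if x: "x .: (T n)" for x
      using gd[of x] S.dd[of "f x" "n - 1"] module_hom_mem[OF conjunct1[OF f], of x] x by simp
    then show "\<exists>g. ?P (n - 1) g & (\<forall>x \<in> carrier (T (n - 1 + 1)). g (d (n - 1 + 1) x) = d' (n - 1 + 1) (f x))" using g gd by auto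
  qed
  then show ?thesis using e0 by metis
qed

end

text \<open>The difference \<open>u = g - id\<close> is killed by \<open>eta\<close> in degree 0, so
  \<open>u 0\<close> lifts through \<open>d 1\<close>; from this first component the homotopy is
  again built outwards.\<close>

lemma cres_homotopy:
  assumes C: "cres R M T d eta" and g: "!!n. g n \<in> module_hom R (T n) (T n)"
    and gd: "!!n x. x .: (T (n + 1)) ==> g n (d (n + 1) x) = d (n + 1) (g (n + 1) x)" and ge: "!!x. x .: (T 0) ==> eta (g 0 x) = eta x"
  shows "\<exists>h. (\<forall>n. h n \<in> module_hom R (T n) (T (n + 1))) \<and>
    (\<forall>n. \<forall>x \<in> carrier (T n). g n x \<ominus>\<^sub>(T n) x = d (n + 1) (h n x) \<oplus>\<^sub>(T n) h (n - 1) (d n x))"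
proof -
  interpret C: cres R M T d eta by (rule C)
  interpret cres_pair R M T d eta T d eta ..
  have ab: "abelian_group (T n)" for n by (rule left_module_abelian[OF C.T])
  note cl = abelian_group.minus_closed[OF ab]
  define u where "u n x = g n x \<ominus>\<^sub>(T n) x" for n x
  have u: "u n \<in> module_hom R (T n) (T n)" for n unfolding u_def by (rule module_hom_diff[OF C.T C.T g module_hom_id])
  note um = module_hom_mem[OF u]
  have ud: "u n (d (n + 1) x) = d (n + 1) (u (n + 1) x)" if x: "x .: (T (n + 1))" for n x
    using module_hom_minus[OF C.T C.T C.d' module_hom_mem[OF g x] x] gd[OF x] by (simp add: u_def)
  have sub: "x \<ominus>\<^sub>(T n) x = \<zero>\<^sub>(T n)" "x \<ominus>\<^sub>(T n) \<zero>\<^sub>(T n) = x" if "x .: (T n)" for x n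
  proof -
    interpret abelian_group "T n" by (rule ab)
    show "x \<ominus>\<^sub>(T n) x = \<zero>\<^sub>(T n)" "x \<ominus>\<^sub>(T n) \<zero>\<^sub>(T n) = x" using that by (simp_all add: a_minus_def r_neg)
  qed
  have add_diff: "x \<ominus>\<^sub>(T n) y \<oplus>\<^sub>(T n) y = x" "y \<oplus>\<^sub>(T n) (x \<ominus>\<^sub>(T n) y) = x"
    if "x .: (T n)" "y .: (T n)" for x y n
  proof -
    interpret abelian_group "T n" by (rule ab)
    show "x \<ominus>\<^sub>(T n) y \<oplus>\<^sub>(T n) y = x" "y \<oplus>\<^sub>(T n) (x \<ominus>\<^sub>(T n) y) = x"
      using that by (simp_all add: a_minus_def a_assoc l_neg r_neg r_neg1 r_neg2 a_lcomm)
  qed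
  have "eta (u 0 x) = \<zero>\<^sub>M" if x: "x .: (T 0)" for x
  proof -
    interpret M: left_module R M by (rule C.M)
    have "eta x .: M" by (rule module_hom_mem[OF C.eps x])
    then show ?thesis using module_hom_minus[OF C.T C.M C.eps module_hom_mem[OF g x] x] ge[OF x] by (simp add: u_def a_minus_def M.r_neg)
  qed
  then have im0: "!!x. x .: (T 0) ==> u 0 x \<in> d 1 ` carrier (T 1)" using C.eps_ker um by auto
  have d1: "d 1 \<in> module_hom R (T 1) (T 0)" using C.d'[of 0] by simp
  obtain h0 where h0: "h0 \<in> module_hom R (T 0) (T 1)" and h0d: "!!x. x .: (T 0) ==> d 1 (h0 x) = u 0 x"
    using projective_lift[OF C.proj C.T C.T d1 u im0] by auto
  \<comment> \<open>The invariant \<open>d h d = u d\<close> is what both ends require: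
    \<open>u - h d\<close> takes values in cycles one degree up, and \<open>u - d h\<close> kills
    boundaries in the present degree.\<close>
  let ?P = "%n h. h \<in> module_hom R (T n) (T (n + 1)) \<and>
    (\<forall>x \<in> carrier (T (n + 1)). d (n + 1) (h (d (n + 1) x)) = u n (d (n + 1) x))"
  let ?R = "%n h h'. \<forall>x \<in> carrier (T (n + 1)). u (n + 1) x = d (n + 1 + 1) (h' x) \<oplus>\<^sub>(T (n + 1)) h (d (n + 1) x)"
  have "\<exists>h. h 0 = h0 & (\<forall>n. ?P n (h n) & ?R n (h n) (h (n + 1)))"
  proof (rule int_dependent_choice)
    show "?P 0 h0" using h0 h0d C.d_mem'[of _ 0] by simp
    fix n h assume h: "?P n h"
    have hm: "h (d (n + 1) x) .: (T (n + 1))" if "x .: (T (n + 1))" for x using module_hom_mem[OF conjunct1[OF h] C.d_mem'[OF that]] .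
    have "d (n + 1) (u (n + 1) x \<ominus>\<^sub>(T (n + 1)) h (d (n + 1) x)) = \<zero>\<^sub>(T n)" if x: "x .: (T (n + 1))" for x
      using module_hom_minus[OF C.T C.T C.d' um[OF x] hm[OF x]] h x ud[OF x] sub(1)[OF C.d_mem'[OF um[OF x]]] by simp
    then obtain h' where h': "h' \<in> module_hom R (T (n + 1)) (T (n + 1 + 1))" and hd': "!!x. x .: (T (n + 1)) ==>
        d (n + 1 + 1) (h' x) = u (n + 1) x \<ominus>\<^sub>(T (n + 1)) h (d (n + 1) x)"
      using lift[OF module_hom_diff[OF C.T C.T u module_hom_compose[OF C.d' conjunct1[OF h]]]] by auto
    have "d (n + 1 + 1) (h' (d (n + 1 + 1) x)) = u (n + 1) (d (n + 1 + 1) x)" if x: "x .: (T (n + 1 + 1))" for x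
      using hd'[OF C.d_mem'[OF x]] C.dd[OF x] module_hom_zero[OF C.T C.T conjunct1[OF h]] sub(2)[OF um[OF C.d_mem'[OF x]]] by simp
    then show "\<exists>h'. ?P (n + 1) h' & ?R n h h'" using h' hd' add_diff(1)[OF um hm] by (intro exI[of _ h']) simp
  next
    fix n h assume h: "?P n h"
    have hm: "d (n + 1) (h x) .: (T n)" "h x .: (T (n + 1))" if "x .: (T n)" for x
      using C.d_mem'[OF module_hom_mem[OF conjunct1[OF h] that]] module_hom_mem[OF conjunct1[OF h] that] by auto
    have "u n (d (n + 1) x) \<ominus>\<^sub>(T n) d (n + 1) (h (d (n + 1) x)) = \<zero>\<^sub>(T n)" if x: "x .: (T (n + 1))" for x
      using h x sub(1)[OF um[OF C.d_mem'[OF x]]] by simp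
    then obtain h' where h': "h' \<in> module_hom R (T (n - 1)) (T n)" and hd': "!!x. x .: (T n) ==> h' (d n x) = u n x \<ominus>\<^sub>(T n) d (n + 1) (h x)"
      using extend[OF module_hom_diff[OF C.T C.T u module_hom_compose[OF conjunct1[OF h] C.d']]] by auto
    have "d n (h' (d n x)) = u (n - 1) (d n x)" if x: "x .: (T n)" for x
      using module_hom_minus[OF C.T C.T C.d um[OF x] hm(1)[OF x]] hd'[OF x] C.dd[OF hm(2)[OF x]]
        sub(2)[OF C.d_mem[OF um[OF x]]] ud[of x "n - 1"] x by simp
    then show "\<exists>h'. ?P (n - 1) h' & ?R (n - 1) h' h" using h' hd' add_diff(2)[OF um hm(1)] by (intro exI[of _ h']) simp
  qed
  then obtain h where h: "!!n. ?P n (h n)" "!!n. ?R n (h n) (h (n + 1))" by blast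
  have "u n x = d (n + 1) (h n x) \<oplus>\<^sub>(T n) h (n - 1) (d n x)" if "x .: (T n)" for n x using h(2)[of "n - 1"] that by simp
  then show ?thesis using h(1) unfolding u_def by blast
qed

section \<open>Dimension of a subquotient\<close>

text \<open>Evaluation by the functionals \<open>\<pi> w\<close> identifies \<open>Z / B\<close>
  with the functions on \<open>W\<close>: \<open>ker\<close> gives injectivity and
  \<open>onto\<close> the dual vectors. Everything is phrased on \<open>Z\<close>, the space of
  cycles in the application.\<close>

lemma has_dimension_quotient:
  fixes V :: "('k, 'v) module" and K :: "('k, 'e) ring_scheme"
  assumes K: "field K" and V: "module K V" and Z: "Z \<subseteq> carrier V" and Z0: "\<zero>\<^sub>V \<in> Z"
    and Zadd: "!!x y. [|x \<in> Z; y \<in> Z|] ==> x \<oplus>\<^sub>V y \<in> Z" and Zsm: "!!c x. [|c .: K; x \<in> Z|] ==> c \<odot>\<^sub>V x \<in> Z"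
    and B: "B \<subseteq> Z" and W: "finite W" and pc: "!!w x. [|w \<in> W; x \<in> Z|] ==> \<pi> w x .: K"
    and padd: "!!w x y. [|w \<in> W; x \<in> Z; y \<in> Z|] ==> \<pi> w (x \<oplus>\<^sub>V y) = \<pi> w x \<oplus>\<^sub>K \<pi> w y"
    and psm: "!!w c x. [|w \<in> W; c .: K; x \<in> Z|] ==> \<pi> w (c \<odot>\<^sub>V x) = c \<otimes>\<^sub>K \<pi> w x"
    and ker: "!!x. x \<in> Z ==> x \<in> B \<longleftrightarrow> (\<forall>w\<in>W. \<pi> w x = \<zero>\<^sub>K)"
    and onto: "!!w. w \<in> W ==> \<exists>z\<in>Z. \<forall>w'\<in>W. \<pi> w' z = (if w' = w then \<one>\<^sub>K else \<zero>\<^sub>K)"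
  shows "has_dimension K (quotient_module (V\<lparr>carrier := Z\<rparr>) B) (card W)"
proof -
  interpret K: field K by (rule K)
  interpret V: module K V by (rule V)
  let ?Q = "quotient_module (V\<lparr>carrier := Z\<rparr>) B"
  have ZV: "x \<in> Z ==> x .: V" for x using Z by auto
  have Zneg: "\<ominus>\<^sub>V x \<in> Z" if "x \<in> Z" for x
  proof -
    have "(\<ominus>\<^sub>K \<one>\<^sub>K) \<odot>\<^sub>V x = \<ominus>\<^sub>V x" using ZV[OF that] V.smult_l_minus[of "\<one>\<^sub>K" x] by simp
    then show ?thesis using Zsm[of "\<ominus>\<^sub>K \<one>\<^sub>K" x] that by simp
  qed
  \<comment> \<open>Cosets of \<open>B\<close> are the fibres of the tuple of functionals. The
    operations on the quotient are set-valued, and on fibres they can be computed.\<close>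
  define fib where "fib x = {y \<in> Z. \<forall>w\<in>W. \<pi> w y = \<pi> w x}" for x
  have diffZ: "y \<oplus>\<^sub>V \<ominus>\<^sub>V x \<in> Z" if "x \<in> Z" "y \<in> Z" for x y using that by (intro Zadd Zneg)
  have diffV: "y \<oplus>\<^sub>V \<ominus>\<^sub>V x \<oplus>\<^sub>V x = y" if "x \<in> Z" "y \<in> Z" for x y
    using that ZV by (simp add: V.M.a_assoc V.M.l_neg)
  have pdiff: "\<pi> w (y \<oplus>\<^sub>V \<ominus>\<^sub>V x) \<oplus>\<^sub>K \<pi> w x = \<pi> w y" if "x \<in> Z" "y \<in> Z" "w \<in> W" for w x y
    using padd[OF that(3) diffZ[OF that(1,2)] that(1)] diffV[OF that(1,2)] by simp
  have cos: "B +>\<^bsub>V\<lparr>carrier := Z\<rparr>\<^esub> x = fib x" if x: "x \<in> Z" for x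
  proof
    show "B +>\<^bsub>V\<lparr>carrier := Z\<rparr>\<^esub> x \<subseteq> fib x"
    proof
      fix y assume "y \<in> B +>\<^bsub>V\<lparr>carrier := Z\<rparr>\<^esub> x"
      then obtain b where b: "b \<in> B" "y = b \<oplus>\<^sub>V x" by (auto simp: a_r_coset_def r_coset_def)
      then have bZ: "b \<in> Z" using B by auto
      have "\<forall>w\<in>W. \<pi> w b = \<zero>\<^sub>K" using b(1) ker[OF bZ] by simp
      then show "y \<in> fib x" using b bZ x by (simp add: fib_def Zadd padd pc)
    qed
    show "fib x \<subseteq> B +>\<^bsub>V\<lparr>carrier := Z\<rparr>\<^esub> x"
    proof
      fix y assume "y \<in> fib x"
      then have y: "y \<in> Z" and e: "!!w. w \<in> W ==> \<pi> w y = \<pi> w x" by (auto simp: fib_def)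
      have "\<pi> w (y \<oplus>\<^sub>V \<ominus>\<^sub>V x) = \<zero>\<^sub>K" if w: "w \<in> W" for w
        using pdiff[OF x y w] e[OF w] pc[OF w x] pc[OF w diffZ[OF x y]] by (simp add: K.add.r_cancel_one)
      then have "y \<oplus>\<^sub>V \<ominus>\<^sub>V x \<in> B" using ker[OF diffZ[OF x y]] by simp
      then show "y \<in> B +>\<^bsub>V\<lparr>carrier := Z\<rparr>\<^esub> x" using diffV[OF x y] by (force simp: a_r_coset_def r_coset_def)
    qed
  qed
  have carQ: "carrier ?Q = fib ` Z" using cos by (auto simp: quotient_module_def FactRing_def A_RCOSETS_def RCOSETS_def a_r_coset_def)
  have fibx: "x \<in> Z ==> x \<in> fib x" for x by (simp add: fib_def)
  have fib_eq: "fib x = fib y \<longleftrightarrow> (\<forall>w\<in>W. \<pi> w x = \<pi> w y)" if "x \<in> Z" "y \<in> Z" for x y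
    using that fibx[OF that(1)] by (auto simp: fib_def)
  have addQ: "fib x \<oplus>\<^sub>?Q fib y = fib (x \<oplus>\<^sub>V y)" if x: "x \<in> Z" and y: "y \<in> Z" for x y
  proof -
    have "fib x \<oplus>\<^sub>?Q fib y = {u \<oplus>\<^sub>V v | u v. u \<in> fib x & v \<in> fib y}"
      by (auto simp: quotient_module_def FactRing_def set_add_def set_mult_def)
    also have "... = fib (x \<oplus>\<^sub>V y)"
    proof
      show "{u \<oplus>\<^sub>V v | u v. u \<in> fib x & v \<in> fib y} \<subseteq> fib (x \<oplus>\<^sub>V y)" using x y by (auto simp: fib_def Zadd padd)
      show "fib (x \<oplus>\<^sub>V y) \<subseteq> {u \<oplus>\<^sub>V v | u v. u \<in> fib x & v \<in> fib y}"
      proof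
        fix z assume "z \<in> fib (x \<oplus>\<^sub>V y)"
        then have z: "z \<in> Z" and e: "!!w. w \<in> W ==> \<pi> w z = \<pi> w x \<oplus>\<^sub>K \<pi> w y" using x y by (auto simp: fib_def padd)
        have "\<pi> w (z \<oplus>\<^sub>V \<ominus>\<^sub>V y) = \<pi> w x" if w: "w \<in> W" for w
          using pdiff[OF y z w] e[OF w] pc[OF w x] pc[OF w y] pc[OF w diffZ[OF y z]] by simp
        then have "z \<oplus>\<^sub>V \<ominus>\<^sub>V y \<in> fib x" using diffZ[OF y z] by (simp add: fib_def)
        then show "z \<in> {u \<oplus>\<^sub>V v | u v. u \<in> fib x & v \<in> fib y}" using diffV[OF y z] fibx[OF y] by force
      qed
    qed
    finally show ?thesis .
  qed
  have smQ: "c \<odot>\<^sub>?Q fib x = fib (c \<odot>\<^sub>V x)" if c: "c .: K" and x: "x \<in> Z" for c x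
  proof -
    have "c \<odot>\<^sub>?Q fib x = (\<Union>u\<in>fib x. B +>\<^bsub>V\<lparr>carrier := Z\<rparr>\<^esub> (c \<odot>\<^sub>V u))"
      by (simp add: quotient_module_def)
    also have "... = (\<Union>u\<in>fib x. fib (c \<odot>\<^sub>V x))"
    proof (rule SUP_cong)
      fix u assume "u \<in> fib x"
      then have u: "u \<in> Z" "\<forall>w\<in>W. \<pi> w u = \<pi> w x" by (auto simp: fib_def)
      show "B +>\<^bsub>V\<lparr>carrier := Z\<rparr>\<^esub> (c \<odot>\<^sub>V u) = fib (c \<odot>\<^sub>V x)" using u x c by (simp add: cos Zsm fib_eq psm)
    qed simp
    finally show ?thesis using fibx[OF x] by auto
  qed
  have zQ: "\<zero>\<^sub>?Q = fib \<zero>\<^sub>V"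
  proof -
    have "\<zero>\<^sub>?Q = B" by (simp add: quotient_module_def FactRing_def)
    also have "B = B +>\<^bsub>V\<lparr>carrier := Z\<rparr>\<^esub> \<zero>\<^sub>V" using B ZV by (force simp: a_r_coset_def r_coset_def)
    finally show ?thesis using cos[OF Z0] by simp
  qed
  have Qab: "abelian_group ?Q"
  proof (rule abelian_groupI)
    fix X assume "X .: ?Q"
    then obtain x where x: "x \<in> Z" "X = fib x" by (auto simp: carQ)
    show "\<exists>Y\<in>carrier ?Q. Y \<oplus>\<^sub>?Q X = \<zero>\<^sub>?Q"
      using x Zneg[of x] ZV by (intro bexI[of _ "fib (\<ominus>\<^sub>V x)"]) (auto simp: addQ zQ carQ V.M.l_neg)
  qed (auto simp: carQ addQ Zadd zQ Z0 ZV V.M.a_ac)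
  have Qm: "module K ?Q" by (rule moduleI[OF K.is_cring Qab])
      (auto simp: carQ addQ smQ Zsm Zadd ZV V.smult_l_distr V.smult_r_distr V.smult_assoc1)
  then have Qvs: "vectorspace K ?Q" using K by (simp add: vectorspace_def)
  interpret Q: vectorspace K ?Q by (rule Qvs)
  \<comment> \<open>Coordinates of a class may be read off at any of its elements, since the
    functionals are constant on fibres.\<close>
  define E where "E w X = \<pi> w (SOME x. x \<in> X)" for w X
  have Efib: "E w (fib x) = \<pi> w x" if "w \<in> W" "x \<in> Z" for w x
  proof -
    have "(SOME y. y \<in> fib x) \<in> fib x" using fibx[OF that(2)] by (rule someI)
    then show ?thesis using that(1) by (auto simp: E_def fib_def)
  qed
  have Ec: "E w X .: K" if "w \<in> W" "X .: ?Q" for w X using that by (auto simp: carQ Efib pc)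
  have Eadd: "E w (X \<oplus>\<^sub>?Q Y) = E w X \<oplus>\<^sub>K E w Y" if "w \<in> W" "X .: ?Q" "Y .: ?Q" for w X Y
    using that by (auto simp: carQ Efib addQ Zadd padd)
  have Esm: "E w (c \<odot>\<^sub>?Q X) = c \<otimes>\<^sub>K E w X" if "w \<in> W" "X .: ?Q" "c .: K" for w X c
    using that by (auto simp: carQ Efib smQ Zsm psm)
  have Einj: "X = Y" if "X .: ?Q" "Y .: ?Q" "!!w. w \<in> W ==> E w X = E w Y" for X Y
  proof -
    from that(1,2) obtain x y where x: "x \<in> Z" "X = fib x" and y: "y \<in> Z" "Y = fib y" by (auto simp: carQ)
    show ?thesis using that(3) x y by (simp add: fib_eq Efib)
  qed
  have "\<forall>w\<in>W. \<exists>z. z \<in> Z & (\<forall>w'\<in>W. \<pi> w' z = (if w' = w then \<one>\<^sub>K else \<zero>\<^sub>K))" using onto by blast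
  from bchoice[OF this] obtain z where z: "!!w. w \<in> W ==> z w \<in> Z"
    and pz: "!!w w'. [|w \<in> W; w' \<in> W|] ==> \<pi> w' (z w) = (if w' = w then \<one>\<^sub>K else \<zero>\<^sub>K)" by blast
  define v where "v w = fib (z w)" for w
  have vQ: "w \<in> W ==> v w .: ?Q" for w using z by (simp add: v_def carQ)
  have Ev: "E w' (v w) = (if w' = w then \<one>\<^sub>K else \<zero>\<^sub>K)" if "w \<in> W" "w' \<in> W" for w w' using that z pz by (simp add: v_def Efib)
  have inj: "inj_on v W"
  proof (rule inj_onI)
    fix w w' assume w: "w \<in> W" "w' \<in> W" "v w = v w'"
    show "w = w'" using Ev[OF w(1) w(1)] Ev[OF w(2) w(1)] w(3) K.one_not_zero by (auto split: if_splits)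
  qed
  let ?A = "v ` W"
  have A: "finite ?A" "?A \<subseteq> carrier ?Q" using W vQ by auto
  have Elc: "E w (Q.lincomb a ?A) = a (v w)" if a: "a \<in> ?A \<rightarrow> carrier K" and w: "w \<in> W" for a w
  proof -
    have ac: "w' \<in> W ==> a (v w') .: K" for w' using a by auto
    have "Q.lincomb a ?A = (\<Oplus>\<^sub>?Q w'\<in>W. a (v w') \<odot>\<^sub>?Q v w')"
      unfolding Q.lincomb_def using inj ac vQ by (intro Q.finsum_reindex) auto
    then have "E w (Q.lincomb a ?A) = (\<Oplus>\<^sub>K w'\<in>W. E w (a (v w') \<odot>\<^sub>?Q v w'))"
      using additive_finsum[OF Qab K.is_abelian_group, of "E w" W "%w'. a (v w') \<odot>\<^sub>?Q v w'"]
        Ec[OF w] Eadd[OF w] ac vQ by simp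
    also have "... = (\<Oplus>\<^sub>K w'\<in>W. if w = w' then a (v w') else \<zero>\<^sub>K)" using w ac vQ Ev by (intro K.finsum_eqI) (auto simp: Esm)
    also have "... = a (v w)" using w W ac by (intro K.finsum_singleton) auto
    finally show ?thesis .
  qed
  have gen: "Q.gen_set ?A"
  proof
    show "Q.span ?A \<subseteq> carrier ?Q" by (rule Q.span_is_subset2[OF A(2)])
    show "carrier ?Q \<subseteq> Q.span ?A"
    proof
      fix X assume X: "X .: ?Q"
      define a where "a = (%u. E (the_inv_into W v u) X)"
      have av: "w \<in> W ==> a (v w) = E w X" for w using inj by (simp add: a_def the_inv_into_f_f)
      have aA: "a \<in> ?A \<rightarrow> carrier K" using av Ec[OF _ X] by auto
      have "X = Q.lincomb a ?A" using Elc[OF aA] av aA A by (intro Einj X Q.lincomb_closed) auto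
      then show "X \<in> Q.span ?A" unfolding Q.span_def using A aA by blast
    qed
  qed
  have li: "~ Q.lin_dep ?A"
  proof (rule Q.finite_lin_indpt2[OF A])
    fix a assume a: "a \<in> ?A \<rightarrow> carrier K" and e: "Q.lincomb a ?A = \<zero>\<^sub>?Q"
    have "a (v w) = \<zero>\<^sub>K" if w: "w \<in> W" for w using Elc[OF a w] additive_zero[OF Qab K.is_abelian_group Ec[OF w] Eadd[OF w]] by (simp add: e)
    then show "\<forall>u\<in>?A. a u = \<zero>\<^sub>K" by auto
  qed
  have "Q.dim = card ?A" using A gen li by (intro Q.dim_basis) (auto simp: Q.basis_def)
  moreover have "Q.fin_dim" unfolding Q.fin_dim_def using A gen by blast
  ultimately show ?thesis using Qvs card_image[OF inj] by (simp add: has_dimension_def)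
qed

section \<open>Tensor products\<close>

definition pure_tensor ::
  "('r, 'e) ring_scheme => ('r, 'm, 'f) module_scheme => ('r, 'n, 'g) module_scheme
    => 'm => 'n => ('m \<times> 'n \<Rightarrow>\<^sub>0 int) set" where "pure_tensor R M N x y = tensor_class R M N (frag_of (x, y))"

lemma frag_extend_plus:
  "frag_extend (%z. f z + g z) u = frag_extend f u + frag_extend g u" by (simp add: frag_extend_def frag_cmul_distrib2 sum.distrib)

lemma frag_extend_minus_fun:
  fixes f g :: "'z => 'y \<Rightarrow>\<^sub>0 int" shows "frag_extend (%z. f z - g z) u = frag_extend f u - frag_extend g u"
proof -
  have "frag_cmul c (x - y) = frag_cmul c x - frag_cmul c y" for c and x y :: "'y \<Rightarrow>\<^sub>0 int"
    by (rule poly_mapping_eqI) (simp add: lookup_minus right_diff_distrib)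
  then show ?thesis by (simp add: frag_extend_def sum_subtractf)
qed

text \<open>Besides the additive structure only closure under the actions is assumed; it guarantees
  that the relations are formal sums over the carriers. The locale serves tensor products over
  \<open>K\<close> and over the enveloping algebra alike.\<close>

locale tensor_product =
  fixes R :: "('r, 'e) ring_scheme" and M :: "('r, 'm, 'f) module_scheme" and N :: "('r, 'n, 'g) module_scheme"
  assumes M: "abelian_group M" and N: "abelian_group N" and Msm: "[|r .: R; x .: M|] ==> r \<odot>\<^sub>M x .: M"
    and Nsm: "[|r .: R; y .: N|] ==> r \<odot>\<^sub>N y .: N"
begin

abbreviation "Ker == tensor_kernel R M N"
abbreviation "cls == tensor_class R M N"
abbreviation "F == {u :: 'm \<times> 'n \<Rightarrow>\<^sub>0 int. Poly_Mapping.keys u \<subseteq> carrier M \<times> carrier N}"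

lemma F_add: "u \<in> F ==> v \<in> F ==> u + v \<in> F"
  using keys_add[of u v] by blast

lemma F_minus: "u \<in> F ==> - u \<in> F"
  by simp

lemma F_diff: "u \<in> F ==> v \<in> F ==> u - v \<in> F"
  using keys_diff[of u v] by blast

lemma F_of: "x .: M ==> y .: N ==> frag_of (x, y) \<in> F"
  by simp

lemma relation_cases:
  assumes "u \<in> tensor_relations R M N"
  obtains (left) x x' y where "x .: M" "x' .: M" "y .: N"
      "u = frag_of (x \<oplus>\<^sub>M x', y) - frag_of (x, y) - frag_of (x', y)"
    | (right) x y y' where "x .: M" "y .: N" "y' .: N"
      "u = frag_of (x, y \<oplus>\<^sub>N y') - frag_of (x, y) - frag_of (x, y')"
    | (middle) r x y where "r .: R" "x .: M" "y .: N"
      "u = frag_of (r \<odot>\<^sub>M x, y) - frag_of (x, r \<odot>\<^sub>N y)" using assms unfolding tensor_relations_def by blast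

lemma relations_F: "tensor_relations R M N \<subseteq> F"
proof
  interpret M: abelian_group M by (rule M)
  interpret N: abelian_group N by (rule N)
  fix u assume "u \<in> tensor_relations R M N"
  then show "u \<in> F"
  proof (cases rule: relation_cases)
    case left
    show ?thesis unfolding left(4) by (intro F_diff F_of M.a_closed left)
  next
    case right
    show ?thesis unfolding right(4) by (intro F_diff F_of N.a_closed right)
  next
    case middle
    show ?thesis unfolding middle(4) by (intro F_diff F_of Msm Nsm middle)
  qed
qed

lemma Ker_F: "k \<in> Ker ==> k \<in> F"
proof -
  have "Ker \<subseteq> carrier (free_Abelian_group (carrier M \<times> carrier N))" unfolding tensor_kernel_def using relations_F
    by (intro group.generate_incl group_free_Abelian_group) auto
  then have "k \<in> Ker ==> k .: (free_Abelian_group (carrier M \<times> carrier N))" by blast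
  then show "k \<in> Ker ==> k \<in> F" by simp
qed

lemma Ker_zero: "0 \<in> Ker"
  using generate.one[of "free_Abelian_group (carrier M \<times> carrier N)"] by (simp add: tensor_kernel_def)

lemma Ker_add: "u \<in> Ker ==> v \<in> Ker ==> u + v \<in> Ker"
  unfolding tensor_kernel_def using generate.eng[of u "free_Abelian_group (carrier M \<times> carrier N)"] by simp

lemma Ker_rel: "u \<in> tensor_relations R M N ==> u \<in> Ker"
  unfolding tensor_kernel_def by (rule generate.incl)

text \<open>\<open>generate\<close> adjoins inverses of the generators, hence the claim for
  \<open>- u\<close> in the relation case.\<close>

lemma Ker_induct [consumes 1, case_names zero rel add]:
  assumes k: "k \<in> Ker" and P0: "P 0" and rel: "!!u. u \<in> tensor_relations R M N ==> P u & P (- u)" and add: "!!u v. [|P u; P v|] ==> P (u + v)"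
  shows "P k" using k unfolding tensor_kernel_def
proof (induction rule: generate.induct)
  case (inv h)
  then have "inv\<^bsub>free_Abelian_group (carrier M \<times> carrier N)\<^esub> h = - h" using relations_F by (intro inv_free_Abelian_group) auto
  then show ?case using rel[OF inv] by simp
qed (use P0 rel add in auto)

lemma Ker_minus: "u \<in> Ker ==> - u \<in> Ker"
proof (induction rule: Ker_induct)
  case (rel u)
  have "Poly_Mapping.keys u \<subseteq> carrier M \<times> carrier N" using relations_F rel by auto
  then have "inv\<^bsub>free_Abelian_group (carrier M \<times> carrier N)\<^esub> u = - u" by (rule inv_free_Abelian_group)
  then have "- u \<in> Ker" using generate.inv[OF rel, of "free_Abelian_group (carrier M \<times> carrier N)"] by (simp add: tensor_kernel_def)
  then show ?case using Ker_rel[OF rel] by simp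
next
  case (add u v)
  then show ?case using Ker_add[of "- u" "- v"] by simp
qed (use Ker_zero in simp)

lemma cls_def: "cls u = (%k. k + u) ` Ker"
  by (auto simp: tensor_class_def r_coset_def)

lemma cls_self: "u \<in> cls u"
  using Ker_zero by (force simp: cls_def)

lemma cls_eq: "cls u = cls v \<longleftrightarrow> u - v \<in> Ker"
proof
  assume "cls u = cls v"
  then have "u \<in> cls v" using cls_self by auto
  then show "u - v \<in> Ker" by (auto simp: cls_def)
next
  assume uv: "u - v \<in> Ker"
  have "k + u \<in> cls v" if "k \<in> Ker" for k using Ker_add[OF that uv] by (force simp: cls_def intro: image_eqI[of _ _ "k + (u - v)"])
  moreover have "k + v \<in> cls u" if "k \<in> Ker" for k
    using Ker_add[OF that Ker_minus[OF uv]] by (force simp: cls_def intro: image_eqI[of _ _ "k + - (u - v)"])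
  ultimately show "cls u = cls v" by (auto simp: cls_def)
qed

lemma cls_memD: "v \<in> cls u ==> \<exists>k\<in>Ker. v = u + k"
  by (auto simp: cls_def add.commute)

lemma tensor_group_carrier: "carrier (tensor_group R M N) = cls ` F"
  by (auto simp: tensor_group_def FactGroup_def RCOSETS_def tensor_class_def)

lemma tensor_space_carrier: "carrier (tensor_space R sc M N) = cls ` F"
  by (simp add: tensor_space_def tensor_group_carrier)

lemma tensor_space_zero: "\<zero>\<^sub>(tensor_space R sc M N) = cls 0"
  by (simp add: tensor_space_def tensor_group_def FactGroup_def cls_def)

lemma tensor_space_add: "cls u \<oplus>\<^sub>(tensor_space R sc M N) cls v = cls (u + v)"
proof -
  have "cls u \<oplus>\<^sub>(tensor_space R sc M N) cls v = {x + y | x y. x \<in> cls u & y \<in> cls v}"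
    by (auto simp: tensor_space_def tensor_group_def FactGroup_def set_mult_def)
  also have "... = cls (u + v)"
  proof
    show "{x + y | x y. x \<in> cls u & y \<in> cls v} \<subseteq> cls (u + v)"
    proof safe
      fix x y assume "x \<in> cls u" "y \<in> cls v"
      then obtain k l where "k \<in> Ker" "l \<in> Ker" "x = k + u" "y = l + v" by (auto simp: cls_def)
      then show "x + y \<in> cls (u + v)" using Ker_add[of k l] by (force simp: cls_def intro: image_eqI[of _ _ "k + l"])
    qed
    show "cls (u + v) \<subseteq> {x + y | x y. x \<in> cls u & y \<in> cls v}"
    proof
      fix x assume "x \<in> cls (u + v)"
      then obtain k where k: "k \<in> Ker" "x = (k + u) + v" by (auto simp: cls_def add.assoc)
      then show "x \<in> {x + y | x y. x \<in> cls u & y \<in> cls v}" using cls_self[of v] by (force simp: cls_def)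
    qed
  qed
  finally show ?thesis .
qed

lemma abelian_group_tensor: "abelian_group (tensor_space R sc M N)"
proof (rule abelian_groupI)
  fix X assume "X .: (tensor_space R sc M N)"
  then obtain u where u: "u \<in> F" "X = cls u" by (auto simp: tensor_space_carrier)
  then show "\<exists>Y\<in>carrier (tensor_space R sc M N). Y \<oplus>\<^sub>(tensor_space R sc M N) X = \<zero>\<^sub>(tensor_space R sc M N)"
    using F_minus[of u] by (intro bexI[of _ "cls (- u)"])
      (auto simp: tensor_space_carrier tensor_space_add tensor_space_zero)
qed (use F_add in \<open>auto simp: tensor_space_carrier tensor_space_add tensor_space_zero add_ac intro!: imageI\<close>)

abbreviation "pure == pure_tensor R M N"

lemma pure_closed: "[|x .: M; y .: N|] ==> pure x y .: (tensor_space R sc M N)"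
  unfolding tensor_space_carrier pure_tensor_def by (intro imageI F_of)

lemma pure_add_left:
  assumes "x .: M" "x' .: M" "y .: N" shows "pure (x \<oplus>\<^sub>M x') y = pure x y \<oplus>\<^sub>(tensor_space R sc M N) pure x' y"
  unfolding pure_tensor_def tensor_space_add cls_eq using assms by (intro Ker_rel) (auto simp: tensor_relations_def diff_diff_eq)

lemma pure_add_right:
  assumes "x .: M" "y .: N" "y' .: N" shows "pure x (y \<oplus>\<^sub>N y') = pure x y \<oplus>\<^sub>(tensor_space R sc M N) pure x y'"
proof -
  have "frag_of (x, y \<oplus>\<^sub>N y') - frag_of (x, y) - frag_of (x, y') \<in> tensor_relations R M N"
    unfolding tensor_relations_def using assms by blast
  then show ?thesis unfolding pure_tensor_def tensor_space_add cls_eq by (intro Ker_rel) (simp add: diff_diff_eq)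
qed

lemma pure_middle:
  assumes "r .: R" "x .: M" "y .: N" shows "pure (r \<odot>\<^sub>M x) y = pure x (r \<odot>\<^sub>N y)" unfolding pure_tensor_def cls_eq using assms
  by (intro Ker_rel) (auto simp: tensor_relations_def)

lemma pure_zero_left:
  assumes y: "y .: N" shows "pure \<zero>\<^sub>M y = \<zero>\<^sub>(tensor_space R sc M N)"
  by (rule additive_zero[OF M abelian_group_tensor]) (use y in \<open>auto simp: pure_closed pure_add_left\<close>)

text \<open>The negative of a pure tensor is pure, because the sign can be moved into the left
  factor; so sums of pure tensors exhaust the space. The induction over formal sums proceeds by
  differences and therefore carries the claim for \<open>u\<close> and \<open>- u\<close>
  together.\<close>

lemma tensor_induct [consumes 1, case_names pure add]:
  assumes X: "X .: (tensor_space R sc M N)" and pure: "!!x y. [|x .: M; y .: N|] ==> P (pure x y)"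
    and add: "!!X Y. [|X .: (tensor_space R sc M N); Y .: (tensor_space R sc M N); P X; P Y|]
      ==> P (X \<oplus>\<^sub>(tensor_space R sc M N) Y)" shows "P X"
proof -
  interpret M: abelian_group M by (rule M)
  interpret N: abelian_group N by (rule N)
  have neg: "cls (- frag_of (x, y)) = pure (\<ominus>\<^sub>M x) y" if "x .: M" "y .: N" for x y
  proof -
    have "pure \<zero>\<^sub>M y = pure (\<ominus>\<^sub>M x) y \<oplus>\<^sub>(tensor_space R sc M N) pure x y"
      using that pure_add_left[of "\<ominus>\<^sub>M x" x y] by (simp add: M.l_neg)
    then have "cls (frag_of (\<ominus>\<^sub>M x, y) + frag_of (x, y)) = cls 0"
      using pure_zero_left[OF that(2)] by (simp add: pure_tensor_def tensor_space_add tensor_space_zero)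
    then have "frag_of (\<ominus>\<^sub>M x, y) + frag_of (x, y) \<in> Ker" by (simp add: cls_eq)
    from Ker_minus[OF this] show ?thesis unfolding pure_tensor_def cls_eq by (simp add: algebra_simps)
  qed
  obtain u where u: "u \<in> F" "X = cls u" using X by (auto simp: tensor_space_carrier)
  have "P (cls u) & P (cls (- u))"
  proof (rule free_Abelian_group_induct[of u "carrier M \<times> carrier N"])
    show "Poly_Mapping.keys u \<subseteq> carrier M \<times> carrier N" using u by simp
    have "cls 0 = pure \<zero>\<^sub>M \<zero>\<^sub>N" using pure_zero_left[of "\<zero>\<^sub>N"] by (simp add: tensor_space_zero)
    then show "P (cls 0) & P (cls (- 0))" using pure by simp
    show "P (cls (frag_of a)) & P (cls (- frag_of a))" if "a \<in> carrier M \<times> carrier N" for a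
      using that pure neg by (cases a) (auto simp: pure_tensor_def)
    show "P (cls (v - w)) & P (cls (- (v - w)))"
      if vw: "Poly_Mapping.keys v \<subseteq> carrier M \<times> carrier N" "Poly_Mapping.keys w \<subseteq> carrier M \<times> carrier N"
        and P: "P (cls v) & P (cls (- v))" "P (cls w) & P (cls (- w))" for v w
    proof -
      have c: "cls v .: (tensor_space R sc M N)" "cls w .: (tensor_space R sc M N)"
        "cls (- v) .: (tensor_space R sc M N)" "cls (- w) .: (tensor_space R sc M N)" using vw by (auto simp: tensor_space_carrier)
      show ?thesis using add[OF c(1) c(4)] add[OF c(2) c(3)] P by (simp add: tensor_space_add)
    qed
  qed
  then show ?thesis using u by simp
qed

lemma tensor_hom_eqI:
  assumes H: "abelian_group H" and f: "!!X Y. [|X .: (tensor_space R sc M N); Y .: (tensor_space R sc M N)|]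
      ==> f (X \<oplus>\<^sub>(tensor_space R sc M N) Y) = f X \<oplus>\<^sub>H f Y"
    and g: "!!X Y. [|X .: (tensor_space R sc M N); Y .: (tensor_space R sc M N)|]
      ==> g (X \<oplus>\<^sub>(tensor_space R sc M N) Y) = g X \<oplus>\<^sub>H g Y" and e: "!!x y. [|x .: M; y .: N|] ==> f (pure x y) = g (pure x y)"
    and X: "X .: (tensor_space R sc M N)" shows "f X = g X" using X by (induction rule: tensor_induct) (simp_all add: e f g)

text \<open>Operations on tensor classes are defined as unions over representatives. If
  \<open>\<phi>\<close> is additive and \<open>c\<close> does not see the images of kernel elements,
  all the united cosets coincide.\<close>

lemma Union_cls:
  assumes f: "!!u v. \<phi> (u + v) = \<phi> u + (\<phi> v :: 'c \<Rightarrow>\<^sub>0 int)"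
    and k: "!!k. k \<in> Ker ==> c (\<phi> u + \<phi> k) = c (\<phi> u)" shows "(\<Union>v\<in>cls u. c (\<phi> v)) = c (\<phi> u)"
proof -
  have "c (\<phi> v) = c (\<phi> u)" if v: "v \<in> cls u" for v
  proof -
    obtain l where "l \<in> Ker" "v = u + l" using cls_memD[OF v] by blast
    then show ?thesis using k[of l] by (simp only: f)
  qed
  then have "(\<Union>v\<in>cls u. c (\<phi> v)) = (\<Union>v\<in>cls u. c (\<phi> u))" by (intro SUP_cong refl)
  also have "... = c (\<phi> u)" using cls_self[of u] by auto
  finally show ?thesis .
qed

text \<open>The universal property of the tensor product. \<open>tensor_induced\<close> is an
  explicit sum over some representative. The homomorphism \<open>h\<close> on the free abelian group
  kills the kernel (\<open>hk\<close>) and is computed by that sum (\<open>hex\<close>), so the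
  choice of the representative is immaterial.\<close>

lemma balanced_hom:
  assumes H: "abelian_group H" and gc: "!!x y. [|x .: M; y .: N|] ==> g (x, y) .: H" and gl: "!!x x' y. [|x .: M; x' .: M; y .: N|]
      ==> g (x \<oplus>\<^sub>M x', y) = g (x, y) \<oplus>\<^sub>H g (x', y)" and gr: "!!x y y'. [|x .: M; y .: N; y' .: N|]
      ==> g (x, y \<oplus>\<^sub>N y') = g (x, y) \<oplus>\<^sub>H g (x, y')"
    and gm: "!!r x y. [|r .: R; x .: M; y .: N|] ==> g (r \<odot>\<^sub>M x, y) = g (x, r \<odot>\<^sub>N y)"
  shows "!!u. u \<in> F ==> tensor_induced H g (cls u) .: H" and "!!u v. [|u \<in> F; v \<in> F|] ==> tensor_induced H g (cls (u + v))
      = tensor_induced H g (cls u) \<oplus>\<^sub>H tensor_induced H g (cls v)" and "!!x y. [|x .: M; y .: N|] ==> tensor_induced H g (pure x y) = g (x, y)"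
proof -
  interpret H: abelian_group H by (rule H)
  interpret M: abelian_group M by (rule M)
  interpret N: abelian_group N by (rule N)
  let ?S = "carrier M \<times> carrier N"
  have gS: "g ` ?S \<subseteq> carrier (add_monoid H)" using gc by auto
  obtain h where h: "h \<in> hom (free_Abelian_group ?S) (add_monoid H)" and hg: "!!z. z \<in> ?S ==> h (frag_of z) = g z"
    using comm_group.free_Abelian_group_universal[OF H.a_comm_group gS] by blast
  have hc: "u \<in> F ==> h u .: H" for u using h by (auto simp: hom_def)
  have ha: "[|u \<in> F; v \<in> F|] ==> h (u + v) = h u \<oplus>\<^sub>H h v" for u v using h by (auto simp: hom_def)
  have h0: "h 0 = \<zero>\<^sub>H" using ha[of 0 0] hc[of 0] by (simp add: H.add.l_cancel_one)
  have hm: "h (- u) = \<ominus>\<^sub>H h u" if "u \<in> F" for u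
    using ha[OF F_minus[OF that] that] h0 hc[OF that] hc[OF F_minus[OF that]] by (simp add: H.minus_equality)
  have hd: "h (u - v) = h u \<ominus>\<^sub>H h v" if "u \<in> F" "v \<in> F" for u v
    using ha[OF that(1) F_minus[OF that(2)]] hm[OF that(2)] by (simp add: a_minus_def)
  have hof: "[|x .: M; y .: N|] ==> h (frag_of (x, y)) = g (x, y)" for x y by (rule hg) simp
  have hk: "h k = \<zero>\<^sub>H" if "k \<in> Ker" for k
  proof -
    have sub2: "a \<oplus>\<^sub>H b \<ominus>\<^sub>H a \<ominus>\<^sub>H b = \<zero>\<^sub>H" if "a .: H" "b .: H" for a b
    proof -
      have "a \<oplus>\<^sub>H b \<ominus>\<^sub>H a = b" using that H.r_neg1[of a b] by (simp add: a_minus_def H.a_comm[of _ "\<ominus>\<^sub>H a"])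
      then show ?thesis using that by (simp add: a_minus_def H.r_neg)
    qed
    have sub1: "a \<ominus>\<^sub>H a = \<zero>\<^sub>H" if "a .: H" for a using that by (simp add: a_minus_def H.r_neg)
    have rel0: "h u = \<zero>\<^sub>H" if u: "u \<in> tensor_relations R M N" for u
    proof -
      from u show ?thesis
      proof (cases rule: relation_cases)
        case (left x x' y)
        then have "h u = h (frag_of (x \<oplus>\<^sub>M x', y)) \<ominus>\<^sub>H h (frag_of (x, y)) \<ominus>\<^sub>H h (frag_of (x', y))"
          by (simp only: hd F_diff F_of M.a_closed)
        then show ?thesis using left by (simp add: hof gl sub2 gc)
      next
        case (right x y y')
        then have "h u = h (frag_of (x, y \<oplus>\<^sub>N y')) \<ominus>\<^sub>H h (frag_of (x, y)) \<ominus>\<^sub>H h (frag_of (x, y'))"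
          by (simp only: hd F_diff F_of N.a_closed)
        then show ?thesis using right by (simp add: hof gr sub2 gc)
      next
        case (middle r x y)
        then have "h u = h (frag_of (r \<odot>\<^sub>M x, y)) \<ominus>\<^sub>H h (frag_of (x, r \<odot>\<^sub>N y))" by (simp only: hd F_of Msm Nsm)
        then show ?thesis using middle by (simp add: hof gm sub1 gc Msm Nsm)
      qed
    qed
    have "k \<in> F & h k = \<zero>\<^sub>H" using that
    proof (induction rule: Ker_induct)
      case zero
      then show ?case using h0 by simp
    next
      case (rel u)
      then have "u \<in> F" using relations_F by auto
      then show ?case using rel0[OF rel] hm[of u] F_minus[of u] by simp
    next
      case (add u v)
      then show ?case using ha[of u v] F_add[of u v] by simp
    qed
    then show ?thesis ..
  qed
  have hex: "h u = (\<Oplus>\<^sub>H z\<in>Poly_Mapping.keys u. [Poly_Mapping.lookup u z] \<cdot>\<^sub>H g z)" if u: "u \<in> F" for u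
  proof -
    have cm: "frag_cmul c (frag_of z) \<in> F & h (frag_cmul c (frag_of z)) = [c] \<cdot>\<^sub>H g z" if z: "z \<in> ?S" for c z
    proof
      show "frag_cmul c (frag_of z) \<in> F" using z keys_cmul[of c "frag_of z"] by auto
      have "h (frag_of z [^]\<^sub>(free_Abelian_group ?S) c) = h (frag_of z) [^]\<^sub>(add_monoid H) c"
        using z by (intro hom_int_pow[OF h]) (auto intro: H.a_group)
      then show "h (frag_cmul c (frag_of z)) = [c] \<cdot>\<^sub>H g z" using z hg[OF z] by (simp add: add_pow_def)
    qed
    have "(\<Sum>z\<in>A. frag_cmul (c z) (frag_of z)) \<in> F \<and>
        h (\<Sum>z\<in>A. frag_cmul (c z) (frag_of z)) = (\<Oplus>\<^sub>H z\<in>A. [c z] \<cdot>\<^sub>H g z)"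
      if "finite A" "A \<subseteq> ?S" for A and c :: "'m \<times> 'n => int" using that
    proof (induction A rule: finite_induct)
      case empty
      then show ?case using h0 by simp
    next
      case (insert a A)
      have a: "a \<in> ?S" using insert.prems by auto
      have IH: "(\<Sum>z\<in>A. frag_cmul (c z) (frag_of z)) \<in> F"
        "h (\<Sum>z\<in>A. frag_cmul (c z) (frag_of z)) = (\<Oplus>\<^sub>H z\<in>A. [c z] \<cdot>\<^sub>H g z)" using insert by auto
      have gA: "[c z] \<cdot>\<^sub>H g z .: H" if "z \<in> insert a A" for z using that insert.prems gc by (intro H.add.int_pow_closed) auto
      have "h (\<Sum>z\<in>insert a A. frag_cmul (c z) (frag_of z))
          = h (frag_cmul (c a) (frag_of a)) \<oplus>\<^sub>H h (\<Sum>z\<in>A. frag_cmul (c z) (frag_of z))"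
        using insert.hyps cm[OF a, of "c a"] IH(1) by (subst ha[symmetric]) auto
      also have "... = (\<Oplus>\<^sub>H z\<in>insert a A. [c z] \<cdot>\<^sub>H g z)" using insert.hyps cm[OF a] IH(2) gA by (subst H.finsum_insert) auto
      finally show ?case using F_add[OF conjunct1[OF cm[OF a, of "c a"]] IH(1)] insert.hyps by simp
    qed
    from this[of "Poly_Mapping.keys u" "Poly_Mapping.lookup u"] u
    show ?thesis using frag_expansion[of u] by (auto simp: frag_extend_def)
  qed
  have ind: "tensor_induced H g (cls u) = h u" if u: "u \<in> F" for u
  proof -
    have "(\<Oplus>\<^sub>H z\<in>Poly_Mapping.keys v. [Poly_Mapping.lookup v z] \<cdot>\<^sub>H g z) = h u" if vu: "v \<in> cls u" for v
    proof -
      obtain k where k: "k \<in> Ker" "v = u + k" using cls_memD[OF vu] by blast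
      then have v: "v \<in> F" using F_add[OF u Ker_F] by simp
      have "h v = h u" using ha[OF u Ker_F[OF k(1)]] hk[OF k(1)] hc[OF u] k(2) by simp
      then show ?thesis using hex[OF v] by simp
    qed
    then show ?thesis unfolding tensor_induced_def using cls_self[of u] by (intro the_equality bexI[of _ u]) auto
  qed
  show "!!u. u \<in> F ==> tensor_induced H g (cls u) .: H" using ind hc by simp
  show "!!u v. [|u \<in> F; v \<in> F|] ==> tensor_induced H g (cls (u + v))
      = tensor_induced H g (cls u) \<oplus>\<^sub>H tensor_induced H g (cls v)" using ind ha F_add by simp
  show "!!x y. [|x .: M; y .: N|] ==> tensor_induced H g (pure x y) = g (x, y)" unfolding pure_tensor_def using ind[OF F_of] hof by simp
qed

lemma tensor_induced_hom:
  assumes H: "abelian_group H" and gc: "!!x y. [|x .: M; y .: N|] ==> g (x, y) .: H" and gl: "!!x x' y. [|x .: M; x' .: M; y .: N|]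
      ==> g (x \<oplus>\<^sub>M x', y) = g (x, y) \<oplus>\<^sub>H g (x', y)" and gr: "!!x y y'. [|x .: M; y .: N; y' .: N|]
      ==> g (x, y \<oplus>\<^sub>N y') = g (x, y) \<oplus>\<^sub>H g (x, y')"
    and gm: "!!r x y. [|r .: R; x .: M; y .: N|] ==> g (r \<odot>\<^sub>M x, y) = g (x, r \<odot>\<^sub>N y)"
  shows "X .: (tensor_space R sc M N) ==> tensor_induced H g X .: H" and "[|X .: (tensor_space R sc M N); Y .: (tensor_space R sc M N)|]
      ==> tensor_induced H g (X \<oplus>\<^sub>(tensor_space R sc M N) Y) = tensor_induced H g X \<oplus>\<^sub>H tensor_induced H g Y"
    and "[|x .: M; y .: N|] ==> tensor_induced H g (pure x y) = g (x, y)"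
proof -
  note B = balanced_hom[where H = H and g = g, OF H gc gl gr gm]
  show "X .: (tensor_space R sc M N) ==> tensor_induced H g X .: H" unfolding tensor_space_carrier using B(1) by blast
  show "[|X .: (tensor_space R sc M N); Y .: (tensor_space R sc M N)|]
      ==> tensor_induced H g (X \<oplus>\<^sub>(tensor_space R sc M N) Y) = tensor_induced H g X \<oplus>\<^sub>H tensor_induced H g Y"
    unfolding tensor_space_carrier using B(2) by (auto simp: tensor_space_add)
  show "[|x .: M; y .: N|] ==> tensor_induced H g (pure x y) = g (x, y)" using B(3) .
qed

end

context tensor_product
begin

text \<open>\<open>L\<close> stands for the kernel of another tensor product. The assumption on
  \<open>\<phi>\<close> is in terms of differences to match \<open>frag_extend_diff\<close>.\<close>

lemma Ker_map:
  assumes k: "k \<in> Ker" and a: "!!u v. \<phi> (u - v) = \<phi> u - (\<phi> v :: 'c \<Rightarrow>\<^sub>0 int)"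
    and L: "0 \<in> L" "!!u v. [|u \<in> L; v \<in> L|] ==> u + v \<in> L" "!!u. u \<in> L ==> - u \<in> L"
    and rel: "!!u. u \<in> tensor_relations R M N ==> \<phi> u \<in> L" shows "\<phi> k \<in> L"
proof -
  have z: "\<phi> 0 = 0" using a[of 0 0] by simp
  have m: "\<phi> (- u) = - \<phi> u" for u using a[of 0 u] z by simp
  have p: "\<phi> (u + v) = \<phi> u + \<phi> v" for u v using a[of u "- v"] m by simp
  show ?thesis using k by (induction rule: Ker_induct) (use z m p L rel in auto)
qed

end

section \<open>Scalars and functoriality\<close>

text \<open>\<open>K\<close> acts through the left factor by \<open>sc\<close>, and
  \<open>sc_R\<close> makes this compatible with the relations over \<open>R\<close>. For tensor
  products of algebras \<open>R\<close> is \<open>K\<close> itself; for the homology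
  \<open>R\<close> is the enveloping algebra.\<close>

locale tensor_scalars = tensor_product R M N + K: cring K
  for R :: "('r, 'e) ring_scheme" and M :: "('r, 'm, 'f) module_scheme" and N :: "('r, 'n, 'g) module_scheme" and K :: "('k, 'h) ring_scheme" +
  fixes sc :: "'k => 'm => 'm"
  assumes sc_closed: "[|c .: K; x .: M|] ==> sc c x .: M"
    and sc_add: "[|c .: K; x .: M; x' .: M|] ==> sc c (x \<oplus>\<^sub>M x') = sc c x \<oplus>\<^sub>M sc c x'"
    and sc_R: "[|c .: K; r .: R; x .: M|] ==> sc c (r \<odot>\<^sub>M x) = r \<odot>\<^sub>M sc c x"
    and sc_plus: "[|c .: K; c' .: K; x .: M|] ==> sc (c \<oplus>\<^sub>K c') x = sc c x \<oplus>\<^sub>M sc c' x"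
    and sc_mult: "[|c .: K; c' .: K; x .: M|] ==> sc (c \<otimes>\<^sub>K c') x = sc c (sc c' x)" and sc_one: "x .: M ==> sc \<one>\<^sub>K x = x"
begin

abbreviation "TS == tensor_space R sc M N"

lemma smult_cls:
  assumes c: "c .: K" and u: "u \<in> F" shows "c \<odot>\<^sub>TS cls u = cls (frag_extend (%(x, y). frag_of (sc c x, y)) u)"
proof -
  interpret M: abelian_group M by (rule M)
  interpret N: abelian_group N by (rule N)
  let ?\<phi> = "frag_extend (%(x, y). frag_of (sc c x, y)) :: ('m \<times> 'n \<Rightarrow>\<^sub>0 int) => _"
  have k: "?\<phi> k \<in> Ker" if "k \<in> Ker" for k
  proof (rule Ker_map[OF that frag_extend_diff Ker_zero Ker_add Ker_minus])
    fix u assume "u \<in> tensor_relations R M N"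
    then show "?\<phi> u \<in> Ker"
    proof (cases rule: relation_cases)
      case (left x x' y)
      have "frag_of (sc c x \<oplus>\<^sub>M sc c x', y) - frag_of (sc c x, y) - frag_of (sc c x', y) \<in> tensor_relations R M N"
        unfolding tensor_relations_def using left c sc_closed by blast
      then show ?thesis using left c by (simp add: frag_extend_diff sc_add Ker_rel)
    next
      case (right x y y')
      have "frag_of (sc c x, y \<oplus>\<^sub>N y') - frag_of (sc c x, y) - frag_of (sc c x, y') \<in> tensor_relations R M N"
        unfolding tensor_relations_def using right c sc_closed by blast
      then show ?thesis using right c by (simp add: frag_extend_diff Ker_rel)
    next
      case (middle r x y)
      have "frag_of (r \<odot>\<^sub>M sc c x, y) - frag_of (sc c x, r \<odot>\<^sub>N y) \<in> tensor_relations R M N"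
        unfolding tensor_relations_def using middle c sc_closed by blast
      then show ?thesis using middle c by (simp add: frag_extend_diff sc_R Ker_rel)
    qed
  qed auto
  have "(\<Union>v\<in>cls u. cls (?\<phi> v)) = cls (?\<phi> u)" by (rule Union_cls) (use k in \<open>auto simp: frag_extend_add cls_eq\<close>)
  then show ?thesis by (simp add: tensor_space_def)
qed

lemma smult_pure:
  assumes "c .: K" "x .: M" "y .: N" shows "c \<odot>\<^sub>TS pure x y = pure (sc c x) y" unfolding pure_tensor_def using assms by (subst smult_cls) auto

lemma frag_sc_F:
  assumes c: "c .: K" and u: "u \<in> F" shows "frag_extend (%(x, y). frag_of (sc c x, y)) u \<in> F"
proof (rule free_Abelian_group_induct[of u "carrier M \<times> carrier N"])
  show "Poly_Mapping.keys u \<subseteq> carrier M \<times> carrier N" using u by simp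
qed (use F_diff c sc_closed in \<open>auto simp: frag_extend_diff\<close>)

lemma smult_closed:
  assumes c: "c .: K" and X: "X .: TS" shows "c \<odot>\<^sub>TS X .: TS"
proof -
  obtain u where "u \<in> F" "X = cls u" using X by (auto simp: tensor_space_carrier)
  then show ?thesis using c frag_sc_F[OF c, of u] by (simp add: smult_cls tensor_space_carrier)
qed

lemma smult_add:
  assumes c: "c .: K" and X: "X .: TS" and Y: "Y .: TS"
  shows "c \<odot>\<^sub>TS (X \<oplus>\<^sub>TS Y) = c \<odot>\<^sub>TS X \<oplus>\<^sub>TS c \<odot>\<^sub>TS Y"
proof -
  obtain u v where u: "u \<in> F" "X = cls u" and v: "v \<in> F" "Y = cls v" using X Y by (auto simp: tensor_space_carrier)
  then show ?thesis using c F_add[of u v] by (simp add: smult_cls tensor_space_add frag_extend_add)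
qed

lemma module_tensor: "module K TS"
proof -
  interpret T: abelian_group TS by (rule abelian_group_tensor)
  interpret M: abelian_group M by (rule M)
  show ?thesis
  proof (rule moduleI[OF K.is_cring abelian_group_tensor])
    fix c d X assume c: "c .: K" and d: "d .: K" and X: "X .: TS"
    note cd = K.add.m_closed[OF c d] K.m_closed[OF c d]
    show "(c \<oplus>\<^sub>K d) \<odot>\<^sub>TS X = c \<odot>\<^sub>TS X \<oplus>\<^sub>TS d \<odot>\<^sub>TS X" using X
    proof (induction rule: tensor_induct)
      case (pure x y)
      then show ?case using c d by (simp add: smult_pure sc_plus pure_add_left[where sc = sc] sc_closed)
    next
      case (add X Y)
      then show ?case using c d by (simp add: smult_add T.a_ac smult_closed)
    qed
    show "(c \<otimes>\<^sub>K d) \<odot>\<^sub>TS X = c \<odot>\<^sub>TS (d \<odot>\<^sub>TS X)" using X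
    proof (induction rule: tensor_induct)
      case (pure x y)
      then show ?case using c d by (simp add: smult_pure sc_mult sc_closed)
    next
      case (add X Y)
      then show ?case using c d by (simp add: smult_add smult_closed)
    qed
  next
    fix X assume "X .: TS"
    then show "\<one>\<^sub>K \<odot>\<^sub>TS X = X" by (induction rule: tensor_induct) (simp_all add: smult_pure sc_one smult_add)
  qed (use smult_closed smult_add in auto)
qed

end

locale tensor_map = T: tensor_product R M N + T': tensor_product R M N'
  for R :: "('r, 'e) ring_scheme" and M :: "('r, 'm, 'f) module_scheme" and N :: "('r, 'n, 'g) module_scheme" and N' :: "('r, 'l, 'i) module_scheme" +
  fixes h :: "'n => 'l"
  assumes h: "h \<in> module_hom R N N'"
begin

lemma map_right_cls:
  assumes u: "u \<in> T.F" shows "tensor_map_right R M N' h (T.cls u) = T'.cls (frag_extend (%(x, y). frag_of (x, h y)) u)"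
proof -
  interpret M: abelian_group M by (rule T.M)
  interpret N: abelian_group N by (rule T.N)
  let ?\<phi> = "frag_extend (%(x, y). frag_of (x, h y)) :: ('m \<times> 'n \<Rightarrow>\<^sub>0 int) => _"
  have hy: "y .: N ==> h y .: N'" for y by (rule module_hom_mem[OF h])
  have k: "?\<phi> k \<in> T'.Ker" if "k \<in> T.Ker" for k
  proof (rule T.Ker_map[OF that frag_extend_diff T'.Ker_zero T'.Ker_add T'.Ker_minus])
    fix u assume "u \<in> tensor_relations R M N"
    then show "?\<phi> u \<in> T'.Ker"
    proof (cases rule: T.relation_cases)
      case (left x x' y)
      have "frag_of (x \<oplus>\<^sub>M x', h y) - frag_of (x, h y) - frag_of (x', h y) \<in> tensor_relations R M N'"
        unfolding tensor_relations_def using left hy by blast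
      then show ?thesis using left by (simp add: frag_extend_diff T'.Ker_rel)
    next
      case (right x y y')
      have "frag_of (x, h y \<oplus>\<^sub>(N') h y') - frag_of (x, h y) - frag_of (x, h y') \<in> tensor_relations R M N'"
        unfolding tensor_relations_def using right hy by blast
      then show ?thesis using right by (simp add: frag_extend_diff T'.Ker_rel module_hom_add[OF h])
    next
      case (middle r x y)
      have "frag_of (r \<odot>\<^sub>M x, h y) - frag_of (x, r \<odot>\<^sub>(N') h y) \<in> tensor_relations R M N'"
        unfolding tensor_relations_def using middle hy by blast
      then show ?thesis using middle by (simp add: frag_extend_diff T'.Ker_rel module_hom_smult[OF h])
    qed
  qed auto
  have "(\<Union>v\<in>T.cls u. T'.cls (?\<phi> v)) = T'.cls (?\<phi> u)" by (rule T.Union_cls) (use k in \<open>auto simp: frag_extend_add T'.cls_eq\<close>)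
  then show ?thesis by (simp add: tensor_map_right_def)
qed

lemma map_right_pure:
  assumes "x .: M" "y .: N" shows "tensor_map_right R M N' h (T.pure x y) = T'.pure x (h y)"
  unfolding pure_tensor_def using assms by (subst map_right_cls) auto

lemma map_right_closed:
  assumes X: "X .: (tensor_space R sc M N)" shows "tensor_map_right R M N' h X .: (tensor_space R sc M N')"
proof -
  obtain u where u: "u \<in> T.F" "X = T.cls u" using X by (auto simp: T.tensor_space_carrier)
  have "frag_extend (%(x, y). frag_of (x, h y)) u \<in> T'.F"
  proof (rule free_Abelian_group_induct[of u "carrier M \<times> carrier N"])
    show "Poly_Mapping.keys u \<subseteq> carrier M \<times> carrier N" using u by simp
  qed (use T'.F_diff module_hom_mem[OF h] in \<open>auto simp: frag_extend_diff\<close>)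
  then show ?thesis using u by (simp add: map_right_cls T'.tensor_space_carrier)
qed

lemma map_right_add:
  assumes X: "X .: (tensor_space R sc M N)" and Y: "Y .: (tensor_space R sc M N)"
  shows "tensor_map_right R M N' h (X \<oplus>\<^sub>(tensor_space R sc M N) Y)
    = tensor_map_right R M N' h X \<oplus>\<^sub>(tensor_space R sc M N') tensor_map_right R M N' h Y"
proof -
  obtain u v where u: "u \<in> T.F" "X = T.cls u" and v: "v \<in> T.F" "Y = T.cls v" using X Y by (auto simp: T.tensor_space_carrier)
  then show ?thesis using T.F_add[of u v] by (simp add: map_right_cls T.tensor_space_add T'.tensor_space_add frag_extend_add)
qed

end

section \<open>Algebras over a commutative ring and their tensor products\<close>

locale kalg =
  fixes K :: "('k, 'e) ring_scheme" and A :: "('k, 'a) module" (structure)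
  assumes module_A: "module K A" and ring_A: "ring A" and smult_mult_left: "[|c .: K; x .: A; y .: A|]
      ==> (c \<odot> x) \<otimes> y = c \<odot> (x \<otimes> y)" and smult_mult_right: "[|c .: K; x .: A; y .: A|]
      ==> x \<otimes> (c \<odot> y) = c \<odot> (x \<otimes> y)"
begin

sublocale A: ring A by (rule ring_A)
sublocale V: module K A by (rule module_A)

lemma opposite_simps:
  "carrier (opposite A) = carrier A" "x \<otimes>\<^sub>(opposite A) y = y \<otimes> x" "\<one>\<^sub>(opposite A) = \<one>"
  "\<zero>\<^sub>(opposite A) = \<zero>" "x \<oplus>\<^sub>(opposite A) y = x \<oplus> y" "c \<odot>\<^sub>(opposite A) x = c \<odot> x"
  by (simp_all add: opposite_def)

lemma kalg_opposite: "kalg K (opposite A)"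
proof -
  have ab: "abelian_group (opposite A)" by (rule abelian_groupI) (auto simp: opposite_simps A.a_ac intro: A.add.l_inv_ex)
  have "ring (opposite A)" by (rule ringI[OF ab]) (auto intro!: monoidI simp: opposite_simps A.m_assoc A.l_distr A.r_distr)
  moreover have "module K (opposite A)" by (rule moduleI[OF V.is_cring ab])
      (auto simp: opposite_simps V.smult_l_distr V.smult_r_distr V.smult_assoc1)
  ultimately show ?thesis by (intro kalg.intro) (auto simp: opposite_simps smult_mult_left smult_mult_right)
qed

end

locale kalg_pair = A: kalg K A + B: kalg K B
  for K :: "('k, 'e) ring_scheme" and A :: "('k, 'a) module" and B :: "('k, 'b) module"
begin

sublocale T: tensor_scalars K A B K "smult A"
proof
  show "a \<odot>\<^sub>A (b \<odot>\<^sub>A x) = b \<odot>\<^sub>A (a \<odot>\<^sub>A x)" if "a .: K" "b .: K" "x .: A" for a b x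
    using that by (simp add: A.V.smult_assoc1[symmetric] A.V.R.m_comm)
qed (auto simp: A.V.smult_l_distr A.V.smult_r_distr A.V.smult_assoc1 A.A.is_abelian_group
      B.A.is_abelian_group A.V.R.is_cring)

abbreviation "AB == tensor_algebra K A B"

lemma AB_simps:
  "carrier AB = carrier T.TS" "\<zero>\<^sub>AB = \<zero>\<^sub>T.TS" "X \<oplus>\<^sub>AB Y = X \<oplus>\<^sub>T.TS Y"
  "c \<odot>\<^sub>AB X = c \<odot>\<^sub>T.TS X" "\<one>\<^sub>AB = T.pure \<one>\<^sub>A \<one>\<^sub>B"
  by (simp_all add: tensor_algebra_def pure_tensor_def)

text \<open>The product on formal sums, before passing to classes. It is biadditive and the kernel
  is stable under it from both sides, so it descends; the ring axioms are then checked on pure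
  tensors.\<close>

definition fmult :: "('a \<times> 'b \<Rightarrow>\<^sub>0 int) => ('a \<times> 'b \<Rightarrow>\<^sub>0 int) => ('a \<times> 'b \<Rightarrow>\<^sub>0 int)"
  where "fmult u v = frag_extend (%(x, y).
    frag_extend (%(x', y'). frag_of (x \<otimes>\<^sub>A x', y \<otimes>\<^sub>B y')) v) u"

lemma fmult_add: "fmult (u + u') v = fmult u v + fmult u' v" "fmult u (v + v') = fmult u v + fmult u v'"
  "fmult (u - u') v = fmult u v - fmult u' v" "fmult u (v - v') = fmult u v - fmult u v'"
  by (simp_all add: fmult_def frag_extend_add frag_extend_diff case_prod_unfold frag_extend_plus frag_extend_minus_fun)

lemma fmult_of: "fmult (frag_of (x, y)) (frag_of (x', y')) = frag_of (x \<otimes>\<^sub>A x', y \<otimes>\<^sub>B y')"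
  by (simp add: fmult_def)

lemma fmult_F: "[|u \<in> T.F; v \<in> T.F|] ==> fmult u v \<in> T.F"
proof -
  assume u: "u \<in> T.F" and v: "v \<in> T.F"
  have 1: "fmult (frag_of z) v \<in> T.F" if z: "z \<in> carrier A \<times> carrier B" for z
  proof (rule free_Abelian_group_induct[of v "carrier A \<times> carrier B"])
    show "Poly_Mapping.keys v \<subseteq> carrier A \<times> carrier B" using v by simp
  qed (use T.F_diff z in \<open>auto simp: fmult_add fmult_def[of _ 0] fmult_of\<close>)
  show ?thesis
  proof (rule free_Abelian_group_induct[of u "carrier A \<times> carrier B"])
    show "Poly_Mapping.keys u \<subseteq> carrier A \<times> carrier B" using u by simp
    show "fmult 0 v \<in> T.F" by (simp add: fmult_def)
  qed (use T.F_diff 1 in \<open>auto simp: fmult_add\<close>)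
qed

lemma fmult_Ker_right:
  assumes u: "u \<in> T.F" and k: "k \<in> T.Ker" shows "fmult u k \<in> T.Ker"
proof -
  have 1: "fmult (frag_of (x, y)) k \<in> T.Ker" if x: "x .: A" and y: "y .: B" for x y
  proof (rule T.Ker_map[OF k fmult_add(4) T.Ker_zero T.Ker_add T.Ker_minus])
    fix r assume "r \<in> tensor_relations K A B"
    then show "fmult (frag_of (x, y)) r \<in> T.Ker"
    proof (cases rule: T.relation_cases)
      case (left l l' z)
      have "frag_of (x \<otimes>\<^sub>A l \<oplus>\<^sub>A x \<otimes>\<^sub>A l', y \<otimes>\<^sub>B z) - frag_of (x \<otimes>\<^sub>A l, y \<otimes>\<^sub>B z)
          - frag_of (x \<otimes>\<^sub>A l', y \<otimes>\<^sub>B z) \<in> tensor_relations K A B" unfolding tensor_relations_def using left x y by blast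
      then show ?thesis using left x by (simp add: fmult_add fmult_of A.A.r_distr T.Ker_rel)
    next
      case (right l z z')
      have "frag_of (x \<otimes>\<^sub>A l, y \<otimes>\<^sub>B z \<oplus>\<^sub>B y \<otimes>\<^sub>B z') - frag_of (x \<otimes>\<^sub>A l, y \<otimes>\<^sub>B z)
          - frag_of (x \<otimes>\<^sub>A l, y \<otimes>\<^sub>B z') \<in> tensor_relations K A B" unfolding tensor_relations_def using right x y by blast
      then show ?thesis using right y by (simp add: fmult_add fmult_of B.A.r_distr T.Ker_rel)
    next
      case (middle c l z)
      have "frag_of (c \<odot>\<^sub>A (x \<otimes>\<^sub>A l), y \<otimes>\<^sub>B z) - frag_of (x \<otimes>\<^sub>A l, c \<odot>\<^sub>B (y \<otimes>\<^sub>B z))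
          \<in> tensor_relations K A B" unfolding tensor_relations_def using middle x y by blast
      then show ?thesis using middle x y by (simp add: fmult_add fmult_of A.smult_mult_right B.smult_mult_right T.Ker_rel)
    qed
  qed auto
  show ?thesis
  proof (rule free_Abelian_group_induct[of u "carrier A \<times> carrier B"])
    show "Poly_Mapping.keys u \<subseteq> carrier A \<times> carrier B" using u by simp
    show "fmult 0 k \<in> T.Ker" by (simp add: fmult_def T.Ker_zero)
    show "fmult (v - w) k \<in> T.Ker" if "fmult v k \<in> T.Ker" "fmult w k \<in> T.Ker" for v w
      using T.Ker_add[OF that(1) T.Ker_minus[OF that(2)]] by (simp add: fmult_add)
  qed (use 1 in auto)
qed

lemma fmult_Ker_left:
  assumes u: "u \<in> T.F" and k: "k \<in> T.Ker" shows "fmult k u \<in> T.Ker"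
proof -
  have 1: "fmult k (frag_of (x, y)) \<in> T.Ker" if x: "x .: A" and y: "y .: B" for x y
  proof (rule T.Ker_map[OF k fmult_add(3) T.Ker_zero T.Ker_add T.Ker_minus])
    fix r assume "r \<in> tensor_relations K A B"
    then show "fmult r (frag_of (x, y)) \<in> T.Ker"
    proof (cases rule: T.relation_cases)
      case (left l l' z)
      have "frag_of (l \<otimes>\<^sub>A x \<oplus>\<^sub>A l' \<otimes>\<^sub>A x, z \<otimes>\<^sub>B y) - frag_of (l \<otimes>\<^sub>A x, z \<otimes>\<^sub>B y)
          - frag_of (l' \<otimes>\<^sub>A x, z \<otimes>\<^sub>B y) \<in> tensor_relations K A B" unfolding tensor_relations_def using left x y by blast
      then show ?thesis using left x by (simp add: fmult_add fmult_of A.A.l_distr T.Ker_rel)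
    next
      case (right l z z')
      have "frag_of (l \<otimes>\<^sub>A x, z \<otimes>\<^sub>B y \<oplus>\<^sub>B z' \<otimes>\<^sub>B y) - frag_of (l \<otimes>\<^sub>A x, z \<otimes>\<^sub>B y)
          - frag_of (l \<otimes>\<^sub>A x, z' \<otimes>\<^sub>B y) \<in> tensor_relations K A B" unfolding tensor_relations_def using right x y by blast
      then show ?thesis using right y by (simp add: fmult_add fmult_of B.A.l_distr T.Ker_rel)
    next
      case (middle c l z)
      have "frag_of (c \<odot>\<^sub>A (l \<otimes>\<^sub>A x), z \<otimes>\<^sub>B y) - frag_of (l \<otimes>\<^sub>A x, c \<odot>\<^sub>B (z \<otimes>\<^sub>B y))
          \<in> tensor_relations K A B" unfolding tensor_relations_def using middle x y by blast
      then show ?thesis using middle x y by (simp add: fmult_add fmult_of A.smult_mult_left B.smult_mult_left T.Ker_rel)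
    qed
  qed auto
  show ?thesis
  proof (rule free_Abelian_group_induct[of u "carrier A \<times> carrier B"])
    show "Poly_Mapping.keys u \<subseteq> carrier A \<times> carrier B" using u by simp
    show "fmult k 0 \<in> T.Ker" using fmult_add(4)[of k 0 0] by (simp add: T.Ker_zero)
    show "fmult k (v - w) \<in> T.Ker" if "fmult k v \<in> T.Ker" "fmult k w \<in> T.Ker" for v w
      using T.Ker_add[OF that(1) T.Ker_minus[OF that(2)]] by (simp add: fmult_add)
  qed (use 1 in auto)
qed

lemma mult_cls:
  assumes u: "u \<in> T.F" and v: "v \<in> T.F" shows "T.cls u \<otimes>\<^sub>AB T.cls v = T.cls (fmult u v)"
proof -
  have "T.cls u \<otimes>\<^sub>AB T.cls v = (\<Union>x\<in>T.cls u. \<Union>y\<in>T.cls v. T.cls (fmult x y))" by (simp add: tensor_algebra_def fmult_def)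
  also have "... = (\<Union>x\<in>T.cls u. T.cls (fmult x v))"
  proof (rule SUP_cong[OF refl])
    fix x assume x: "x \<in> T.cls u"
    obtain k where "k \<in> T.Ker" "x = u + k" using T.cls_memD[OF x] by blast
    then have "x \<in> T.F" using T.F_add[OF u T.Ker_F] by simp
    then show "(\<Union>y\<in>T.cls v. T.cls (fmult x y)) = T.cls (fmult x v)" by (intro T.Union_cls) (auto simp: fmult_add T.cls_eq fmult_Ker_right)
  qed
  also have "... = T.cls (fmult u v)" by (rule T.Union_cls) (use v in \<open>auto simp: fmult_add T.cls_eq fmult_Ker_left\<close>)
  finally show ?thesis .
qed

lemma AB_mult_closed: "[|X .: AB; Y .: AB|] ==> X \<otimes>\<^sub>AB Y .: AB"
  unfolding AB_simps T.tensor_space_carrier using fmult_F by (auto simp: mult_cls)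

lemma AB_mult_pure:
  assumes "x .: A" "y .: B" "x' .: A" "y' .: B" shows "T.pure x y \<otimes>\<^sub>AB T.pure x' y' = T.pure (x \<otimes>\<^sub>A x') (y \<otimes>\<^sub>B y')"
  unfolding pure_tensor_def using assms by (subst mult_cls) (auto simp: fmult_of)

lemma AB_l_distr:
  assumes "X .: AB" "Y .: AB" "Z .: AB" shows "(X \<oplus>\<^sub>AB Y) \<otimes>\<^sub>AB Z = X \<otimes>\<^sub>AB Z \<oplus>\<^sub>AB Y \<otimes>\<^sub>AB Z"
proof -
  obtain u v w where "u \<in> T.F" "X = T.cls u" "v \<in> T.F" "Y = T.cls v" "w \<in> T.F" "Z = T.cls w"
    using assms by (auto simp: AB_simps T.tensor_space_carrier)
  then show ?thesis using T.F_add[of u v] by (simp add: AB_simps T.tensor_space_add mult_cls fmult_add)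
qed

lemma AB_r_distr:
  assumes "X .: AB" "Y .: AB" "Z .: AB" shows "Z \<otimes>\<^sub>AB (X \<oplus>\<^sub>AB Y) = Z \<otimes>\<^sub>AB X \<oplus>\<^sub>AB Z \<otimes>\<^sub>AB Y"
proof -
  obtain u v w where "u \<in> T.F" "X = T.cls u" "v \<in> T.F" "Y = T.cls v" "w \<in> T.F" "Z = T.cls w"
    using assms by (auto simp: AB_simps T.tensor_space_carrier)
  then show ?thesis using T.F_add[of u v] by (simp add: AB_simps T.tensor_space_add mult_cls fmult_add)
qed

lemma AB_abelian: "abelian_group AB"
proof -
  interpret T: abelian_group T.TS by (rule T.abelian_group_tensor)
  show ?thesis by (rule abelian_groupI) (auto simp: AB_simps T.a_ac intro: T.add.l_inv_ex)
qed

lemma AB_induct [consumes 1, case_names pure add]: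
  assumes X: "X .: AB" and pure: "!!x y. [|x .: A; y .: B|] ==> P (T.pure x y)" and add: "!!X Y. [|X .: AB; Y .: AB; P X; P Y|] ==> P (X \<oplus>\<^sub>AB Y)"
  shows "P X" using X pure add unfolding AB_simps by (rule T.tensor_induct) auto

lemma AB_pure_closed: "[|x .: A; y .: B|] ==> T.pure x y .: AB"
  unfolding AB_simps by (rule T.pure_closed)

lemma AB_pure_add:
  "[|x .: A; x' .: A; y .: B|] ==> T.pure (x \<oplus>\<^sub>A x') y = T.pure x y \<oplus>\<^sub>AB T.pure x' y"
  "[|x .: A; y .: B; y' .: B|] ==> T.pure x (y \<oplus>\<^sub>B y') = T.pure x y \<oplus>\<^sub>AB T.pure x y'"
  unfolding AB_simps by (rule T.pure_add_left T.pure_add_right; assumption)+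

lemma AB_smult_pure:
  "[|c .: K; x .: A; y .: B|] ==> c \<odot>\<^sub>AB T.pure x y = T.pure (c \<odot>\<^sub>A x) y" unfolding AB_simps by (rule T.smult_pure)

lemma AB_smult_pure_right:
  "[|c .: K; x .: A; y .: B|] ==> c \<odot>\<^sub>AB T.pure x y = T.pure x (c \<odot>\<^sub>B y)" by (simp add: AB_smult_pure T.pure_middle)

lemma AB_module: "module K AB"
proof -
  interpret T: module K T.TS by (rule T.module_tensor)
  show ?thesis by (rule moduleI[OF A.V.R.is_cring AB_abelian])
      (auto simp: AB_simps T.smult_l_distr T.smult_r_distr T.smult_assoc1)
qed

lemma kalg_AB: "kalg K AB"
proof -
  interpret AB: abelian_group AB by (rule AB_abelian)
  interpret M: module K AB by (rule AB_module)
  note cl = AB_mult_closed AB_pure_closed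
  have assoc: "(X \<otimes>\<^sub>AB Y) \<otimes>\<^sub>AB Z = X \<otimes>\<^sub>AB (Y \<otimes>\<^sub>AB Z)"
    if X: "X .: AB" and Y: "Y .: AB" and Z: "Z .: AB" for X Y Z using X
  proof (induction rule: AB_induct)
    case p1: (pure x y)
    show ?case using Y
    proof (induction rule: AB_induct)
      case p2: (pure x' y')
      show ?case using Z
      proof (induction rule: AB_induct)
        case (pure x'' y'')
        then show ?case using p1 p2 by (simp add: AB_mult_pure A.A.m_assoc B.A.m_assoc)
      next
        case (add X Y)
        then show ?case using p1 p2 by (simp add: AB_r_distr cl)
      qed
    next
      case (add X Y)
      then show ?case using p1 Z by (simp add: AB_r_distr AB_l_distr cl)
    qed
  next
    case (add X Y')
    then show ?case using Y Z by (simp add: AB_l_distr cl)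
  qed
  have onec: "\<one>\<^sub>AB .: AB" unfolding AB_simps(5) by (rule AB_pure_closed) auto
  have l_one: "\<one>\<^sub>AB \<otimes>\<^sub>AB X = X" if "X .: AB" for X using that
  proof (induction rule: AB_induct)
    case (pure x y)
    then show ?case unfolding AB_simps(5) by (simp add: AB_mult_pure)
  qed (simp add: AB_r_distr onec)
  have r_one: "X \<otimes>\<^sub>AB \<one>\<^sub>AB = X" if "X .: AB" for X using that
  proof (induction rule: AB_induct)
    case (pure x y)
    then show ?case unfolding AB_simps(5) by (simp add: AB_mult_pure)
  qed (simp add: AB_l_distr onec)
  have "monoid AB" by (rule monoidI) (use cl assoc onec l_one r_one in auto)
  then have ring: "ring AB" by (intro ringI AB_abelian) (use AB_l_distr AB_r_distr in auto)
  have sl: "(c \<odot>\<^sub>AB X) \<otimes>\<^sub>AB Y = c \<odot>\<^sub>AB (X \<otimes>\<^sub>AB Y)"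
    if c: "c .: K" and X: "X .: AB" and Y: "Y .: AB" for c X Y using X
  proof (induction rule: AB_induct)
    case p1: (pure x y)
    show ?case using Y
    proof (induction rule: AB_induct)
      case (pure x' y')
      then show ?case using p1 c by (simp add: AB_mult_pure AB_smult_pure A.smult_mult_left)
    next
      case (add X Y)
      then show ?case using p1 c by (simp add: AB_r_distr cl M.smult_r_distr)
    qed
  next
    case (add X Y')
    then show ?case using Y c by (simp add: AB_l_distr cl M.smult_r_distr)
  qed
  have sr: "X \<otimes>\<^sub>AB (c \<odot>\<^sub>AB Y) = c \<odot>\<^sub>AB (X \<otimes>\<^sub>AB Y)"
    if c: "c .: K" and X: "X .: AB" and Y: "Y .: AB" for c X Y using X
  proof (induction rule: AB_induct)
    case p1: (pure x y)
    show ?case using Y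
    proof (induction rule: AB_induct)
      case (pure x' y')
      then show ?case using p1 c by (simp add: AB_mult_pure AB_smult_pure A.smult_mult_right)
    next
      case (add X Y)
      then show ?case using p1 c by (simp add: AB_r_distr cl M.smult_r_distr)
    qed
  next
    case (add X Y')
    then show ?case using Y c by (simp add: AB_l_distr cl M.smult_r_distr)
  qed
  show ?thesis by (rule kalg.intro[OF AB_module ring]) (use sl sr in auto)
qed

lemma AB_induced:
  assumes H: "abelian_group H" and gc: "!!x y. [|x .: A; y .: B|] ==> g (x, y) .: H" and gl: "!!x x' y. [|x .: A; x' .: A; y .: B|]
      ==> g (x \<oplus>\<^sub>A x', y) = g (x, y) \<oplus>\<^sub>H g (x', y)" and gr: "!!x y y'. [|x .: A; y .: B; y' .: B|]
      ==> g (x, y \<oplus>\<^sub>B y') = g (x, y) \<oplus>\<^sub>H g (x, y')"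
    and gm: "!!r x y. [|r .: K; x .: A; y .: B|] ==> g (r \<odot>\<^sub>A x, y) = g (x, r \<odot>\<^sub>B y)" shows "X .: AB ==> tensor_induced H g X .: H"
    and "[|X .: AB; Y .: AB|]
      ==> tensor_induced H g (X \<oplus>\<^sub>AB Y) = tensor_induced H g X \<oplus>\<^sub>H tensor_induced H g Y"
    and "[|x .: A; y .: B|] ==> tensor_induced H g (T.pure x y) = g (x, y)" unfolding AB_simps
  by (rule T.tensor_induced_hom[where H = H and g = g, OF H gc gl gr gm]; assumption)+

end

section \<open>Double sums\<close>

lemma (in abelian_monoid) finsum_swap:
  assumes "finite I" "finite J" and f: "!!i j. [|i \<in> I; j \<in> J|] ==> f i j .: G"
  shows "(\<Oplus>i\<in>I. \<Oplus>j\<in>J. f i j) = (\<Oplus>j\<in>J. \<Oplus>i\<in>I. f i j)" using assms(1) f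
proof (induction I rule: finite_induct)
  case empty
  then show ?case by simp
next
  case (insert i I)
  have c: "(%j. f i j) \<in> J \<rightarrow> carrier G" "(%j. \<Oplus>i\<in>I. f i j) \<in> J \<rightarrow> carrier G"
    using insert.prems by (auto intro!: finsum_closed)
  have "(\<Oplus>i\<in>insert i I. \<Oplus>j\<in>J. f i j) = (\<Oplus>j\<in>J. f i j) \<oplus> (\<Oplus>j\<in>J. \<Oplus>i\<in>I. f i j)"
    using insert.hyps insert.prems insert.IH by (subst finsum_insert) (auto intro!: finsum_closed)
  also have "... = (\<Oplus>j\<in>J. f i j \<oplus> (\<Oplus>i\<in>I. f i j))" using c by (simp add: finsum_addf)
  also have "... = (\<Oplus>j\<in>J. \<Oplus>i\<in>insert i I. f i j)"
    using insert.hyps insert.prems by (intro finsum_eqI) (auto simp: finsum_insert intro!: finsum_closed)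
  finally show ?case .
qed

lemma (in abelian_monoid) finsum_Times:
  assumes "finite I" "finite J" and f: "!!i j. [|i \<in> I; j \<in> J|] ==> f (i, j) .: G"
  shows "(\<Oplus>p\<in>I \<times> J. f p) = (\<Oplus>i\<in>I. \<Oplus>j\<in>J. f (i, j))" using assms(1) f
proof (induction I rule: finite_induct)
  case empty
  then show ?case by simp
next
  case (insert i I)
  have e: "insert i I \<times> J = Pair i ` J \<union> I \<times> J" by auto
  have "(\<Oplus>p\<in>insert i I \<times> J. f p) = (\<Oplus>p\<in>Pair i ` J. f p) \<oplus> (\<Oplus>p\<in>I \<times> J. f p)"
    unfolding e using insert.hyps insert.prems assms(2) by (intro finsum_Un_disjoint) auto
  also have "(\<Oplus>p\<in>Pair i ` J. f p) = (\<Oplus>j\<in>J. f (i, j))" using insert.prems by (intro finsum_reindex) (auto simp: inj_on_def)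
  finally show ?case using insert by (subst finsum_insert) (auto intro!: finsum_closed)
qed

section \<open>The enveloping algebra and its actions\<close>

locale envalg = kalg K A
  for K :: "('k, 'e) ring_scheme" and A :: "('k, 'a) module" (structure)
begin

sublocale E: kalg_pair K A "opposite A" using kalg_axioms kalg_opposite by (simp add: kalg_pair_def)

abbreviation "Ae == enveloping K A"
abbreviation "tt == pure_tensor K A (opposite A)"
abbreviation "AA == regular_bimodule A"
abbreviation env_mult (infixl "\<star>" 70) where "U \<star> V == U \<otimes>\<^sub>Ae V"
abbreviation env_add (infixl "\<boxplus>" 65) where "U \<boxplus> V == U \<oplus>\<^sub>Ae V"
abbreviation env_diff (infixl "\<boxminus>" 65) where "U \<boxminus> V == U \<ominus>\<^sub>Ae V"
abbreviation env_smult (infixl "\<bullet>" 70) where "c \<bullet> U == c \<odot>\<^sub>Ae U"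

lemmas opp = opposite_simps

lemma kalg_Ae: "kalg K Ae"
  using E.kalg_AB by (simp add: enveloping_def)

sublocale Ae: kalg K Ae by (rule kalg_Ae)

lemmas aA = A.is_abelian_group and aE = Ae.A.is_abelian_group

lemma tt_closed: "[|x .: A; y .: A|] ==> tt x y .: Ae"
  using E.AB_pure_closed by (simp add: enveloping_def opp)

lemma tt_add_left: "[|x .: A; x' .: A; y .: A|] ==> tt (x \<oplus> x') y = tt x y \<boxplus> tt x' y"
  using E.AB_pure_add(1) by (simp add: enveloping_def opp)

lemma tt_add_right: "[|x .: A; y .: A; y' .: A|] ==> tt x (y \<oplus> y') = tt x y \<boxplus> tt x y'"
  using E.AB_pure_add(2) by (simp add: enveloping_def opp)

lemma tt_mult: "[|x .: A; y .: A; x' .: A; y' .: A|]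
    ==> tt x y \<star> tt x' y' = tt (x \<otimes> x') (y' \<otimes> y)" using E.AB_mult_pure by (simp add: enveloping_def opp)

lemma tt_smult_left: "[|c .: K; x .: A; y .: A|] ==> tt (c \<odot> x) y = c \<bullet> tt x y"
  using E.AB_smult_pure by (simp add: enveloping_def opp)

lemma tt_smult_right: "[|c .: K; x .: A; y .: A|] ==> tt x (c \<odot> y) = c \<bullet> tt x y"
  using E.AB_smult_pure_right by (simp add: enveloping_def opp)

lemma Ae_one: "\<one>\<^sub>Ae = tt \<one> \<one>"
  using E.AB_simps(5) by (simp add: enveloping_def opp)

lemma Ae_induct [consumes 1, case_names pure add]:
  assumes "X .: Ae" and "!!x y. [|x .: A; y .: A|] ==> P (tt x y)" and "!!X Y. [|X .: Ae; Y .: Ae; P X; P Y|] ==> P (X \<boxplus> Y)" shows "P X"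
  using assms unfolding enveloping_def by (rule E.AB_induct) (auto simp: opp)

lemma Ae_induced:
  assumes H: "abelian_group H" and gc: "!!x y. [|x .: A; y .: A|] ==> g (x, y) .: H" and gl: "!!x x' y. [|x .: A; x' .: A; y .: A|]
      ==> g (x \<oplus> x', y) = g (x, y) \<oplus>\<^sub>H g (x', y)" and gr: "!!x y y'. [|x .: A; y .: A; y' .: A|]
      ==> g (x, y \<oplus> y') = g (x, y) \<oplus>\<^sub>H g (x, y')"
    and gm: "!!r x y. [|r .: K; x .: A; y .: A|] ==> g (r \<odot> x, y) = g (x, r \<odot> y)" shows "X .: Ae ==> tensor_induced H g X .: H"
    and "[|X .: Ae; Y .: Ae|]
      ==> tensor_induced H g (X \<boxplus> Y) = tensor_induced H g X \<oplus>\<^sub>H tensor_induced H g Y"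
    and "[|x .: A; y .: A|] ==> tensor_induced H g (tt x y) = g (x, y)"
  using E.AB_induced[where H = H and g = g, OF H] gc gl gr gm by (simp_all add: enveloping_def opp)

lemma reg_simps:
  "carrier (env_left AA) = carrier A" "carrier (env_right AA) = carrier A"
  "x \<oplus>\<^sub>(env_left AA) y = x \<oplus> y" "x \<oplus>\<^sub>(env_right AA) y = x \<oplus> y"
  "\<zero>\<^sub>(env_left AA) = \<zero>" "\<zero>\<^sub>(env_right AA) = \<zero>" "b \<odot>\<^sub>AA x = b \<otimes> x"
  by (simp_all add: env_left_def env_right_def regular_bimodule_def)

lemma AA_abelian: "abelian_group AA"
  by (rule abelian_groupI) (auto simp: regular_bimodule_def A.a_ac intro: A.add.l_inv_ex)

abbreviation "lact U b == U \<odot>\<^sub>(env_left AA) b"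
abbreviation "ract b U == U \<odot>\<^sub>(env_right AA) b"

lemma lact:
  assumes b: "b .: A" shows lact_closed: "U .: Ae ==> lact U b .: A"
    and lact_add: "[|U .: Ae; V .: Ae|] ==> lact (U \<boxplus> V) b = lact U b \<oplus> lact V b"
    and lact_tt: "[|l .: A; r .: A|] ==> lact (tt l r) b = (l \<otimes> b) \<otimes> r"
  using Ae_induced[where g = "%(l, l'). rsmult AA (l \<odot>\<^sub>AA b) l'", OF AA_abelian] b
  by (simp_all add: env_left_def regular_bimodule_def A.l_distr A.r_distr smult_mult_left smult_mult_right)

lemma ract:
  assumes b: "b .: A" shows ract_closed: "U .: Ae ==> ract b U .: A"
    and ract_add: "[|U .: Ae; V .: Ae|] ==> ract b (U \<boxplus> V) = ract b U \<oplus> ract b V"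
    and ract_tt: "[|l .: A; r .: A|] ==> ract b (tt l r) = (r \<otimes> b) \<otimes> l"
  using Ae_induced[where g = "%(l, l'). rsmult AA (l' \<odot>\<^sub>AA b) l", OF AA_abelian] b
  by (simp_all add: env_right_def regular_bimodule_def A.l_distr A.r_distr smult_mult_left smult_mult_right)

lemma ract_add_left:
  assumes "b .: A" "b' .: A" "U .: Ae" shows "ract (b \<oplus> b') U = ract b U \<oplus> ract b' U" using assms(3) by (induction rule: Ae_induct)
    (use assms(1,2) in \<open>simp_all add: ract_tt ract_add ract_closed A.l_distr A.r_distr A.a_ac\<close>)

lemma lact_add_right:
  assumes "b .: A" "b' .: A" "U .: Ae" shows "lact U (b \<oplus> b') = lact U b \<oplus> lact U b'" using assms(3) by (induction rule: Ae_induct)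
    (use assms(1,2) in \<open>simp_all add: lact_tt lact_add lact_closed A.l_distr A.r_distr A.a_ac\<close>)

lemma ract_mult:
  assumes b: "b .: A" and U: "U .: Ae" and V: "V .: Ae" shows "ract b (U \<star> V) = ract (ract b U) V" using U
proof (induction rule: Ae_induct)
  case p: (pure x y)
  show ?case using V by (induction rule: Ae_induct)
      (use b p in \<open>simp_all add: ract_tt ract_add ract_closed tt_mult tt_closed A.m_assoc Ae.A.r_distr\<close>)
next
  case (add U U')
  then show ?case using b V by (simp add: Ae.A.l_distr ract_add ract_add_left ract_closed)
qed

lemma lact_mult:
  assumes b: "b .: A" and U: "U .: Ae" and V: "V .: Ae" shows "lact (U \<star> V) b = lact U (lact V b)" using V
proof (induction rule: Ae_induct)
  case p: (pure x y)
  show ?case using U by (induction rule: Ae_induct)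
      (use b p in \<open>simp_all add: lact_tt lact_add lact_closed tt_mult tt_closed A.m_assoc Ae.A.l_distr\<close>)
next
  case (add V V')
  then show ?case using b U by (simp add: Ae.A.r_distr lact_add lact_add_right lact_closed)
qed

lemma ract_smult:
  assumes b: "b .: A" and U: "U .: Ae" and c: "c .: K" shows "ract b (c \<bullet> U) = c \<odot> ract b U" and "ract (c \<odot> b) U = c \<odot> ract b U"
proof -
  show "ract b (c \<bullet> U) = c \<odot> ract b U" using U by (induction rule: Ae_induct)
      (use b c in \<open>simp_all add: ract_tt ract_add ract_closed tt_smult_left[symmetric] smult_mult_right
        Ae.V.smult_r_distr V.smult_r_distr\<close>)
  show "ract (c \<odot> b) U = c \<odot> ract b U" using U by (induction rule: Ae_induct)
      (use b c in \<open>simp_all add: ract_tt ract_add ract_closed smult_mult_right smult_mult_left V.smult_r_distr\<close>)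
qed

lemma ract_one: "b .: A ==> ract b \<one>\<^sub>Ae = b"
  by (simp add: Ae_one ract_tt)

lemma lact_smult:
  assumes b: "b .: A" and U: "U .: Ae" and c: "c .: K" shows "lact (c \<bullet> U) b = c \<odot> lact U b" using U by (induction rule: Ae_induct)
    (use b c in \<open>simp_all add: lact_tt lact_add lact_closed tt_smult_left[symmetric] smult_mult_left
      Ae.V.smult_r_distr V.smult_r_distr\<close>)

lemma left_module_A: "left_module Ae (env_left AA)"
proof -
  have ab: "abelian_group (env_left AA)" by (rule abelian_groupI) (auto simp: reg_simps A.a_ac intro: A.add.l_inv_ex)
  show ?thesis by (intro left_module.intro left_module_axioms.intro Ae.ring_A ab)
      (auto simp: reg_simps lact_closed lact_add lact_add_right lact_mult Ae_one lact_tt)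
qed

lemma abelian_group_right: "abelian_group (env_right AA)"
  by (rule abelian_groupI) (auto simp: reg_simps A.a_ac intro: A.add.l_inv_ex)

lemma tt_finsum_left: "[|!!i. i \<in> I ==> u i .: A; y .: A|]
    ==> tt (\<Oplus>i\<in>I. u i) y = (\<Oplus>\<^sub>Ae i\<in>I. tt (u i) y)" by (rule additive_finsum[OF aA aE]) (auto simp: tt_closed tt_add_left)

lemma tt_finsum_right: "[|!!i. i \<in> I ==> u i .: A; x .: A|]
    ==> tt x (\<Oplus>i\<in>I. u i) = (\<Oplus>\<^sub>Ae i\<in>I. tt x (u i))" by (rule additive_finsum[OF aA aE]) (auto simp: tt_closed tt_add_right)

lemma tt_zero: "y .: A ==> tt \<zero> y = \<zero>\<^sub>Ae" "x .: A ==> tt x \<zero> = \<zero>\<^sub>Ae"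
  using tt_finsum_left[of "{}"] tt_finsum_right[of "{}"] by auto

lemma tt_expand:
  assumes IJ: "finite I" "finite J" and u: "!!i. i \<in> I ==> u i .: A" and v: "!!j. j \<in> J ==> v j .: A"
    and \<alpha>: "!!i. i \<in> I ==> \<alpha> i .: K" and \<beta>: "!!j. j \<in> J ==> \<beta> j .: K"
  shows "tt (\<Oplus>i\<in>I. \<alpha> i \<odot> u i) (\<Oplus>j\<in>J. \<beta> j \<odot> v j)
    = (\<Oplus>\<^sub>Ae p\<in>I \<times> J. (\<alpha> (fst p) \<otimes>\<^sub>K \<beta> (snd p)) \<bullet> tt (u (fst p)) (v (snd p)))"
proof -
  have vc: "(\<Oplus>j\<in>J. \<beta> j \<odot> v j) .: A" using v \<beta> by (intro A.finsum_closed) auto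
  have "tt (\<Oplus>i\<in>I. \<alpha> i \<odot> u i) (\<Oplus>j\<in>J. \<beta> j \<odot> v j)
      = (\<Oplus>\<^sub>Ae i\<in>I. tt (\<alpha> i \<odot> u i) (\<Oplus>j\<in>J. \<beta> j \<odot> v j))" using u \<alpha> vc by (intro tt_finsum_left) auto
  also have "... = (\<Oplus>\<^sub>Ae i\<in>I. \<Oplus>\<^sub>Ae j\<in>J. (\<alpha> i \<otimes>\<^sub>K \<beta> j) \<bullet> tt (u i) (v j))"
  proof (rule Ae.A.finsum_eqI)
    fix i assume i: "i \<in> I"
    have "tt (\<alpha> i \<odot> u i) (\<Oplus>j\<in>J. \<beta> j \<odot> v j) = (\<Oplus>\<^sub>Ae j\<in>J. tt (\<alpha> i \<odot> u i) (\<beta> j \<odot> v j))"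
      using u v \<alpha> \<beta> i by (intro tt_finsum_right) auto
    also have "... = (\<Oplus>\<^sub>Ae j\<in>J. (\<alpha> i \<otimes>\<^sub>K \<beta> j) \<bullet> tt (u i) (v j))" using u v \<alpha> \<beta> i
      by (intro Ae.A.finsum_eqI)
        (simp_all add: tt_smult_left tt_smult_right tt_closed Ae.V.smult_assoc1[symmetric] V.R.m_comm)
    finally show "tt (\<alpha> i \<odot> u i) (\<Oplus>j\<in>J. \<beta> j \<odot> v j)
      = (\<Oplus>\<^sub>Ae j\<in>J. (\<alpha> i \<otimes>\<^sub>K \<beta> j) \<bullet> tt (u i) (v j))" .
  qed (use u v \<alpha> \<beta> in \<open>auto intro!: Ae.A.finsum_closed tt_closed\<close>)
  also have "... = (\<Oplus>\<^sub>Ae p\<in>I \<times> J. (\<alpha> (fst p) \<otimes>\<^sub>K \<beta> (snd p)) \<bullet> tt (u (fst p)) (v (snd p)))"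
    by (rule trans[OF _ Ae.A.finsum_Times[OF IJ, symmetric]])
      (use u v \<alpha> \<beta> in \<open>auto intro!: tt_closed\<close>)
  finally show ?thesis .
qed

end

section \<open>Frobenius algebras\<close>

text \<open>Dual bases \<open>e\<close>, \<open>e'\<close> for the form \<open>lam\<close>, encoded
  by the two expansion formulas. This is how they are applied throughout: an element is recovered
  from its values under the form on either side.\<close>

locale frobenius = envalg K A
  for K :: "('k, 'e) ring_scheme" and A :: "('k, 'a) module" (structure) +
  fixes I :: "'i set" and e e' :: "'i => 'a" and lam :: "'a => 'k"
  assumes I: "finite I" and e: "i \<in> I ==> e i .: A" and e': "i \<in> I ==> e' i .: A" and lam_closed: "x .: A ==> lam x .: K"
    and lam_add: "[|x .: A; y .: A|] ==> lam (x \<oplus> y) = lam x \<oplus>\<^sub>K lam y"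
    and lam_smult: "[|c .: K; x .: A|] ==> lam (c \<odot> x) = c \<otimes>\<^sub>K lam x"
    and exp_left: "z .: A ==> (\<Oplus>i\<in>I. lam (e' i \<otimes> z) \<odot> e i) = z"
    and exp_right: "z .: A ==> (\<Oplus>i\<in>I. lam (z \<otimes> e i) \<odot> e' i) = z"
begin

lemma lam_lincomb:
  assumes "!!j. j \<in> J ==> u j .: A" "!!j. j \<in> J ==> c j .: K"
  shows "lam (\<Oplus>j\<in>J. c j \<odot> u j) = (\<Oplus>\<^sub>K j\<in>J. c j \<otimes>\<^sub>K lam (u j))"
proof -
  have "lam (\<Oplus>j\<in>J. c j \<odot> u j) = (\<Oplus>\<^sub>K j\<in>J. lam (c j \<odot> u j))" using assms
    by (intro additive_finsum[OF aA V.R.is_abelian_group]) (auto simp: lam_closed lam_add)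
  also have "... = (\<Oplus>\<^sub>K j\<in>J. c j \<otimes>\<^sub>K lam (u j))" using assms by (intro V.R.finsum_eqI) (auto simp: lam_smult lam_closed)
  finally show ?thesis .
qed

lemma lincomb_mult_right:
  assumes "!!j. j \<in> J ==> u j .: A" "!!j. j \<in> J ==> c j .: K" "y .: A"
  shows "(\<Oplus>j\<in>J. c j \<odot> u j) \<otimes> y = (\<Oplus>j\<in>J. c j \<odot> (u j \<otimes> y))"
proof -
  have "(\<Oplus>j\<in>J. c j \<odot> u j) \<otimes> y = (\<Oplus>j\<in>J. (c j \<odot> u j) \<otimes> y)"
    using assms by (intro additive_finsum[OF aA aA]) (auto simp: A.l_distr)
  also have "... = (\<Oplus>j\<in>J. c j \<odot> (u j \<otimes> y))" using assms by (intro A.finsum_eqI) (auto simp: smult_mult_left)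
  finally show ?thesis .
qed

lemma lincomb_mult_left:
  assumes "!!j. j \<in> J ==> u j .: A" "!!j. j \<in> J ==> c j .: K" "y .: A"
  shows "y \<otimes> (\<Oplus>j\<in>J. c j \<odot> u j) = (\<Oplus>j\<in>J. c j \<odot> (y \<otimes> u j))"
proof -
  have "y \<otimes> (\<Oplus>j\<in>J. c j \<odot> u j) = (\<Oplus>j\<in>J. y \<otimes> (c j \<odot> u j))"
    using assms by (intro additive_finsum[OF aA aA]) (auto simp: A.r_distr)
  also have "... = (\<Oplus>j\<in>J. c j \<odot> (y \<otimes> u j))" using assms by (intro A.finsum_eqI) (auto simp: smult_mult_right)
  finally show ?thesis .
qed

section \<open>Nondegeneracy and the Nakayama automorphism\<close>

lemma lam_nondeg_left:
  assumes z: "z .: A" "z' .: A" and eq: "!!y. y .: A ==> lam (z \<otimes> y) = lam (z' \<otimes> y)" shows "z = z'"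
proof -
  have "z = (\<Oplus>i\<in>I. lam (z \<otimes> e i) \<odot> e' i)" using exp_right z by simp
  also have "... = (\<Oplus>i\<in>I. lam (z' \<otimes> e i) \<odot> e' i)" using eq e e' z lam_closed by (intro A.finsum_eqI) auto
  also have "... = z'" using exp_right z by simp
  finally show ?thesis .
qed

lemma lam_nondeg_right:
  assumes z: "z .: A" "z' .: A" and eq: "!!y. y .: A ==> lam (y \<otimes> z) = lam (y \<otimes> z')" shows "z = z'"
proof -
  have "z = (\<Oplus>i\<in>I. lam (e' i \<otimes> z) \<odot> e i)" using exp_left z by simp
  also have "... = (\<Oplus>i\<in>I. lam (e' i \<otimes> z') \<odot> e i)" using eq e e' z lam_closed by (intro A.finsum_eqI) auto
  also have "... = z'" using exp_left z by simp
  finally show ?thesis .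
qed

text \<open>The Nakayama automorphism, characterised by
  \<open>lam (nu z \<otimes> y) = lam (y \<otimes> z)\<close> in \<open>lam_nu\<close>; its further
  properties follow from this by nondegeneracy. \<open>nu'\<close> is its inverse.\<close>

definition nu :: "'a => 'a" where "nu z = (\<Oplus>i\<in>I. lam (e i \<otimes> z) \<odot> e' i)"
definition nu' :: "'a => 'a" where "nu' z = (\<Oplus>i\<in>I. lam (z \<otimes> e' i) \<odot> e i)"

lemma nu_closed: "z .: A ==> nu z .: A"
  unfolding nu_def using e e' lam_closed by (intro A.finsum_closed) auto

lemma nu'_closed: "z .: A ==> nu' z .: A"
  unfolding nu'_def using e e' lam_closed by (intro A.finsum_closed) auto

lemma lam_nu:
  assumes z: "z .: A" and y: "y .: A" shows "lam (nu z \<otimes> y) = lam (y \<otimes> z)"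
proof -
  have "lam (nu z \<otimes> y) = (\<Oplus>\<^sub>K i\<in>I. lam (e i \<otimes> z) \<otimes>\<^sub>K lam (e' i \<otimes> y))"
    unfolding nu_def using e e' z y lam_closed by (subst lincomb_mult_right) (auto simp: lam_lincomb)
  also have "... = (\<Oplus>\<^sub>K i\<in>I. lam (e' i \<otimes> y) \<otimes>\<^sub>K lam (e i \<otimes> z))"
    using e e' z y lam_closed by (intro V.R.finsum_eqI) (auto simp: V.R.m_comm)
  also have "... = lam ((\<Oplus>i\<in>I. lam (e' i \<otimes> y) \<odot> e i) \<otimes> z)"
    using e e' z y lam_closed by (subst lincomb_mult_right) (auto simp: lam_lincomb)
  finally show ?thesis using exp_left[OF y] by simp
qed

lemma lam_nu':
  assumes z: "z .: A" and y: "y .: A" shows "lam (y \<otimes> nu' z) = lam (z \<otimes> y)"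
proof -
  have "lam (y \<otimes> nu' z) = (\<Oplus>\<^sub>K i\<in>I. lam (z \<otimes> e' i) \<otimes>\<^sub>K lam (y \<otimes> e i))"
    unfolding nu'_def using e e' z y lam_closed by (subst lincomb_mult_left) (auto simp: lam_lincomb)
  also have "... = (\<Oplus>\<^sub>K i\<in>I. lam (y \<otimes> e i) \<otimes>\<^sub>K lam (z \<otimes> e' i))"
    using e e' z y lam_closed by (intro V.R.finsum_eqI) (auto simp: V.R.m_comm)
  also have "... = lam (z \<otimes> (\<Oplus>i\<in>I. lam (y \<otimes> e i) \<odot> e' i))"
    using e e' z y lam_closed by (subst lincomb_mult_left) (auto simp: lam_lincomb)
  finally show ?thesis using exp_right[OF y] by simp
qed

lemma nu_nu': "z .: A ==> nu (nu' z) = z"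
  by (rule lam_nondeg_left) (auto simp: nu_closed nu'_closed lam_nu lam_nu')

lemma nu'_nu: "z .: A ==> nu' (nu z) = z"
  by (rule lam_nondeg_right) (auto simp: nu_closed nu'_closed lam_nu lam_nu')

lemma nu_add: "[|x .: A; y .: A|] ==> nu (x \<oplus> y) = nu x \<oplus> nu y"
  by (rule lam_nondeg_left) (auto simp: nu_closed lam_nu A.l_distr A.r_distr lam_add)

lemma nu_smult: "[|c .: K; y .: A|] ==> nu (c \<odot> y) = c \<odot> nu y"
  by (rule lam_nondeg_left) (auto simp: nu_closed lam_nu smult_mult_left smult_mult_right lam_smult)

lemma nu_mult:
  assumes "x .: A" "y .: A" shows "nu (x \<otimes> y) = nu x \<otimes> nu y"
proof (rule lam_nondeg_left)
  fix z assume z: "z .: A"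
  have "lam (nu (x \<otimes> y) \<otimes> z) = lam ((z \<otimes> x) \<otimes> y)" using assms z by (simp add: lam_nu A.m_assoc)
  also have "... = lam ((nu y \<otimes> z) \<otimes> x)" using assms z lam_nu[of y "z \<otimes> x"] by (simp add: A.m_assoc nu_closed)
  also have "... = lam ((nu x \<otimes> nu y) \<otimes> z)" using assms z lam_nu[of x "nu y \<otimes> z"] by (simp add: A.m_assoc nu_closed)
  finally show "lam (nu (x \<otimes> y) \<otimes> z) = lam ((nu x \<otimes> nu y) \<otimes> z)" .
qed (use assms nu_closed in auto)

lemma nu'_add: "[|x .: A; y .: A|] ==> nu' (x \<oplus> y) = nu' x \<oplus> nu' y"
  by (rule lam_nondeg_right) (auto simp: nu'_closed lam_nu' A.l_distr A.r_distr lam_add)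

lemma nu'_smult: "[|c .: K; y .: A|] ==> nu' (c \<odot> y) = c \<odot> nu' y"
  by (rule lam_nondeg_right) (auto simp: nu'_closed lam_nu' smult_mult_left smult_mult_right lam_smult)

text \<open>The anti-automorphism of the enveloping algebra that twists by the Nakayama automorphism.\<close>

definition theta :: "'a env => 'a env" where "theta = tensor_induced Ae (%(l, r). tt r (nu l))"
definition theta' :: "'a env => 'a env" where "theta' = tensor_induced Ae (%(l, r). tt (nu' r) l)"

lemma theta:
  shows theta_closed: "U .: Ae ==> theta U .: Ae" and theta_add: "[|U .: Ae; U' .: Ae|] ==> theta (U \<boxplus> U') = theta U \<boxplus> theta U'"
    and theta_tt: "[|l .: A; r .: A|] ==> theta (tt l r) = tt r (nu l)" unfolding theta_def using Ae_induced[where g = "%(l, r). tt r (nu l)", OF aE]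
  by (simp_all add: tt_closed nu_closed nu_add tt_add_left tt_add_right nu_smult tt_smult_left tt_smult_right)

lemma theta':
  shows theta'_closed: "U .: Ae ==> theta' U .: Ae" and theta'_add: "[|U .: Ae; U' .: Ae|] ==> theta' (U \<boxplus> U') = theta' U \<boxplus> theta' U'"
    and theta'_tt: "[|l .: A; r .: A|] ==> theta' (tt l r) = tt (nu' r) l" unfolding theta'_def using Ae_induced[where g = "%(l, r). tt (nu' r) l", OF aE]
  by (simp_all add: tt_closed nu'_closed nu'_add tt_add_left tt_add_right nu'_smult tt_smult_left tt_smult_right)

lemma theta_theta': "U .: Ae ==> theta (theta' U) = U"
  by (induction rule: Ae_induct)
    (simp_all add: theta_tt theta'_tt nu_nu' nu'_closed theta_add theta'_add theta'_closed)

lemma theta'_theta: "U .: Ae ==> theta' (theta U) = U"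
  by (induction rule: Ae_induct)
    (simp_all add: theta_tt theta'_tt nu'_nu nu_closed theta_add theta'_add theta_closed)

lemma theta_finsum: "(!!i. i \<in> J ==> u i .: Ae) ==> theta (\<Oplus>\<^sub>Ae i\<in>J. u i) = (\<Oplus>\<^sub>Ae i\<in>J. theta (u i))"
  by (rule additive_finsum[OF aE aE]) (auto simp: theta_closed theta_add)

lemma theta_zero: "theta \<zero>\<^sub>Ae = \<zero>\<^sub>Ae"
  using theta_finsum[of "{}"] by simp

lemma theta_zero_iff: "U .: Ae ==> theta U = \<zero>\<^sub>Ae \<longleftrightarrow> U = \<zero>\<^sub>Ae"
  using theta'_theta[of U] theta'_theta[of "\<zero>\<^sub>Ae"] theta_zero by auto

text \<open>Exchanging the two tensor factors reverses products. This is what lets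
  \<open>theta\<close> convert exactness on rows into exactness on columns.\<close>

lemma theta_mult:
  assumes U: "U .: Ae" and V: "V .: Ae" shows "theta (U \<star> V) = theta V \<star> theta U" using U
proof (induction rule: Ae_induct)
  case p: (pure x y)
  show ?case using V
  proof (induction rule: Ae_induct)
    case (pure x' y')
    then show ?case using p by (simp add: tt_mult theta_tt nu_closed nu_mult)
  next
    case (add V V')
    then show ?case using p by (simp add: Ae.A.l_distr Ae.A.r_distr theta_add theta_closed tt_closed)
  qed
next
  case (add U U')
  then show ?case using V by (simp add: Ae.A.l_distr Ae.A.r_distr theta_add theta_closed)
qed

text \<open>\<open>theta U\<close> is the adjoint of \<open>U\<close> for the pairing
  \<open>lam (b \<otimes> b')\<close>. After tensoring with \<open>A\<close>, the twisted transposes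
  in negative degrees therefore become plain transposes of the positive differentials.\<close>

lemma lam_ract_theta:
  assumes b: "b .: A" "b' .: A" and U: "U .: Ae" shows "lam (ract b (theta U) \<otimes> b') = lam (b \<otimes> ract b' U)" using U
proof (induction rule: Ae_induct)
  case (pure l r)
  have "lam (ract b (theta (tt l r)) \<otimes> b') = lam (nu l \<otimes> (b \<otimes> r \<otimes> b'))"
    using b pure by (simp add: theta_tt ract_tt nu_closed A.m_assoc)
  also have "... = lam (b \<otimes> ract b' (tt l r))" using b pure by (simp add: lam_nu ract_tt A.m_assoc)
  finally show ?case .
next
  case (add U V)
  then show ?case using b by (simp add: theta_add ract_add theta_closed ract_closed A.l_distr A.r_distr lam_add)
qed

section \<open>The Frobenius form on the enveloping algebra\<close>

definition Lam :: "'a env => 'k" where "Lam = tensor_induced K (%(l, r). lam l \<otimes>\<^sub>K lam r)"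

lemma Lam:
  shows Lam_closed: "U .: Ae ==> Lam U .: K" and Lam_add: "[|U .: Ae; U' .: Ae|] ==> Lam (U \<boxplus> U') = Lam U \<oplus>\<^sub>K Lam U'"
    and Lam_tt: "[|l .: A; r .: A|] ==> Lam (tt l r) = lam l \<otimes>\<^sub>K lam r" unfolding Lam_def
  using Ae_induced[where g = "%(l, r). lam l \<otimes>\<^sub>K lam r", OF V.R.is_abelian_group]
  by (simp_all add: lam_closed lam_add V.R.l_distr V.R.r_distr lam_smult V.R.m_ac)

lemma Lam_smult:
  assumes "U .: Ae" "c .: K" shows "Lam (c \<bullet> U) = c \<otimes>\<^sub>K Lam U" using assms(1) by (induction rule: Ae_induct)
    (use assms(2) in \<open>simp_all add: Lam_tt Lam_add tt_smult_left[symmetric] lam_smult lam_closed V.R.m_assoc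
      Ae.V.smult_r_distr V.R.r_distr Lam_closed\<close>)

text \<open>The second factor multiplies in the opposite order, so there the two bases trade places:
  the elements \<open>tt (e i) (e' j)\<close> are dual to the \<open>tt (e' i) (e j)\<close> under
  \<open>Lam\<close>.\<close>

lemma Ae_exp_left:
  assumes Z: "Z .: Ae" shows "(\<Oplus>\<^sub>Ae p\<in>I \<times> I. Lam (tt (e' (fst p)) (e (snd p)) \<star> Z) \<bullet> tt (e (fst p)) (e' (snd p))) = Z"
  using Z
proof (induction rule: Ae_induct)
  case (pure l r)
  have "tt l r = tt (\<Oplus>i\<in>I. lam (e' i \<otimes> l) \<odot> e i) (\<Oplus>i\<in>I. lam (r \<otimes> e i) \<odot> e' i)"
    using pure by (simp add: exp_left exp_right)
  also have "... = (\<Oplus>\<^sub>Ae p\<in>I \<times> I. (lam (e' (fst p) \<otimes> l) \<otimes>\<^sub>K lam (r \<otimes> e (snd p))) \<bullet> tt (e (fst p)) (e' (snd p)))"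
    using pure I e e' lam_closed by (intro tt_expand) auto
  also have "... = (\<Oplus>\<^sub>Ae p\<in>I \<times> I. Lam (tt (e' (fst p)) (e (snd p)) \<star> tt l r) \<bullet> tt (e (fst p)) (e' (snd p)))"
    using pure e e' lam_closed by (intro Ae.A.finsum_eqI) (auto simp: tt_mult Lam_tt intro!: Ae.V.smult_closed tt_closed)
  finally show ?case by simp
next
  case (add X Y)
  let ?E = "%p. tt (e (fst p)) (e' (snd p))" and ?E' = "%p. tt (e' (fst p)) (e (snd p))"
  have c: "?E p .: Ae" "?E' p .: Ae" if "p \<in> I \<times> I" for p using that e e' by (auto intro!: tt_closed)
  have "(\<Oplus>\<^sub>Ae p\<in>I \<times> I. Lam (?E' p \<star> (X \<boxplus> Y)) \<bullet> ?E p)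
    = (\<Oplus>\<^sub>Ae p\<in>I \<times> I. Lam (?E' p \<star> X) \<bullet> ?E p \<boxplus> Lam (?E' p \<star> Y) \<bullet> ?E p)"
    using add(1,2) c by (intro Ae.A.finsum_eqI) (simp_all add: Ae.A.r_distr Lam_add Lam_closed Ae.V.smult_l_distr)
  also have "... = X \<boxplus> Y" using add c by (subst Ae.A.finsum_addf) (auto intro!: Ae.V.smult_closed Lam_closed Ae.A.m_closed)
  finally show ?case .
qed

lemma Ae_exp_right:
  assumes Z: "Z .: Ae" shows "(\<Oplus>\<^sub>Ae p\<in>I \<times> I. Lam (Z \<star> tt (e (fst p)) (e' (snd p))) \<bullet> tt (e' (fst p)) (e (snd p))) = Z"
  using Z
proof (induction rule: Ae_induct)
  case (pure l r)
  have "tt l r = tt (\<Oplus>i\<in>I. lam (l \<otimes> e i) \<odot> e' i) (\<Oplus>i\<in>I. lam (e' i \<otimes> r) \<odot> e i)"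
    using pure by (simp add: exp_left exp_right)
  also have "... = (\<Oplus>\<^sub>Ae p\<in>I \<times> I. (lam (l \<otimes> e (fst p)) \<otimes>\<^sub>K lam (e' (snd p) \<otimes> r)) \<bullet> tt (e' (fst p)) (e (snd p)))"
    using pure I e e' lam_closed by (intro tt_expand) auto
  also have "... = (\<Oplus>\<^sub>Ae p\<in>I \<times> I. Lam (tt l r \<star> tt (e (fst p)) (e' (snd p))) \<bullet> tt (e' (fst p)) (e (snd p)))"
    using pure e e' lam_closed by (intro Ae.A.finsum_eqI) (auto simp: tt_mult Lam_tt intro!: Ae.V.smult_closed tt_closed)
  finally show ?case by simp
next
  case (add X Y)
  let ?E = "%p. tt (e (fst p)) (e' (snd p))" and ?E' = "%p. tt (e' (fst p)) (e (snd p))"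
  have c: "?E p .: Ae" "?E' p .: Ae" if "p \<in> I \<times> I" for p using that e e' by (auto intro!: tt_closed)
  have "(\<Oplus>\<^sub>Ae p\<in>I \<times> I. Lam ((X \<boxplus> Y) \<star> ?E p) \<bullet> ?E' p)
    = (\<Oplus>\<^sub>Ae p\<in>I \<times> I. Lam (X \<star> ?E p) \<bullet> ?E' p \<boxplus> Lam (Y \<star> ?E p) \<bullet> ?E' p)"
    using add(1,2) c by (intro Ae.A.finsum_eqI) (simp_all add: Ae.A.l_distr Lam_add Lam_closed Ae.V.smult_l_distr)
  also have "... = X \<boxplus> Y" using add c by (subst Ae.A.finsum_addf) (auto intro!: Ae.V.smult_closed Lam_closed Ae.A.m_closed)
  finally show ?case .
qed

lemma Lam_nondeg:
  assumes Z: "Z .: Ae" "Z' .: Ae" and eq: "!!Y. Y .: Ae ==> Lam (Y \<star> Z) = Lam (Y \<star> Z')" shows "Z = Z'"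
proof -
  have c: "tt (e (fst p)) (e' (snd p)) .: Ae" "tt (e' (fst p)) (e (snd p)) .: Ae" if "p \<in> I \<times> I" for p using that e e' by (auto intro!: tt_closed)
  have "Z = (\<Oplus>\<^sub>Ae p\<in>I \<times> I. Lam (tt (e' (fst p)) (e (snd p)) \<star> Z) \<bullet> tt (e (fst p)) (e' (snd p)))"
    by (rule Ae_exp_left[OF Z(1), symmetric])
  also have "... = (\<Oplus>\<^sub>Ae p\<in>I \<times> I. Lam (tt (e' (fst p)) (e (snd p)) \<star> Z') \<bullet> tt (e (fst p)) (e' (snd p)))"
    using c Z by (intro Ae.A.finsum_eqI) (simp_all add: eq Lam_closed)
  also have "... = Z'" by (rule Ae_exp_left[OF Z(2)])
  finally show ?thesis .
qed

text \<open>\<open>Z\<close> is assembled from the values of \<open>\<mu>\<close> on the dual basis.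
  Through this lemma a contraction that is linear over \<open>K\<close> only can still produce
  elements of the enveloping algebra.\<close>

lemma Lam_represents:
  assumes m: "!!X. X .: Ae ==> \<mu> X .: K" and ma: "!!X Y. [|X .: Ae; Y .: Ae|] ==> \<mu> (X \<boxplus> Y) = \<mu> X \<oplus>\<^sub>K \<mu> Y"
    and ms: "!!c X. [|c .: K; X .: Ae|] ==> \<mu> (c \<bullet> X) = c \<otimes>\<^sub>K \<mu> X"
  shows "\<exists>Z\<in>carrier Ae. \<forall>X\<in>carrier Ae. \<mu> X = Lam (X \<star> Z)"
proof -
  let ?E = "%p. tt (e (fst p)) (e' (snd p))" and ?E' = "%p. tt (e' (fst p)) (e (snd p))"
  have c: "?E p .: Ae" "?E' p .: Ae" if "p \<in> I \<times> I" for p using that e e' by (auto intro!: tt_closed)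
  define Z where "Z = (\<Oplus>\<^sub>Ae p\<in>I \<times> I. \<mu> (?E' p) \<bullet> ?E p)"
  have Zc: "Z .: Ae" unfolding Z_def using c m by (intro Ae.A.finsum_closed) auto
  have "\<mu> X = Lam (X \<star> Z)" if X: "X .: Ae" for X
  proof -
    have lc: "Lam (X \<star> ?E p) .: K" if "p \<in> I \<times> I" for p using X c[OF that] by (intro Lam_closed) auto
    have "\<mu> X = \<mu> (\<Oplus>\<^sub>Ae p\<in>I \<times> I. Lam (X \<star> ?E p) \<bullet> ?E' p)" by (simp only: Ae_exp_right[OF X])
    also have "... = (\<Oplus>\<^sub>K p\<in>I \<times> I. \<mu> (Lam (X \<star> ?E p) \<bullet> ?E' p))"
      using c lc by (intro additive_finsum[OF aE V.R.is_abelian_group] m ma) auto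
    also have "... = (\<Oplus>\<^sub>K p\<in>I \<times> I. Lam (\<mu> (?E' p) \<bullet> (X \<star> ?E p)))"
      using c lc m X by (intro V.R.finsum_eqI) (simp_all add: ms Lam_smult V.R.m_comm)
    also have "... = Lam (\<Oplus>\<^sub>Ae p\<in>I \<times> I. \<mu> (?E' p) \<bullet> (X \<star> ?E p))" using c m X
      by (intro additive_finsum[OF aE V.R.is_abelian_group Lam_closed Lam_add, symmetric]) auto
    also have "(\<Oplus>\<^sub>Ae p\<in>I \<times> I. \<mu> (?E' p) \<bullet> (X \<star> ?E p)) = (\<Oplus>\<^sub>Ae p\<in>I \<times> I. X \<star> (\<mu> (?E' p) \<bullet> ?E p))"
      using c m X by (intro Ae.A.finsum_eqI) (simp_all add: Ae.smult_mult_right)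
    also have "... = X \<star> Z" unfolding Z_def using c m X by (intro additive_finsum[OF aE aE, symmetric]) (auto simp: Ae.A.r_distr)
    finally show ?thesis .
  qed
  then show ?thesis using Zc by blast
qed

section \<open>The Casimir element\<close>

definition Delta :: "'a env" where "Delta = (\<Oplus>\<^sub>Ae i\<in>I. tt (e i) (e' i))"

lemma Delta_closed: "Delta .: Ae"
  unfolding Delta_def using e e' by (intro Ae.A.finsum_closed) (auto intro!: tt_closed)

lemma mult_Delta:
  assumes "l .: A" "r .: A" shows "tt l r \<star> Delta = (\<Oplus>\<^sub>Ae i\<in>I. tt (l \<otimes> e i) (e' i \<otimes> r))"
proof -
  have "tt l r \<star> Delta = (\<Oplus>\<^sub>Ae i\<in>I. tt l r \<star> tt (e i) (e' i))" unfolding Delta_def using assms e e'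
    by (intro additive_finsum[OF aE aE]) (auto simp: Ae.A.r_distr tt_closed)
  also have "... = (\<Oplus>\<^sub>Ae i\<in>I. tt (l \<otimes> e i) (e' i \<otimes> r))"
    using assms e e' by (intro Ae.A.finsum_eqI) (auto simp: tt_mult intro!: tt_closed)
  finally show ?thesis .
qed

text \<open>Left multiplication by \<open>l\<close> on the \<open>e j\<close> and right
  multiplication by \<open>l\<close> on the \<open>e' i\<close> are described by the same matrix
  \<open>lam (e' i \<otimes> (l \<otimes> e j))\<close>.\<close>

lemma Delta_casimir:
  assumes l: "l .: A" shows "tt l \<one> \<star> Delta = tt \<one> l \<star> Delta"
proof -
  let ?c = "%i j. lam (e' i \<otimes> (l \<otimes> e j))"
  have c: "[|i \<in> I; j \<in> I|] ==> ?c i j .: K" for i j using l e e' by (intro lam_closed) auto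
  have "tt l \<one> \<star> Delta = (\<Oplus>\<^sub>Ae j\<in>I. tt (l \<otimes> e j) (e' j \<otimes> \<one>))" using l by (simp add: mult_Delta)
  also have "... = (\<Oplus>\<^sub>Ae j\<in>I. \<Oplus>\<^sub>Ae i\<in>I. ?c i j \<bullet> tt (e i) (e' j))"
  proof (rule Ae.A.finsum_eqI)
    fix j assume j: "j \<in> I"
    have "tt (l \<otimes> e j) (e' j \<otimes> \<one>) = tt (\<Oplus>i\<in>I. ?c i j \<odot> e i) (e' j)"
      using l e[OF j] e'[OF j] exp_left[of "l \<otimes> e j"] by simp
    also have "... = (\<Oplus>\<^sub>Ae i\<in>I. tt (?c i j \<odot> e i) (e' j))" using j c e e' by (intro tt_finsum_left) auto
    also have "... = (\<Oplus>\<^sub>Ae i\<in>I. ?c i j \<bullet> tt (e i) (e' j))"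
      using j c e e' by (intro Ae.A.finsum_eqI) (auto simp: tt_smult_left tt_closed)
    finally show "tt (l \<otimes> e j) (e' j \<otimes> \<one>) = (\<Oplus>\<^sub>Ae i\<in>I. ?c i j \<bullet> tt (e i) (e' j))" .
  qed (use c e e' in \<open>auto intro!: Ae.A.finsum_closed tt_closed\<close>)
  also have "... = (\<Oplus>\<^sub>Ae i\<in>I. \<Oplus>\<^sub>Ae j\<in>I. ?c i j \<bullet> tt (e i) (e' j))"
    using I c e e' by (intro Ae.A.finsum_swap) (auto intro!: tt_closed)
  also have "... = (\<Oplus>\<^sub>Ae i\<in>I. tt (\<one> \<otimes> e i) (e' i \<otimes> l))"
  proof (rule Ae.A.finsum_eqI)
    fix i assume i: "i \<in> I"
    have "tt (\<one> \<otimes> e i) (e' i \<otimes> l) = tt (e i) (\<Oplus>j\<in>I. lam ((e' i \<otimes> l) \<otimes> e j) \<odot> e' j)"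
      using l e[OF i] e'[OF i] exp_right[of "e' i \<otimes> l"] by simp
    also have "(\<Oplus>j\<in>I. lam ((e' i \<otimes> l) \<otimes> e j) \<odot> e' j) = (\<Oplus>j\<in>I. ?c i j \<odot> e' j)"
      using i c e e' l by (intro A.finsum_eqI) (auto simp: A.m_assoc)
    also have "tt (e i) ... = (\<Oplus>\<^sub>Ae j\<in>I. tt (e i) (?c i j \<odot> e' j))" using i c e e' by (intro tt_finsum_right) auto
    also have "... = (\<Oplus>\<^sub>Ae j\<in>I. ?c i j \<bullet> tt (e i) (e' j))"
      using i c e e' by (intro Ae.A.finsum_eqI) (auto simp: tt_smult_right tt_closed)
    finally show "(\<Oplus>\<^sub>Ae j\<in>I. ?c i j \<bullet> tt (e i) (e' j)) = tt (\<one> \<otimes> e i) (e' i \<otimes> l)" by simp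
  qed (use l e e' in \<open>auto intro!: tt_closed\<close>)
  also have "... = tt \<one> l \<star> Delta" using l by (simp add: mult_Delta)
  finally show ?thesis .
qed

text \<open>By the Casimir property only the product of the two factors of \<open>F\<close> matters.
  Left multiples of \<open>Delta\<close> are thus indexed by \<open>A\<close>, and
  \<open>Delta_faithful\<close> makes this indexing injective.\<close>

lemma Delta_act:
  assumes F: "F .: Ae" shows "F \<star> Delta = tt (lact F \<one>) \<one> \<star> Delta" using F
proof (induction rule: Ae_induct)
  case (pure l r)
  have "tt l r \<star> Delta = tt l \<one> \<star> (tt \<one> r \<star> Delta)"
    using pure Delta_closed by (simp add: Ae.A.m_assoc[symmetric] tt_closed tt_mult)
  also have "... = tt (l \<otimes> r) \<one> \<star> Delta" using pure Delta_closed
    by (simp add: Delta_casimir[symmetric] Ae.A.m_assoc[symmetric] tt_closed tt_mult)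
  finally show ?case using pure by (simp add: lact_tt)
next
  case (add X Y)
  then show ?case using Delta_closed by (simp add: Ae.A.l_distr lact_add lact_closed tt_add_left tt_closed)
qed

text \<open>Applying \<open>lam\<close> to the second factor sends \<open>Delta\<close> to 1. This
  detects left multiples of \<open>Delta\<close> and extracts the cofactor of a Casimir
  element.\<close>

definition contract :: "'a env => 'a" where "contract = tensor_induced A (%(l, r). lam r \<odot> l)"

lemma contract:
  shows contract_closed: "U .: Ae ==> contract U .: A"
    and contract_add: "[|U .: Ae; U' .: Ae|] ==> contract (U \<boxplus> U') = contract U \<oplus> contract U'"
    and contract_tt: "[|l .: A; r .: A|] ==> contract (tt l r) = lam r \<odot> l" unfolding contract_def
  using Ae_induced[where g = "%(l, r). lam r \<odot> l", OF aA]
  by (simp_all add: lam_closed lam_add lam_smult V.smult_l_distr V.smult_r_distr V.smult_assoc1[symmetric] V.R.m_comm)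

lemma contract_mult_left:
  assumes "l .: A" "U .: Ae" shows "contract (tt l \<one> \<star> U) = l \<otimes> contract U" using assms(2) by (induction rule: Ae_induct)
    (use assms(1) in \<open>simp_all add: tt_mult contract_tt lam_closed smult_mult_right Ae.A.r_distr A.r_distr
      contract_add contract_closed tt_closed\<close>)

lemma Delta_faithful:
  assumes z: "z .: A" and 0: "tt z \<one> \<star> Delta = \<zero>\<^sub>Ae" shows "z = \<zero>"
proof -
  have c0: "contract \<zero>\<^sub>Ae = \<zero>" by (rule additive_zero[OF aE aA contract_closed contract_add])
  have "contract Delta = (\<Oplus>i\<in>I. contract (tt (e i) (e' i)))" unfolding Delta_def using e e'
    by (intro additive_finsum[OF aE aA contract_closed contract_add])
      (auto intro: tt_closed)
  also have "... = (\<Oplus>i\<in>I. lam (e' i \<otimes> \<one>) \<odot> e i)" using e e' lam_closed by (intro A.finsum_eqI) (auto simp: contract_tt)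
  also have "... = \<one>" by (simp add: exp_left)
  finally have "z \<otimes> \<one> = \<zero>" using contract_mult_left[OF z Delta_closed] 0 c0 by simp
  then show ?thesis using z by simp
qed

lemma Delta_annihilator:
  assumes F: "F .: Ae" and 0: "F \<star> Delta = \<zero>\<^sub>Ae" shows "lact F \<one> = \<zero>"
  using Delta_faithful[OF lact_closed[OF _ F]] Delta_act[OF F] 0 by simp

text \<open>Expanding the second factor in the \<open>e' j\<close> gives the coefficients
  \<open>contract (tt \<one> (e j) \<star> Z)\<close>. The Casimir property moves \<open>e j\<close>
  to the first factor, where it comes out as a multiplier of \<open>contract Z\<close>.\<close>

lemma casimir_multiple:
  assumes Z: "Z .: Ae" and cas: "!!l. l .: A ==> tt l \<one> \<star> Z = tt \<one> l \<star> Z" shows "Z = Delta \<star> tt (contract Z) \<one>"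
proof -
  have ex: "(\<Oplus>\<^sub>Ae j\<in>I. tt (contract (tt \<one> (e j) \<star> U)) (e' j)) = U" if "U .: Ae" for U using that
  proof (induction rule: Ae_induct)
    case (pure l r)
    have "(\<Oplus>\<^sub>Ae j\<in>I. tt (contract (tt \<one> (e j) \<star> tt l r)) (e' j))
      = (\<Oplus>\<^sub>Ae j\<in>I. tt l (lam (r \<otimes> e j) \<odot> e' j))" using pure e e' by (intro Ae.A.finsum_eqI)
        (auto simp: tt_mult contract_tt tt_smult_left tt_smult_right lam_closed tt_closed)
    also have "... = tt l r" using pure e e' lam_closed exp_right[of r] by (subst tt_finsum_right[symmetric]) auto
    finally show ?case .
  next
    case (add X Y)
    have c: "tt \<one> (e j) .: Ae" if "j \<in> I" for j using that e by (auto intro: tt_closed)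
    have "(\<Oplus>\<^sub>Ae j\<in>I. tt (contract (tt \<one> (e j) \<star> (X \<boxplus> Y))) (e' j))
      = (\<Oplus>\<^sub>Ae j\<in>I. tt (contract (tt \<one> (e j) \<star> X)) (e' j) \<boxplus> tt (contract (tt \<one> (e j) \<star> Y)) (e' j))"
      using add(1,2) c e' by (intro Ae.A.finsum_eqI)
        (simp_all add: Ae.A.r_distr contract_add contract_closed tt_add_left tt_closed)
    also have "... = (\<Oplus>\<^sub>Ae j\<in>I. tt (contract (tt \<one> (e j) \<star> X)) (e' j))
      \<boxplus> (\<Oplus>\<^sub>Ae j\<in>I. tt (contract (tt \<one> (e j) \<star> Y)) (e' j))"
      using add(1,2) c e e' by (intro Ae.A.finsum_addf) (auto intro!: tt_closed contract_closed Ae.A.m_closed)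
    also have "... = X \<boxplus> Y" by (simp only: add(3,4))
    finally show ?case .
  qed
  have "Z = (\<Oplus>\<^sub>Ae j\<in>I. tt (contract (tt \<one> (e j) \<star> Z)) (e' j))" by (rule ex[OF Z, symmetric])
  also have "... = (\<Oplus>\<^sub>Ae j\<in>I. tt (e j) (e' j) \<star> tt (contract Z) \<one>)" using Z e e' by (intro Ae.A.finsum_eqI)
      (simp_all add: cas[symmetric] contract_mult_left contract_closed tt_mult tt_closed)
  also have "... = Delta \<star> tt (contract Z) \<one>" unfolding Delta_def using Z e e' by (intro additive_finsum[OF aE aE, symmetric])
      (auto simp: Ae.A.l_distr tt_closed contract_closed)
  finally show ?thesis .
qed

text \<open>\<open>theta\<close> replaces the pair \<open>e\<close>, \<open>e'\<close> by
  \<open>e'\<close>, \<open>nu e\<close>. By the defining property of \<open>nu\<close> these are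
  dual bases again, and the Casimir element does not depend on the choice of dual bases. Hence the
  gluing map is its own twisted transpose, and degree -1 mirrors degree 0.\<close>

lemma theta_Delta: "theta Delta = Delta"
proof -
  have nuc: "j \<in> I ==> nu (e j) .: A" for j using e nu_closed by auto
  have c: "[|i \<in> I; j \<in> I|] ==> lam (e' i \<otimes> e' j) .: K" for i j using e' by (intro lam_closed) auto
  have inner: "(\<Oplus>j\<in>I. lam (e' i \<otimes> e' j) \<odot> nu (e j)) = e' i" if i: "i \<in> I" for i
  proof (rule lam_nondeg_left)
    show "(\<Oplus>j\<in>I. lam (e' i \<otimes> e' j) \<odot> nu (e j)) .: A" using c[OF i] nuc by (intro A.finsum_closed) auto
    fix y assume y: "y .: A"
    have "lam ((\<Oplus>j\<in>I. lam (e' i \<otimes> e' j) \<odot> nu (e j)) \<otimes> y)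
        = (\<Oplus>\<^sub>K j\<in>I. lam (e' i \<otimes> e' j) \<otimes>\<^sub>K lam (nu (e j) \<otimes> y))"
      using c[OF i] nuc y by (subst lincomb_mult_right) (auto simp: lam_lincomb)
    also have "... = (\<Oplus>\<^sub>K j\<in>I. lam (y \<otimes> e j) \<otimes>\<^sub>K lam (e' i \<otimes> e' j))"
      using c[OF i] e y by (intro V.R.finsum_eqI) (auto simp: lam_nu lam_closed V.R.m_comm)
    also have "... = lam (e' i \<otimes> (\<Oplus>j\<in>I. lam (y \<otimes> e j) \<odot> e' j))"
      using i e e' y lam_closed by (subst lincomb_mult_left) (auto simp: lam_lincomb)
    finally show "lam ((\<Oplus>j\<in>I. lam (e' i \<otimes> e' j) \<odot> nu (e j)) \<otimes> y) = lam (e' i \<otimes> y)" by (simp add: exp_right[OF y])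
  qed (use e' i in auto)
  have "theta Delta = (\<Oplus>\<^sub>Ae j\<in>I. theta (tt (e j) (e' j)))" unfolding Delta_def using e e' by (intro theta_finsum) (auto intro: tt_closed)
  also have "... = (\<Oplus>\<^sub>Ae j\<in>I. \<Oplus>\<^sub>Ae i\<in>I. lam (e' i \<otimes> e' j) \<bullet> tt (e i) (nu (e j)))"
  proof (rule Ae.A.finsum_eqI)
    fix j assume j: "j \<in> I"
    have "theta (tt (e j) (e' j)) = tt (\<Oplus>i\<in>I. lam (e' i \<otimes> e' j) \<odot> e i) (nu (e j))"
      using e[OF j] e'[OF j] by (simp add: theta_tt exp_left)
    also have "... = (\<Oplus>\<^sub>Ae i\<in>I. tt (lam (e' i \<otimes> e' j) \<odot> e i) (nu (e j)))" using j c e nuc by (intro tt_finsum_left) auto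
    also have "... = (\<Oplus>\<^sub>Ae i\<in>I. lam (e' i \<otimes> e' j) \<bullet> tt (e i) (nu (e j)))"
      using j c e nuc by (intro Ae.A.finsum_eqI) (auto simp: tt_smult_left tt_closed)
    finally show "theta (tt (e j) (e' j)) = (\<Oplus>\<^sub>Ae i\<in>I. lam (e' i \<otimes> e' j) \<bullet> tt (e i) (nu (e j)))" .
  qed (use c e nuc in \<open>auto intro!: Ae.A.finsum_closed tt_closed\<close>)
  also have "... = (\<Oplus>\<^sub>Ae i\<in>I. \<Oplus>\<^sub>Ae j\<in>I. lam (e' i \<otimes> e' j) \<bullet> tt (e i) (nu (e j)))"
    using I c e nuc by (intro Ae.A.finsum_swap) (auto intro!: tt_closed)
  also have "... = (\<Oplus>\<^sub>Ae i\<in>I. tt (e i) (e' i))"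
  proof (rule Ae.A.finsum_eqI)
    fix i assume i: "i \<in> I"
    have "tt (e i) (e' i) = tt (e i) (\<Oplus>j\<in>I. lam (e' i \<otimes> e' j) \<odot> nu (e j))" by (simp only: inner[OF i])
    also have "... = (\<Oplus>\<^sub>Ae j\<in>I. tt (e i) (lam (e' i \<otimes> e' j) \<odot> nu (e j)))" using i c e nuc by (intro tt_finsum_right) auto
    also have "... = (\<Oplus>\<^sub>Ae j\<in>I. lam (e' i \<otimes> e' j) \<bullet> tt (e i) (nu (e j)))"
      using i c e nuc by (intro Ae.A.finsum_eqI) (auto simp: tt_smult_right tt_closed)
    finally show "(\<Oplus>\<^sub>Ae j\<in>I. lam (e' i \<otimes> e' j) \<bullet> tt (e i) (nu (e j))) = tt (e i) (e' i)" by simp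
  qed (use e e' in \<open>auto intro: tt_closed\<close>)
  finally show ?thesis by (simp add: Delta_def)
qed

end

section \<open>Complexes of free modules given by matrices\<close>

text \<open>Vectors are rows and matrices act from the right, so that the map commutes with scalars
  on the left.\<close>

definition mat_map ::
  "('r, 'e) ring_scheme => nat => nat => (nat => nat => 'r) => (nat => 'r) => nat => 'r"
  where "mat_map R r c D f = (%j. if j < c then \<Oplus>\<^sub>R i\<in>{..<r}. f i \<otimes>\<^sub>R D i j else \<zero>\<^sub>R)"

abbreviation "fmod R r == free_module R {..<r::nat}"

lemma fmod_carrier:
  assumes "ring R" shows "f .: (fmod R r) \<longleftrightarrow> (\<forall>i<r. f i .: R) & (\<forall>i\<ge>r. f i = \<zero>\<^sub>R)"
proof -
  interpret R: ring R by fact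
  show ?thesis
  proof
    assume "f .: (fmod R r)"
    then show "(\<forall>i<r. f i .: R) & (\<forall>i\<ge>r. f i = \<zero>\<^sub>R)" by (auto simp: free_module_carrier)
  next
    assume a: "(\<forall>i<r. f i .: R) & (\<forall>i\<ge>r. f i = \<zero>\<^sub>R)"
    have "{i. f i ~= \<zero>\<^sub>R} \<subseteq> {..<r}" using a by (force simp: not_less[symmetric])
    from finite_subset[OF this] have "finite {i. f i ~= \<zero>\<^sub>R}" by simp
    moreover have "f i .: R" for i using a by (cases "i < r") auto
    ultimately show "f .: (fmod R r)" using a by (auto simp: free_module_carrier)
  qed
qed

context ring
begin

lemma finsum_swap_mult:
  assumes f: "!!i. i < m ==> f i .: R" and D: "!!i j. [|i < m; j < n|] ==> D i j .: R" and h: "!!j. j < n ==> h j .: R"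
  shows "(\<Oplus>j\<in>{..<n::nat}. (\<Oplus>i\<in>{..<m::nat}. f i \<otimes> D i j) \<otimes> h j) = (\<Oplus>i\<in>{..<m}. f i \<otimes> (\<Oplus>j\<in>{..<n}. D i j \<otimes> h j))"
proof -
  have "(\<Oplus>j\<in>{..<n}. (\<Oplus>i\<in>{..<m}. f i \<otimes> D i j) \<otimes> h j) = (\<Oplus>j\<in>{..<n}. \<Oplus>i\<in>{..<m}. f i \<otimes> D i j \<otimes> h j)"
    using f D h by (intro finsum_eqI) (auto simp: finsum_ldistr intro!: finsum_closed)
  also have "... = (\<Oplus>i\<in>{..<m}. \<Oplus>j\<in>{..<n}. f i \<otimes> D i j \<otimes> h j)" using f D h by (intro finsum_swap) auto
  also have "... = (\<Oplus>i\<in>{..<m}. f i \<otimes> (\<Oplus>j\<in>{..<n}. D i j \<otimes> h j))"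
  proof (rule finsum_eqI)
    fix i assume i: "i \<in> {..<m}"
    have "(\<Oplus>j\<in>{..<n}. f i \<otimes> D i j \<otimes> h j) = (\<Oplus>j\<in>{..<n}. f i \<otimes> (D i j \<otimes> h j))"
      using f D h i by (intro finsum_eqI) (auto simp: m_assoc)
    also have "... = f i \<otimes> (\<Oplus>j\<in>{..<n}. D i j \<otimes> h j)" using f D h i by (intro finsum_rdistr[symmetric]) auto
    finally show "(\<Oplus>j\<in>{..<n}. f i \<otimes> D i j \<otimes> h j) = f i \<otimes> (\<Oplus>j\<in>{..<n}. D i j \<otimes> h j)" .
  qed (use f D h in \<open>auto intro!: finsum_closed\<close>)
  finally show ?thesis .
qed

lemma mat_map_hom:
  assumes D: "!!i j. D i j .: R" shows "mat_map R r c D \<in> module_hom R (fmod R r) (fmod R c)"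
proof (rule module_homI)
  note rR = ring_axioms
  show "mat_map R r c D f .: (fmod R c)" if "f .: (fmod R r)" for f using that D by (auto simp: fmod_carrier[OF rR] mat_map_def intro!: finsum_closed)
  show "mat_map R r c D (f \<oplus>\<^sub>(fmod R r) g) = mat_map R r c D f \<oplus>\<^sub>(fmod R c) mat_map R r c D g"
    if "f .: (fmod R r)" "g .: (fmod R r)" for f g
  proof
    fix j
    have fg: "f i .: R" "g i .: R" for i using that by (auto simp: free_module_carrier)
    have "(\<Oplus>i\<in>{..<r}. (f i \<oplus> g i) \<otimes> D i j) = (\<Oplus>i\<in>{..<r}. f i \<otimes> D i j \<oplus> g i \<otimes> D i j)"
      using fg D by (intro finsum_eqI) (auto simp: l_distr)
    also have "... = (\<Oplus>i\<in>{..<r}. f i \<otimes> D i j) \<oplus> (\<Oplus>i\<in>{..<r}. g i \<otimes> D i j)" using fg D by (intro finsum_addf) auto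
    finally show "mat_map R r c D (f \<oplus>\<^sub>(fmod R r) g) j = (mat_map R r c D f \<oplus>\<^sub>(fmod R c) mat_map R r c D g) j"
      by (simp add: mat_map_def free_module_simps)
  qed
  show "mat_map R r c D (a \<odot>\<^sub>(fmod R r) f) = a \<odot>\<^sub>(fmod R c) mat_map R r c D f" if "a .: R" "f .: (fmod R r)" for a f
  proof
    fix j
    have f: "f i .: R" for i using that by (auto simp: free_module_carrier)
    have "(\<Oplus>i\<in>{..<r}. (a \<otimes> f i) \<otimes> D i j) = (\<Oplus>i\<in>{..<r}. a \<otimes> (f i \<otimes> D i j))"
      using f D that by (intro finsum_eqI) (auto simp: m_assoc)
    also have "... = a \<otimes> (\<Oplus>i\<in>{..<r}. f i \<otimes> D i j)" using f D that by (intro finsum_rdistr[symmetric]) auto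
    finally show "mat_map R r c D (a \<odot>\<^sub>(fmod R r) f) j = (a \<odot>\<^sub>(fmod R c) mat_map R r c D f) j"
      using that by (simp add: mat_map_def free_module_simps)
  qed
qed

lemma column_hom:
  assumes h: "!!i. i < r ==> h i .: R" shows "(%f. \<Oplus>i\<in>{..<r}. f i \<otimes> h i) \<in> module_hom R (fmod R r) (left_regular R)"
proof -
  define D where "D i j = (if i < r then h i else \<zero>)" for i j :: nat
  have D: "D i j .: R" for i j using h by (simp add: D_def)
  have e: "(\<Oplus>i\<in>{..<r}. f i \<otimes> h i) = mat_map R r 1 D f 0" if "f .: (fmod R r)" for f
    using h that by (auto simp: mat_map_def D_def free_module_carrier intro!: finsum_eqI)
  have "(%f. mat_map R r 1 D f 0) \<in> module_hom R (fmod R r) (left_regular R)" using mat_map_hom[OF D, of r 1]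
    by (auto simp: module_hom_def left_regular_def free_module_simps free_module_carrier Pi_iff)
  from module_hom_cong[OF this left_module_free[OF ring_axioms] e] show ?thesis .
qed

lemma hom_regular_column:
  assumes u: "u \<in> module_hom R (fmod R r) (left_regular R)" and f: "f .: (fmod R r)"
  shows "u f = (\<Oplus>i\<in>{..<r}. f i \<otimes> u (unit_vector R i))"
proof -
  have "{i. f i ~= \<zero>} \<subseteq> {..<r}" using f by (force simp: free_module_carrier)
  then have "u f = (\<Oplus>\<^sub>(left_regular R)i\<in>{..<r}. f i \<odot>\<^sub>(left_regular R) u (unit_vector R i))"
    by (intro free_module_hom_expansion[OF ring_axioms left_module_regular[OF ring_axioms] u f]) auto
  then show ?thesis by (simp add: left_regular_def finsum_def finprod_def)
qed

lemma mat_map_unit: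
  assumes D: "!!i j. D i j .: R" and i: "i < r" and j: "j < c" shows "mat_map R r c D (unit_vector R i) j = D i j"
proof -
  have "(\<Oplus>k\<in>{..<r}. unit_vector R i k \<otimes> D k j) = (\<Oplus>k\<in>{..<r}. if i = k then D k j else \<zero>)"
    using D by (intro finsum_eqI) (auto simp: unit_vector_def)
  also have "... = D i j" using i D by (intro finsum_singleton) auto
  finally show ?thesis using j by (simp add: mat_map_def)
qed

lemma unit_vector_inj: "\<one> ~= \<zero> ==> inj_on (unit_vector R) A"
  by (rule inj_onI) (auto simp: unit_vector_def fun_eq_iff split: if_splits)

text \<open>The free module in \<open>projective\<close> is indexed by elements of the module
  itself; the unit vectors serve as indices.\<close>

lemma projective_fmod:
  assumes 1: "\<one> ~= \<zero>" shows "projective R (fmod R r)"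
proof -
  let ?I = "unit_vector R ` {..<r}"
  note F = left_module_free[OF ring_axioms]
  have b: "(%i. unit_vector R (unit_vector R i)) \<in> {..<r} \<rightarrow> carrier (free_module R ?I)" by (auto intro!: unit_vector_closed ring_axioms)
  have b': "(%m. m) \<in> ?I \<rightarrow> carrier (fmod R r)" by (auto intro!: unit_vector_closed ring_axioms)
  let ?s = "free_lift R (free_module R ?I) (%i. unit_vector R (unit_vector R i))"
  let ?t = "free_lift R (fmod R r) (%m. m)"
  note s = free_lift_hom[OF ring_axioms F b] and t = free_lift_hom[OF ring_axioms F b']
  have "?t (?s x) = x" if "x .: (fmod R r)" for x by (rule free_module_hom_eqI[OF ring_axioms F module_hom_compose[OF s t] module_hom_id _ that])
      (simp add: free_lift_unit[OF ring_axioms F b] free_lift_unit[OF ring_axioms F b'])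
  with s t F show ?thesis unfolding projective_def by blast
qed

lemma finitely_generated_fmod:
  assumes 1: "\<one> ~= \<zero>" shows "finitely_generated R (fmod R r)"
proof -
  let ?S = "unit_vector R ` {..<r}"
  interpret F: left_module R "fmod R r" by (rule left_module_free[OF ring_axioms])
  have inj: "inj_on (unit_vector R) {..<r}" by (rule unit_vector_inj[OF 1])
  have S: "finite ?S" "?S \<subseteq> carrier (fmod R r)" by (auto intro!: unit_vector_closed ring_axioms)
  have "\<exists>c \<in> ?S \<rightarrow> carrier R. x = (\<Oplus>\<^sub>(fmod R r)s\<in>?S. c s \<odot>\<^sub>(fmod R r) s)" if x: "x .: (fmod R r)" for x
  proof -
    define c where "c s = x (the_inv_into {..<r} (unit_vector R) s)" for s
    have c: "c (unit_vector R i) = x i" if "i < r" for i using inj that by (simp add: c_def the_inv_into_f_f)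
    have cS: "c \<in> ?S \<rightarrow> carrier R" using c x by (auto simp: free_module_carrier)
    have "{i. x i ~= \<zero>} \<subseteq> {..<r}" using x by (force simp: free_module_carrier)
    then have "x = (\<Oplus>\<^sub>(fmod R r)i\<in>{..<r}. x i \<odot>\<^sub>(fmod R r) unit_vector R i)"
      by (intro free_module_hom_expansion[OF ring_axioms F.left_module_axioms module_hom_id x]) auto
    also have "... = (\<Oplus>\<^sub>(fmod R r)i\<in>{..<r}. c (unit_vector R i) \<odot>\<^sub>(fmod R r) unit_vector R i)"
      using S x c by (intro F.finsum_eqI) (auto simp: free_module_carrier[of x] intro!: F.lsmult_closed)
    also have "... = (\<Oplus>\<^sub>(fmod R r)s\<in>?S. c s \<odot>\<^sub>(fmod R r) s)"
      using S cS inj by (intro F.finsum_reindex[symmetric]) (auto intro!: F.lsmult_closed)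
    finally show ?thesis using cS by blast
  qed
  then show ?thesis using S unfolding finitely_generated_def by blast
qed

end

text \<open>Reduction to matrices. \<open>left\<close> is exactness on rows. \<open>right\<close> is
  exactness on columns and amounts to acyclicity of Hom, because a homomorphism from a free module
  of finite rank to \<open>R\<close> is the pairing with the column of its values on unit vectors.
  \<open>aug\<close> and \<open>surj\<close> present \<open>M\<close> as a cyclic module with
  generator \<open>m0\<close> whose annihilator is generated by the entries \<open>D 1 i 0\<close>,
  in accordance with rank 1 in degree 0.\<close>

theorem matrix_complete_resolution:
  fixes R :: "('r, 'e) ring_scheme" and M :: "('r, 'b) module"
  assumes R: "ring R" and 1: "\<one>\<^sub>R ~= \<zero>\<^sub>R" and M: "left_module R M" and m0: "m0 .: M" and r0: "rk 0 = 1" and D: "!!n i j. D n i j .: R"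
    and dd: "!!n i k. [|i < rk (n + 1); k < rk (n - 1)|]
      ==> (\<Oplus>\<^sub>R j\<in>{..<rk n}. D (n + 1) i j \<otimes>\<^sub>R D n j k) = \<zero>\<^sub>R"
    and left: "!!n f. [|!!i. f i .: R; !!j. j < rk (n - 1) ==> (\<Oplus>\<^sub>R i\<in>{..<rk n}. f i \<otimes>\<^sub>R D n i j) = \<zero>\<^sub>R|]
      ==> \<exists>g. (\<forall>i. g i .: R) & (\<forall>j<rk n. f j = (\<Oplus>\<^sub>R i\<in>{..<rk (n + 1)}. g i \<otimes>\<^sub>R D (n + 1) i j))"
    and right: "!!n g. [|!!i. g i .: R; !!i. i < rk (n + 1) ==> (\<Oplus>\<^sub>R j\<in>{..<rk n}. D (n + 1) i j \<otimes>\<^sub>R g j) = \<zero>\<^sub>R|]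
      ==> \<exists>h. (\<forall>i. h i .: R) & (\<forall>i<rk n. g i = (\<Oplus>\<^sub>R j\<in>{..<rk (n - 1)}. D n i j \<otimes>\<^sub>R h j))"
    and aug: "!!z. z .: R ==> z \<odot>\<^sub>M m0 = \<zero>\<^sub>M \<longleftrightarrow>
        (\<exists>g. (\<forall>i. g i .: R) & z = (\<Oplus>\<^sub>R i\<in>{..<rk 1}. g i \<otimes>\<^sub>R D 1 i 0))"
    and surj: "!!m. m .: M ==> \<exists>z\<in>carrier R. z \<odot>\<^sub>M m0 = m"
  shows "complete_resolution R M (%n. fmod R (rk n)) (%n. mat_map R (rk n) (rk (n - 1)) (D n))"
proof -
  interpret R: ring R by (rule R)
  interpret M: left_module R M by (rule M)
  let ?S = "%n. fmod R (rk n)" and ?d = "%n. mat_map R (rk n) (rk (n - 1)) (D n)"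
  note F = left_module_free[OF R]
  have d: "?d n \<in> module_hom R (?S n) (?S (n - 1))" for n by (rule R.mat_map_hom[OF D])
  have fc: "f .: (fmod R m) ==> f i .: R" for f i m by (auto simp: free_module_carrier)
  have trunc: "(%i. if i < m then g i else \<zero>\<^sub>R) .: (fmod R m)" if "!!i. g i .: R" for g m using that by (simp add: fmod_carrier[OF R])
  have trunc_sum: "(\<Oplus>\<^sub>R i\<in>{..<m}. (if i < m then g i else \<zero>\<^sub>R) \<otimes>\<^sub>R c i) = (\<Oplus>\<^sub>R i\<in>{..<m}. g i \<otimes>\<^sub>R c i)"
    if "!!i. g i .: R" "!!i. c i .: R" for g c and m :: nat using that by (intro R.finsum_eqI) auto
  have ddS: "?d (n - 1) (?d n x) = \<zero>\<^sub>(?S (n - 2))" if x: "x .: (?S n)" for n x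
  proof
    fix k
    show "?d (n - 1) (?d n x) k = \<zero>\<^sub>(?S (n - 2)) k"
    proof (cases "k < rk (n - 1 - 1)")
      case True
      have "?d (n - 1) (?d n x) k = (\<Oplus>\<^sub>R j\<in>{..<rk (n - 1)}. (\<Oplus>\<^sub>R i\<in>{..<rk n}. x i \<otimes>\<^sub>R D n i j) \<otimes>\<^sub>R D (n - 1) j k)"
        using True fc[OF x] D by (auto simp: mat_map_def intro!: R.finsum_eqI R.finsum_closed)
      also have "... = (\<Oplus>\<^sub>R i\<in>{..<rk n}. x i \<otimes>\<^sub>R (\<Oplus>\<^sub>R j\<in>{..<rk (n - 1)}. D n i j \<otimes>\<^sub>R D (n - 1) j k))"
        using fc[OF x] D by (intro R.finsum_swap_mult)
      also have "... = (\<Oplus>\<^sub>R i\<in>{..<rk n}. \<zero>\<^sub>R)" using dd[of _ "n - 1" k] True fc[OF x] by (intro R.finsum_eqI) simp_all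
      finally show ?thesis by (simp add: free_module_simps)
    qed (simp add: mat_map_def free_module_simps)
  qed
  have cc: "chain_complex R ?S ?d" unfolding chain_complex_def using F d ddS by blast
  have exact: "exact_at ?S ?d n" for n unfolding exact_at_def
  proof
    show "cycles ?S ?d n \<subseteq> boundaries ?S ?d n"
    proof
      fix f assume "f \<in> cycles ?S ?d n"
      then have f: "f .: (?S n)" and z: "?d n f = \<zero>\<^sub>(?S (n - 1))" by (auto simp: cycles_def)
      have "(\<Oplus>\<^sub>R i\<in>{..<rk n}. f i \<otimes>\<^sub>R D n i j) = \<zero>\<^sub>R" if "j < rk (n - 1)" for j
        using fun_cong[OF z, of j] that by (simp add: mat_map_def free_module_simps)
      from left[OF fc[OF f] this] obtain g where g: "!!i. g i .: R"
        and fg: "!!j. j < rk n ==> f j = (\<Oplus>\<^sub>R i\<in>{..<rk (n + 1)}. g i \<otimes>\<^sub>R D (n + 1) i j)" by blast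
      have "f = ?d (n + 1) (%i. if i < rk (n + 1) then g i else \<zero>\<^sub>R)"
      proof
        fix j
        show "f j = ?d (n + 1) (%i. if i < rk (n + 1) then g i else \<zero>\<^sub>R) j"
          using f fg[of j] trunc_sum[OF g D] by (auto simp: mat_map_def fmod_carrier[OF R])
      qed
      then show "f \<in> boundaries ?S ?d n" unfolding boundaries_def by (rule image_eqI[OF _ trunc[OF g]])
    qed
    show "boundaries ?S ?d n \<subseteq> cycles ?S ?d n"
    proof
      fix f assume "f \<in> boundaries ?S ?d n"
      then obtain g where g: "g .: (?S (n + 1))" "f = ?d (n + 1) g" by (auto simp: boundaries_def)
      show "f \<in> cycles ?S ?d n" using module_hom_mem[OF d[of "n + 1"] g(1)] ddS[OF g(1)] by (simp add: cycles_def g(2))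
    qed
  qed
  have hex: "exact_at (hom_complex R ?S (left_regular R)) (hom_differential ?S ?d :: int => ((nat => 'r) => 'r) => _) n" for n unfolding exact_at_def
  proof
    show "cycles (hom_complex R ?S (left_regular R)) (hom_differential ?S ?d) n
        \<subseteq> boundaries (hom_complex R ?S (left_regular R)) (hom_differential ?S ?d) n"
    proof
      fix u assume "u \<in> cycles (hom_complex R ?S (left_regular R)) (hom_differential ?S ?d) n"
      then have u: "u \<in> module_hom R (?S (- n)) (left_regular R)" "u \<in> extensional (carrier (?S (- n)))"
        and ud: "restrict (u \<circ> ?d (1 - n)) (carrier (?S (1 - n))) = (\<lambda>x\<in>carrier (?S (1 - n)). \<zero>\<^sub>R)"
        by (auto simp: cycles_def hom_complex_def hom_group_def hom_differential_def left_regular_def)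
      define g where "g i = (if i < rk (- n) then u (unit_vector R i) else \<zero>\<^sub>R)" for i
      have g: "g i .: R" for i using module_hom_mem[OF u(1) unit_vector_closed[OF R, of i "{..<rk (- n)}"]] by (auto simp: g_def left_regular_def)
      have ug: "u f = (\<Oplus>\<^sub>R i\<in>{..<rk (- n)}. f i \<otimes>\<^sub>R g i)" if f: "f .: (?S (- n))" for f
      proof -
        have "u f = (\<Oplus>\<^sub>R i\<in>{..<rk (- n)}. f i \<otimes>\<^sub>R u (unit_vector R i))" by (rule R.hom_regular_column[OF u(1) f])
        also have "... = (\<Oplus>\<^sub>R i\<in>{..<rk (- n)}. f i \<otimes>\<^sub>R g i)"
        proof (rule R.finsum_eqI)
          show "i \<in> {..<rk (- n)} ==> f i \<otimes>\<^sub>R u (unit_vector R i) = f i \<otimes>\<^sub>R g i" for i by (simp add: g_def)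
          show "f i \<otimes>\<^sub>R g i .: R" for i by (intro R.m_closed fc[OF f] g)
        qed
        finally show ?thesis .
      qed
      have "(\<Oplus>\<^sub>R j\<in>{..<rk (- n)}. D (- n + 1) i j \<otimes>\<^sub>R g j) = \<zero>\<^sub>R" if i: "i < rk (- n + 1)" for i
      proof -
        have ui: "unit_vector R i .: (?S (1 - n))" using i by (intro unit_vector_closed[OF R]) (simp add: add.commute)
        have "\<zero>\<^sub>R = u (?d (1 - n) (unit_vector R i))" using fun_cong[OF ud, of "unit_vector R i"] ui by simp
        also have "... = (\<Oplus>\<^sub>R j\<in>{..<rk (- n)}. ?d (1 - n) (unit_vector R i) j \<otimes>\<^sub>R g j)"
          using module_hom_mem[OF d ui] by (intro ug) simp
        also have "... = (\<Oplus>\<^sub>R j\<in>{..<rk (- n)}. D (- n + 1) i j \<otimes>\<^sub>R g j)"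
          using i g D R.mat_map_unit[OF D] by (intro R.finsum_eqI) (simp_all add: add.commute)
        finally show ?thesis by simp
      qed
      from right[OF g this] obtain h where h: "!!i. h i .: R"
        and gh: "!!i. i < rk (- n) ==> g i = (\<Oplus>\<^sub>R j\<in>{..<rk (- n - 1)}. D (- n) i j \<otimes>\<^sub>R h j)" by blast
      define v where "v = restrict (%f. \<Oplus>\<^sub>R j\<in>{..<rk (- n - 1)}. f j \<otimes>\<^sub>R h j) (carrier (?S (- n - 1)))"
      have v: "v \<in> module_hom R (?S (- n - 1)) (left_regular R)" unfolding v_def by (rule module_hom_cong[OF R.column_hom[OF h] F]) simp
      have vd: "v (?d (- n) f) = u f" if f: "f .: (?S (- n))" for f
      proof -
        have "v (?d (- n) f) = (\<Oplus>\<^sub>R j\<in>{..<rk (- n - 1)}. (\<Oplus>\<^sub>R i\<in>{..<rk (- n)}. f i \<otimes>\<^sub>R D (- n) i j) \<otimes>\<^sub>R h j)"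
          using module_hom_mem[OF d f] fc[OF f] h D by (auto simp: v_def mat_map_def intro!: R.finsum_eqI R.finsum_closed)
        also have "... = (\<Oplus>\<^sub>R i\<in>{..<rk (- n)}. f i \<otimes>\<^sub>R (\<Oplus>\<^sub>R j\<in>{..<rk (- n - 1)}. D (- n) i j \<otimes>\<^sub>R h j))"
          using fc[OF f] h D by (intro R.finsum_swap_mult)
        also have "... = u f" unfolding ug[OF f]
        proof (rule R.finsum_eqI)
          show "f i \<otimes>\<^sub>R (\<Oplus>\<^sub>R j\<in>{..<rk (- n - 1)}. D (- n) i j \<otimes>\<^sub>R h j) = f i \<otimes>\<^sub>R g i"
            if "i \<in> {..<rk (- n)}" for i using gh[of i] that by simp
          show "f i \<otimes>\<^sub>R g i .: R" for i by (intro R.m_closed fc[OF f] g)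
        qed
        finally show ?thesis .
      qed
      have "u = restrict (v \<circ> ?d (1 - (n + 1))) (carrier (?S (1 - (n + 1))))" using vd u(2) by (auto simp: fun_eq_iff extensional_def restrict_def)
      moreover have "v .: (hom_complex R ?S (left_regular R) (n + 1))" using v by (simp add: hom_complex_def hom_group_def v_def)
      ultimately show "u \<in> boundaries (hom_complex R ?S (left_regular R)) (hom_differential ?S ?d) n"
        unfolding boundaries_def hom_differential_def by blast
    qed
    show "boundaries (hom_complex R ?S (left_regular R)) (hom_differential ?S ?d) n
        \<subseteq> cycles (hom_complex R ?S (left_regular R)) (hom_differential ?S ?d) n"
    proof
      fix u assume "u \<in> boundaries (hom_complex R ?S (left_regular R)) (hom_differential ?S ?d) n"
      then obtain v where v: "v \<in> module_hom R (?S (- (n + 1))) (left_regular R)"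
        and u: "u = restrict (v \<circ> ?d (1 - (n + 1))) (carrier (?S (1 - (n + 1))))"
        by (auto simp: boundaries_def hom_complex_def hom_group_def hom_differential_def)
      have v': "v \<in> module_hom R (?S (- n - 1)) (left_regular R)" using v by simp
      have uh: "u \<in> module_hom R (?S (- n)) (left_regular R)" unfolding u by (rule module_hom_cong[OF module_hom_compose[OF d[of "- n"] v'] F]) simp
      have "restrict (u \<circ> ?d (1 - n)) (carrier (?S (1 - n))) = (\<lambda>x\<in>carrier (?S (1 - n)). \<zero>\<^sub>R)"
      proof (rule restrict_ext)
        fix x assume x: "x .: (?S (1 - n))"
        have dx: "?d (1 - n) x .: (?S (- n))" using module_hom_mem[OF d x] by simp
        have "?d (- n) (?d (1 - n) x) = \<zero>\<^sub>(?S (- n - 1))" using ddS[OF x] by (simp add: free_module_simps)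
        then have "u (?d (1 - n) x) = v \<zero>\<^sub>(?S (- n - 1))" using dx by (simp add: u)
        also have "... = \<zero>\<^sub>R" using module_hom_zero[OF F left_module_regular[OF R] v'] by (simp add: left_regular_def)
        finally show "(u \<circ> ?d (1 - n)) x = \<zero>\<^sub>R" by simp
      qed
      then show "u \<in> cycles (hom_complex R ?S (left_regular R)) (hom_differential ?S ?d) n"
        using uh by (simp add: cycles_def hom_complex_def hom_group_def hom_differential_def left_regular_def u)
    qed
  qed
  \<comment> \<open>The projective resolution is the truncation of the complex, with the free module
    of rank 0 in negative degrees; the chain map onto it is the identity in degrees
    \<open>n \<ge> 0\<close>.\<close>
  define P where "P n = (if n >= 0 then ?S n else fmod R 0)" for n
  define \<delta> where "\<delta> n = (if n > 0 then ?d n else (%x i. \<zero>\<^sub>R))" for n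
  define eta where "eta f = f (0::nat) \<odot>\<^sub>M m0" for f
  define \<phi> :: "int => (nat => 'r) => nat => 'r" where "\<phi> n = (if n >= 0 then (%x. x) else (%x i. \<zero>\<^sub>R))" for n
  have P: "left_module R (P n)" "projective R (P n)" for n unfolding P_def by (cases "n >= 0"; simp only: if_True if_False F R.projective_fmod[OF 1])+
  have zero_hom: "(%x i. \<zero>\<^sub>R) \<in> module_hom R (N :: ('r, 'z) module) (fmod R m)" for N m
    using module_hom_const_zero[OF F] by (simp add: free_module_simps)
  have \<delta>: "\<delta> n \<in> module_hom R (P n) (P (n - 1))" for n
  proof (cases "n > 0")
    case False
    then have "P (n - 1) = fmod R 0" "\<delta> n = (%x i. \<zero>\<^sub>R)" by (simp_all add: P_def \<delta>_def del: lessThan_0)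
    then show ?thesis by (simp only: zero_hom)
  qed (simp add: P_def \<delta>_def d)
  have \<delta>0: "\<delta> n (%i. \<zero>\<^sub>R) = (%i. \<zero>\<^sub>R)" for n
    using module_hom_zero[OF P(1) P(1) \<delta>[of n]] by (simp add: P_def free_module_simps split: if_splits)
  have \<delta>\<delta>: "\<delta> (n - 1) (\<delta> n x) = \<zero>\<^sub>(P (n - 2))" if "x .: (P n)" for n x
    using that ddS[of x n] by (auto simp: \<delta>_def P_def free_module_simps)
  have eps: "eta \<in> module_hom R (P 0) M" by (rule module_homI)
      (auto simp: eta_def P_def free_module_carrier free_module_simps m0 M.lsmult_closed M.lsmult_l_distr M.lsmult_assoc)
  have eps_surj: "eta ` carrier (P 0) = carrier M"
  proof
    show "eta ` carrier (P 0) \<subseteq> carrier M" using module_hom_mem[OF eps] by auto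
    show "carrier M \<subseteq> eta ` carrier (P 0)"
    proof
      fix m assume "m .: M"
      from surj[OF this] obtain z where z: "z .: R" "z \<odot>\<^sub>M m0 = m" by blast
      show "m \<in> eta ` carrier (P 0)" by (rule image_eqI[of _ _ "%i. if i < 1 then z else \<zero>\<^sub>R"])
          (use z r0 in \<open>auto simp: eta_def P_def fmod_carrier[OF R]\<close>)
    qed
  qed
  have eps_ker: "{x \<in> carrier (P 0). eta x = \<zero>\<^sub>M} = boundaries P \<delta> 0"
  proof
    show "{x \<in> carrier (P 0). eta x = \<zero>\<^sub>M} \<subseteq> boundaries P \<delta> 0"
    proof safe
      fix x assume x: "x .: (P 0)" and "eta x = \<zero>\<^sub>M"
      have xc: "x .: (fmod R 1)" using x by (simp add: P_def r0)
      then obtain g where g: "!!i. g i .: R" and xg: "x 0 = (\<Oplus>\<^sub>R i\<in>{..<rk 1}. g i \<otimes>\<^sub>R D 1 i 0)"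
        using aug[OF fc[OF xc]] \<open>eta x = \<zero>\<^sub>M\<close> by (auto simp: eta_def)
      have "x = ?d 1 (%i. if i < rk 1 then g i else \<zero>\<^sub>R)"
      proof
        fix j
        show "x j = ?d 1 (%i. if i < rk 1 then g i else \<zero>\<^sub>R) j"
          using xc xg trunc_sum[OF g D] by (cases "j = 0") (auto simp: mat_map_def fmod_carrier[OF R] r0)
      qed
      then show "x \<in> boundaries P \<delta> 0" unfolding boundaries_def \<delta>_def P_def using trunc[OF g] by force
    qed
    show "boundaries P \<delta> 0 \<subseteq> {x \<in> carrier (P 0). eta x = \<zero>\<^sub>M}"
    proof
      fix x assume "x \<in> boundaries P \<delta> 0"
      then obtain g where g: "g .: (?S 1)" "x = ?d 1 g" by (auto simp: boundaries_def P_def \<delta>_def)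
      have x: "x .: (?S 0)" using module_hom_mem[OF d g(1)] g(2) by simp
      have "x 0 = (\<Oplus>\<^sub>R i\<in>{..<rk 1}. g i \<otimes>\<^sub>R D 1 i 0)" using g(2) r0 by (simp add: mat_map_def)
      then have "eta x = \<zero>\<^sub>M" unfolding eta_def by (intro iffD2[OF aug[OF fc[OF x]]] exI[of _ g] conjI allI fc[OF g(1)])
      then show "x \<in> {x \<in> carrier (P 0). eta x = \<zero>\<^sub>M}" using x by (simp add: P_def)
    qed
  qed
  have P0: "carrier (P n) = {\<zero>\<^sub>(P n)}" if "n < 0" for n using that by (auto simp: P_def fmod_carrier[OF R] free_module_simps simp del: lessThan_0)
  have Pex: "exact_at P \<delta> n" if "n > 0" for n using exact[of n] that by (simp add: exact_at_def cycles_def boundaries_def P_def \<delta>_def)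
  have pr: "projective_resolution R M P \<delta> eta" unfolding projective_resolution_def chain_complex_def
    using P \<delta> \<delta>\<delta> P0 Pex eps eps_surj eps_ker by blast
  have cm: "chain_map R ?S ?d P \<delta> \<phi>" unfolding chain_map_def
  proof (intro allI conjI ballI)
    fix n
    show "\<phi> n \<in> module_hom R (?S n) (P n)" by (cases "n >= 0") (simp_all add: \<phi>_def P_def module_hom_id zero_hom del: lessThan_0)
    fix x assume x: "x .: (?S n)"
    show "\<phi> (n - 1) (?d n x) = \<delta> n (\<phi> n x)" by (auto simp: \<phi>_def \<delta>_def)
  qed
  have bij: "bij_betw (\<phi> n) (carrier (?S n)) (carrier (P n))" if "n >= 0" for n using that by (simp add: \<phi>_def P_def bij_betw_def inj_on_def)
  show ?thesis unfolding complete_resolution_def acyclic_complex_def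
  proof (intro conjI allI)
    show "chain_complex R ?S ?d" by (rule cc)
    show "finitely_generated R (?S n)" "projective R (?S n)" for n by (rule R.finitely_generated_fmod[OF 1] R.projective_fmod[OF 1])+
    show "exact_at ?S ?d n" for n by (rule exact)
    show "exact_at (hom_complex R ?S (left_regular R))
        (hom_differential ?S ?d :: int => ((nat => 'r) => 'r) => _) n" for n by (rule hex)
    show "\<exists>(P :: int => ('r, nat => 'r) module) \<delta> eta f. projective_resolution R M P \<delta> eta \<and>
        chain_map R ?S ?d P \<delta> f & (\<forall>n\<ge>0. bij_betw (f n) (carrier (?S n)) (carrier (P n)))" using pr cm bij by blast
  qed
qed


section \<open>Complete resolutions over Frobenius algebras\<close>

text \<open>The nonnegative half: a free resolution with ranks \<open>r\<close>, matrices
  \<open>D n\<close> from degree \<open>n\<close> to degree \<open>n - 1\<close>, and a contraction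
  \<open>h\<close> that is linear over \<open>K\<close> only. \<open>contraction0\<close> involves
  the section \<open>m \<mapsto> 1 \<otimes> m\<close> of the augmentation.\<close>

locale frob_resolution = frobenius K A I e e' lam
  for K :: "('k, 'e) ring_scheme" and A :: "('k, 'a) module" (structure) and I :: "'i set" and e e' lam +
  fixes r :: "nat => nat" and D :: "nat => nat => nat => 'a env" and h :: "nat => (nat => 'a env) => nat => 'a env"
  assumes nontrivial: "\<one> ~= \<zero>" and r0: "r 0 = 1" and D: "D n i j .: Ae" and DD: "[|i < r (Suc (Suc n)); k < r n|]
      ==> (\<Oplus>\<^sub>Ae j\<in>{..<r (Suc n)}. D (Suc (Suc n)) i j \<star> D (Suc n) j k) = \<zero>\<^sub>Ae"
    and D1: "i < r 1 ==> lact (D 1 i 0) \<one> = \<zero>" and h: "f .: (fmod Ae (r n)) ==> h n f \<in> carrier (fmod Ae (r (Suc n)))"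
    and h_add: "[|f .: (fmod Ae (r n)); g .: (fmod Ae (r n))|]
      ==> h n (%i. f i \<boxplus> g i) = (%i. h n f i \<boxplus> h n g i)" and h_smult: "[|c .: K; f .: (fmod Ae (r n))|]
      ==> h n (%i. c \<bullet> f i) = (%i. c \<bullet> h n f i)" and contraction: "[|f \<in> carrier (fmod Ae (r (Suc n))); j < r (Suc n)|] ==>
        (\<Oplus>\<^sub>Ae i\<in>{..<r (Suc (Suc n))}. h (Suc n) f i \<star> D (Suc (Suc n)) i j) \<boxplus>
        h n (mat_map Ae (r (Suc n)) (r n) (D (Suc n)) f) j = f j" and contraction0: "f .: (fmod Ae 1) ==>
        (\<Oplus>\<^sub>Ae i\<in>{..<r 1}. h 0 f i \<star> D 1 i 0) \<boxplus> tt \<one> (lact (f 0) \<one>) = f 0"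
begin

lemmas fmodc = fmod_carrier[OF Ae.ring_A]

lemma trunc: "(!!i. g i .: Ae) ==> (%i. if i < m then g i else \<zero>\<^sub>Ae) .: (fmod Ae m)"
  by (simp add: fmodc)

lemma fmod_mem: "f .: (fmod Ae m) ==> f i .: Ae"
  by (auto simp: free_module_carrier)

lemma mat_closed: "mat_map Ae m n (D k) f .: (fmod Ae n)" if "f .: (fmod Ae m)"
  using module_hom_mem[OF Ae.A.mat_map_hom[OF D] that] .

lemma h_zero: "h n (%i. \<zero>\<^sub>Ae) = (%i. \<zero>\<^sub>Ae)"
proof
  fix i
  have 0: "(%i. \<zero>\<^sub>Ae) .: (fmod Ae (r n))" by (simp add: fmodc)
  have "h n (%i. \<zero>\<^sub>Ae) i \<boxplus> h n (%i. \<zero>\<^sub>Ae) i = h n (%i. \<zero>\<^sub>Ae) i" using fun_cong[OF h_add[OF 0 0], of i] by simp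
  then show "h n (%i. \<zero>\<^sub>Ae) i = \<zero>\<^sub>Ae" using fmod_mem[OF h[OF 0], of i] by (simp add: Ae.A.add.l_cancel_one)
qed

lemma exact_left:
  assumes f: "!!i. f i .: Ae" and z: "!!j. j < r n ==> (\<Oplus>\<^sub>Ae i\<in>{..<r (Suc n)}. f i \<star> D (Suc n) i j) = \<zero>\<^sub>Ae"
  shows "\<exists>g. (\<forall>i. g i .: Ae) \<and>
    (\<forall>j<r (Suc n). f j = (\<Oplus>\<^sub>Ae i\<in>{..<r (Suc (Suc n))}. g i \<star> D (Suc (Suc n)) i j))"
proof -
  let ?f = "%i. if i < r (Suc n) then f i else \<zero>\<^sub>Ae"
  have fc: "?f \<in> carrier (fmod Ae (r (Suc n)))" by (rule trunc[OF f])
  have "mat_map Ae (r (Suc n)) (r n) (D (Suc n)) ?f = (%i. \<zero>\<^sub>Ae)"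
  proof
    fix j
    have "(\<Oplus>\<^sub>Ae i\<in>{..<r (Suc n)}. ?f i \<star> D (Suc n) i j) = (\<Oplus>\<^sub>Ae i\<in>{..<r (Suc n)}. f i \<star> D (Suc n) i j)"
      using f D by (intro Ae.A.finsum_eqI) simp_all
    then show "mat_map Ae (r (Suc n)) (r n) (D (Suc n)) ?f j = \<zero>\<^sub>Ae" using z[of j] by (simp add: mat_map_def)
  qed
  then have "f j = (\<Oplus>\<^sub>Ae i\<in>{..<r (Suc (Suc n))}. h (Suc n) ?f i \<star> D (Suc (Suc n)) i j)" if "j < r (Suc n)" for j
    using contraction[OF fc that] that h_zero[of n] fmod_mem[OF h[OF fc]] D by (simp add: Ae.A.finsum_closed)
  then show ?thesis using fmod_mem[OF h[OF fc]] by blast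
qed

lemma exact_left0:
  assumes z: "z .: Ae"
  shows "lact z \<one> = \<zero> \<longleftrightarrow> (\<exists>g. (\<forall>i. g i .: Ae) & z = (\<Oplus>\<^sub>Ae i\<in>{..<r 1}. g i \<star> D 1 i 0))"
proof
  assume 0: "lact z \<one> = \<zero>"
  let ?f = "%i::nat. if i < 1 then z else \<zero>\<^sub>Ae"
  have fc: "?f .: (fmod Ae 1)" using trunc[of "%_. z" 1] z by simp
  have fc': "?f .: (fmod Ae (r 0))" using fc r0 by simp
  have "z = (\<Oplus>\<^sub>Ae i\<in>{..<r 1}. h 0 ?f i \<star> D 1 i 0)"
    using contraction0[OF fc] 0 fmod_mem[OF h[OF fc']] D by (simp add: tt_zero Ae.A.finsum_closed)
  then show "\<exists>g. (\<forall>i. g i .: Ae) & z = (\<Oplus>\<^sub>Ae i\<in>{..<r 1}. g i \<star> D 1 i 0)" using fmod_mem[OF h[OF fc']] by blast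
next
  assume "\<exists>g. (\<forall>i. g i .: Ae) & z = (\<Oplus>\<^sub>Ae i\<in>{..<r 1}. g i \<star> D 1 i 0)"
  then obtain g where g: "!!i. g i .: Ae" "z = (\<Oplus>\<^sub>Ae i\<in>{..<r 1}. g i \<star> D 1 i 0)" by blast
  have "lact z \<one> = (\<Oplus>i\<in>{..<r 1}. lact (g i \<star> D 1 i 0) \<one>)" unfolding g(2) using g(1) D
    by (intro additive_finsum[OF aE aA]) (auto simp: lact_closed lact_add)
  also have "... = (\<Oplus>i\<in>{..<r 1}. \<zero>)" using g(1) D D1 left_module.lsmult_r_null[OF left_module_A]
    by (intro A.finsum_eqI) (auto simp: lact_mult reg_simps)
  finally show "lact z \<one> = \<zero>" by simp
qed

text \<open>Pairing rows with the column \<open>g\<close> under \<open>Lam\<close> gives a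
  functional \<open>P\<close> that vanishes on boundaries, so the contraction yields
  \<open>P f = P (h (f D))\<close>. The composite of \<open>P\<close> and \<open>h\<close> is linear
  over \<open>K\<close>, hence itself the pairing with a column \<open>H\<close>. Nondegeneracy of
  \<open>Lam\<close> turns \<open>Lam (f g) = Lam (f D H)\<close> into
  \<open>g = D H\<close>.\<close>

lemma exact_right:
  assumes g: "!!i. g i .: Ae"
    and z: "!!i. i < r (Suc (Suc n)) ==> (\<Oplus>\<^sub>Ae j\<in>{..<r (Suc n)}. D (Suc (Suc n)) i j \<star> g j) = \<zero>\<^sub>Ae"
  shows "\<exists>H. (\<forall>j. H j .: Ae) & (\<forall>i<r (Suc n). g i = (\<Oplus>\<^sub>Ae j\<in>{..<r n}. D (Suc n) i j \<star> H j))"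
proof -
  interpret F: left_module Ae "fmod Ae (r n)" by (rule left_module_free[OF Ae.ring_A])
  define P where "P f = Lam (\<Oplus>\<^sub>Ae i\<in>{..<r (Suc n)}. f i \<star> g i)" for f
  have Pc: "P f .: K" if "f \<in> carrier (fmod Ae (r (Suc n)))" for f unfolding P_def using fmod_mem[OF that] g by (intro Lam_closed Ae.A.finsum_closed) auto
  have Padd: "P (%i. f i \<boxplus> f' i) = P f \<oplus>\<^sub>K P f'"
    if f: "f \<in> carrier (fmod Ae (r (Suc n)))" "f' \<in> carrier (fmod Ae (r (Suc n)))" for f f'
  proof -
    have "(\<Oplus>\<^sub>Ae i\<in>{..<r (Suc n)}. (f i \<boxplus> f' i) \<star> g i) = (\<Oplus>\<^sub>Ae i\<in>{..<r (Suc n)}. f i \<star> g i \<boxplus> f' i \<star> g i)"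
      using fmod_mem[OF f(1)] fmod_mem[OF f(2)] g by (intro Ae.A.finsum_eqI) (simp_all add: Ae.A.l_distr)
    also have "... = (\<Oplus>\<^sub>Ae i\<in>{..<r (Suc n)}. f i \<star> g i) \<boxplus> (\<Oplus>\<^sub>Ae i\<in>{..<r (Suc n)}. f' i \<star> g i)"
      using fmod_mem[OF f(1)] fmod_mem[OF f(2)] g by (intro Ae.A.finsum_addf) auto
    finally show ?thesis using fmod_mem[OF f(1)] fmod_mem[OF f(2)] g by (simp add: P_def Lam_add Ae.A.finsum_closed)
  qed
  have Psm: "P (%i. c \<bullet> f i) = c \<otimes>\<^sub>K P f" if f: "f \<in> carrier (fmod Ae (r (Suc n)))" and c: "c .: K" for f c
  proof -
    have "(\<Oplus>\<^sub>Ae i\<in>{..<r (Suc n)}. (c \<bullet> f i) \<star> g i) = (\<Oplus>\<^sub>Ae i\<in>{..<r (Suc n)}. c \<bullet> (f i \<star> g i))"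
      using fmod_mem[OF f] g c by (intro Ae.A.finsum_eqI) (simp_all add: Ae.smult_mult_left)
    also have "... = c \<bullet> (\<Oplus>\<^sub>Ae i\<in>{..<r (Suc n)}. f i \<star> g i)" using fmod_mem[OF f] g c
      by (intro additive_finsum[OF aE aE, symmetric]) (auto simp: Ae.V.smult_r_distr)
    finally show ?thesis using fmod_mem[OF f] g c by (simp add: P_def Lam_smult Ae.A.finsum_closed)
  qed
  \<comment> \<open>Rows with a single entry, through which functionals on rows are represented one
    coordinate at a time.\<close>
  define sgl where "sgl j X = (%i. if i = j then X else \<zero>\<^sub>Ae)" for j :: nat and X
  have sgl: "sgl j X .: (fmod Ae m)" if "j < m" "X .: Ae" for j X m using that by (auto simp: sgl_def fmodc)
  have sgl_add: "sgl j (X \<boxplus> Y) = (%i. sgl j X i \<boxplus> sgl j Y i)" if "X .: Ae" "Y .: Ae" for j X Y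
    using that by (auto simp: sgl_def fun_eq_iff simp del: set_eq_iff)
  have sgl_sm: "sgl j (c \<bullet> X) = (%i. c \<bullet> sgl j X i)" if "X .: Ae" "c .: K" for j X c using that by (simp add: sgl_def fun_eq_iff)
  have sgl_sum: "(\<Oplus>\<^sub>Ae i\<in>{..<m}. sgl j X i \<star> v i) = X \<star> v j"
    if "j < m" "X .: Ae" "!!i. i < m ==> v i .: Ae" for j X v and m :: nat
  proof -
    have "(\<Oplus>\<^sub>Ae i\<in>{..<m}. sgl j X i \<star> v i) = (\<Oplus>\<^sub>Ae i\<in>{..<m}. if j = i then X \<star> v i else \<zero>\<^sub>Ae)"
      using that by (intro Ae.A.finsum_eqI) (simp_all add: sgl_def)
    also have "... = X \<star> v j" using that by (intro Ae.A.finsum_singleton) auto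
    finally show ?thesis .
  qed
  have "\<exists>Z\<in>carrier Ae. \<forall>X\<in>carrier Ae. P (h n (sgl j X)) = Lam (X \<star> Z)" if j: "j < r n" for j
    by (rule Lam_represents) (use j in \<open>simp_all add: Pc h sgl sgl_add sgl_sm h_add h_smult Padd Psm\<close>)
  then have "\<forall>j. \<exists>Z. Z .: Ae & (j < r n --> (\<forall>X\<in>carrier Ae. P (h n (sgl j X)) = Lam (X \<star> Z)))"
    using Ae.A.zero_closed by blast
  from choice[OF this] obtain H where H: "!!j. H j .: Ae" and PH: "!!j X. [|j < r n; X .: Ae|] ==> P (h n (sgl j X)) = Lam (X \<star> H j)" by blast
  have Ph: "P (h n f) = Lam (\<Oplus>\<^sub>Ae j\<in>{..<r n}. f j \<star> H j)" if f: "f .: (fmod Ae (r n))" for f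
  proof -
    have "{i. f i ~= \<zero>\<^sub>Ae} \<subseteq> {..<r n}" using f by (force simp: free_module_carrier)
    then have "f = (\<Oplus>\<^sub>(fmod Ae (r n))i\<in>{..<r n}. f i \<odot>\<^sub>(fmod Ae (r n)) unit_vector Ae i)"
      by (intro free_module_hom_expansion[OF Ae.ring_A F.left_module_axioms module_hom_id f]) auto
    also have "... = (\<Oplus>\<^sub>(fmod Ae (r n))i\<in>{..<r n}. sgl i (f i))" using fmod_mem[OF f] sgl
      by (intro F.finsum_eqI) (auto simp: free_module_simps unit_vector_def sgl_def fun_eq_iff simp del: set_eq_iff)
    finally have "P (h n f) = P (h n (\<Oplus>\<^sub>(fmod Ae (r n))i\<in>{..<r n}. sgl i (f i)))" by simp
    also have "... = (\<Oplus>\<^sub>K i\<in>{..<r n}. P (h n (sgl i (f i))))" using fmod_mem[OF f] sgl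
      by (intro additive_finsum[OF F.abelian_group_M V.R.is_abelian_group])
        (simp_all add: Pc h free_module_simps h_add Padd)
    also have "... = (\<Oplus>\<^sub>K i\<in>{..<r n}. Lam (f i \<star> H i))" using fmod_mem[OF f] H by (intro V.R.finsum_eqI) (simp_all add: PH Lam_closed)
    also have "... = Lam (\<Oplus>\<^sub>Ae j\<in>{..<r n}. f j \<star> H j)" using fmod_mem[OF f] H
      by (intro additive_finsum[OF aE V.R.is_abelian_group Lam_closed Lam_add, symmetric]) simp_all
    finally show ?thesis .
  qed
  have "g i = (\<Oplus>\<^sub>Ae j\<in>{..<r n}. D (Suc n) i j \<star> H j)" if i: "i < r (Suc n)" for i
  proof (rule Lam_nondeg[OF g])
    let ?DH = "%i. \<Oplus>\<^sub>Ae j\<in>{..<r n}. D (Suc n) i j \<star> H j"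
    have DHc: "?DH i .: Ae" for i using D H by (intro Ae.A.finsum_closed) auto
    show "?DH i .: Ae" by (rule DHc)
    fix X assume X: "X .: Ae"
    let ?f = "sgl i X"
    have f: "?f \<in> carrier (fmod Ae (r (Suc n)))" by (rule sgl[OF i X])
    let ?u = "mat_map Ae (r (Suc n)) (r n) (D (Suc n)) ?f"
    have u: "?u .: (fmod Ae (r n))" by (rule mat_closed[OF f])
    let ?w = "%j. \<Oplus>\<^sub>Ae i\<in>{..<r (Suc (Suc n))}. h (Suc n) ?f i \<star> D (Suc (Suc n)) i j"
    have wc: "?w j .: Ae" for j using fmod_mem[OF h[OF f]] D by (intro Ae.A.finsum_closed) auto
    have "(\<Oplus>\<^sub>Ae j\<in>{..<r (Suc n)}. ?f j \<star> g j)
        = (\<Oplus>\<^sub>Ae j\<in>{..<r (Suc n)}. ?w j \<star> g j \<boxplus> h n ?u j \<star> g j)"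
    proof (rule Ae.A.finsum_eqI)
      fix j assume "j \<in> {..<r (Suc n)}"
      then have "?f j = ?w j \<boxplus> h n ?u j" using contraction[OF f] by simp
      then show "?f j \<star> g j = ?w j \<star> g j \<boxplus> h n ?u j \<star> g j" using Ae.A.l_distr[OF wc fmod_mem[OF h[OF u]] g] by (simp only:)
    qed (use wc g fmod_mem[OF h[OF u]] in auto)
    also have "... = (\<Oplus>\<^sub>Ae j\<in>{..<r (Suc n)}. ?w j \<star> g j) \<boxplus> (\<Oplus>\<^sub>Ae j\<in>{..<r (Suc n)}. h n ?u j \<star> g j)"
      using wc g fmod_mem[OF h[OF u]] by (intro Ae.A.finsum_addf) auto
    also have "(\<Oplus>\<^sub>Ae j\<in>{..<r (Suc n)}. ?w j \<star> g j)
        = (\<Oplus>\<^sub>Ae i\<in>{..<r (Suc (Suc n))}. h (Suc n) ?f i \<star> (\<Oplus>\<^sub>Ae j\<in>{..<r (Suc n)}. D (Suc (Suc n)) i j \<star> g j))"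
      using fmod_mem[OF h[OF f]] D g by (intro Ae.A.finsum_swap_mult)
    also have "... = (\<Oplus>\<^sub>Ae i\<in>{..<r (Suc (Suc n))}. \<zero>\<^sub>Ae)" using z fmod_mem[OF h[OF f]] by (intro Ae.A.finsum_eqI) simp_all
    finally have fg: "(\<Oplus>\<^sub>Ae j\<in>{..<r (Suc n)}. ?f j \<star> g j) = (\<Oplus>\<^sub>Ae j\<in>{..<r (Suc n)}. h n ?u j \<star> g j)"
      using g fmod_mem[OF h[OF u]] by (simp add: Ae.A.finsum_closed)
    have "Lam (X \<star> g i) = Lam (\<Oplus>\<^sub>Ae j\<in>{..<r (Suc n)}. ?f j \<star> g j)" using sgl_sum[OF i X g] by simp
    also have "... = P (h n ?u)" by (simp add: fg P_def)
    also have "... = Lam (\<Oplus>\<^sub>Ae j\<in>{..<r n}. ?u j \<star> H j)" by (rule Ph[OF u])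
    also have "(\<Oplus>\<^sub>Ae j\<in>{..<r n}. ?u j \<star> H j)
        = (\<Oplus>\<^sub>Ae j\<in>{..<r n}. (\<Oplus>\<^sub>Ae i\<in>{..<r (Suc n)}. ?f i \<star> D (Suc n) i j) \<star> H j)"
      using fmod_mem[OF f] D H by (intro Ae.A.finsum_eqI) (simp_all add: mat_map_def Ae.A.finsum_closed)
    also have "... = (\<Oplus>\<^sub>Ae i\<in>{..<r (Suc n)}. ?f i \<star> ?DH i)" using fmod_mem[OF f] D H by (intro Ae.A.finsum_swap_mult)
    also have "... = X \<star> ?DH i" by (rule sgl_sum[OF i X DHc])
    finally show "Lam (X \<star> g i) = Lam (X \<star> ?DH i)" .
  qed
  then show ?thesis using H by blast
qed

text \<open>The entries of \<open>D 1\<close> generate the kernel of the multiplication map, which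
  contains all \<open>l \<otimes> 1 - 1 \<otimes> l\<close>. What they kill is therefore a Casimir
  element, hence a multiple of \<open>Delta\<close>.\<close>

lemma exact_right0:
  assumes g: "g .: Ae" and z: "!!i. i < r 1 ==> D 1 i 0 \<star> g = \<zero>\<^sub>Ae" shows "\<exists>w\<in>carrier Ae. g = Delta \<star> w"
proof -
  have "tt l \<one> \<star> g = tt \<one> l \<star> g" if l: "l .: A" for l
  proof -
    have t: "tt l \<one> .: Ae" "tt \<one> l .: Ae" using l by (auto intro!: tt_closed)
    have "lact (tt l \<one> \<boxminus> tt \<one> l) \<one> = lact (tt l \<one>) \<one> \<ominus> lact (tt \<one> l) \<one>"
      using t by (intro additive_diff[OF aE aA]) (auto simp: lact_closed lact_add)
    also have "... = \<zero>" using l by (simp add: lact_tt a_minus_def A.r_neg)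
    finally obtain u where u: "!!i. u i .: Ae" and lu: "tt l \<one> \<boxminus> tt \<one> l = (\<Oplus>\<^sub>Ae i\<in>{..<r 1}. u i \<star> D 1 i 0)"
      using exact_left0 t by (meson Ae.A.minus_closed)
    have "(tt l \<one> \<boxminus> tt \<one> l) \<star> g = (\<Oplus>\<^sub>Ae i\<in>{..<r 1}. (u i \<star> D 1 i 0) \<star> g)"
      unfolding lu using u D g by (intro Ae.A.finsum_ldistr) auto
    also have "... = (\<Oplus>\<^sub>Ae i\<in>{..<r 1}. \<zero>\<^sub>Ae)" using u D g z by (intro Ae.A.finsum_eqI) (simp_all add: Ae.A.m_assoc)
    finally have "tt l \<one> \<star> g \<boxminus> tt \<one> l \<star> g = \<zero>\<^sub>Ae" using t g by (simp add: a_minus_def Ae.A.l_distr Ae.A.l_minus)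
    then show ?thesis using t g by simp
  qed
  from casimir_multiple[OF g this] show ?thesis using contract_closed[OF g] by (intro bexI[of _ "tt (contract g) \<one>"]) (auto intro: tt_closed)
qed

section \<open>Gluing the two halves\<close>

definition rk :: "int => nat" where "rk n = r (nat (if n >= 0 then n else - 1 - n))"

text \<open>Degree \<open>- 1 - k\<close> has the rank of degree \<open>k\<close>, so the
  differential leaving degree \<open>- k\<close>, for \<open>k > 0\<close>, is the twisted transpose
  of \<open>D k\<close>, and the one leaving degree 0 is the 1 by 1 matrix
  \<open>Delta\<close>.\<close>

definition Dm :: "int => nat => nat => 'a env" where "Dm n i j = (if n > 0 then D (nat n) i j else if n = 0 then Delta else theta (D (nat (- n)) j i))"

lemma rk_pos: "rk (int k) = r k" and rk_neg: "rk (- 1 - int k) = r k"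
  by (simp_all add: rk_def)

lemma Dm_pos: "Dm (int (Suc k)) i j = D (Suc k) i j" and Dm_zero: "Dm 0 i j = Delta"
  and Dm_neg: "Dm (- int (Suc k)) i j = theta (D (Suc k) j i)" by (simp_all add: Dm_def nat_add_distrib del: of_nat_Suc)

lemma Dm_closed: "Dm n i j .: Ae"
  by (simp add: Dm_def D Delta_closed theta_closed)

text \<open>Exactness in degree \<open>n\<close> involves \<open>Dm (n + 1)\<close> and
  \<open>Dm n\<close>. Both belong to the same half except for \<open>n = 0\<close> and
  \<open>n = - 1\<close>, where one of them is \<open>Delta\<close>.\<close>

lemma int_degree_cases:
  obtains (pos) k where "n = int (Suc k)" | (zero) "n = 0" | (minus_one) "n = - 1" | (neg) k where "n = - 1 - int (Suc k)"
proof -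
  consider "n > 0" | "n = 0" | "n = - 1" | "n < - 1" by linarith
  then show ?thesis
  proof cases
    case 1
    then have "n = int (Suc (nat (n - 1)))" by simp
    then show ?thesis using pos by blast
  next
    case 4
    then have "n = - 1 - int (Suc (nat (- n - 2)))" by simp
    then show ?thesis using neg by blast
  qed (use zero minus_one in auto)
qed

lemma theta_sum:
  assumes "!!i. i < m ==> u i .: Ae" "!!i. i < m ==> v i .: Ae"
  shows "theta (\<Oplus>\<^sub>Ae i\<in>{..<m::nat}. u i \<star> v i) = (\<Oplus>\<^sub>Ae i\<in>{..<m}. theta (v i) \<star> theta (u i))"
proof -
  have "theta (\<Oplus>\<^sub>Ae i\<in>{..<m}. u i \<star> v i) = (\<Oplus>\<^sub>Ae i\<in>{..<m}. theta (u i \<star> v i))"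
    using assms by (intro theta_finsum) auto
  also have "... = (\<Oplus>\<^sub>Ae i\<in>{..<m}. theta (v i) \<star> theta (u i))"
    using assms by (intro Ae.A.finsum_eqI) (simp_all add: theta_mult theta_closed)
  finally show ?thesis .
qed

lemma D1_Delta: "i < r 1 ==> D 1 i 0 \<star> Delta = \<zero>\<^sub>Ae"
  using Delta_act[OF D] D1 Delta_closed by (simp add: tt_zero)

lemma sum_lessThan_one: "u 0 .: Ae ==> (\<Oplus>\<^sub>Ae i\<in>{..<1::nat}. u i) = u 0"
  by (simp add: lessThan_Suc)

text \<open>In negative degrees \<open>theta\<close> exchanges statements on rows and on columns:
  \<open>exact_right\<close> gives exactness there and \<open>exact_left\<close> gives acyclicity of
  Hom. Next to the gluing map their place is taken by \<open>exact_right0\<close> on one side and by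
  \<open>Delta_annihilator\<close> with \<open>exact_left0\<close> on the other.\<close>

theorem frob_complete_resolution:
  "complete_resolution Ae (env_left AA) (%n. fmod Ae (rk n)) (%n. mat_map Ae (rk n) (rk (n - 1)) (Dm n))"
proof (rule matrix_complete_resolution[OF Ae.ring_A _ left_module_A, where ?m0.0 = "\<one>"])
  show "\<one>\<^sub>Ae ~= \<zero>\<^sub>Ae"
  proof
    assume "\<one>\<^sub>Ae = \<zero>\<^sub>Ae"
    then have "lact \<one>\<^sub>Ae \<one> = lact \<zero>\<^sub>Ae \<one>" by simp
    then show False using nontrivial left_module.lsmult_l_null[OF left_module_A, of "\<one>"]
        left_module.lsmult_one[OF left_module_A, of "\<one>"] by (simp add: reg_simps)
  qed
  show "\<one> .: (env_left AA)" by (simp add: reg_simps)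
  show "rk 0 = 1" using rk_pos[of 0] r0 by simp
  show "Dm n i j .: Ae" for n i j by (rule Dm_closed)
  have rk1: "rk 1 = r 1" "rk (- 1) = 1" "rk (- 2) = r 1" "rk 0 = 1" using rk_pos[of 1] rk_neg[of 0] rk_neg[of 1] rk_pos[of 0] r0 by simp_all
  have Dm1: "Dm 1 i j = D 1 i j" "Dm (- 1) i j = theta (D 1 j i)" for i j using Dm_pos[of 0] Dm_neg[of 0] by simp_all
  have rks: "rk (int (Suc k) + 1) = r (Suc (Suc k))" "rk (int (Suc k)) = r (Suc k)" "rk (int (Suc k) - 1) = r k"
    "rk (- 1 - int (Suc k) + 1) = r k" "rk (- 1 - int (Suc k)) = r (Suc k)" "rk (- 1 - int (Suc k) - 1) = r (Suc (Suc k))" for k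
    using rk_pos[of "Suc (Suc k)"] rk_pos[of "Suc k"] rk_pos[of k] rk_neg[of k] rk_neg[of "Suc k"] rk_neg[of "Suc (Suc k)"] by (simp_all add: algebra_simps)
  have Dms: "Dm (int (Suc k) + 1) i j = D (Suc (Suc k)) i j" "Dm (int (Suc k)) i j = D (Suc k) i j"
    "Dm (- 1 - int (Suc k) + 1) i j = theta (D (Suc k) j i)" "Dm (- 1 - int (Suc k)) i j = theta (D (Suc (Suc k)) j i)" for k i j
    using Dm_pos[of "Suc k"] Dm_pos[of k] Dm_neg[of k] Dm_neg[of "Suc k"] by (simp_all add: algebra_simps)
  show "(\<Oplus>\<^sub>Ae j\<in>{..<rk n}. Dm (n + 1) i j \<star> Dm n j k) = \<zero>\<^sub>Ae" if ik: "i < rk (n + 1)" "k < rk (n - 1)" for n i k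
  proof (cases n rule: int_degree_cases)
    case (pos m)
    then show ?thesis using ik DD[of i m k] by (simp only: rks Dms)
  next
    case zero
    then show ?thesis using ik D1_Delta[of i] by (simp add: rk1 Dm1 Dm_zero sum_lessThan_one[unfolded One_nat_def])
  next
    case minus_one
    have "Delta \<star> theta (D 1 k 0) = theta (D 1 k 0 \<star> Delta)" using D Delta_closed by (simp add: theta_mult theta_Delta)
    also have "... = \<zero>\<^sub>Ae" using ik D1_Delta[of k] by (simp add: minus_one rk1 theta_zero)
    finally show ?thesis using minus_one ik by (simp add: rk1 Dm1 Dm_zero sum_lessThan_one[unfolded One_nat_def])
  next
    case (neg m)
    have "(\<Oplus>\<^sub>Ae j\<in>{..<r (Suc m)}. theta (D (Suc m) j i) \<star> theta (D (Suc (Suc m)) k j))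
      = theta (\<Oplus>\<^sub>Ae j\<in>{..<r (Suc m)}. D (Suc (Suc m)) k j \<star> D (Suc m) j i)" using D by (simp add: theta_sum)
    also have "... = \<zero>\<^sub>Ae" using DD[of k m i] ik unfolding neg rks by (simp add: theta_zero)
    finally show ?thesis unfolding neg rks Dms .
  qed
  show "\<exists>g. (\<forall>i. g i .: Ae) & (\<forall>j<rk n. f j = (\<Oplus>\<^sub>Ae i\<in>{..<rk (n + 1)}. g i \<star> Dm (n + 1) i j))"
    if f: "!!i. f i .: Ae" and z: "!!j. j < rk (n - 1) ==> (\<Oplus>\<^sub>Ae i\<in>{..<rk n}. f i \<star> Dm n i j) = \<zero>\<^sub>Ae" for n f
  proof (cases n rule: int_degree_cases)
    case (pos m)
    show ?thesis unfolding pos rks Dms by (rule exact_left[OF f z[unfolded pos rks Dms]])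
  next
    case zero
    have "f 0 \<star> Delta = \<zero>\<^sub>Ae" using z[of 0] f Delta_closed by (simp add: zero rk1 Dm_zero sum_lessThan_one[unfolded One_nat_def])
    then have "lact (f 0) \<one> = \<zero>" using Delta_annihilator[OF f] by blast
    then show ?thesis using exact_left0[OF f] by (simp add: zero rk1 Dm1)
  next
    case minus_one
    define G where "G = theta' (f 0)"
    have G: "G .: Ae" "f 0 = theta G" using f by (simp_all add: G_def theta'_closed theta_theta')
    have "D 1 i 0 \<star> G = \<zero>\<^sub>Ae" if i: "i < r 1" for i
    proof -
      have "theta (D 1 i 0 \<star> G) = f 0 \<star> theta (D 1 i 0)" using G D by (simp add: theta_mult)
      also have "... = \<zero>\<^sub>Ae" using z[of i] i f D by (simp add: minus_one rk1 Dm1 sum_lessThan_one[unfolded One_nat_def] theta_closed)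
      finally show ?thesis using theta_zero_iff G D by simp
    qed
    from exact_right0[OF G(1) this] obtain w where w: "w .: Ae" "G = Delta \<star> w" by blast
    have "f 0 = theta w \<star> Delta" using G(2) w Delta_closed by (simp add: theta_mult theta_Delta)
    then show ?thesis using w(1) theta_closed Delta_closed
      by (intro exI[of _ "%_. theta w"]) (simp add: minus_one rk1 Dm_zero sum_lessThan_one[unfolded One_nat_def])
  next
    case (neg m)
    define G where "G i = theta' (f i)" for i
    have G: "G i .: Ae" "f i = theta (G i)" for i using f by (simp_all add: G_def theta'_closed theta_theta')
    have "(\<Oplus>\<^sub>Ae j\<in>{..<r (Suc m)}. D (Suc (Suc m)) i j \<star> G j) = \<zero>\<^sub>Ae" if i: "i < r (Suc (Suc m))" for i
    proof -
      have "theta (\<Oplus>\<^sub>Ae j\<in>{..<r (Suc m)}. D (Suc (Suc m)) i j \<star> G j)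
          = (\<Oplus>\<^sub>Ae j\<in>{..<r (Suc m)}. f j \<star> theta (D (Suc (Suc m)) i j))" using G D by (simp add: theta_sum)
      also have "... = \<zero>\<^sub>Ae" using z[of i] i unfolding neg rks Dms by blast
      finally show ?thesis using theta_zero_iff G D by (simp add: Ae.A.finsum_closed)
    qed
    from exact_right[OF G(1) this] obtain H where H: "!!j. H j .: Ae"
      and GH: "!!i. i < r (Suc m) ==> G i = (\<Oplus>\<^sub>Ae j\<in>{..<r m}. D (Suc m) i j \<star> H j)" by blast
    have "f i = (\<Oplus>\<^sub>Ae j\<in>{..<r m}. theta (H j) \<star> theta (D (Suc m) i j))" if "i < r (Suc m)" for i
      unfolding G(2) GH[OF that] using H D by (simp add: theta_sum)
    then show ?thesis unfolding neg rks Dms using H theta_closed by (intro exI[of _ "%j. theta (H j)"]) blast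
  qed
  show "\<exists>H. (\<forall>i. H i .: Ae) & (\<forall>i<rk n. g i = (\<Oplus>\<^sub>Ae j\<in>{..<rk (n - 1)}. Dm n i j \<star> H j))" if g: "!!i. g i .: Ae"
      and z: "!!i. i < rk (n + 1) ==> (\<Oplus>\<^sub>Ae j\<in>{..<rk n}. Dm (n + 1) i j \<star> g j) = \<zero>\<^sub>Ae" for n g
  proof (cases n rule: int_degree_cases)
    case (pos m)
    show ?thesis unfolding pos rks Dms by (rule exact_right[OF g z[unfolded pos rks Dms]])
  next
    case zero
    have "D 1 i 0 \<star> g 0 = \<zero>\<^sub>Ae" if "i < r 1" for i using z[of i] that g D by (simp add: zero rk1 Dm1 sum_lessThan_one[unfolded One_nat_def])
    from exact_right0[OF g this] obtain w where w: "w .: Ae" "g 0 = Delta \<star> w" by blast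
    then show ?thesis using Delta_closed by (intro exI[of _ "%_. w"]) (simp add: zero rk1 Dm_zero sum_lessThan_one[unfolded One_nat_def])
  next
    case minus_one
    define G where "G = theta' (g 0)"
    have G: "G .: Ae" "g 0 = theta G" using g by (simp_all add: G_def theta'_closed theta_theta')
    have "theta (G \<star> Delta) = Delta \<star> g 0" using G Delta_closed by (simp add: theta_mult theta_Delta)
    also have "... = \<zero>\<^sub>Ae" using z[of 0] g Delta_closed by (simp add: minus_one rk1 Dm_zero sum_lessThan_one[unfolded One_nat_def])
    finally have "G \<star> Delta = \<zero>\<^sub>Ae" using theta_zero_iff G Delta_closed by simp
    then have "lact G \<one> = \<zero>" by (rule Delta_annihilator[OF G(1)])
    then obtain u where u: "!!i. u i .: Ae" "G = (\<Oplus>\<^sub>Ae i\<in>{..<r 1}. u i \<star> D 1 i 0)" using exact_left0[OF G(1)] by blast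
    have "g 0 = (\<Oplus>\<^sub>Ae i\<in>{..<r 1}. theta (D 1 i 0) \<star> theta (u i))" unfolding G(2) u(2) using u(1) D by (simp add: theta_sum)
    then show ?thesis using u(1) theta_closed by (intro exI[of _ "%i. theta (u i)"]) (simp add: minus_one rk1 Dm1)
  next
    case (neg m)
    define G where "G i = theta' (g i)" for i
    have G: "G i .: Ae" "g i = theta (G i)" for i using g by (simp_all add: G_def theta'_closed theta_theta')
    have "(\<Oplus>\<^sub>Ae j\<in>{..<r (Suc m)}. G j \<star> D (Suc m) j i) = \<zero>\<^sub>Ae" if i: "i < r m" for i
    proof -
      have "theta (\<Oplus>\<^sub>Ae j\<in>{..<r (Suc m)}. G j \<star> D (Suc m) j i)
          = (\<Oplus>\<^sub>Ae j\<in>{..<r (Suc m)}. theta (D (Suc m) j i) \<star> g j)" using G D by (simp add: theta_sum)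
      also have "... = \<zero>\<^sub>Ae" using z[of i] i unfolding neg rks Dms by blast
      finally show ?thesis using theta_zero_iff G D by (simp add: Ae.A.finsum_closed)
    qed
    from exact_left[OF G(1) this] obtain H where H: "!!j. H j .: Ae"
      and GH: "!!j. j < r (Suc m) ==> G j = (\<Oplus>\<^sub>Ae i\<in>{..<r (Suc (Suc m))}. H i \<star> D (Suc (Suc m)) i j)" by blast
    have "g j = (\<Oplus>\<^sub>Ae i\<in>{..<r (Suc (Suc m))}. theta (D (Suc (Suc m)) i j) \<star> theta (H i))" if "j < r (Suc m)" for j
      unfolding G(2) GH[OF that] using H D by (simp add: theta_sum)
    then show ?thesis unfolding neg rks Dms using H theta_closed by (intro exI[of _ "%j. theta (H j)"]) blast
  qed
  show "lact z \<one> = \<zero>\<^sub>(env_left AA) \<longleftrightarrow> (\<exists>g. (\<forall>i. g i .: Ae) & z = (\<Oplus>\<^sub>Ae i\<in>{..<rk 1}. g i \<star> Dm 1 i 0))"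
    if "z .: Ae" for z using exact_left0[OF that] by (simp add: rk1 Dm1 reg_simps)
  show "\<exists>z\<in>carrier Ae. lact z \<one> = m" if "m .: (env_left AA)" for m
    using that by (intro bexI[of _ "tt m \<one>"]) (auto simp: reg_simps lact_tt intro: tt_closed)
qed

end

section \<open>The free algebra\<close>

locale free_alg = K: field K for K :: "('k, 'e) ring_scheme" (structure)
begin

abbreviation "FA == free_algebra K :: ('k, 'g list => 'k) module"
abbreviation "wd == word_monomial K"

lemma FA_carrier: "f .: FA \<longleftrightarrow> (\<forall>w. f w .: K) & finite {w. f w ~= \<zero>}"
  by (auto simp: free_algebra_def free_module_def)

lemma FA_simps:
  "\<zero>\<^sub>FA = (%w. \<zero>)" "f \<oplus>\<^sub>FA g = (%w. f w \<oplus> g w)" "c \<odot>\<^sub>FA f = (%w. c \<otimes> f w)"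
  "(f \<otimes>\<^sub>FA g) w = (\<Oplus>i\<in>{..length w}. f (take i w) \<otimes> g (drop i w))" "\<one>\<^sub>FA = wd []"
  by (auto simp: free_algebra_def free_module_def word_monomial_def)

lemma FA_left_module: "left_module K (free_module K UNIV)"
  by (rule left_module_free) (rule K.ring_axioms)

lemma FA_abelian: "abelian_group FA"
proof -
  interpret F: left_module K "free_module K UNIV" by (rule FA_left_module)
  have *: "carrier FA = carrier (free_module K UNIV)" "\<zero>\<^sub>FA = \<zero>\<^sub>(free_module K UNIV)"
    "f \<oplus>\<^sub>FA g = f \<oplus>\<^sub>(free_module K UNIV) g" for f g by (simp_all add: free_algebra_def)
  show ?thesis by (rule abelian_groupI) (auto simp: * F.a_ac intro: F.add.l_inv_ex)
qed

lemma FA_module: "module K FA"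
proof -
  interpret F: left_module K "free_module K UNIV" by (rule FA_left_module)
  have *: "carrier FA = carrier (free_module K UNIV)" "f \<oplus>\<^sub>FA g = f \<oplus>\<^sub>(free_module K UNIV) g"
    "c \<odot>\<^sub>FA f = c \<odot>\<^sub>(free_module K UNIV) f" for f g c by (simp_all add: free_algebra_def)
  show ?thesis by (rule moduleI[OF K.is_cring FA_abelian])
      (simp_all add: * F.lsmult_closed F.lsmult_l_distr F.lsmult_r_distr F.lsmult_assoc F.lsmult_one)
qed

lemma FA_mem: "f .: FA ==> f w .: K"
  by (simp add: FA_carrier)

lemma wd_closed: "wd w .: FA"
proof -
  have "{v. wd w v ~= \<zero>} \<subseteq> {w}" by (auto simp: word_monomial_def)
  from finite_subset[OF this] show ?thesis by (auto simp: FA_carrier word_monomial_def)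
qed

lemma FA_induct [consumes 1, case_names word add]:
  assumes f: "f .: FA" and w: "!!c w. c .: K ==> P (c \<odot>\<^sub>FA wd w)" and add: "!!f g. [|f .: FA; g .: FA; P f; P g|] ==> P (f \<oplus>\<^sub>FA g)"
  shows "P f"
proof -
  interpret F: module K FA by (rule FA_module)
  have "finite A ==> (\<forall>f\<in>carrier FA. {w. f w ~= \<zero>} \<subseteq> A --> P f)" for A
  proof (induction A rule: finite_induct)
    case empty
    have "P (\<zero> \<odot>\<^sub>FA wd undefined)" by (rule w) simp
    moreover have "f = \<zero> \<odot>\<^sub>FA wd undefined" if "{w. f w ~= \<zero>} \<subseteq> {}" for f
      using that by (auto simp: FA_simps word_monomial_def fun_eq_iff)
    ultimately show ?case by metis
  next
    case (insert v A)
    show ?case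
    proof (intro ballI impI)
      fix f assume f: "f .: FA" and s: "{w. f w ~= \<zero>} \<subseteq> insert v A"
      define g where "g = f(v := \<zero>)"
      have gs: "{w. g w ~= \<zero>} \<subseteq> {w. f w ~= \<zero>}" "{w. g w ~= \<zero>} \<subseteq> A" using s by (auto simp: g_def)
      have g: "g .: FA" using f finite_subset[OF gs(1)] by (simp add: FA_carrier g_def)
      have "P g" using insert.IH g gs(2) by blast
      then have "P (f v \<odot>\<^sub>FA wd v \<oplus>\<^sub>FA g)" using f g by (intro add w F.smult_closed wd_closed) (auto simp: FA_mem)
      moreover have "f v \<odot>\<^sub>FA wd v \<oplus>\<^sub>FA g = f" using FA_mem[OF f] by (auto simp: FA_simps word_monomial_def g_def fun_eq_iff)
      ultimately show "P f" by simp
    qed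
  qed
  then show ?thesis using f by (auto simp: FA_carrier)
qed

lemma FA_mult_closed:
  assumes f: "f .: FA" and g: "g .: FA" shows "f \<otimes>\<^sub>FA g .: FA"
proof -
  have c: "(f \<otimes>\<^sub>FA g) w .: K" for w using FA_mem[OF f] FA_mem[OF g] by (auto simp: FA_simps intro!: K.finsum_closed)
  have "{w. (f \<otimes>\<^sub>FA g) w ~= \<zero>} \<subseteq> (%(u, v). u @ v) ` ({w. f w ~= \<zero>} \<times> {w. g w ~= \<zero>})"
  proof
    fix w assume w: "w \<in> {w. (f \<otimes>\<^sub>FA g) w ~= \<zero>}"
    have "\<exists>i. f (take i w) \<otimes> g (drop i w) ~= \<zero>"
    proof (rule ccontr)
      assume "~ (\<exists>i. f (take i w) \<otimes> g (drop i w) ~= \<zero>)"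
      then have "(f \<otimes>\<^sub>FA g) w = \<zero>" by (simp add: FA_simps)
      then show False using w by simp
    qed
    then obtain i where "f (take i w) \<otimes> g (drop i w) ~= \<zero>" by blast
    then have "f (take i w) ~= \<zero>" "g (drop i w) ~= \<zero>" using FA_mem[OF f] FA_mem[OF g] by auto
    then show "w \<in> (%(u, v). u @ v) ` ({w. f w ~= \<zero>} \<times> {w. g w ~= \<zero>})" by (intro image_eqI[of _ _ "(take i w, drop i w)"]) auto
  qed
  then have "finite {w. (f \<otimes>\<^sub>FA g) w ~= \<zero>}" using f g by (rule_tac finite_subset) (auto simp: FA_carrier)
  then show ?thesis using c by (simp add: FA_carrier)
qed

lemma FA_distr:
  assumes "f .: FA" "g .: FA" "k .: FA" shows "(f \<oplus>\<^sub>FA g) \<otimes>\<^sub>FA k = f \<otimes>\<^sub>FA k \<oplus>\<^sub>FA g \<otimes>\<^sub>FA k"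
    and "k \<otimes>\<^sub>FA (f \<oplus>\<^sub>FA g) = k \<otimes>\<^sub>FA f \<oplus>\<^sub>FA k \<otimes>\<^sub>FA g"
proof -
  note m = FA_mem[OF assms(1)] FA_mem[OF assms(2)] FA_mem[OF assms(3)]
  show "(f \<oplus>\<^sub>FA g) \<otimes>\<^sub>FA k = f \<otimes>\<^sub>FA k \<oplus>\<^sub>FA g \<otimes>\<^sub>FA k"
  proof
    fix w
    show "((f \<oplus>\<^sub>FA g) \<otimes>\<^sub>FA k) w = (f \<otimes>\<^sub>FA k \<oplus>\<^sub>FA g \<otimes>\<^sub>FA k) w"
      using m by (simp add: FA_simps K.l_distr K.finsum_addf Pi_iff)
  qed
  show "k \<otimes>\<^sub>FA (f \<oplus>\<^sub>FA g) = k \<otimes>\<^sub>FA f \<oplus>\<^sub>FA k \<otimes>\<^sub>FA g"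
  proof
    fix w
    show "(k \<otimes>\<^sub>FA (f \<oplus>\<^sub>FA g)) w = (k \<otimes>\<^sub>FA f \<oplus>\<^sub>FA k \<otimes>\<^sub>FA g) w"
      using m by (simp add: FA_simps K.r_distr K.finsum_addf Pi_iff)
  qed
qed

lemma FA_smult_mult:
  assumes f: "f .: FA" and g: "g .: FA" and c: "c .: K"
  shows "(c \<odot>\<^sub>FA f) \<otimes>\<^sub>FA g = c \<odot>\<^sub>FA (f \<otimes>\<^sub>FA g)" and "f \<otimes>\<^sub>FA (c \<odot>\<^sub>FA g) = c \<odot>\<^sub>FA (f \<otimes>\<^sub>FA g)"
proof -
  note m = FA_mem[OF f] FA_mem[OF g]
  show "(c \<odot>\<^sub>FA f) \<otimes>\<^sub>FA g = c \<odot>\<^sub>FA (f \<otimes>\<^sub>FA g)"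
  proof
    fix w
    show "((c \<odot>\<^sub>FA f) \<otimes>\<^sub>FA g) w = (c \<odot>\<^sub>FA (f \<otimes>\<^sub>FA g)) w"
      using m c by (simp add: FA_simps K.finsum_rdistr K.m_assoc Pi_iff)
  qed
  show "f \<otimes>\<^sub>FA (c \<odot>\<^sub>FA g) = c \<odot>\<^sub>FA (f \<otimes>\<^sub>FA g)"
  proof
    fix w
    show "(f \<otimes>\<^sub>FA (c \<odot>\<^sub>FA g)) w = (c \<odot>\<^sub>FA (f \<otimes>\<^sub>FA g)) w"
      using m c by (simp add: FA_simps K.finsum_rdistr K.m_lcomm Pi_iff)
  qed
qed

lemma wd_mult: "wd u \<otimes>\<^sub>FA wd v = wd (u @ v)"
proof
  fix w
  have "(wd u \<otimes>\<^sub>FA wd v) w = (\<Oplus>i\<in>{..length w}. if length u = i then wd (u @ v) w else \<zero>)" unfolding FA_simps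
  proof (rule K.finsum_eqI)
    fix i assume i: "i \<in> {..length w}"
    show "wd u (take i w) \<otimes> wd v (drop i w) = (if length u = i then wd (u @ v) w else \<zero>)"
    proof (cases "take i w = u & drop i w = v")
      case True
      then have "w = u @ v" by (metis append_take_drop_id)
      moreover have "length u = i" using True i by auto
      ultimately show ?thesis using True by (simp add: word_monomial_def)
    next
      case False
      then have "length u = i ==> w ~= u @ v" by auto
      then show ?thesis using False by (auto simp: word_monomial_def)
    qed
  qed (auto simp: word_monomial_def)
  also have "... = wd (u @ v) w"
  proof (cases "length u <= length w")
    case True
    then show ?thesis by (intro K.finsum_singleton) (auto simp: word_monomial_def)
  next
    case False
    then have "wd (u @ v) w = \<zero>" by (auto simp: word_monomial_def)
    then show ?thesis by simp
  qed
  finally show "(wd u \<otimes>\<^sub>FA wd v) w = wd (u @ v) w" .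
qed

lemma kalg_FA: "kalg K FA"
proof -
  interpret F: module K FA by (rule FA_module)
  note cl = FA_mult_closed wd_closed
  have assoc: "(f \<otimes>\<^sub>FA g) \<otimes>\<^sub>FA k = f \<otimes>\<^sub>FA (g \<otimes>\<^sub>FA k)"
    if f: "f .: FA" and g: "g .: FA" and k: "k .: FA" for f g k :: "'g list => 'k" using f
  proof (induction rule: FA_induct)
    case w1: (word c w)
    show ?case using g
    proof (induction rule: FA_induct)
      case w2: (word c' w')
      show ?case using k
      proof (induction rule: FA_induct)
        case (word c'' w'')
        then show ?case using w1 w2 by (simp add: FA_smult_mult cl wd_mult)
      next
        case (add f g)
        then show ?case using w1 w2 by (simp add: FA_distr cl)
      qed
    next
      case (add f g)
      then show ?case using w1 k by (simp add: FA_distr cl)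
    qed
  next
    case (add f f')
    then show ?case using g k by (simp add: FA_distr cl)
  qed
  have l: "\<one>\<^sub>FA \<otimes>\<^sub>FA f = f" and r: "f \<otimes>\<^sub>FA \<one>\<^sub>FA = f" if "f .: FA" for f :: "'g list => 'k" using that
    by (induction rule: FA_induct) (simp_all add: FA_simps(5) FA_smult_mult wd_closed wd_mult FA_distr)
  have "\<one>\<^sub>FA .: FA" by (simp add: FA_simps(5) wd_closed)
  then have "monoid FA" by (intro monoidI) (simp_all add: cl assoc l r)
  then have "ring FA" by (intro ringI FA_abelian) (simp_all add: FA_distr)
  then show ?thesis by (rule kalg.intro[OF FA_module]) (simp_all add: FA_smult_mult)
qed

end

section \<open>Quotient algebras\<close>

locale kalg_quotient = kalg K A for K :: "('k, 'e) ring_scheme" and A :: "('k, 'a) module" (structure) +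
  fixes I :: "'a set" assumes I: "ideal I A"
begin

interpretation I: ideal I A by (rule I)

abbreviation "Q == quotient_module A I"
definition cl :: "'a => 'a set" where "cl f = I +> f"

lemma Q_carrier: "carrier Q = cl ` carrier A"
  by (auto simp: quotient_module_def FactRing_def A_RCOSETS_def' cl_def)

lemma cl_closed: "f .: A ==> cl f .: Q"
  by (simp add: Q_carrier)

lemma cl_add: "[|f .: A; g .: A|] ==> cl f \<oplus>\<^sub>Q cl g = cl (f \<oplus> g)"
  by (simp add: quotient_module_def FactRing_def cl_def I.a_rcos_sum)

lemma cl_mult: "[|f .: A; g .: A|] ==> cl f \<otimes>\<^sub>Q cl g = cl (f \<otimes> g)"
  by (simp add: quotient_module_def FactRing_def cl_def I.rcoset_mult_add)

lemma cl_one: "\<one>\<^sub>Q = cl \<one>"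
  by (simp add: quotient_module_def FactRing_def cl_def)

lemma cl_zero: "\<zero>\<^sub>Q = cl \<zero>"
proof -
  have "I +> \<zero> = I" by (rule A.a_rcos_zero[OF I additive_subgroup.zero_closed[OF ideal.axioms(1)[OF I]]])
  then show ?thesis by (simp add: quotient_module_def FactRing_def cl_def)
qed

lemma cl_eq: "[|f .: A; g .: A|] ==> cl f = cl g \<longleftrightarrow> f \<ominus> g \<in> I"
  using A.quotient_eq_iff_same_a_r_cos[OF I] by (simp add: cl_def)

lemma cl_zero_iff: "f .: A ==> cl f = \<zero>\<^sub>Q \<longleftrightarrow> f \<in> I"
  using cl_eq[of f "\<zero>"] by (simp add: cl_zero a_minus_def)

lemma cl_smult:
  assumes c: "c .: K" and f: "f .: A" shows "c \<odot>\<^sub>Q cl f = cl (c \<odot> f)"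
proof -
  have self: "f \<in> cl f" unfolding cl_def by (rule I.a_rcos_self) (use f in auto)
  have "c \<odot>\<^sub>Q cl f = (\<Union>u\<in>cl f. cl (c \<odot> u))" by (simp add: quotient_module_def cl_def)
  also have "... = (\<Union>u\<in>cl f. cl (c \<odot> f))"
  proof (rule SUP_cong[OF refl])
    fix u assume "u \<in> cl f"
    then obtain i where i: "i \<in> I" "u = i \<oplus> f" by (auto simp: cl_def a_r_coset_def')
    have iA: "i .: A" using i I.Icarr by auto
    \<comment> \<open>The ideal is stable under scalars because they act through
      \<open>c \<odot> \<one>\<close>.\<close>
    have "c \<odot> i = (c \<odot> \<one>) \<otimes> i" using c iA by (simp add: smult_mult_left)
    also have "... \<in> I" using c i by (intro I.I_l_closed) auto
    finally have ci: "c \<odot> i \<in> I" .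
    have "c \<odot> u \<ominus> c \<odot> f = c \<odot> i" using c iA f by (simp add: i(2) V.smult_r_distr a_minus_def A.a_assoc A.r_neg)
    then show "cl (c \<odot> u) = cl (c \<odot> f)" using ci c iA f i(2) by (subst cl_eq) auto
  qed
  finally show ?thesis using self by auto
qed

lemma kalg_Q: "kalg K Q"
proof -
  have ab: "abelian_group Q"
  proof (rule abelian_groupI)
    fix X assume "X .: Q"
    then obtain f where f: "f .: A" "X = cl f" by (auto simp: Q_carrier)
    then show "\<exists>Y\<in>carrier Q. Y \<oplus>\<^sub>Q X = \<zero>\<^sub>Q"
      by (intro bexI[of _ "cl (\<ominus> f)"]) (simp_all add: cl_closed cl_add cl_zero A.l_neg)
  next
    show "\<zero>\<^sub>Q .: Q" by (simp add: cl_zero cl_closed)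
  next
    fix X Y assume "X .: Q" "Y .: Q"
    then obtain f g where fg: "f .: A" "X = cl f" "g .: A" "Y = cl g" by (auto simp: Q_carrier)
    show "X \<oplus>\<^sub>Q Y .: Q" "X \<oplus>\<^sub>Q Y = Y \<oplus>\<^sub>Q X" "\<zero>\<^sub>Q \<oplus>\<^sub>Q X = X"
      using fg by (simp_all add: cl_add cl_closed A.a_comm cl_zero)
    fix Z assume "Z .: Q"
    then obtain k where k: "k .: A" "Z = cl k" by (auto simp: Q_carrier)
    show "X \<oplus>\<^sub>Q Y \<oplus>\<^sub>Q Z = X \<oplus>\<^sub>Q (Y \<oplus>\<^sub>Q Z)" using fg k by (simp add: cl_add A.a_assoc)
  qed
  have mon: "monoid Q"
  proof (rule monoidI)
    fix X Y Z assume "X .: Q" "Y .: Q" "Z .: Q"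
    then obtain f g k where "f .: A" "X = cl f" "g .: A" "Y = cl g" "k .: A" "Z = cl k" by (auto simp: Q_carrier)
    then show "X \<otimes>\<^sub>Q Y \<otimes>\<^sub>Q Z = X \<otimes>\<^sub>Q (Y \<otimes>\<^sub>Q Z)" by (simp add: cl_mult A.m_assoc)
  qed (auto simp: Q_carrier cl_mult cl_one)
  have ring: "ring Q"
  proof (rule ringI[OF ab mon])
    fix X Y Z assume "X .: Q" "Y .: Q" "Z .: Q"
    then obtain f g k where fgk: "f .: A" "X = cl f" "g .: A" "Y = cl g" "k .: A" "Z = cl k" by (auto simp: Q_carrier)
    show "(X \<oplus>\<^sub>Q Y) \<otimes>\<^sub>Q Z = X \<otimes>\<^sub>Q Z \<oplus>\<^sub>Q Y \<otimes>\<^sub>Q Z" "Z \<otimes>\<^sub>Q (X \<oplus>\<^sub>Q Y) = Z \<otimes>\<^sub>Q X \<oplus>\<^sub>Q Z \<otimes>\<^sub>Q Y"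
      using fgk by (simp_all add: cl_mult cl_add A.l_distr A.r_distr)
  qed
  have mod: "module K Q"
  proof (rule moduleI[OF V.R.is_cring ab])
    fix c X assume c: "c .: K" and "X .: Q"
    then obtain f where f: "f .: A" "X = cl f" by (auto simp: Q_carrier)
    show "c \<odot>\<^sub>Q X .: Q" using c f by (simp add: cl_smult cl_closed)
    fix d assume "d .: K"
    then show "(c \<oplus>\<^sub>K d) \<odot>\<^sub>Q X = c \<odot>\<^sub>Q X \<oplus>\<^sub>Q d \<odot>\<^sub>Q X" "(c \<otimes>\<^sub>K d) \<odot>\<^sub>Q X = c \<odot>\<^sub>Q (d \<odot>\<^sub>Q X)"
      using c f by (simp_all add: cl_smult cl_add V.smult_l_distr V.smult_assoc1)
  next
    fix c X Y assume "c .: K" "X .: Q" "Y .: Q"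
    moreover then obtain f g where "f .: A" "X = cl f" "g .: A" "Y = cl g" by (auto simp: Q_carrier)
    ultimately show "c \<odot>\<^sub>Q (X \<oplus>\<^sub>Q Y) = c \<odot>\<^sub>Q X \<oplus>\<^sub>Q c \<odot>\<^sub>Q Y"
      by (simp add: cl_smult cl_add V.smult_r_distr)
  qed (auto simp: Q_carrier cl_smult)
  show ?thesis
  proof (rule kalg.intro[OF mod ring])
    fix c X Y assume c: "c .: K" and "X .: Q" "Y .: Q"
    then obtain f g where "f .: A" "X = cl f" "g .: A" "Y = cl g" by (auto simp: Q_carrier)
    then show "(c \<odot>\<^sub>Q X) \<otimes>\<^sub>Q Y = c \<odot>\<^sub>Q (X \<otimes>\<^sub>Q Y)" "X \<otimes>\<^sub>Q (c \<odot>\<^sub>Q Y) = c \<odot>\<^sub>Q (X \<otimes>\<^sub>Q Y)"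
      using c by (simp_all add: cl_smult cl_mult smult_mult_left smult_mult_right)
  qed
qed

end

section \<open>Normal forms in the quantum complete intersection\<close>

lemma nat_pow_ge_zero:
  assumes "ring R" "z .: R" "z [^]\<^sub>R (m::nat) = \<zero>\<^sub>R" "n >= m" shows "z [^]\<^sub>R n = \<zero>\<^sub>R"
proof -
  interpret R: ring R by fact
  have "z [^]\<^sub>R m \<otimes>\<^sub>R z [^]\<^sub>R (n - m) = z [^]\<^sub>R n" using R.nat_pow_mult[OF assms(2), of m "n - m"] assms(4) by simp
  then show ?thesis using R.nat_pow_closed[OF assms(2)] by (simp add: assms(3))
qed

text \<open>The normal form property of the quantum complete intersection, separated from its
  construction: the monomials \<open>y^j x^i\<close> with \<open>i < a\<close> and
  \<open>j < b\<close> form a basis, with \<open>cof (i, j)\<close> as coordinate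
  functionals.\<close>

locale qalg = envalg K A for K :: "('k, 'e) ring_scheme" and A :: "('k, 'a) module" (structure) +
  fixes a b :: nat and q :: 'k and x y :: 'a and cof :: "nat \<times> nat => 'a => 'k"
  assumes field: "field K" and a2: "a >= 2" and b2: "b >= 2" and q: "q .: K" and q0: "q ~= \<zero>\<^sub>K" and x: "x .: A" and y: "y .: A"
    and xy: "x \<otimes> y = q \<odot> (y \<otimes> x)" and xa: "x [^] a = \<zero>" and yb: "y [^] b = \<zero>" and cof_closed: "z .: A ==> cof p z .: K"
    and cof_add: "[|z .: A; z' .: A|] ==> cof p (z \<oplus> z') = cof p z \<oplus>\<^sub>K cof p z'"
    and cof_smult: "[|c .: K; z .: A|] ==> cof p (c \<odot> z) = c \<otimes>\<^sub>K cof p z" and expand: "z .: A ==>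
      (\<Oplus>p\<in>{..<a} \<times> {..<b}. cof p z \<odot> (y [^] snd p \<otimes> x [^] fst p)) = z" and cof_monomial: "[|i < a; j < b; k < a; l < b|] ==>
      cof (i, j) (y [^] l \<otimes> x [^] k) = (if i = k & j = l then \<one>\<^sub>K else \<zero>\<^sub>K)"

text \<open>Counts the pairs of an X standing before a Y. Each such pair costs a factor
  \<open>q\<close> when the word is sorted with all Y in front.\<close>

primrec winv :: "xy list => nat" where
  "winv [] = 0"
| "winv (g # w) = winv w + (if g = GenX then count_list w GenY else 0)"

lemma winv_append: "winv (v @ w) = winv v + winv w + count_list v GenX * count_list w GenY"
  by (induction v) (auto simp: algebra_simps)

lemma winv_replicate: "winv (replicate j GenY @ replicate i GenX) = 0"
proof -
  have 1: "winv (replicate i GenX) = 0" by (induction i) auto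
  have 2: "winv (replicate j GenY) = 0" by (induction j) auto
  have 3: "count_list (replicate j GenY) GenX = 0" by (induction j) auto
  show ?thesis by (simp add: winv_append 1 2 3)
qed

lemma count_replicate_xy:
  "count_list (replicate n g) h = (if g = h then n else 0)" by (induction n) auto

definition word_class :: "nat => nat => xy list set" where "word_class i j = {w. count_list w GenX = i & count_list w GenY = j}"

lemma word_length: "length (w :: xy list) = count_list w GenX + count_list w GenY"
proof (induction w)
  case (Cons g w) then show ?case by (cases g) auto
qed simp

lemma finite_word_class: "finite (word_class i j)"
proof -
  have f: "finite (UNIV :: xy set)" by (rule finite_subset[of _ "{GenX, GenY}"]) (auto intro: xy.exhaust)
  have "word_class i j \<subseteq> {w. set w \<subseteq> UNIV & length w = i + j}" by (auto simp: word_class_def word_length)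
  then show ?thesis using finite_lists_length_eq[OF f, of "i + j"] by (rule finite_subset)
qed

locale qci = free_alg K for K :: "('k, 'e) ring_scheme" (structure) +
  fixes a b :: nat and q :: 'k
  assumes a2: "a >= 2" and b2: "b >= 2" and q: "q .: K" and q0: "q ~= \<zero>"
begin

abbreviation "FX == free_algebra K :: ('k, xy list => 'k) module"

sublocale FX: kalg K FX by (rule kalg_FA)

text \<open>The coefficient of \<open>y^j x^i\<close> in the normal form of \<open>f\<close>. Linear
  independence of the monomials comes from these functionals on the free algebra: their common
  kernel for \<open>i < a\<close>, \<open>j < b\<close> is an ideal containing the
  relations.\<close>

definition nf :: "nat => nat => (xy list => 'k) => 'k" where "nf i j f = (\<Oplus>w\<in>word_class i j. q [^] winv w \<otimes> f w)"

lemma nf_closed: "f .: FX ==> nf i j f .: K"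
  unfolding nf_def using q FA_mem by (intro K.finsum_closed) auto

lemma nf_add: "[|f .: FX; g .: FX|] ==> nf i j (f \<oplus>\<^sub>FX g) = nf i j f \<oplus> nf i j g"
  using q FA_mem[of f] FA_mem[of g] by (simp add: nf_def FA_simps K.r_distr K.finsum_addf Pi_iff)

lemma nf_smult: "[|f .: FX; c .: K|] ==> nf i j (c \<odot>\<^sub>FX f) = c \<otimes> nf i j f"
  using q FA_mem[of f] finite_word_class by (simp add: nf_def FA_simps K.finsum_rdistr Pi_iff K.m_lcomm)

lemma nf_word: "nf i j (wd w) = (if w \<in> word_class i j then q [^] winv w else \<zero>)"
proof -
  have "nf i j (wd w) = (\<Oplus>v\<in>word_class i j. if w = v then q [^] winv v else \<zero>)"
    unfolding nf_def using q by (intro K.finsum_eqI) (auto simp: word_monomial_def)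
  also have "... = (if w \<in> word_class i j then q [^] winv w else \<zero>)"
  proof (cases "w \<in> word_class i j")
    case True
    then show ?thesis using q finite_word_class K.finsum_singleton[of w "word_class i j" "%v. q [^] winv v"] by simp
  next
    case False
    then have "(\<Oplus>v\<in>word_class i j. if w = v then q [^] winv v else \<zero>) = (\<Oplus>v\<in>word_class i j. \<zero>)" by (intro K.finsum_eqI) auto
    then show ?thesis using False by simp
  qed
  finally show ?thesis .
qed

lemma nf_zero: "nf i j \<zero>\<^sub>FX = \<zero>"
  using q by (simp add: nf_def FA_simps)

lemma nf_neg: "f .: FX ==> nf i j (\<ominus>\<^sub>FX f) = \<ominus> nf i j f"
  by (rule additive_neg[where f = "nf i j", OF FX.A.is_abelian_group K.is_abelian_group nf_closed nf_add])

text \<open>The number of inversions between \<open>v\<close> and a following word depends on that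
  word only through its letter counts. So multiplication by a word turns each \<open>nf\<close> into
  a multiple of another one whose indices have not increased, and the range \<open>i < a\<close>,
  \<open>j < b\<close> is respected.\<close>

lemma nf_mult_left:
  assumes "f .: FX" shows "nf i j (wd v \<otimes>\<^sub>FX f) = (if count_list v GenX <= i & count_list v GenY <= j
    then q [^] (winv v + count_list v GenX * (j - count_list v GenY)) \<otimes> nf (i - count_list v GenX) (j - count_list v GenY) f
    else \<zero>)" using assms
proof (induction rule: FA_induct)
  case (word c w)
  show ?case
  proof (cases "v @ w \<in> word_class i j")
    case True
    then have "w \<in> word_class (i - count_list v GenX) (j - count_list v GenY)" "count_list v GenX <= i" "count_list v GenY <= j"
      "count_list w GenY = j - count_list v GenY" by (auto simp: word_class_def)
    then show ?thesis using True word q by (simp add: FX.smult_mult_right wd_closed wd_mult nf_smult nf_word winv_append K.m_lcomm K.nat_pow_mult ac_simps)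
  next
    case False
    then have "~ (count_list v GenX <= i & count_list v GenY <= j & w \<in> word_class (i - count_list v GenX) (j - count_list v GenY))"
      by (auto simp: word_class_def)
    then show ?thesis using False word q by (auto simp: FX.smult_mult_right wd_closed wd_mult nf_smult nf_word)
  qed
next
  case (add f g)
  then show ?case using q by (simp add: FX.A.r_distr wd_closed nf_add FA_mult_closed nf_closed K.r_distr)
qed

lemma nf_mult_right:
  assumes "f .: FX" shows "nf i j (f \<otimes>\<^sub>FX wd v) = (if count_list v GenX <= i & count_list v GenY <= j
    then q [^] (winv v + (i - count_list v GenX) * count_list v GenY) \<otimes> nf (i - count_list v GenX) (j - count_list v GenY) f
    else \<zero>)" using assms
proof (induction rule: FA_induct)
  case (word c w)
  show ?case
  proof (cases "w @ v \<in> word_class i j")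
    case True
    then have "w \<in> word_class (i - count_list v GenX) (j - count_list v GenY)" "count_list v GenX <= i" "count_list v GenY <= j"
      "count_list w GenX = i - count_list v GenX" by (auto simp: word_class_def)
    then show ?thesis using True word q by (simp add: FX.smult_mult_left wd_closed wd_mult nf_smult nf_word winv_append K.m_lcomm K.nat_pow_mult ac_simps)
  next
    case False
    then have "~ (count_list v GenX <= i & count_list v GenY <= j & w \<in> word_class (i - count_list v GenX) (j - count_list v GenY))"
      by (auto simp: word_class_def)
    then show ?thesis using False word q by (auto simp: FX.smult_mult_left wd_closed wd_mult nf_smult nf_word)
  qed
next
  case (add f g)
  then show ?case using q by (simp add: FX.A.l_distr wd_closed nf_add FA_mult_closed nf_closed K.r_distr)
qed

definition nf_kernel :: "(xy list => 'k) set" where "nf_kernel = {f \<in> carrier FX. \<forall>i<a. \<forall>j<b. nf i j f = \<zero>}"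

lemma ideal_nf_kernel: "ideal nf_kernel FX"
proof (rule idealI[OF FX.ring_A])
  show "subgroup nf_kernel (add_monoid FX)"
  proof (rule subgroup.intro)
    show "inv\<^bsub>add_monoid FX\<^esub> f \<in> nf_kernel" if "f \<in> nf_kernel" for f
      using that by (auto simp: nf_kernel_def nf_neg a_inv_def[symmetric])
  qed (auto simp: nf_kernel_def nf_add nf_zero)
  fix f g assume "f \<in> nf_kernel" and g: "g .: FX"
  then have f: "f .: FX" and 0: "!!i j. [|i < a; j < b|] ==> nf i j f = \<zero>" by (auto simp: nf_kernel_def)
  have "nf i j (g \<otimes>\<^sub>FX f) = \<zero> & nf i j (f \<otimes>\<^sub>FX g) = \<zero>" if ij: "i < a" "j < b" for i j using g
  proof (induction rule: FA_induct)
    case (word c w)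
    then show ?case using ij q f 0 less_imp_diff_less[OF ij(1)] less_imp_diff_less[OF ij(2)]
      by (simp add: FX.smult_mult_left FX.smult_mult_right nf_smult nf_mult_left nf_mult_right FA_mult_closed wd_closed)
  next
    case (add g g')
    then show ?case using f by (simp add: FX.A.l_distr FX.A.r_distr nf_add FA_mult_closed)
  qed
  then show "g \<otimes>\<^sub>FX f \<in> nf_kernel" "f \<otimes>\<^sub>FX g \<in> nf_kernel" using f g by (auto simp: nf_kernel_def FA_mult_closed)
qed

abbreviation "qideal == Idl\<^bsub>FX\<^esub> (qci_relations K a b q)"

lemma relations_closed: "qci_relations K a b q \<subseteq> carrier FX"
  using q wd_closed by (auto simp: qci_relations_def intro!: FX.A.minus_closed FX.V.smult_closed)

lemma ideal_qideal: "ideal qideal FX"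
  by (rule FX.A.genideal_ideal[OF relations_closed])

lemma qideal_nf: "qideal \<subseteq> nf_kernel"
proof (rule FX.A.genideal_minimal[OF ideal_nf_kernel])
  have X: "nf i j (wd (replicate a GenX)) = \<zero>" if "i < a" for i j using that by (simp add: nf_word word_class_def count_replicate_xy)
  have Y: "nf i j (wd (replicate b GenY)) = \<zero>" if "j < b" for i j using that by (simp add: nf_word word_class_def count_replicate_xy)
  have XY: "nf i j (wd [GenX, GenY] \<ominus>\<^sub>FX q \<odot>\<^sub>FX wd [GenY, GenX]) = \<zero>" for i j using q
    by (simp add: wd_closed a_minus_def nf_add nf_neg nf_smult nf_word word_class_def) (auto simp: K.r_neg)
  show "qci_relations K a b q \<subseteq> nf_kernel" using X Y XY relations_closed by (auto simp: qci_relations_def nf_kernel_def)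
qed

sublocale QQ: kalg_quotient K FX qideal by (intro kalg_quotient.intro kalg_quotient_axioms.intro kalg_FA ideal_qideal)

abbreviation "QA == quantum_complete_intersection K a b q"

lemma QA_def: "QA = QQ.Q"
  by (simp add: quantum_complete_intersection_def)

lemma kalg_QA: "kalg K QA"
  unfolding QA_def by (rule QQ.kalg_Q)

sublocale QA: envalg K QA using kalg_QA by (simp add: envalg_def)

text \<open>Well defined on classes in range because the ideal lies in the common kernel; indices
  out of range give the zero functional, as linearity is wanted at every index.\<close>

definition kap :: "nat \<times> nat => (xy list => 'k) set => 'k" where "kap p Z = (if fst p < a & snd p < b
    then nf (fst p) (snd p) (SOME f. f .: FX & QQ.cl f = Z) else \<zero>)"

lemma kap_cl:
  assumes f: "f .: FX" and p: "i < a" "j < b" shows "kap (i, j) (QQ.cl f) = nf i j f"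
proof -
  let ?g = "SOME g. g .: FX & QQ.cl g = QQ.cl f"
  have g: "?g .: FX & QQ.cl ?g = QQ.cl f" by (rule someI[of _ f]) (use f in simp)
  then have "?g \<ominus>\<^sub>FX f \<in> nf_kernel" using QQ.cl_eq[of ?g f] f qideal_nf by auto
  then have "nf i j (?g \<ominus>\<^sub>FX f) = \<zero>" using p by (simp add: nf_kernel_def)
  then have "nf i j ?g \<ominus> nf i j f = \<zero>" using f g by (simp add: a_minus_def nf_add nf_neg)
  then have "nf i j ?g = nf i j f" using nf_closed f g by simp
  then show ?thesis using p by (simp add: kap_def)
qed

abbreviation "gx == QQ.cl (wd [GenX])"
abbreviation "gy == QQ.cl (wd [GenY])"
definition mon :: "nat \<times> nat => (xy list => 'k) set" where "mon p = gy [^]\<^sub>QA snd p \<otimes>\<^sub>QA gx [^]\<^sub>QA fst p"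

lemma gens_closed: "gx .: QA" "gy .: QA"
  unfolding QA_def by (simp_all add: QQ.cl_closed wd_closed)

lemma mon_closed: "mon p .: QA"
  using gens_closed by (simp add: mon_def)

lemma gen_relation: "gx \<otimes>\<^sub>QA gy = q \<odot>\<^sub>QA (gy \<otimes>\<^sub>QA gx)"
proof -
  have "wd [GenX, GenY] \<ominus>\<^sub>FX q \<odot>\<^sub>FX wd [GenY, GenX] \<in> qideal"
    by (rule subsetD[OF FX.A.genideal_self[OF relations_closed]]) (simp add: qci_relations_def)
  then have "QQ.cl (wd [GenX, GenY]) = QQ.cl (q \<odot>\<^sub>FX wd [GenY, GenX])" using q wd_closed by (subst QQ.cl_eq) auto
  then show ?thesis unfolding QA_def using q by (simp add: QQ.cl_mult QQ.cl_smult wd_closed wd_mult FA_mult_closed)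
qed

lemma cl_replicate: "QQ.cl (wd (replicate n g)) = QQ.cl (wd [g]) [^]\<^sub>QA n"
proof (induction n)
  case 0
  then show ?case unfolding QA_def by (simp add: QQ.cl_one FA_simps)
next
  case (Suc n)
  have "QQ.cl (wd (replicate (Suc n) g)) = QQ.cl (wd (replicate n g)) \<otimes>\<^sub>QA QQ.cl (wd [g])"
    unfolding QA_def by (simp add: QQ.cl_mult wd_closed wd_mult replicate_append_same)
  then show ?case by (simp add: Suc)
qed

lemma gens_nilpotent: "gx [^]\<^sub>QA a = \<zero>\<^sub>QA" "gy [^]\<^sub>QA b = \<zero>\<^sub>QA"
proof -
  have "wd (replicate a GenX) \<in> qideal" "wd (replicate b GenY) \<in> qideal"
    by (rule subsetD[OF FX.A.genideal_self[OF relations_closed]]; simp add: qci_relations_def)+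
  then have "QQ.cl (wd (replicate a GenX)) = \<zero>\<^sub>QA" "QQ.cl (wd (replicate b GenY)) = \<zero>\<^sub>QA"
    unfolding QA_def by (simp_all add: QQ.cl_zero_iff wd_closed)
  then show "gx [^]\<^sub>QA a = \<zero>\<^sub>QA" "gy [^]\<^sub>QA b = \<zero>\<^sub>QA" by (simp_all add: cl_replicate)
qed

lemma mon_zero: "fst p >= a | snd p >= b ==> mon p = \<zero>\<^sub>QA"
  using nat_pow_ge_zero[OF QA.ring_A gens_closed(1) gens_nilpotent(1)]
    nat_pow_ge_zero[OF QA.ring_A gens_closed(2) gens_nilpotent(2)] gens_closed by (auto simp: mon_def)

lemma gx_gy_pow: "gx \<otimes>\<^sub>QA gy [^]\<^sub>QA (j::nat) = q [^] j \<odot>\<^sub>QA (gy [^]\<^sub>QA j \<otimes>\<^sub>QA gx)"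
proof (induction j)
  case 0
  then show ?case using gens_closed by simp
next
  case (Suc j)
  note c = gens_closed QA.A.nat_pow_closed[OF gens_closed(1)] QA.A.nat_pow_closed[OF gens_closed(2)]
  have "gx \<otimes>\<^sub>QA gy [^]\<^sub>QA Suc j = (gx \<otimes>\<^sub>QA gy [^]\<^sub>QA j) \<otimes>\<^sub>QA gy" using c by (simp add: QA.A.m_assoc)
  also have "... = q [^] j \<odot>\<^sub>QA (gy [^]\<^sub>QA j \<otimes>\<^sub>QA (gx \<otimes>\<^sub>QA gy))"
    using c q by (simp add: Suc QA.smult_mult_left QA.A.m_assoc)
  also have "... = q [^] Suc j \<odot>\<^sub>QA (gy [^]\<^sub>QA Suc j \<otimes>\<^sub>QA gx)"
    using c q by (simp add: gen_relation QA.smult_mult_right QA.V.smult_assoc1 QA.A.m_assoc)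
  finally show ?case .
qed

lemma cl_word: "QQ.cl (wd w) = q [^] winv w \<odot>\<^sub>QA mon (count_list w GenX, count_list w GenY)"
proof (induction w)
  case Nil
  have "QQ.cl (wd []) = \<one>\<^sub>QA" by (simp add: QA_def QQ.cl_one FA_simps(5))
  then show ?case by (simp add: mon_def)
next
  case (Cons g w)
  note c = gens_closed QA.A.nat_pow_closed[OF gens_closed(1)] QA.A.nat_pow_closed[OF gens_closed(2)] mon_closed
  have e: "QQ.cl (wd (g # w)) = QQ.cl (wd [g]) \<otimes>\<^sub>QA QQ.cl (wd w)" unfolding QA_def by (simp add: QQ.cl_mult wd_closed wd_mult)
  show ?case
  proof (cases g)
    case GenX
    have "gx \<otimes>\<^sub>QA mon (count_list w GenX, count_list w GenY)
        = (gx \<otimes>\<^sub>QA gy [^]\<^sub>QA count_list w GenY) \<otimes>\<^sub>QA gx [^]\<^sub>QA count_list w GenX"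
      using c by (simp add: mon_def QA.A.m_assoc)
    also have "... = q [^] count_list w GenY \<odot>\<^sub>QA (gy [^]\<^sub>QA count_list w GenY \<otimes>\<^sub>QA (gx \<otimes>\<^sub>QA gx [^]\<^sub>QA count_list w GenX))"
      using c q by (simp add: gx_gy_pow QA.smult_mult_left QA.A.m_assoc)
    also have "gx \<otimes>\<^sub>QA gx [^]\<^sub>QA count_list w GenX = gx [^]\<^sub>QA Suc (count_list w GenX)"
      by (rule QA.A.nat_pow_Suc2[OF gens_closed(1), symmetric])
    also have "gy [^]\<^sub>QA count_list w GenY \<otimes>\<^sub>QA gx [^]\<^sub>QA Suc (count_list w GenX) = mon (Suc (count_list w GenX), count_list w GenY)"
      by (simp add: mon_def)
    finally have *: "gx \<otimes>\<^sub>QA mon (count_list w GenX, count_list w GenY)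
      = q [^] count_list w GenY \<odot>\<^sub>QA mon (Suc (count_list w GenX), count_list w GenY)" .
    have "QQ.cl (wd (g # w)) = q [^] winv w \<odot>\<^sub>QA (gx \<otimes>\<^sub>QA mon (count_list w GenX, count_list w GenY))"
      using c q by (simp add: e[unfolded GenX] GenX Cons QA.smult_mult_right)
    also have "... = q [^] (winv w + count_list w GenY) \<odot>\<^sub>QA mon (Suc (count_list w GenX), count_list w GenY)"
      using c q by (simp add: * QA.V.smult_assoc1[symmetric] K.nat_pow_mult)
    finally show ?thesis using GenX by simp
  next
    case GenY
    have "gy \<otimes>\<^sub>QA mon (count_list w GenX, count_list w GenY) = mon (count_list w GenX, Suc (count_list w GenY))"
      using c by (simp add: mon_def QA.A.m_assoc[symmetric] QA.A.nat_pow_Suc2[OF gens_closed(2), symmetric] del: QA.A.nat_pow_Suc)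
    then have "QQ.cl (wd (g # w)) = q [^] winv w \<odot>\<^sub>QA mon (count_list w GenX, Suc (count_list w GenY))"
      using c q by (simp add: e[unfolded GenY] GenY Cons QA.smult_mult_right)
    then show ?thesis using GenY by simp
  qed
qed

lemma mon_word: "mon (i, j) = QQ.cl (wd (replicate j GenY @ replicate i GenX))"
  using mon_closed by (simp add: cl_word winv_replicate count_replicate_xy)

lemma QA_elem: "Z .: QA ==> \<exists>f\<in>carrier FX. Z = QQ.cl f"
  unfolding QA_def by (auto simp: QQ.Q_carrier)

lemma qalg_QA: "qalg K QA a b q gx gy kap"
proof (intro qalg.intro QA.envalg_axioms qalg_axioms.intro)
  show "field K" by (rule K.field_axioms)
  show "a >= 2" "b >= 2" "q .: K" "q ~= \<zero>" by (rule a2 b2 q q0)+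
  show "gx .: QA" "gy .: QA" by (rule gens_closed)+
  show "gx \<otimes>\<^sub>QA gy = q \<odot>\<^sub>QA (gy \<otimes>\<^sub>QA gx)" by (rule gen_relation)
  show "gx [^]\<^sub>QA a = \<zero>\<^sub>QA" "gy [^]\<^sub>QA b = \<zero>\<^sub>QA" by (rule gens_nilpotent)+
  have cases: "(fst p < a & snd p < b) | kap p = (%_. \<zero>)" for p by (auto simp: kap_def)
  have kc: "kap p Z .: K" if Z: "Z .: QA" for p Z using QA_elem[OF Z] cases[of p] by (cases p) (auto simp: kap_cl nf_closed)
  then show "kap p Z .: K" if Z: "Z .: QA" for p Z using Z by blast
  have kadd: "kap p (Z \<oplus>\<^sub>QA Z') = kap p Z \<oplus> kap p Z'" if Z: "Z .: QA" "Z' .: QA" for p Z Z'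
  proof -
    obtain f g where f: "f .: FX" "Z = QQ.cl f" and g: "g .: FX" "Z' = QQ.cl g" using QA_elem Z by blast
    then have "Z \<oplus>\<^sub>QA Z' = QQ.cl (f \<oplus>\<^sub>FX g)" unfolding QA_def by (simp add: QQ.cl_add)
    then show ?thesis using f g cases[of p] by (cases p) (auto simp: kap_cl nf_add)
  qed
  then show "kap p (Z \<oplus>\<^sub>QA Z') = kap p Z \<oplus> kap p Z'" if Z: "Z .: QA" "Z' .: QA" for p Z Z' using Z by blast
  have ksm: "kap p (c \<odot>\<^sub>QA Z) = c \<otimes> kap p Z" if c: "c .: K" and Z: "Z .: QA" for p c Z
  proof -
    obtain f where f: "f .: FX" "Z = QQ.cl f" using QA_elem Z by blast
    then have "c \<odot>\<^sub>QA Z = QQ.cl (c \<odot>\<^sub>FX f)" unfolding QA_def using c by (simp add: QQ.cl_smult)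
    then show ?thesis using f c cases[of p] by (cases p) (auto simp: kap_cl nf_smult)
  qed
  then show "kap p (c \<odot>\<^sub>QA Z) = c \<otimes> kap p Z" if "c .: K" "Z .: QA" for p c Z using that by blast
  have kmon: "kap (i, j) (mon (k, l)) = (if i = k & j = l then \<one> else \<zero>)" if "i < a" "j < b" for i j k l
    using that by (simp add: mon_word kap_cl wd_closed nf_word word_class_def count_replicate_xy winv_replicate)
  then show "kap (i, j) (gy [^]\<^sub>QA l \<otimes>\<^sub>QA gx [^]\<^sub>QA k) = (if i = k & j = l then \<one> else \<zero>)"
    if "i < a" "j < b" "k < a" "l < b" for i j k l using that kmon[of i j k l] by (simp add: mon_def)
  let ?J = "{..<a} \<times> {..<b}"
  have "(\<Oplus>\<^sub>QA p\<in>?J. kap p Z \<odot>\<^sub>QA mon p) = Z" if Z: "Z .: QA" for Z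
  proof -
    obtain f where f: "f .: FX" "Z = QQ.cl f" using QA_elem Z by blast
    have "(\<Oplus>\<^sub>QA p\<in>?J. kap p (QQ.cl f) \<odot>\<^sub>QA mon p) = QQ.cl f" using f(1)
    proof (induction rule: FA_induct)
      case (word c w)
      let ?i = "count_list w GenX" and ?j = "count_list w GenY"
      have e: "QQ.cl (c \<odot>\<^sub>FX wd w) = (c \<otimes> q [^] winv w) \<odot>\<^sub>QA mon (?i, ?j)"
      proof -
        have "QQ.cl (c \<odot>\<^sub>FX wd w) = c \<odot>\<^sub>QA QQ.cl (wd w)" unfolding QA_def using word by (simp add: QQ.cl_smult wd_closed)
        then show ?thesis using word q mon_closed by (simp add: cl_word QA.V.smult_assoc1)
      qed
      have k: "kap p (QQ.cl (c \<odot>\<^sub>FX wd w)) = (if (?i, ?j) = p then c \<otimes> q [^] winv w else \<zero>)" if "p \<in> ?J" for p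
        using that word by (cases p) (auto simp: kap_cl wd_closed nf_smult nf_word word_class_def)
      have "(\<Oplus>\<^sub>QA p\<in>?J. kap p (QQ.cl (c \<odot>\<^sub>FX wd w)) \<odot>\<^sub>QA mon p)
        = (\<Oplus>\<^sub>QA p\<in>?J. if (?i, ?j) = p then (c \<otimes> q [^] winv w) \<odot>\<^sub>QA mon p else \<zero>\<^sub>QA)"
        using k word q mon_closed by (intro QA.A.finsum_eqI) (simp_all add: QA.V.smult_l_null)
      also have "... = (c \<otimes> q [^] winv w) \<odot>\<^sub>QA mon (?i, ?j)"
      proof (cases "(?i, ?j) \<in> ?J")
        case True
        then show ?thesis using word q mon_closed by (intro QA.A.finsum_singleton) auto
      next
        \<comment> \<open>A word with too many X or too many Y has no coordinate in range, and its
          monomial vanishes in the algebra.\<close>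
        case False
        then have "(\<Oplus>\<^sub>QA p\<in>?J. if (?i, ?j) = p then (c \<otimes> q [^] winv w) \<odot>\<^sub>QA mon p else \<zero>\<^sub>QA) = (\<Oplus>\<^sub>QA p\<in>?J. \<zero>\<^sub>QA)"
          by (intro QA.A.finsum_eqI) (auto simp del: set_eq_iff)
        moreover have "mon (?i, ?j) = \<zero>\<^sub>QA" using False by (intro mon_zero) auto
        ultimately show ?thesis using word q by simp
      qed
      finally show ?case using e by simp
    next
      case (add f g)
      have c: "QQ.cl f .: QA" "QQ.cl g .: QA" unfolding QA_def using add by (simp_all add: QQ.cl_closed)
      have e: "QQ.cl (f \<oplus>\<^sub>FX g) = QQ.cl f \<oplus>\<^sub>QA QQ.cl g" unfolding QA_def using add by (simp add: QQ.cl_add)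
      have "(\<Oplus>\<^sub>QA p\<in>?J. kap p (QQ.cl (f \<oplus>\<^sub>FX g)) \<odot>\<^sub>QA mon p)
        = (\<Oplus>\<^sub>QA p\<in>?J. kap p (QQ.cl f) \<odot>\<^sub>QA mon p \<oplus>\<^sub>QA kap p (QQ.cl g) \<odot>\<^sub>QA mon p)"
        unfolding e using c mon_closed by (intro QA.A.finsum_eqI) (simp_all add: kadd kc QA.V.smult_l_distr)
      also have "... = (\<Oplus>\<^sub>QA p\<in>?J. kap p (QQ.cl f) \<odot>\<^sub>QA mon p) \<oplus>\<^sub>QA (\<Oplus>\<^sub>QA p\<in>?J. kap p (QQ.cl g) \<odot>\<^sub>QA mon p)"
        using c mon_closed kc by (intro QA.A.finsum_addf) auto
      finally show ?case by (simp only: add e)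
    qed
    then show ?thesis using f by simp
  qed
  then show "(\<Oplus>\<^sub>QA p\<in>?J. kap p Z \<odot>\<^sub>QA (gy [^]\<^sub>QA snd p \<otimes>\<^sub>QA gx [^]\<^sub>QA fst p)) = Z"
    if "Z .: QA" for Z using that by (simp add: mon_def)
qed

end

section \<open>Monomials and the Frobenius form\<close>

lemma (in abelian_group) finsum_lessThan_Suc_shift:
  assumes "!!l. l < Suc n ==> F l .: G" shows "(\<Oplus>l\<in>{..<Suc n}. F l) = F 0 \<oplus> (\<Oplus>l\<in>{..<n}. F (Suc l))"
proof -
  have e: "{..<Suc n} = insert 0 (Suc ` {..<n})" by (auto simp: image_iff less_Suc_eq_0_disj)
  have "(\<Oplus>l\<in>{..<Suc n}. F l) = F 0 \<oplus> (\<Oplus>l\<in>Suc ` {..<n}. F l)" unfolding e using assms by (subst finsum_insert) auto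
  also have "(\<Oplus>l\<in>Suc ` {..<n}. F l) = (\<Oplus>l\<in>{..<n}. F (Suc l))" using assms by (intro finsum_reindex) auto
  finally show ?thesis .
qed

lemma (in abelian_group) finsum_reverse:
  assumes "!!l. l <= m ==> F l .: G" shows "(\<Oplus>l\<in>{..<Suc m}. F l) = (\<Oplus>l\<in>{..<Suc m}. F (m - l))"
proof -
  have e: "{..<Suc m} = (%l. m - l) ` {..<Suc m}"
  proof
    show "{..<Suc m} \<subseteq> (%l. m - l) ` {..<Suc m}"
    proof
      fix l assume "l \<in> {..<Suc m}"
      then show "l \<in> (%l. m - l) ` {..<Suc m}" by (intro image_eqI[of _ _ "m - l"]) auto
    qed
  qed auto
  have "(\<Oplus>l\<in>{..<Suc m}. F l) = (\<Oplus>l\<in>(%l. m - l) ` {..<Suc m}. F l)" using e by simp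
  also have "... = (\<Oplus>l\<in>{..<Suc m}. F (m - l))" using assms by (intro finsum_reindex) (auto simp: inj_on_def)
  finally show ?thesis .
qed

lemma (in abelian_group) finsum_diff:
  assumes "!!i. i \<in> I ==> F i .: G" "!!i. i \<in> I ==> H i .: G"
  shows "(\<Oplus>i\<in>I. F i \<ominus> H i) = (\<Oplus>i\<in>I. F i) \<ominus> (\<Oplus>i\<in>I. H i)"
proof -
  have "(\<Oplus>i\<in>I. F i \<ominus> H i) = (\<Oplus>i\<in>I. F i) \<oplus> (\<Oplus>i\<in>I. \<ominus> H i)"
    using assms by (simp add: a_minus_def finsum_addf Pi_iff)
  also have "(\<Oplus>i\<in>I. \<ominus> H i) = \<ominus> (\<Oplus>i\<in>I. H i)"
    using assms by (intro additive_finsum[OF abelian_group_axioms abelian_group_axioms, symmetric])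
      (auto simp: minus_add)
  finally show ?thesis by (simp add: a_minus_def)
qed

lemma (in abelian_group) finsum_telescope:
  assumes "!!l. l <= m ==> F l .: G" shows "(\<Oplus>l\<in>{..<m}. F l \<ominus> F (Suc l)) = F 0 \<ominus> F m" using assms
proof (induction m)
  case 0
  then show ?case by (simp add: a_minus_def r_neg)
next
  case (Suc m)
  have c: "F 0 .: G" "F m .: G" "F (Suc m) .: G" using Suc.prems by auto
  have "(\<Oplus>l\<in>{..<Suc m}. F l \<ominus> F (Suc l)) = (F m \<ominus> F (Suc m)) \<oplus> (F 0 \<ominus> F m)" using Suc by (simp add: lessThan_Suc)
  also have "... = F 0 \<ominus> F (Suc m)" using c by (simp add: a_minus_def a_ac r_neg2)
  finally show ?case .
qed

context qalg
begin

sublocale KF: field K by (rule field)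

abbreviation "J == {..<a} \<times> {..<b}"
definition M :: "nat \<times> nat => 'a" where "M p = y [^] snd p \<otimes> x [^] fst p"
abbreviation Q :: "nat => 'k" where "Q n == q [^]\<^sub>K n"

lemma Q_closed: "Q n .: K" using q by simp

lemma Q_nonzero: "Q n ~= \<zero>\<^sub>K"
proof (induction n)
  case (Suc n) then show ?case using q q0 KF.integral[of "Q n" q] by auto
qed simp

lemma Q_add: "Q (m + n) = Q m \<otimes>\<^sub>K Q n"
  using q by (simp add: V.R.nat_pow_mult)

lemma xp: "x [^] (n::nat) .: A" and yp: "y [^] (n::nat) .: A"
  using x y by auto

lemma xp_zero: "n >= a ==> x [^] n = \<zero>" and yp_zero: "n >= b ==> y [^] n = \<zero>"
  using nat_pow_ge_zero[OF ring_A x xa] nat_pow_ge_zero[OF ring_A y yb] by auto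

lemma M_closed: "M p .: A" using xp yp by (simp add: M_def)

lemma M_zero: "i >= a | j >= b ==> M (i, j) = \<zero>"
  using xp yp xp_zero yp_zero by (auto simp: M_def)

lemma x_yp: "x \<otimes> y [^] (j::nat) = Q j \<odot> (y [^] j \<otimes> x)"
proof (induction j)
  case 0
  then show ?case using x by simp
next
  case (Suc j)
  have "x \<otimes> y [^] Suc j = (x \<otimes> y [^] j) \<otimes> y" using x y yp by (simp add: A.m_assoc)
  also have "... = Q j \<odot> (y [^] j \<otimes> (x \<otimes> y))" using x y yp Q_closed by (simp add: Suc smult_mult_left A.m_assoc)
  also have "... = Q (Suc j) \<odot> (y [^] Suc j \<otimes> x)" using x y yp q by (simp add: xy smult_mult_right V.smult_assoc1 A.m_assoc)
  finally show ?case .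
qed

lemma xp_yp: "x [^] (i::nat) \<otimes> y [^] (j::nat) = Q (i * j) \<odot> (y [^] j \<otimes> x [^] i)"
proof (induction i)
  case 0
  then show ?case using yp by simp
next
  case (Suc i)
  have "x [^] Suc i \<otimes> y [^] j = x [^] i \<otimes> (x \<otimes> y [^] j)" using x xp yp by (simp add: A.m_assoc)
  also have "... = Q j \<odot> ((x [^] i \<otimes> y [^] j) \<otimes> x)" using x xp yp Q_closed by (simp add: x_yp smult_mult_right A.m_assoc)
  also have "... = Q (j + i * j) \<odot> (y [^] j \<otimes> x [^] Suc i)"
    using x xp yp Q_closed by (simp add: Suc smult_mult_left A.m_assoc V.smult_assoc1 Q_add)
  finally show ?case by simp
qed

lemma M_mult: "M (i, j) \<otimes> M (k, l) = Q (i * l) \<odot> M (i + k, j + l)"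
proof -
  have "M (i, j) \<otimes> M (k, l) = y [^] j \<otimes> (x [^] i \<otimes> y [^] l) \<otimes> x [^] k" using xp yp by (simp add: M_def A.m_assoc)
  also have "... = Q (i * l) \<odot> ((y [^] j \<otimes> y [^] l) \<otimes> (x [^] i \<otimes> x [^] k))"
    using xp yp Q_closed by (simp add: xp_yp smult_mult_left smult_mult_right A.m_assoc)
  also have "... = Q (i * l) \<odot> M (i + k, j + l)" using x y by (simp add: M_def A.nat_pow_mult)
  finally show ?thesis .
qed

lemma cof_M: "[|p \<in> J; p' \<in> J|] ==> cof p (M p') = (if p = p' then \<one>\<^sub>K else \<zero>\<^sub>K)"
  by (cases p; cases p') (auto simp: M_def cof_monomial)

lemma expand_M: "z .: A ==> (\<Oplus>p\<in>J. cof p z \<odot> M p) = z"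
  using expand by (simp add: M_def)

lemma cof_zero: "cof p \<zero> = \<zero>\<^sub>K"
  by (rule additive_zero[where f = "cof p", OF aA V.R.is_abelian_group cof_closed cof_add])

definition lam :: "'a => 'k" where "lam = cof (a - 1, b - 1)"
definition cmp :: "nat \<times> nat => nat \<times> nat" where "cmp p = (a - 1 - fst p, b - 1 - snd p)"
text \<open>\<open>lam\<close> is the coefficient of the socle monomial. Complementary monomials
  multiply to it up to the power of \<open>q\<close> that comes from moving \<open>x\<close> to the
  power \<open>a - 1 - fst p\<close> past \<open>y\<close> to the power \<open>snd p\<close>; the
  scalar inverts that power.\<close>

definition Mdual :: "nat \<times> nat => 'a" where "Mdual p = inv\<^bsub>K\<^esub> Q ((a - 1 - fst p) * snd p) \<odot> M (cmp p)"

lemma invQ: "inv\<^bsub>K\<^esub> Q n .: K" "inv\<^bsub>K\<^esub> Q n \<otimes>\<^sub>K Q n = \<one>\<^sub>K" "Q n \<otimes>\<^sub>K inv\<^bsub>K\<^esub> Q n = \<one>\<^sub>K"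
  using Q_closed[of n] Q_nonzero[of n] by (simp_all add: KF.field_Units)

lemma lam_M: "lam (M (i, j)) = (if i = a - 1 & j = b - 1 then \<one>\<^sub>K else \<zero>\<^sub>K)"
proof (cases "i < a & j < b")
  case True
  then show ?thesis using a2 b2 by (auto simp: lam_def cof_M)
next
  case False
  then have "M (i, j) = \<zero>" by (intro M_zero) auto
  then show ?thesis using False a2 b2 by (auto simp: lam_def cof_zero)
qed

lemma lam_MM:
  assumes "p \<in> J" "p' \<in> J" shows "lam (M p \<otimes> M p') = (if p' = cmp p then Q (fst p * snd p') else \<zero>\<^sub>K)"
proof -
  obtain i j k l where e: "p = (i, j)" "p' = (k, l)" by (cases p; cases p')
  have "lam (M p \<otimes> M p') = Q (i * l) \<otimes>\<^sub>K lam (M (i + k, j + l))" using M_closed Q_closed by (simp add: e M_mult lam_def cof_smult)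
  moreover have "i + k = a - 1 & j + l = b - 1 \<longleftrightarrow> p' = cmp p" using assms by (auto simp: e cmp_def)
  ultimately show ?thesis using Q_closed by (auto simp: lam_M e cmp_def split: if_splits)
qed

lemma cmp: "p \<in> J ==> cmp p \<in> J" "p \<in> J ==> cmp (cmp p) = p"
  by (auto simp: cmp_def)

lemma lam_dual:
  assumes "p \<in> J" "p' \<in> J" shows "lam (Mdual p \<otimes> M p') = (if p = p' then \<one>\<^sub>K else \<zero>\<^sub>K)"
proof -
  have "lam (Mdual p \<otimes> M p') = inv\<^bsub>K\<^esub> Q ((a - 1 - fst p) * snd p) \<otimes>\<^sub>K lam (M (cmp p) \<otimes> M p')"
    using invQ M_closed by (simp add: Mdual_def smult_mult_left lam_def cof_smult)
  then show ?thesis using assms cmp invQ by (auto simp: lam_MM cmp_def)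
qed

lemma Mdual_closed: "Mdual p .: A"
  using invQ M_closed by (simp add: Mdual_def)

lemma lam_props:
  "z .: A ==> lam z .: K"
  "[|z .: A; z' .: A|] ==> lam (z \<oplus> z') = lam z \<oplus>\<^sub>K lam z'"
  "[|c .: K; z .: A|] ==> lam (c \<odot> z) = c \<otimes>\<^sub>K lam z" by (simp_all add: lam_def cof_closed cof_add cof_smult)

text \<open>Comparison on monomials. The target is an arbitrary module over \<open>K\<close>;
  functionals are the case \<open>left_regular K\<close>.\<close>

lemma linear_eqI:
  assumes H: "module K H" and f: "!!z. z .: A ==> f z .: H" "!!z z'. [|z .: A; z' .: A|] ==> f (z \<oplus> z') = f z \<oplus>\<^sub>H f z'"
      "!!c z. [|c .: K; z .: A|] ==> f (c \<odot> z) = c \<odot>\<^sub>H f z"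
    and g: "!!z. z .: A ==> g z .: H" "!!z z'. [|z .: A; z' .: A|] ==> g (z \<oplus> z') = g z \<oplus>\<^sub>H g z'"
      "!!c z. [|c .: K; z .: A|] ==> g (c \<odot> z) = c \<odot>\<^sub>H g z" and e: "!!p. p \<in> J ==> f (M p) = g (M p)" and z: "z .: A" shows "f z = g z"
proof -
  interpret H: module K H by (rule H)
  have s: "u z = (\<Oplus>\<^sub>H p\<in>J. cof p z \<odot>\<^sub>H u (M p))"
    if u: "!!z. z .: A ==> u z .: H" "!!z z'. [|z .: A; z' .: A|] ==> u (z \<oplus> z') = u z \<oplus>\<^sub>H u z'"
      "!!c z. [|c .: K; z .: A|] ==> u (c \<odot> z) = c \<odot>\<^sub>H u z" for u
  proof -
    have "u z = u (\<Oplus>p\<in>J. cof p z \<odot> M p)" by (simp only: expand_M[OF z])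
    also have "... = (\<Oplus>\<^sub>H p\<in>J. u (cof p z \<odot> M p))"
      using z M_closed cof_closed by (intro additive_finsum[OF aA H.abelian_group_axioms u(1,2)]) auto
    also have "... = (\<Oplus>\<^sub>H p\<in>J. cof p z \<odot>\<^sub>H u (M p))" using z M_closed cof_closed u by (intro H.finsum_eqI) simp_all
    finally show ?thesis .
  qed
  have "f z = (\<Oplus>\<^sub>H p\<in>J. cof p z \<odot>\<^sub>H f (M p))" by (rule s[OF f])
  also have "... = (\<Oplus>\<^sub>H p\<in>J. cof p z \<odot>\<^sub>H g (M p))" using e z M_closed cof_closed g by (intro H.finsum_eqI) simp_all
  also have "... = g z" by (rule s[OF g, symmetric])
  finally show ?thesis .
qed

lemma module_K: "module K (left_regular K)"
  by (rule module.intro[OF V.R.cring_axioms _ module_axioms.intro])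
    (auto simp: left_regular_def V.R.l_distr V.R.r_distr V.R.m_assoc V.R.a_ac intro!: abelian_groupI V.R.add.l_inv_ex)

lemma frobenius: "frobenius K A J M Mdual lam"
proof (intro frobenius.intro envalg_axioms frobenius_axioms.intro)
  show "finite J" by simp
  fix z assume z: "z .: A"
  have 1: "lam (Mdual p \<otimes> z) = cof p z" if p: "p \<in> J" for p
  proof (rule linear_eqI[OF module_K _ _ _ _ _ _ _ z])
    fix p' assume "p' \<in> J"
    then show "lam (Mdual p \<otimes> M p') = cof p (M p')" by (simp only: lam_dual[OF p] cof_M[OF p])
  qed (simp_all add: left_regular_def lam_props Mdual_closed A.r_distr smult_mult_right cof_closed cof_add cof_smult)
  show "(\<Oplus>p\<in>J. lam (Mdual p \<otimes> z) \<odot> M p) = z"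
  proof -
    have "(\<Oplus>p\<in>J. lam (Mdual p \<otimes> z) \<odot> M p) = (\<Oplus>p\<in>J. cof p z \<odot> M p)"
      using z M_closed cof_closed by (intro A.finsum_eqI) (simp_all only: 1 V.smult_closed)
    then show ?thesis using expand_M[OF z] by simp
  qed
  show "(\<Oplus>p\<in>J. lam (z \<otimes> M p) \<odot> Mdual p) = z"
  proof (rule linear_eqI[OF module_A _ _ _ _ _ _ _ z, of _ "%z. z"])
    fix p' assume p': "p' \<in> J"
    have "(\<Oplus>p\<in>J. lam (M p' \<otimes> M p) \<odot> Mdual p) = (\<Oplus>p\<in>J. if cmp p' = p then M p' else \<zero>)"
    proof (rule A.finsum_eqI)
      fix p assume p: "p \<in> J"
      show "lam (M p' \<otimes> M p) \<odot> Mdual p = (if cmp p' = p then M p' else \<zero>)"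
      proof (cases "cmp p' = p")
        case True
        have "a - 1 - fst p = fst p'" "cmp p = p'" using True p' by (auto simp: cmp_def)
        then have "lam (M p' \<otimes> M p) \<odot> Mdual p = (Q (fst p' * snd p) \<otimes>\<^sub>K inv\<^bsub>K\<^esub> Q (fst p' * snd p)) \<odot> M p'"
          using p p' True Q_closed invQ(1) M_closed by (simp add: lam_MM Mdual_def V.smult_assoc1)
        then show ?thesis using True invQ M_closed by simp
      next
        case False
        then show ?thesis using p p' Mdual_closed by (auto simp: lam_MM)
      qed
    qed (use M_closed in auto)
    also have "... = M p'" using cmp[OF p'] M_closed by (intro A.finsum_singleton) auto
    finally show "(\<Oplus>p\<in>J. lam (M p' \<otimes> M p) \<odot> Mdual p) = M p'" .
  next
    fix u v assume uv: "u .: A" "v .: A"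
    have "(\<Oplus>p\<in>J. lam ((u \<oplus> v) \<otimes> M p) \<odot> Mdual p)
      = (\<Oplus>p\<in>J. lam (u \<otimes> M p) \<odot> Mdual p \<oplus> lam (v \<otimes> M p) \<odot> Mdual p)" using uv M_closed Mdual_closed
      by (intro A.finsum_eqI) (simp_all add: A.l_distr lam_props V.smult_l_distr)
    also have "... = (\<Oplus>p\<in>J. lam (u \<otimes> M p) \<odot> Mdual p) \<oplus> (\<Oplus>p\<in>J. lam (v \<otimes> M p) \<odot> Mdual p)"
      using uv M_closed Mdual_closed lam_props by (intro A.finsum_addf) auto
    finally show "(\<Oplus>p\<in>J. lam ((u \<oplus> v) \<otimes> M p) \<odot> Mdual p)
      = (\<Oplus>p\<in>J. lam (u \<otimes> M p) \<odot> Mdual p) \<oplus> (\<Oplus>p\<in>J. lam (v \<otimes> M p) \<odot> Mdual p)" .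
  next
    fix c u assume c: "c .: K" and u: "u .: A"
    have "(\<Oplus>p\<in>J. lam ((c \<odot> u) \<otimes> M p) \<odot> Mdual p) = (\<Oplus>p\<in>J. c \<odot> (lam (u \<otimes> M p) \<odot> Mdual p))"
      using c u M_closed Mdual_closed by (intro A.finsum_eqI) (simp_all add: smult_mult_left lam_props V.smult_assoc1)
    also have "... = c \<odot> (\<Oplus>p\<in>J. lam (u \<otimes> M p) \<odot> Mdual p)" using c u M_closed Mdual_closed lam_props
      by (intro additive_finsum[OF aA aA, symmetric]) (auto simp: V.smult_r_distr)
    finally show "(\<Oplus>p\<in>J. lam ((c \<odot> u) \<otimes> M p) \<odot> Mdual p)
      = c \<odot> (\<Oplus>p\<in>J. lam (u \<otimes> M p) \<odot> Mdual p)" .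
  next
    show "(\<Oplus>p\<in>J. lam (u \<otimes> M p) \<odot> Mdual p) .: A" if "u .: A" for u
      using that M_closed Mdual_closed lam_props by (intro A.finsum_closed) auto
  qed auto
qed (simp_all add: M_closed Mdual_closed lam_props)

end

section \<open>Monomial bases of the enveloping algebra\<close>

context qalg
begin

definition kape :: "nat \<times> nat => nat \<times> nat => 'a env => 'k" where "kape p p' = tensor_induced K (%(l, r). cof p l \<otimes>\<^sub>K cof p' r)"

lemma kape:
  shows kape_closed: "Z .: Ae ==> kape p p' Z .: K"
    and kape_add: "[|Z .: Ae; Z' .: Ae|] ==> kape p p' (Z \<boxplus> Z') = kape p p' Z \<oplus>\<^sub>K kape p p' Z'"
    and kape_tt: "[|l .: A; r .: A|] ==> kape p p' (tt l r) = cof p l \<otimes>\<^sub>K cof p' r" unfolding kape_def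
  using Ae_induced[where g = "%(l, r). cof p l \<otimes>\<^sub>K cof p' r", OF V.R.is_abelian_group]
  by (simp_all add: cof_closed cof_add cof_smult V.R.l_distr V.R.r_distr V.R.m_ac)

lemma kape_smult:
  assumes "Z .: Ae" "c .: K" shows "kape p p' (c \<bullet> Z) = c \<otimes>\<^sub>K kape p p' Z" using assms(1) by (induction rule: Ae_induct)
    (use assms(2) in \<open>simp_all add: kape_tt kape_add tt_smult_left[symmetric] cof_smult cof_closed V.R.m_assoc
      Ae.V.smult_r_distr V.R.r_distr kape_closed\<close>)

lemma Ae_expand:
  assumes "Z .: Ae" shows "(\<Oplus>\<^sub>Ae g\<in>J \<times> J. kape (fst g) (snd g) Z \<bullet> tt (M (fst g)) (M (snd g))) = Z" using assms
proof (induction rule: Ae_induct)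
  case (pure l r)
  have "tt l r = tt (\<Oplus>p\<in>J. cof p l \<odot> M p) (\<Oplus>p\<in>J. cof p r \<odot> M p)" using pure by (simp only: expand_M)
  also have "... = (\<Oplus>\<^sub>Ae g\<in>J \<times> J. (cof (fst g) l \<otimes>\<^sub>K cof (snd g) r) \<bullet> tt (M (fst g)) (M (snd g)))"
    using pure M_closed cof_closed by (intro tt_expand) auto
  also have "... = (\<Oplus>\<^sub>Ae g\<in>J \<times> J. kape (fst g) (snd g) (tt l r) \<bullet> tt (M (fst g)) (M (snd g)))"
    using pure M_closed cof_closed by (intro Ae.A.finsum_eqI) (simp_all add: kape_tt tt_closed)
  finally show ?case by (rule sym)
next
  case (add X Y)
  have c: "tt (M (fst g)) (M (snd g)) .: Ae" for g :: "(nat \<times> nat) \<times> nat \<times> nat" by (rule tt_closed[OF M_closed M_closed])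
  have "(\<Oplus>\<^sub>Ae g\<in>J \<times> J. kape (fst g) (snd g) (X \<boxplus> Y) \<bullet> tt (M (fst g)) (M (snd g)))
    = (\<Oplus>\<^sub>Ae g\<in>J \<times> J. kape (fst g) (snd g) X \<bullet> tt (M (fst g)) (M (snd g)) \<boxplus>
        kape (fst g) (snd g) Y \<bullet> tt (M (fst g)) (M (snd g)))"
    using add(1,2) c kape_closed by (intro Ae.A.finsum_eqI) (simp_all add: kape_add Ae.V.smult_l_distr)
  also have "... = (\<Oplus>\<^sub>Ae g\<in>J \<times> J. kape (fst g) (snd g) X \<bullet> tt (M (fst g)) (M (snd g))) \<boxplus>
        (\<Oplus>\<^sub>Ae g\<in>J \<times> J. kape (fst g) (snd g) Y \<bullet> tt (M (fst g)) (M (snd g)))"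
    using add(1,2) c kape_closed by (intro Ae.A.finsum_addf) auto
  finally show ?case by (simp only: add(3,4))
qed

text \<open>
  \<open>nb d d' u u' v v'\<close> is the element of the enveloping algebra that sends a generator \<open>e\<close> of bidegree
  \<open>(d, d')\<close> to \<open>x\<^sup>u e\<^sub>X x\<^sup>u\<^sup>' \<otimes> y\<^sup>v e\<^sub>Y y\<^sup>v\<^sup>'\<close> in the twisted tensor product of the resolutions of
  \<open>k[x]/(x\<^sup>a)\<close> and \<open>k[y]/(y\<^sup>b)\<close>. In these bases the differentials have coefficients \<open>0, 1, -1\<close>.
  It vanishes for exponents out of range.
\<close>

definition nb :: "nat => nat => nat => nat => nat => nat => 'a env" where "nb d d' u u' v v' = Q (v * d + u' * d' + u' * v) \<bullet>
    tt (x [^] u \<otimes> y [^] v) (x [^] u' \<otimes> y [^] v')"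

lemma nb_closed: "nb d d' u u' v v' .: Ae"
  using xp yp Q_closed by (auto simp: nb_def intro!: Ae.V.smult_closed tt_closed)

lemma nb_zero: "u >= a | u' >= a | v >= b | v' >= b ==> nb d d' u u' v v' = \<zero>\<^sub>Ae"
  using xp yp Q_closed xp_zero yp_zero by (auto simp: nb_def tt_zero simp del: set_eq_iff)

text \<open>The total exponent of \<open>q\<close> when \<open>nb\<close> is written in sorted
  monomials; the last two terms come from sorting \<open>x^u y^v\<close> and
  \<open>x^u' y^v'\<close>. As these factors are invertible, the \<open>nb\<close> form a basis for
  each bidegree.\<close>

definition wt :: "nat => nat => (nat \<times> nat) \<times> nat \<times> nat => nat"
  where "wt d d' = (%((u, v), (u', v')). v * d + u' * d' + u' * v + u * v + u' * v')"

abbreviation "nbp d d' g == nb d d' (fst (fst g)) (fst (snd g)) (snd (fst g)) (snd (snd g))"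

lemma nb_M: "nbp d d' g = Q (wt d d' g) \<bullet> tt (M (fst g)) (M (snd g))"
proof -
  obtain u v u' v' where g: "g = ((u, v), (u', v'))" by (metis surj_pair)
  show ?thesis using xp yp Q_closed by (simp add: g nb_def wt_def M_def xp_yp tt_smult_left tt_smult_right tt_closed
        Ae.V.smult_assoc1[symmetric] Q_add V.R.m_ac)
qed

definition cf :: "nat => nat => 'a env => (nat \<times> nat) \<times> nat \<times> nat => 'k"
  where "cf d d' Z g = kape (fst g) (snd g) Z \<otimes>\<^sub>K inv\<^bsub>K\<^esub> Q (wt d d' g)"

lemma cf_closed: "Z .: Ae ==> cf d d' Z g .: K"
  using kape_closed invQ by (simp add: cf_def)

lemma cf_add: "[|Z .: Ae; Z' .: Ae|] ==> cf d d' (Z \<boxplus> Z') g = cf d d' Z g \<oplus>\<^sub>K cf d d' Z' g"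
  using kape_closed invQ by (simp add: cf_def kape_add V.R.l_distr)

lemma cf_smult: "[|Z .: Ae; c .: K|] ==> cf d d' (c \<bullet> Z) g = c \<otimes>\<^sub>K cf d d' Z g"
  using kape_closed invQ by (simp add: cf_def kape_smult V.R.m_assoc)

lemma nb_expand:
  assumes Z: "Z .: Ae" shows "(\<Oplus>\<^sub>Ae g\<in>J \<times> J. cf d d' Z g \<bullet> nbp d d' g) = Z"
proof -
  have "(\<Oplus>\<^sub>Ae g\<in>J \<times> J. cf d d' Z g \<bullet> nbp d d' g)
    = (\<Oplus>\<^sub>Ae g\<in>J \<times> J. kape (fst g) (snd g) Z \<bullet> tt (M (fst g)) (M (snd g)))" using Z M_closed kape_closed invQ Q_closed
    by (intro Ae.A.finsum_eqI)
      (simp_all add: cf_def nb_M tt_closed Ae.V.smult_assoc1[symmetric] V.R.m_assoc)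
  then show ?thesis using Ae_expand[OF Z] by simp
qed

lemma cf_nb:
  assumes g: "g \<in> J \<times> J" and g': "g' \<in> J \<times> J" shows "cf d d' (nbp d d' g) g' = (if g = g' then \<one>\<^sub>K else \<zero>\<^sub>K)"
proof -
  have "kape (fst g') (snd g') (nbp d d' g) = Q (wt d d' g) \<otimes>\<^sub>K (cof (fst g') (M (fst g)) \<otimes>\<^sub>K cof (snd g') (M (snd g)))"
    using M_closed Q_closed by (simp add: nb_M kape_smult kape_tt tt_closed)
  moreover have "cof (fst g') (M (fst g)) = (if fst g' = fst g then \<one>\<^sub>K else \<zero>\<^sub>K)"
    "cof (snd g') (M (snd g)) = (if snd g' = snd g then \<one>\<^sub>K else \<zero>\<^sub>K)" using g g' by (intro cof_M; auto)+
  ultimately show ?thesis using Q_closed invQ by (cases "g = g'") (auto simp: cf_def prod_eq_iff)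
qed

text \<open>The map that is linear over \<open>K\<close> with prescribed values on the basis
  \<open>nb\<close>. The contractions are given in this way, not being linear over the enveloping
  algebra.\<close>

definition lin :: "nat => nat => (nat => nat => nat => nat => 'a env) => 'a env => 'a env"
  where "lin d d' F Z = (\<Oplus>\<^sub>Ae g\<in>J \<times> J. cf d d' Z g \<bullet> F (fst (fst g)) (fst (snd g)) (snd (fst g)) (snd (snd g)))"

definition linear :: "('a env => 'a env) => bool" where "linear f \<longleftrightarrow> (\<forall>Z\<in>carrier Ae. f Z .: Ae) \<and>
    (\<forall>Z\<in>carrier Ae. \<forall>Z'\<in>carrier Ae. f (Z \<boxplus> Z') = f Z \<boxplus> f Z') \<and>
    (\<forall>c\<in>carrier K. \<forall>Z\<in>carrier Ae. f (c \<bullet> Z) = c \<bullet> f Z)"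

lemma linearD:
  assumes "linear f" shows "Z .: Ae ==> f Z .: Ae" and "[|Z .: Ae; Z' .: Ae|] ==> f (Z \<boxplus> Z') = f Z \<boxplus> f Z'"
    and "[|c .: K; Z .: Ae|] ==> f (c \<bullet> Z) = c \<bullet> f Z" using assms by (auto simp: linear_def simp del: set_eq_iff)

lemma linear_zero: "linear f ==> f \<zero>\<^sub>Ae = \<zero>\<^sub>Ae"
  by (rule additive_zero[OF aE aE]) (simp_all add: linearD)

lemma linear_diff: "[|linear f; Z .: Ae; Z' .: Ae|] ==> f (Z \<boxminus> Z') = f Z \<boxminus> f Z'"
  by (rule additive_diff[OF aE aE]) (simp_all add: linearD)

lemma linear_neg: "[|linear f; Z .: Ae|] ==> f (\<ominus>\<^sub>Ae Z) = \<ominus>\<^sub>Ae f Z"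
  by (rule additive_neg[OF aE aE]) (simp_all add: linearD)

lemma linear_finsum: "[|linear f; !!i. i \<in> I ==> u i .: Ae|] ==> f (\<Oplus>\<^sub>Ae i\<in>I. u i) = (\<Oplus>\<^sub>Ae i\<in>I. f (u i))"
  by (rule additive_finsum[OF aE aE]) (simp_all add: linearD)

lemma linear_mult: "[|linear f; W .: Ae|] ==> linear (%Z. f Z \<star> W)"
  unfolding linear_def by (simp add: Ae.A.l_distr Ae.smult_mult_left)

lemma linear_mult': "[|linear f; W .: Ae|] ==> linear (%Z. f (Z \<star> W))"
  unfolding linear_def by (simp add: Ae.A.l_distr Ae.smult_mult_left)

lemma linear_add: "[|linear f; linear g|] ==> linear (%Z. f Z \<boxplus> g Z)"
  unfolding linear_def by (simp add: Ae.A.a_ac Ae.V.smult_r_distr)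

lemma linear_id: "linear (%Z. Z)"
  unfolding linear_def by simp

lemma linear_const_zero: "linear (%Z. \<zero>\<^sub>Ae)"
  unfolding linear_def by simp

lemma linear_lin:
  assumes F: "!!u u' v v'. F u u' v v' .: Ae" shows "linear (lin d d' F)" unfolding linear_def
proof (intro conjI ballI)
  show "lin d d' F Z .: Ae" if "Z .: Ae" for Z using that F cf_closed unfolding lin_def by (intro Ae.A.finsum_closed) auto
  fix Z assume Z: "Z .: Ae"
  show "lin d d' F (Z \<boxplus> Z') = lin d d' F Z \<boxplus> lin d d' F Z'" if Z': "Z' .: Ae" for Z'
    using Z Z' F cf_closed by (simp add: lin_def cf_add Ae.V.smult_l_distr Ae.A.finsum_addf)
  show "lin d d' F (c \<bullet> Z) = c \<bullet> lin d d' F Z" if c: "c .: K" for c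
  proof -
    have "lin d d' F (c \<bullet> Z) = (\<Oplus>\<^sub>Ae g\<in>J \<times> J. c \<bullet> (cf d d' Z g \<bullet> F (fst (fst g)) (fst (snd g)) (snd (fst g)) (snd (snd g))))"
      unfolding lin_def using Z c F cf_closed by (intro Ae.A.finsum_eqI) (simp_all add: cf_smult Ae.V.smult_assoc1)
    also have "... = c \<bullet> lin d d' F Z" unfolding lin_def using Z c F cf_closed
      by (intro additive_finsum[OF aE aE, symmetric]) (simp_all add: Ae.V.smult_r_distr)
    finally show ?thesis .
  qed
qed

lemma lin_nb:
  assumes F: "!!u u' v v'. F u u' v v' .: Ae" and "u < a" "u' < a" "v < b" "v' < b" shows "lin d d' F (nb d d' u u' v v') = F u u' v v'"
proof -
  let ?g = "((u, v), (u', v'))"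
  have g: "?g \<in> J \<times> J" using assms by auto
  have "lin d d' F (nb d d' u u' v v') = (\<Oplus>\<^sub>Ae g\<in>J \<times> J. if ?g = g then F (fst (fst g)) (fst (snd g)) (snd (fst g)) (snd (snd g)) else \<zero>\<^sub>Ae)"
    unfolding lin_def using cf_nb[OF g] F by (intro Ae.A.finsum_eqI) simp_all
  also have "... = F u u' v v'" using g F Ae.A.finsum_singleton[of ?g "J \<times> J" "%g. F (fst (fst g)) (fst (snd g)) (snd (fst g)) (snd (snd g))"]
    by (simp add: Pi_iff)
  finally show ?thesis .
qed

lemma linear_eqI_nb:
  assumes f: "linear f" and g: "linear g" and e: "!!u u' v v'. [|u < a; u' < a; v < b; v' < b|] ==> f (nb d d' u u' v v') = g (nb d d' u u' v v')"
    and Z: "Z .: Ae" shows "f Z = g Z"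
proof -
  have s: "h Z = (\<Oplus>\<^sub>Ae p\<in>J \<times> J. cf d d' Z p \<bullet> h (nbp d d' p))" if h: "linear h" for h
  proof -
    have "h Z = h (\<Oplus>\<^sub>Ae p\<in>J \<times> J. cf d d' Z p \<bullet> nbp d d' p)" by (simp only: nb_expand[OF Z])
    also have "... = (\<Oplus>\<^sub>Ae p\<in>J \<times> J. h (cf d d' Z p \<bullet> nbp d d' p))"
      using Z nb_closed cf_closed by (intro linear_finsum[OF h]) simp
    also have "... = (\<Oplus>\<^sub>Ae p\<in>J \<times> J. cf d d' Z p \<bullet> h (nbp d d' p))"
      using Z nb_closed cf_closed linearD[OF h] by (intro Ae.A.finsum_eqI) simp_all
    finally show ?thesis .
  qed
  show ?thesis unfolding s[OF f] s[OF g] using Z e nb_closed cf_closed linearD[OF g] by (intro Ae.A.finsum_eqI) auto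
qed

lemma nb_one: "nb d d' 0 0 0 0 = \<one>\<^sub>Ae"
  by (simp add: nb_def Ae_one tt_closed)

section \<open>Action of the generators on the bases \<open>nb\<close>\<close>

abbreviation "X1 == tt x \<one>"
abbreviation "X2 == tt \<one> x"
abbreviation "Y1 == tt y \<one>"
abbreviation "Y2 == tt \<one> y"

lemma XY_closed: "X1 .: Ae" "X2 .: Ae" "Y1 .: Ae" "Y2 .: Ae"
  "Q n \<bullet> X2 .: Ae" "Q n \<bullet> Y1 .: Ae" using x y Q_closed by (auto intro!: tt_closed Ae.V.smult_closed)

text \<open>The powers of \<open>q\<close> in \<open>nb\<close> are made for this: a generator of
  degree \<open>Suc d\<close> is replaced by \<open>x\<close> times one of degree \<open>d\<close>,
  and the factor \<open>q^v\<close> from moving \<open>x\<close> past \<open>y^v\<close> is absorbed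
  by the change in \<open>v * d\<close>. No scalar remains, so in these bases the complex looks like
  an untwisted tensor product.\<close>

lemma nb_X1: "nb (Suc d) d' u u' v v' \<star> X1 = nb d d' (Suc u) u' v v'"
proof -
  have "Q v \<odot> ((x [^] u \<otimes> y [^] v) \<otimes> x) = x [^] u \<otimes> (x \<otimes> y [^] v)"
    using x xp yp Q_closed by (simp add: x_yp smult_mult_right A.m_assoc)
  also have "... = x [^] Suc u \<otimes> y [^] v" using x xp yp by (simp add: A.m_assoc)
  finally have 1: "Q v \<odot> ((x [^] u \<otimes> y [^] v) \<otimes> x) = x [^] Suc u \<otimes> y [^] v" .
  have "nb (Suc d) d' u u' v v' \<star> X1
    = Q ((v * d + u' * d' + u' * v) + v) \<bullet> tt ((x [^] u \<otimes> y [^] v) \<otimes> x) (x [^] u' \<otimes> y [^] v')"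
    using x xp yp Q_closed by (simp add: nb_def Ae.smult_mult_left tt_mult tt_closed ac_simps)
  also have "... = Q (v * d + u' * d' + u' * v) \<bullet> tt (Q v \<odot> ((x [^] u \<otimes> y [^] v) \<otimes> x)) (x [^] u' \<otimes> y [^] v')"
    using x xp yp Q_closed by (simp only: Q_add) (simp add: tt_smult_left Ae.V.smult_assoc1 tt_closed)
  finally show ?thesis unfolding 1 nb_def .
qed

lemma nb_X2: "nb (Suc d) d' u u' v v' \<star> (Q d' \<bullet> X2) = nb d d' u (Suc u') v v'"
proof -
  have 1: "x \<otimes> (x [^] u' \<otimes> y [^] v') = x [^] Suc u' \<otimes> y [^] v'" using x xp yp by (subst A.nat_pow_Suc2) (simp_all add: A.m_assoc)
  have e: "v * Suc d + u' * d' + u' * v + d' = v * d + Suc u' * d' + Suc u' * v" by simp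
  have "nb (Suc d) d' u u' v v' \<star> (Q d' \<bullet> X2)
    = Q (v * Suc d + u' * d' + u' * v + d') \<bullet> tt (x [^] u \<otimes> y [^] v) (x \<otimes> (x [^] u' \<otimes> y [^] v'))" using x xp yp Q_closed
    by (simp add: nb_def Ae.smult_mult_left Ae.smult_mult_right tt_mult tt_closed Ae.V.smult_assoc1[symmetric] Q_add V.R.m_ac)
  then show ?thesis unfolding 1 e nb_def .
qed

lemma nb_Y1: "nb d (Suc d') u u' v v' \<star> (Q d \<bullet> Y1) = nb d d' u u' (Suc v) v'"
proof -
  have 1: "(x [^] u \<otimes> y [^] v) \<otimes> y = x [^] u \<otimes> y [^] Suc v" using y xp yp by (simp add: A.m_assoc)
  have e: "v * d + u' * Suc d' + u' * v + d = Suc v * d + u' * d' + u' * Suc v" by simp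
  have "nb d (Suc d') u u' v v' \<star> (Q d \<bullet> Y1)
    = Q (v * d + u' * Suc d' + u' * v + d) \<bullet> tt ((x [^] u \<otimes> y [^] v) \<otimes> y) (x [^] u' \<otimes> y [^] v')" using y xp yp Q_closed
    by (simp add: nb_def Ae.smult_mult_left Ae.smult_mult_right tt_mult tt_closed Ae.V.smult_assoc1[symmetric] Q_add V.R.m_ac)
  then show ?thesis unfolding 1 e nb_def .
qed

lemma nb_Y2: "nb d (Suc d') u u' v v' \<star> Y2 = nb d d' u u' v (Suc v')"
proof -
  have "Q u' \<odot> (y \<otimes> (x [^] u' \<otimes> y [^] v')) = (x [^] u' \<otimes> y) \<otimes> y [^] v'"
    using y xp yp Q_closed xp_yp[of u' 1] by (simp add: smult_mult_left A.m_assoc)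
  also have "... = x [^] u' \<otimes> y [^] Suc v'" using y xp yp by (subst A.nat_pow_Suc2) (simp_all add: A.m_assoc)
  finally have 1: "Q u' \<odot> (y \<otimes> (x [^] u' \<otimes> y [^] v')) = x [^] u' \<otimes> y [^] Suc v'" .
  have "nb d (Suc d') u u' v v' \<star> Y2
    = Q ((v * d + u' * d' + u' * v) + u') \<bullet> tt (x [^] u \<otimes> y [^] v) (y \<otimes> (x [^] u' \<otimes> y [^] v'))"
    using y xp yp Q_closed by (simp add: nb_def Ae.smult_mult_left tt_mult tt_closed ac_simps)
  also have "... = Q (v * d + u' * d' + u' * v) \<bullet> tt (x [^] u \<otimes> y [^] v) (Q u' \<odot> (y \<otimes> (x [^] u' \<otimes> y [^] v')))"
    using y xp yp Q_closed by (simp only: Q_add) (simp add: tt_smult_right Ae.V.smult_assoc1 tt_closed)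
  finally show ?thesis unfolding 1 nb_def .
qed

lemma nb_X1_pow: "nb (d + l) d' u u' v v' \<star> X1 [^]\<^sub>Ae l = nb d d' (u + l) u' v v'"
proof (induction l arbitrary: d)
  case 0
  then show ?case using nb_closed by simp
next
  case (Suc l)
  have "nb (d + Suc l) d' u u' v v' \<star> X1 [^]\<^sub>Ae Suc l = (nb (Suc d + l) d' u u' v v' \<star> X1 [^]\<^sub>Ae l) \<star> X1"
    using nb_closed XY_closed by (simp add: Ae.A.m_assoc)
  also have "... = nb d d' (u + Suc l) u' v v'" by (simp only: Suc nb_X1 add_Suc_right)
  finally show ?case .
qed

lemma nb_X2_pow: "nb (d + l) d' u u' v v' \<star> (Q d' \<bullet> X2) [^]\<^sub>Ae l = nb d d' u (u' + l) v v'"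
proof (induction l arbitrary: d)
  case 0
  then show ?case using nb_closed by simp
next
  case (Suc l)
  have "nb (d + Suc l) d' u u' v v' \<star> (Q d' \<bullet> X2) [^]\<^sub>Ae Suc l = (nb (Suc d + l) d' u u' v v' \<star> (Q d' \<bullet> X2) [^]\<^sub>Ae l) \<star> (Q d' \<bullet> X2)"
    using nb_closed XY_closed by (simp add: Ae.A.m_assoc)
  also have "... = nb d d' u (u' + Suc l) v v'" by (simp only: Suc nb_X2 add_Suc_right)
  finally show ?case .
qed

lemma nb_Y1_pow: "nb d (d' + l) u u' v v' \<star> (Q d \<bullet> Y1) [^]\<^sub>Ae l = nb d d' u u' (v + l) v'"
proof (induction l arbitrary: d')
  case 0
  then show ?case using nb_closed by simp
next
  case (Suc l)
  have "nb d (d' + Suc l) u u' v v' \<star> (Q d \<bullet> Y1) [^]\<^sub>Ae Suc l = (nb d (Suc d' + l) u u' v v' \<star> (Q d \<bullet> Y1) [^]\<^sub>Ae l) \<star> (Q d \<bullet> Y1)"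
    using nb_closed XY_closed by (simp add: Ae.A.m_assoc)
  also have "... = nb d d' u u' (v + Suc l) v'" by (simp only: Suc nb_Y1 add_Suc_right)
  finally show ?case .
qed

lemma nb_Y2_pow: "nb d (d' + l) u u' v v' \<star> Y2 [^]\<^sub>Ae l = nb d d' u u' v (v' + l)"
proof (induction l arbitrary: d')
  case 0
  then show ?case using nb_closed by simp
next
  case (Suc l)
  have "nb d (d' + Suc l) u u' v v' \<star> Y2 [^]\<^sub>Ae Suc l = (nb d (Suc d' + l) u u' v v' \<star> Y2 [^]\<^sub>Ae l) \<star> Y2"
    using nb_closed XY_closed by (simp add: Ae.A.m_assoc)
  also have "... = nb d d' u u' v (v' + Suc l)" by (simp only: Suc nb_Y2 add_Suc_right)
  finally show ?case .
qed

end

section \<open>The one-variable resolution\<close>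

text \<open>
  The resolution of \<open>k[x]/(x\<^sup>m)\<close> over its enveloping algebra in the basis \<open>x\<^sup>u \<otimes> x\<^sup>u\<^sup>'\<close>: for
  \<open>N u u'\<close> in place of \<open>x\<^sup>u \<otimes> x\<^sup>u\<^sup>'\<close>, \<open>strand_d\<close> is the differential from degree \<open>i + 1\<close> to \<open>i\<close> and
  \<open>strand_h\<close> a contracting homotopy of left modules.
\<close>

context abelian_group
begin

lemma add_diff_cancel: "[|x .: G; y .: G|] ==> y \<oplus> (x \<ominus> y) = x"
  by (simp add: a_minus_def a_lcomm[of y] r_neg)

definition strand_d :: "nat => nat => (nat => nat => 'a) => nat => nat => 'a" where "strand_d m i N u u' = (if even i then N (Suc u) u' \<ominus> N u (Suc u')
    else \<Oplus>l\<in>{..<m}. N (u + l) (u' + (m - 1 - l)))"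

definition strand_h :: "nat => nat => (nat => nat => 'a) => nat => nat => 'a" where "strand_h m i N u u' =
    (\<Oplus>l\<in>{..<if even i then if u < m then u else 0 else if u = m - 1 then 1 else 0}.
      N (if even i then u - 1 - l else 0) (u' + l))"

lemma strand_h_closed: "(!!p p'. N p p' .: G) ==> strand_h m i N u u' .: G"
  by (simp add: strand_h_def Pi_iff)

lemma finsum_antidiagonal:
  assumes N: "!!p p'. N p p' .: G"
  shows "(\<Oplus>l\<in>{..<u}. N (Suc (u - 1 - l)) (u' + l) \<ominus> N (u - 1 - l) (Suc (u' + l))) = N u u' \<ominus> N 0 (u' + u)"
proof -
  have "(\<Oplus>l\<in>{..<u}. N (Suc (u - 1 - l)) (u' + l) \<ominus> N (u - 1 - l) (Suc (u' + l)))
    = (\<Oplus>l\<in>{..<u}. N (u - l) (u' + l) \<ominus> N (u - Suc l) (u' + Suc l))" using N by (intro finsum_eqI) (simp_all add: Suc_diff_Suc)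
  also have "... = N (u - 0) (u' + 0) \<ominus> N (u - u) (u' + u)" by (rule finsum_telescope) (rule N)
  finally show ?thesis by simp
qed

text \<open>In degree 0 the telescoping sum stops at \<open>N 0 (u' + u)\<close>, the image under
  the section \<open>x^s \<mapsto> 1 \<otimes> x^s\<close> of the augmentation.\<close>

lemma strand_contraction0:
  assumes "!!p p'. N p p' .: G" "u < m" shows "strand_h m 0 (strand_d m 0 N) u u' = N u u' \<ominus> N 0 (u' + u)"
  using finsum_antidiagonal[OF assms(1)] assms(2) by (simp add: strand_h_def strand_d_def)

text \<open>\<open>N\<close> lists the images of basis elements, so nested expressions are read
  outermost first: the first summand is \<open>d h\<close>, the second \<open>h d\<close>. For even
  \<open>i\<close> the two sums in \<open>h d\<close> cancel up to \<open>N u u'\<close>; at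
  \<open>u = m - 1\<close> one of them is lost because \<open>x^m = 0\<close>, and the norm element
  in \<open>d h\<close> supplies it. For odd \<open>i\<close>, \<open>h\<close> keeps only the term
  of the norm element with left exponent \<open>m - 1\<close>, and this completes the telescoping
  sum from \<open>d h\<close>.\<close>

lemma strand_contraction:
  assumes N: "!!p p'. N p p' .: G" and u: "u < m" shows "strand_h m (Suc i) (strand_d m (Suc i) N) u u' \<oplus> strand_d m i (strand_h m i N) u u' = N u u'"
proof (cases "even i")
  case True
  have sh: "(\<Oplus>l\<in>{..<Suc u}. N (u - l) (u' + l)) = N u u' \<oplus> (\<Oplus>l\<in>{..<u}. N (u - 1 - l) (Suc u' + l))"
    using N by (subst finsum_lessThan_Suc_shift) simp_all
  let ?S = "\<Oplus>l\<in>{..<u}. N (u - 1 - l) (Suc u' + l)"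
  have S: "?S .: G" using N by simp
  show ?thesis
  proof (cases "Suc u < m")
    case 1: True
    then have "strand_h m (Suc i) (strand_d m (Suc i) N) u u' = \<zero>" using True by (simp add: strand_h_def)
    moreover have "strand_d m i (strand_h m i N) u u' = (N u u' \<oplus> ?S) \<ominus> ?S"
      using True 1 u sh by (simp add: strand_d_def strand_h_def del: finsum_lessThan_Suc_shift)
    ultimately show ?thesis using N S by (simp add: a_minus_def a_assoc r_neg)
  next
    case False
    then have m: "m = Suc u" using u by simp
    have "strand_h m (Suc i) (strand_d m (Suc i) N) u u' = (\<Oplus>l\<in>{..<Suc u}. N l (u' + (u - l)))"
      using True m N by (simp add: strand_h_def strand_d_def lessThan_Suc[of 0])
    also have "... = (\<Oplus>l\<in>{..<Suc u}. N (u - l) (u' + (u - (u - l))))" by (rule finsum_reverse) (rule N)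
    also have "... = (\<Oplus>l\<in>{..<Suc u}. N (u - l) (u' + l))" using N by (intro finsum_eqI) simp_all
    also note sh
    finally have "strand_h m (Suc i) (strand_d m (Suc i) N) u u' = N u u' \<oplus> ?S" .
    moreover have "strand_d m i (strand_h m i N) u u' = \<ominus> ?S" using True m S by (simp add: strand_d_def strand_h_def a_minus_def)
    ultimately show ?thesis using N S by (simp add: a_assoc r_neg)
  qed
next
  case False
  have "strand_h m (Suc i) (strand_d m (Suc i) N) u u' = N u u' \<ominus> N 0 (u' + u)"
    using finsum_antidiagonal[OF N] u False by (simp add: strand_h_def strand_d_def)
  moreover have "strand_d m i (strand_h m i N) u u' = (\<Oplus>l\<in>{..<m}. if m - 1 - u = l then N 0 (u' + u) else \<zero>)"
    unfolding strand_d_def using False N u by (simp, intro finsum_eqI) (auto simp: strand_h_def lessThan_Suc[of 0])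
  moreover have "... = N 0 (u' + u)" using N u by (subst finsum_singleton) auto
  ultimately show ?thesis using N by (simp add: a_minus_def a_assoc l_neg)
qed

text \<open>The difference of the two sums telescopes, and both ends carry an exponent of at least
  \<open>m\<close>.\<close>

lemma strand_dd:
  assumes N: "!!p p'. N p p' .: G" and 0: "!!p p'. p >= m | p' >= m ==> N p p' = \<zero>" shows "strand_d m (Suc i) (strand_d m i N) u u' = \<zero>"
proof -
  let ?P = "\<Oplus>l\<in>{..<m}. N (Suc (u + l)) (u' + (m - 1 - l))"
  let ?Q = "\<Oplus>l\<in>{..<m}. N (u + l) (Suc (u' + (m - 1 - l)))"
  have PQ: "?P .: G" "?Q .: G" using N by simp_all
  have "(\<Oplus>l\<in>{..<m}. N (u + l) (u' + (m - l)) \<ominus> N (u + Suc l) (u' + (m - Suc l))) = \<zero>" using N 0[of u "u' + m"] 0[of "u + m" u']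
    by (subst finsum_telescope[where F = "%l. N (u + l) (u' + (m - l))"]) (auto simp: a_minus_def)
  moreover have "(\<Oplus>l\<in>{..<m}. N (u + l) (u' + (m - l)) \<ominus> N (u + Suc l) (u' + (m - Suc l))) = ?Q \<ominus> ?P"
    using N by (subst finsum_diff[symmetric]) (auto intro!: finsum_eqI simp: Suc_diff_Suc)
  ultimately have "?P = ?Q" using minus_equality[OF _ a_inv_closed[OF PQ(1)] PQ(2)] minus_minus[OF PQ(1)] unfolding a_minus_def by metis
  moreover have "strand_d m (Suc i) (strand_d m i N) u u' = ?P \<ominus> ?Q" using N by (cases "even i") (simp_all add: strand_d_def finsum_diff)
  ultimately show ?thesis using PQ by (simp add: a_minus_def r_neg)
qed

lemma strand_h_d_swap:
  assumes N: "!!p p' q q'. N p p' q q' .: G" shows "strand_h m i (%p p'. strand_d n j (%q q'. N p p' q q') v v') u u'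
    = strand_d n j (%q q'. strand_h m i (%p p'. N p p' q q') u u') v v'" unfolding strand_d_def strand_h_def using N
  by (cases "even j"; simp only: if_True if_False) (intro finsum_diff finsum_swap; simp)+

lemma strand_d_d_swap:
  assumes N: "!!p p' q q'. N p p' q q' .: G" shows "strand_d m i (%p p'. strand_d n j (%q q'. N p p' q q') v v') u u'
    = strand_d n j (%q q'. strand_d m i (%p p'. N p p' q q') u u') v v'"
proof -
  have 1: "(\<Oplus>k\<in>{..<m}. \<Oplus>l\<in>{..<n}. N (u + k) (u' + (m - 1 - k)) (v + l) (v' + (n - 1 - l)))
     = (\<Oplus>l\<in>{..<n}. \<Oplus>k\<in>{..<m}. N (u + k) (u' + (m - 1 - k)) (v + l) (v' + (n - 1 - l)))" using N by (intro finsum_swap) simp_all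
  consider "even i" "even j" | "even i" "odd j" | "odd i" "even j" | "odd i" "odd j" by blast
  then show ?thesis
  proof cases
    case 1
    then show ?thesis using N by (simp add: strand_d_def a_minus_def minus_add a_ac)
  next
    case 2
    then show ?thesis using N by (simp only: strand_d_def if_True if_False) (subst finsum_diff, simp_all)
  next
    case 3
    then show ?thesis using N by (simp only: strand_d_def if_True if_False) (subst finsum_diff, simp_all)
  next
    case 4
    then show ?thesis by (simp only: strand_d_def if_False 1)
  qed
qed

lemma strand_hom:
  assumes H: "abelian_group H" and f: "!!z. z .: G ==> f z .: H"
      "!!z z'. [|z .: G; z' .: G|] ==> f (z \<oplus> z') = f z \<oplus>\<^sub>H f z'" and N: "!!p p'. N p p' .: G"
  shows "f (strand_d m i N u u') = abelian_group.strand_d H m i (%p p'. f (N p p')) u u'"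
    and "f (strand_h m i N u u') = abelian_group.strand_h H m i (%p p'. f (N p p')) u u'"
  using N unfolding strand_d_def strand_h_def abelian_group.strand_d_def[OF H] abelian_group.strand_h_def[OF H]
  by (auto simp: additive_diff[OF abelian_group_axioms H f] additive_finsum[OF abelian_group_axioms H f] simp del: set_eq_iff)

end

section \<open>A free resolution of the quantum complete intersection\<close>

context qalg
begin


text \<open>Internal degrees of the generators: 0, 1, a, a + 1, 2a and so on, since the
  differentials alternately have degree 1 and \<open>a - 1\<close>.\<close>

definition dX :: "nat => nat" where "dX i = i div 2 * a + i mod 2"
definition dY :: "nat => nat" where "dY j = j div 2 * b + j mod 2"

lemma degree_0: "dX 0 = 0" "dY 0 = 0" by (simp_all add: dX_def dY_def)

lemma degree_Suc:
  "even i ==> dX (Suc i) = Suc (dX i)" "even i ==> dY (Suc i) = Suc (dY i)"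
  "odd i ==> dX (Suc i) = dX i + (a - 1)" "odd i ==> dY (Suc i) = dY i + (b - 1)" using a2 b2 by (auto elim!: evenE oddE simp: dX_def dY_def)

text \<open>The factor \<open>Q d'\<close> arises when right multiplication by \<open>x\<close> on
  the generator of the X-resolution is moved past the generator of the Y-resolution, of degree
  \<open>d'\<close>. In \<open>DY\<close> it is left multiplication by \<open>y\<close> that has to
  pass the generator of the X-resolution.\<close>

definition DX :: "nat => nat => 'a env" where "DX i d' = (if odd i then X1 \<boxminus> Q d' \<bullet> X2
    else \<Oplus>\<^sub>Ae l\<in>{..<a}. X1 [^]\<^sub>Ae l \<star> (Q d' \<bullet> X2) [^]\<^sub>Ae (a - 1 - l))"

definition DY :: "nat => nat => 'a env" where "DY j d = (if odd j then Q d \<bullet> Y1 \<boxminus> Y2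
    else \<Oplus>\<^sub>Ae l\<in>{..<b}. (Q d \<bullet> Y1) [^]\<^sub>Ae l \<star> Y2 [^]\<^sub>Ae (b - 1 - l))"

lemma DX_closed: "DX i d' .: Ae" and DY_closed: "DY j d .: Ae"
  using XY_closed by (auto simp: DX_def DY_def simp del: set_eq_iff)

lemma nb_DX: "nb (dX (Suc i)) d' u u' v v' \<star> DX (Suc i) d' = Ae.A.strand_d a i (%p p'. nb (dX i) d' p p' v v') u u'"
proof (cases "even i")
  case True
  then show ?thesis using nb_closed XY_closed by (simp add: DX_def Ae.A.strand_d_def degree_Suc a_minus_def Ae.A.r_distr Ae.A.r_minus nb_X1 nb_X2)
next
  case False
  have "nb (dX (Suc i)) d' u u' v v' \<star> DX (Suc i) d'
    = (\<Oplus>\<^sub>Ae l\<in>{..<a}. nb (dX (Suc i)) d' u u' v v' \<star> (X1 [^]\<^sub>Ae l \<star> (Q d' \<bullet> X2) [^]\<^sub>Ae (a - 1 - l)))"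
    using False nb_closed XY_closed by (simp add: DX_def Ae.A.finsum_rdistr)
  also have "... = (\<Oplus>\<^sub>Ae l\<in>{..<a}. nb (dX i) d' (u + l) (u' + (a - 1 - l)) v v')"
  proof (intro Ae.A.finsum_eqI nb_closed)
    fix l assume "l \<in> {..<a}"
    then have e: "dX (Suc i) = dX i + (a - 1 - l) + l" using False by (simp add: degree_Suc)
    show "nb (dX (Suc i)) d' u u' v v' \<star> (X1 [^]\<^sub>Ae l \<star> (Q d' \<bullet> X2) [^]\<^sub>Ae (a - 1 - l)) = nb (dX i) d' (u + l) (u' + (a - 1 - l)) v v'"
      using nb_closed XY_closed by (subst Ae.A.m_assoc[symmetric]) (simp_all only: e nb_X1_pow nb_X2_pow Ae.A.nat_pow_closed)
  qed
  finally show ?thesis using False by (simp add: Ae.A.strand_d_def)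
qed

lemma nb_DY: "nb d (dY (Suc j)) u u' v v' \<star> DY (Suc j) d = Ae.A.strand_d b j (%q q'. nb d (dY j) u u' q q') v v'"
proof (cases "even j")
  case True
  then show ?thesis using nb_closed XY_closed by (simp add: DY_def Ae.A.strand_d_def degree_Suc a_minus_def Ae.A.r_distr Ae.A.r_minus nb_Y1 nb_Y2)
next
  case False
  have "nb d (dY (Suc j)) u u' v v' \<star> DY (Suc j) d
    = (\<Oplus>\<^sub>Ae l\<in>{..<b}. nb d (dY (Suc j)) u u' v v' \<star> ((Q d \<bullet> Y1) [^]\<^sub>Ae l \<star> Y2 [^]\<^sub>Ae (b - 1 - l)))"
    using False nb_closed XY_closed by (simp add: DY_def Ae.A.finsum_rdistr)
  also have "... = (\<Oplus>\<^sub>Ae l\<in>{..<b}. nb d (dY j) u u' (v + l) (v' + (b - 1 - l)))"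
  proof (intro Ae.A.finsum_eqI nb_closed)
    fix l assume "l \<in> {..<b}"
    then have e: "dY (Suc j) = dY j + (b - 1 - l) + l" using False by (simp add: degree_Suc)
    show "nb d (dY (Suc j)) u u' v v' \<star> ((Q d \<bullet> Y1) [^]\<^sub>Ae l \<star> Y2 [^]\<^sub>Ae (b - 1 - l)) = nb d (dY j) u u' (v + l) (v' + (b - 1 - l))"
      using nb_closed XY_closed by (subst Ae.A.m_assoc[symmetric]) (simp_all only: e nb_Y1_pow nb_Y2_pow Ae.A.nat_pow_closed)
  qed
  finally show ?thesis using False by (simp add: Ae.A.strand_d_def)
qed

lemma linear_strand:
  assumes "linear f" "!!p p'. N p p' .: Ae" shows "f (Ae.A.strand_d m i N u u') = Ae.A.strand_d m i (%p p'. f (N p p')) u u'"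
    and "f (Ae.A.strand_h m i N u u') = Ae.A.strand_h m i (%p p'. f (N p p')) u u'"
  by (rule Ae.A.strand_hom[OF aE linearD(1,2)[OF assms(1)] assms(2)]; assumption)+

lemma mult_strand_h:
  assumes "W .: Ae" "!!p p'. N p p' .: Ae" shows "Ae.A.strand_h m i N u u' \<star> W = Ae.A.strand_h m i (%p p'. N p p' \<star> W) u u'"
  by (rule linear_strand(2)[OF linear_mult[OF linear_id assms(1)] assms(2)])

text \<open>Both sides vanish for exponents out of range, so later calculations with shifted
  exponents need no range conditions.\<close>

lemma lin_nb_all:
  assumes F: "!!u u' v v'. F u u' v v' .: Ae" and 0: "!!u u' v v'. u >= a | u' >= a | v >= b | v' >= b ==> F u u' v v' = \<zero>\<^sub>Ae"
  shows "lin d d' F (nb d d' u u' v v') = F u u' v v'"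
proof (cases "u < a & u' < a & v < b & v' < b")
  case True
  then show ?thesis by (intro lin_nb F) auto
next
  case False
  then show ?thesis using nb_zero[of u u' v v'] 0[of u u' v v'] linear_zero[OF linear_lin[OF F]] by auto
qed

section \<open>The contracting homotopy\<close>

definition sH :: "nat => nat => 'a env => 'a env"
  where "sH i j = lin (dX i) (dY j) (%u u' v v'. Ae.A.strand_h a i (%p p'. nb (dX (Suc i)) (dY j) p p' v v') u u')"

text \<open>On a tensor product the contraction is \<open>h_X \<otimes> 1 + s \<otimes> h_Y\<close>,
  where \<open>s\<close> is the augmentation of the X-resolution followed by its section and sends
  \<open>x^u \<otimes> x^u'\<close> to \<open>1 \<otimes> x^(u + u')\<close>. This is the second
  summand, so it lives in X-degree 0.\<close>

definition tH :: "nat => 'a env => 'a env" where "tH j = lin 0 (dY j) (%u u' v v'. Ae.A.strand_h b j (%q q'. nb 0 (dY (Suc j)) 0 (u + u') q q') v v')"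

lemma linear_sH: "linear (sH i j)" and linear_tH: "linear (tH j)"
  unfolding sH_def tH_def by (intro linear_lin Ae.A.strand_h_closed nb_closed)+

lemma strand_h_zero: "(!!p p'. p' >= u' ==> N p p' = \<zero>\<^sub>Ae) ==> Ae.A.strand_h m i N u u' = \<zero>\<^sub>Ae"
  by (simp add: Ae.A.strand_h_def)

lemma sH_nb: "sH i j (nb (dX i) (dY j) u u' v v') = Ae.A.strand_h a i (%p p'. nb (dX (Suc i)) (dY j) p p' v v') u u'"
  unfolding sH_def
proof (intro lin_nb_all Ae.A.strand_h_closed nb_closed)
  fix u u' v v' assume "u >= a | u' >= a | v >= b | v' >= b"
  then show "Ae.A.strand_h a i (%p p'. nb (dX (Suc i)) (dY j) p p' v v') u u' = \<zero>\<^sub>Ae"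
    using a2 by (cases "u >= a") (simp add: Ae.A.strand_h_def, intro strand_h_zero nb_zero, auto)
qed

lemma tH_nb: "tH j (nb 0 (dY j) u u' v v') = Ae.A.strand_h b j (%q q'. nb 0 (dY (Suc j)) 0 (u + u') q q') v v'"
  unfolding tH_def
proof (intro lin_nb_all Ae.A.strand_h_closed nb_closed)
  fix u u' v v' assume "u >= a | u' >= a | v >= b | v' >= b"
  then show "Ae.A.strand_h b j (%q q'. nb 0 (dY (Suc j)) 0 (u + u') q q') v v' = \<zero>\<^sub>Ae"
    using b2 by (cases "v >= b") (simp add: Ae.A.strand_h_def, intro strand_h_zero nb_zero, auto)
qed

lemma sH_contraction:
  assumes Z: "Z .: Ae" shows "sH (Suc i) j Z \<star> DX (Suc (Suc i)) (dY j) \<boxplus> sH i j (Z \<star> DX (Suc i) (dY j)) = Z"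
proof (rule linear_eqI_nb[OF _ linear_id _ Z])
  show "linear (%Z. sH (Suc i) j Z \<star> DX (Suc (Suc i)) (dY j) \<boxplus> sH i j (Z \<star> DX (Suc i) (dY j)))"
    by (intro linear_add linear_mult linear_mult' linear_sH DX_closed)
  fix u u' v v' assume u: "u < a"
  show "sH (Suc i) j (nb (dX (Suc i)) (dY j) u u' v v') \<star> DX (Suc (Suc i)) (dY j)
      \<boxplus> sH i j (nb (dX (Suc i)) (dY j) u u' v v' \<star> DX (Suc i) (dY j)) = nb (dX (Suc i)) (dY j) u u' v v'"
    using nb_closed u by (simp only: sH_nb nb_DX mult_strand_h DX_closed linear_strand[OF linear_sH]
      Ae.A.strand_contraction)
qed

text \<open>In X-degree 0 the X-contraction misses the projection to
  \<open>1 \<otimes> x^(u + u')\<close>, and the Y-contraction recovers exactly this part.\<close>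

lemma tH_contraction:
  assumes Z: "Z .: Ae"
  shows "(tH (Suc j) Z \<star> DY (Suc (Suc j)) 0 \<boxplus> tH j (Z \<star> DY (Suc j) 0)) \<boxplus> sH 0 (Suc j) Z \<star> DX 1 (dY (Suc j)) = Z"
proof (rule linear_eqI_nb[OF _ linear_id _ Z])
  show "linear (%Z. (tH (Suc j) Z \<star> DY (Suc (Suc j)) 0 \<boxplus> tH j (Z \<star> DY (Suc j) 0)) \<boxplus> sH 0 (Suc j) Z \<star> DX 1 (dY (Suc j)))"
    by (intro linear_add linear_mult linear_mult' linear_sH linear_tH DX_closed DY_closed)
  fix u u' v v' assume u: "u < a" and v: "v < b"
  have "sH 0 (Suc j) (nb 0 (dY (Suc j)) u u' v v') \<star> DX 1 (dY (Suc j))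
      = nb 0 (dY (Suc j)) u u' v v' \<boxminus> nb 0 (dY (Suc j)) 0 (u' + u) v v'" using sH_nb[of 0 "Suc j"] nb_DX[of 0] nb_closed u
    by (simp add: degree_0 mult_strand_h DX_closed Ae.A.strand_contraction0)
  moreover have "tH (Suc j) (nb 0 (dY (Suc j)) u u' v v') \<star> DY (Suc (Suc j)) 0
      \<boxplus> tH j (nb 0 (dY (Suc j)) u u' v v' \<star> DY (Suc j) 0) = nb 0 (dY (Suc j)) 0 (u' + u) v v'"
    using nb_closed v by (simp only: tH_nb nb_DY mult_strand_h DY_closed linear_strand[OF linear_tH]
      Ae.A.strand_contraction add.commute[of u])
  ultimately show "(tH (Suc j) (nb 0 (dY (Suc j)) u u' v v') \<star> DY (Suc (Suc j)) 0
      \<boxplus> tH j (nb 0 (dY (Suc j)) u u' v v' \<star> DY (Suc j) 0)) \<boxplus> sH 0 (Suc j) (nb 0 (dY (Suc j)) u u' v v') \<star> DX 1 (dY (Suc j))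
      = nb 0 (dY (Suc j)) u u' v v'" by (simp only: Ae.A.add_diff_cancel nb_closed)
qed

lemma linear_augment: "linear (%Z. tt \<one> (lact Z \<one>))"
  unfolding linear_def by (simp add: lact_closed lact_add lact_smult tt_closed tt_add_right tt_smult_right)

lemma contraction_base:
  assumes Z: "Z .: Ae" shows "(sH 0 0 Z \<star> DX 1 0 \<boxplus> tH 0 Z \<star> DY 1 0) \<boxplus> tt \<one> (lact Z \<one>) = Z"
proof (rule linear_eqI_nb[OF _ linear_id _ Z, of _ 0 0])
  show "linear (%Z. (sH 0 0 Z \<star> DX 1 0 \<boxplus> tH 0 Z \<star> DY 1 0) \<boxplus> tt \<one> (lact Z \<one>))"
    by (intro linear_add linear_mult linear_sH linear_tH linear_augment DX_closed DY_closed)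
  fix u u' v v' assume u: "u < a" and v: "v < b"
  let ?n = "nb 0 0"
  have "sH 0 0 (?n u u' v v') \<star> DX 1 0 = ?n u u' v v' \<boxminus> ?n 0 (u' + u) v v'" using sH_nb[of 0 0] nb_DX[of 0] nb_closed u
    by (simp add: degree_0 mult_strand_h DX_closed Ae.A.strand_contraction0)
  moreover have "tH 0 (?n u u' v v') \<star> DY 1 0 = ?n 0 (u' + u) v v' \<boxminus> ?n 0 (u' + u) 0 (v' + v)" using tH_nb[of 0] nb_DY[of _ 0] nb_closed v
    by (simp add: degree_0 mult_strand_h DY_closed Ae.A.strand_contraction0 add.commute[of u])
  moreover have "tt \<one> (lact (?n u u' v v') \<one>) = ?n 0 (u' + u) 0 (v' + v)"
  proof -
    have "lact (?n u u' v v') \<one> = Q (u' * v) \<odot> ((x [^] u \<otimes> y [^] v) \<otimes> (x [^] u' \<otimes> y [^] v'))"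
      using xp yp Q_closed by (simp add: nb_def lact_smult lact_tt tt_closed)
    also have "... = x [^] u \<otimes> (Q (u' * v) \<odot> (y [^] v \<otimes> x [^] u')) \<otimes> y [^] v'"
      using xp yp Q_closed by (simp add: smult_mult_left smult_mult_right A.m_assoc)
    also have "... = (x [^] u \<otimes> x [^] u') \<otimes> (y [^] v \<otimes> y [^] v')" using xp yp by (simp only: xp_yp[symmetric]) (simp add: A.m_assoc)
    also have "... = x [^] (u' + u) \<otimes> y [^] (v' + v)" using x y by (simp add: A.nat_pow_mult add.commute)
    finally show ?thesis using xp yp by (simp add: nb_def tt_closed)
  qed
  ultimately show "(sH 0 0 (?n u u' v v') \<star> DX 1 0 \<boxplus> tH 0 (?n u u' v v') \<star> DY 1 0) \<boxplus> tt \<one> (lact (?n u u' v v') \<one>) = ?n u u' v v'"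
    using nb_closed by (simp add: a_minus_def Ae.A.a_assoc Ae.A.l_neg Ae.A.r_neg1)
qed

text \<open>The projection in \<open>tH\<close> multiplies the two X-factors together, and the two
  terms of the commutator have the same product.\<close>

lemma tH_DX:
  assumes Z: "Z .: Ae" shows "tH j (Z \<star> DX 1 (dY j)) = \<zero>\<^sub>Ae"
proof (rule linear_eqI_nb[OF _ linear_const_zero _ Z, of _ 1 "dY j"])
  show "linear (%Z. tH j (Z \<star> DX 1 (dY j)))" by (intro linear_mult' linear_tH DX_closed)
  fix u u' v v'
  have "nb 1 (dY j) u u' v v' \<star> DX 1 (dY j) = nb 0 (dY j) (Suc u) u' v v' \<boxminus> nb 0 (dY j) u (Suc u') v v'"
    using nb_DX[of 0 "dY j" u u' v v'] by (simp add: degree_0 degree_Suc Ae.A.strand_d_def)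
  then show "tH j (nb 1 (dY j) u u' v v' \<star> DX 1 (dY j)) = \<zero>\<^sub>Ae"
    using nb_closed by (simp only: linear_diff[OF linear_tH] tH_nb add_Suc_shift)
      (simp add: a_minus_def Ae.A.r_neg Ae.A.strand_h_closed)
qed

lemma sH_DY:
  assumes Z: "Z .: Ae" shows "sH i j (Z \<star> DY (Suc j) (dX i)) = sH i (Suc j) Z \<star> DY (Suc j) (dX (Suc i))"
proof (rule linear_eqI_nb[OF _ _ _ Z, of _ _ "dX i" "dY (Suc j)"])
  show "linear (%Z. sH i j (Z \<star> DY (Suc j) (dX i)))" "linear (%Z. sH i (Suc j) Z \<star> DY (Suc j) (dX (Suc i)))"
    by (intro linear_mult linear_mult' linear_sH DY_closed)+
  fix u u' v v'
  show "sH i j (nb (dX i) (dY (Suc j)) u u' v v' \<star> DY (Suc j) (dX i))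
      = sH i (Suc j) (nb (dX i) (dY (Suc j)) u u' v v') \<star> DY (Suc j) (dX (Suc i))"
    using nb_closed by (simp only: sH_nb nb_DY mult_strand_h DY_closed linear_strand[OF linear_sH] Ae.A.strand_h_d_swap)
qed

text \<open>\<open>nb\<close> with all exponents zero is the unit, so identities between matrix
  entries are read off from the strand identities at a single basis element.\<close>

lemma DX_DX: "DX (Suc (Suc i)) d' \<star> DX (Suc i) d' = \<zero>\<^sub>Ae"
proof -
  have "DX (Suc (Suc i)) d' \<star> DX (Suc i) d' = (nb (dX (Suc (Suc i))) d' 0 0 0 0 \<star> DX (Suc (Suc i)) d') \<star> DX (Suc i) d'"
    by (simp add: nb_one DX_closed)
  also have "... = Ae.A.strand_d a (Suc i) (Ae.A.strand_d a i (%p p'. nb (dX i) d' p p' 0 0)) 0 0"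
    using nb_closed by (simp only: nb_DX linear_strand[OF linear_mult[OF linear_id]] DX_closed)
  also have "... = \<zero>\<^sub>Ae" using nb_closed nb_zero by (intro Ae.A.strand_dd) auto
  finally show ?thesis .
qed

lemma DY_DY: "DY (Suc (Suc j)) d \<star> DY (Suc j) d = \<zero>\<^sub>Ae"
proof -
  have "DY (Suc (Suc j)) d \<star> DY (Suc j) d = (nb d (dY (Suc (Suc j))) 0 0 0 0 \<star> DY (Suc (Suc j)) d) \<star> DY (Suc j) d"
    by (simp add: nb_one DY_closed)
  also have "... = Ae.A.strand_d b (Suc j) (Ae.A.strand_d b j (%q q'. nb d (dY j) 0 0 q q')) 0 0"
    using nb_closed by (simp only: nb_DY linear_strand[OF linear_mult[OF linear_id]] DY_closed)
  also have "... = \<zero>\<^sub>Ae" using nb_closed nb_zero by (intro Ae.A.strand_dd) auto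
  finally show ?thesis .
qed

lemma DX_DY: "DX (Suc i) (dY (Suc j)) \<star> DY (Suc j) (dX i) = DY (Suc j) (dX (Suc i)) \<star> DX (Suc i) (dY j)"
proof -
  let ?n = "nb (dX (Suc i)) (dY (Suc j)) 0 0 0 0"
  have "(?n \<star> DX (Suc i) (dY (Suc j))) \<star> DY (Suc j) (dX i) = (?n \<star> DY (Suc j) (dX (Suc i))) \<star> DX (Suc i) (dY j)"
    using nb_closed by (simp only: nb_DX nb_DY linear_strand[OF linear_mult[OF linear_id]] DX_closed DY_closed)
      (rule Ae.A.strand_d_d_swap)
  then show ?thesis by (simp add: nb_one DX_closed DY_closed)
qed

section \<open>The total complex\<close>

definition D :: "nat => nat => nat => 'a env" where "D n i j = (if i = Suc j then DX i (dY (n - i))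
    else if i = j & i < n then (if even i then DY (n - i) (dX i) else \<ominus>\<^sub>Ae DY (n - i) (dX i)) else \<zero>\<^sub>Ae)"

text \<open>Index \<open>i\<close> in degree \<open>n\<close> belongs to the generator of bidegree
  \<open>(i, n - i)\<close>. A component in X-degree 0 can only come from the Y-contraction, one in
  X-degree \<open>Suc j\<close> only from the X-contraction of component \<open>j\<close>.\<close>

definition hD :: "nat => (nat => 'a env) => nat => 'a env"
  where "hD n f i = (case i of 0 => tH n (f 0) | Suc j => if j <= n then sH j (n - j) (f j) else \<zero>\<^sub>Ae)"

lemma D_closed: "D n i j .: Ae"
  using DX_closed DY_closed by (simp add: D_def)

lemma D_column:
  assumes F: "!!i. F i .: Ae" and j: "j < Suc n"
  shows "(\<Oplus>\<^sub>Ae i\<in>{..<Suc (Suc n)}. F i \<star> D (Suc n) i j) = F (Suc j) \<star> DX (Suc j) (dY (n - j)) \<boxplus> F j \<star> D (Suc n) j j"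
proof -
  have "(\<Oplus>\<^sub>Ae i\<in>{..<Suc (Suc n)}. F i \<star> D (Suc n) i j) = (\<Oplus>\<^sub>Ae i\<in>{j, Suc j}. F i \<star> D (Suc n) i j)"
    using F D_closed j by (intro Ae.A.add.finprod_mono_neutral_cong_left[symmetric]) (auto simp: D_def simp del: set_eq_iff)
  also have "... = F j \<star> D (Suc n) j j \<boxplus> F (Suc j) \<star> D (Suc n) (Suc j) j" using F D_closed by simp
  finally show ?thesis using F D_closed DX_closed by (simp add: Ae.A.a_comm) (simp add: D_def)
qed

lemma D_Suc: "D (Suc n) (Suc j) j = DX (Suc j) (dY (n - j))"
  and D_diag: "j <= n ==> D (Suc n) j j = (if even j then DY (Suc (n - j)) (dX j) else \<ominus>\<^sub>Ae DY (Suc (n - j)) (dX j))"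
  by (simp_all add: D_def Suc_diff_le)

lemma hD_0: "hD n f 0 = tH n (f 0)"
  and hD_Suc: "j <= n ==> hD n f (Suc j) = sH j (n - j) (f j)" by (simp_all add: hD_def)

lemma one_nontrivial: "\<one> ~= \<zero>"
proof
  assume "\<one> = \<zero>"
  then have "cof (0, 0) \<one> = \<zero>\<^sub>K" by (simp add: cof_zero)
  moreover have "cof (0, 0) \<one> = \<one>\<^sub>K" using cof_M[of "(0, 0)" "(0, 0)"] a2 b2 by (simp add: M_def)
  ultimately show False using KF.one_not_zero by simp
qed

text \<open>The sign attached to \<open>DY\<close> alternates with the X-degree, which
  \<open>sH\<close> raises by one; so the mixed terms of the homotopy identity cancel.\<close>

lemma sH_DY_cancel:
  assumes j: "i <= n" and Z: "Z .: Ae"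
  shows "sH i (Suc (n - i)) Z \<star> D (Suc (Suc n)) (Suc i) (Suc i) \<boxplus> sH i (n - i) (Z \<star> D (Suc n) i i) = \<zero>\<^sub>Ae"
proof -
  let ?B = "DY (Suc (n - i)) (dX i)" and ?B' = "DY (Suc (n - i)) (dX (Suc i))"
  have c: "sH i (Suc (n - i)) Z .: Ae" "sH i (Suc (n - i)) Z \<star> ?B' .: Ae" "Z \<star> ?B .: Ae" using linearD(1)[OF linear_sH] Z DY_closed by auto
  have e: "D (Suc (Suc n)) (Suc i) (Suc i) = (if even i then \<ominus>\<^sub>Ae ?B' else ?B')" "D (Suc n) i i = (if even i then ?B else \<ominus>\<^sub>Ae ?B)"
    using j by (simp_all add: D_diag)
  show ?thesis unfolding e using c Z DY_closed
    by (cases "even i") (simp_all add: Ae.A.r_minus Ae.A.l_minus linear_neg[OF linear_sH] sH_DY Ae.A.l_neg Ae.A.r_neg)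
qed

lemma D_D:
  assumes i: "i < Suc (Suc (Suc n))" and k: "k < Suc n"
  shows "(\<Oplus>\<^sub>Ae j\<in>{..<Suc (Suc n)}. D (Suc (Suc n)) i j \<star> D (Suc n) j k) = \<zero>\<^sub>Ae"
proof -
  have "(\<Oplus>\<^sub>Ae j\<in>{..<Suc (Suc n)}. D (Suc (Suc n)) i j \<star> D (Suc n) j k)
      = D (Suc (Suc n)) i (Suc k) \<star> DX (Suc k) (dY (n - k)) \<boxplus> D (Suc (Suc n)) i k \<star> D (Suc n) k k"
    using k by (intro D_column D_closed) auto
  also have "... = \<zero>\<^sub>Ae"
  proof -
    consider "i = Suc (Suc k)" | "i = Suc k" | "i = k" | "i ~= k" "i ~= Suc k" "i ~= Suc (Suc k)" by auto
    then show ?thesis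
    proof cases
      case 1
      then show ?thesis using k D_Suc[of "Suc n" "Suc k"] DX_DX D_closed DX_closed by (simp add: D_def[of _ "Suc (Suc k)" k])
    next
      case 2
      have e: "D (Suc (Suc n)) (Suc k) k = DX (Suc k) (dY (Suc (n - k)))" using k by (simp add: D_Suc Suc_diff_le)
      have "D (Suc (Suc n)) (Suc k) (Suc k) = (if even k then \<ominus>\<^sub>Ae DY (Suc (n - k)) (dX (Suc k)) else DY (Suc (n - k)) (dX (Suc k)))"
        using k by (simp add: D_diag)
      moreover have "D (Suc n) k k = (if even k then DY (Suc (n - k)) (dX k) else \<ominus>\<^sub>Ae DY (Suc (n - k)) (dX k))" using k by (simp add: D_diag)
      ultimately show ?thesis unfolding 2 e using DX_closed DY_closed
        by (cases "even k") (simp_all add: Ae.A.r_minus Ae.A.l_minus DX_DY Ae.A.l_neg Ae.A.r_neg)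
    next
      case 3
      have "D (Suc (Suc n)) k k = (if even k then DY (Suc (Suc (n - k))) (dX k) else \<ominus>\<^sub>Ae DY (Suc (Suc (n - k))) (dX k))"
        using k by (simp add: D_diag Suc_diff_le)
      then have "D (Suc (Suc n)) k k \<star> D (Suc n) k k = \<zero>\<^sub>Ae" using k DY_closed by (simp add: D_diag Ae.A.r_minus Ae.A.l_minus DY_DY)
      then show ?thesis using 3 DX_closed by (simp add: D_def[of _ k "Suc k"])
    next
      case 4
      then have "D (Suc (Suc n)) i (Suc k) = \<zero>\<^sub>Ae" "D (Suc (Suc n)) i k = \<zero>\<^sub>Ae" by (auto simp: D_def)
      then show ?thesis using DX_closed D_closed by simp
    qed
  qed
  finally show ?thesis .
qed

lemma frob_resolution: "frob_resolution K A J M Mdual lam Suc D hD"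
proof (intro frob_resolution.intro frobenius frob_resolution_axioms.intro)
  have fm: "f i .: Ae" if "f .: (fmod Ae r)" for f r i using that by (auto simp: free_module_carrier)
  have hc: "hD n f i .: Ae" if "!!i. f i .: Ae" for n f i
    using that linearD(1)[OF linear_sH] linearD(1)[OF linear_tH] by (auto simp: hD_def split: nat.split simp del: set_eq_iff)
  show "D n i j .: Ae" for n i j by (rule D_closed)
  show "lact (D 1 i 0) \<one> = \<zero>" if "i < Suc 1" for i
  proof -
    have l: "lact (U \<boxminus> V) \<one> = lact U \<one> \<ominus> lact V \<one>" if "U .: Ae" "V .: Ae" for U V
      by (rule additive_diff[OF aE aA, where f = "%U. lact U \<one>"]) (use that in \<open>simp_all add: lact_closed lact_add\<close>)
    from that consider "i = 0" | "i = 1" by linarith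
    then show ?thesis by cases (simp_all add: D_def DX_def DY_def degree_0 l lact_smult lact_tt x y XY_closed Q_closed,
        (simp_all add: a_minus_def A.r_neg x y)?)
  qed
  show "hD n f \<in> carrier (fmod Ae (Suc (Suc n)))" if f: "f .: (fmod Ae (Suc n))" for f n unfolding fmod_carrier[OF Ae.ring_A]
    by (intro conjI allI impI hc fm[OF f]) (auto simp: hD_def split: nat.split)
  show "hD n (%i. f i \<boxplus> g i) = (%i. hD n f i \<boxplus> hD n g i)" if f: "f .: (fmod Ae (Suc n))" and g: "g .: (fmod Ae (Suc n))" for f g n
    using fm[OF f] fm[OF g] linearD(2)[OF linear_sH] linearD(2)[OF linear_tH] by (intro ext) (auto simp: hD_def split: nat.split simp del: set_eq_iff)
  show "hD n (%i. c \<bullet> f i) = (%i. c \<bullet> hD n f i)" if c: "c .: K" and f: "f .: (fmod Ae (Suc n))" for c f n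
    using c fm[OF f] linearD(3)[OF linear_sH] linearD(3)[OF linear_tH] by (intro ext) (auto simp: hD_def split: nat.split simp del: set_eq_iff)
  show "(\<Oplus>\<^sub>Ae i\<in>{..<Suc (Suc (Suc n))}. hD (Suc n) f i \<star> D (Suc (Suc n)) i j) \<boxplus>
      hD n (mat_map Ae (Suc (Suc n)) (Suc n) (D (Suc n)) f) j = f j" if f: "f \<in> carrier (fmod Ae (Suc (Suc n)))" and j: "j < Suc (Suc n)" for f n j
  proof -
    let ?g = "mat_map Ae (Suc (Suc n)) (Suc n) (D (Suc n)) f"
    have g: "?g k = f (Suc k) \<star> DX (Suc k) (dY (n - k)) \<boxplus> f k \<star> D (Suc n) k k" if "k <= n" for k
      using that D_column[OF fm[OF f], of k n] by (simp add: mat_map_def)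
    have gc: "f (Suc k) \<star> DX (Suc k) (dY (n - k)) .: Ae" "f k \<star> D (Suc n) k k .: Ae" for k using fm[OF f] DX_closed D_closed by auto
    have col: "(\<Oplus>\<^sub>Ae i\<in>{..<Suc (Suc (Suc n))}. hD (Suc n) f i \<star> D (Suc (Suc n)) i j)
       = hD (Suc n) f (Suc j) \<star> DX (Suc j) (dY (Suc n - j)) \<boxplus> hD (Suc n) f j \<star> D (Suc (Suc n)) j j"
      by (rule D_column[OF hc[OF fm[OF f]] j])
    note cs = linearD(1)[OF linear_sH] linearD(1)[OF linear_tH] fm[OF f] gc DX_closed DY_closed D_closed
    show ?thesis
    proof (cases j)
      case 0
      have "hD n ?g 0 = tH n (f 0 \<star> DY (Suc n) 0)" using g[of 0] gc[of 0] fm[OF f] linearD(1)[OF linear_tH] tH_DX[of "f 1" n]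
        by (simp add: hD_0 linearD(2)[OF linear_tH] D_diag degree_0 DY_closed)
      then show ?thesis unfolding col[unfolded 0] 0 using tH_contraction[of "f 0" n] cs by (simp add: hD_0 hD_Suc D_diag degree_0 Ae.A.a_ac)
    next
      \<comment> \<open>The terms with X-contraction and X-differential add up to
        \<open>f j\<close>, and the mixed ones cancel by \<open>sH_DY_cancel\<close>;
        \<open>rearr\<close> does the regrouping.\<close>
      case (Suc i)
      have i: "i <= n" using j Suc by simp
      have "hD n ?g j = sH i (n - i) (f j \<star> DX j (dY (n - i))) \<boxplus> sH i (n - i) (f i \<star> D (Suc n) i i)"
        using i gc[of i] by (simp add: Suc hD_Suc g linearD(2)[OF linear_sH])
      moreover have "sH j (n - i) (f j) \<star> DX (Suc j) (dY (n - i)) \<boxplus> sH i (n - i) (f j \<star> DX j (dY (n - i))) = f j"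
        using sH_contraction[of "f j" i "n - i"] fm[OF f] by (simp add: Suc)
      moreover have "sH i (Suc (n - i)) (f i) \<star> D (Suc (Suc n)) j j \<boxplus> sH i (n - i) (f i \<star> D (Suc n) i i) = \<zero>\<^sub>Ae"
        using sH_DY_cancel[OF i] fm[OF f] by (simp add: Suc)
      moreover have "hD (Suc n) f (Suc j) = sH j (n - i) (f j)" "hD (Suc n) f j = sH i (Suc (n - i)) (f i)" using i by (simp_all add: Suc hD_Suc Suc_diff_le)
      moreover have rearr: "[|p \<boxplus> r = w; p' \<boxplus> r' = \<zero>\<^sub>Ae; p .: Ae; p' .: Ae; r .: Ae; r' .: Ae|]
          ==> (p \<boxplus> p') \<boxplus> (r \<boxplus> r') = w" for p p' r r' w
      proof -
        assume a: "p \<boxplus> r = w" "p' \<boxplus> r' = \<zero>\<^sub>Ae" and c: "p .: Ae" "p' .: Ae" "r .: Ae" "r' .: Ae"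
        have "(p \<boxplus> p') \<boxplus> (r \<boxplus> r') = (p \<boxplus> r) \<boxplus> (p' \<boxplus> r')" using c by (simp only: Ae.A.a_ac Ae.A.a_closed)
        also have "... = w" unfolding a(2) using c a(1)[symmetric] by simp
        finally show ?thesis .
      qed
      ultimately show ?thesis unfolding col by (simp only: Suc diff_Suc_Suc, intro rearr) (use cs Suc in \<open>auto simp del: set_eq_iff\<close>)
    qed
  qed
  show "(\<Oplus>\<^sub>Ae i\<in>{..<Suc 1}. hD 0 f i \<star> D 1 i 0) \<boxplus> tt \<one> (lact (f 0) \<one>) = f 0" if f: "f .: (fmod Ae 1)" for f
  proof -
    have "(\<Oplus>\<^sub>Ae i\<in>{..<Suc 1}. hD 0 f i \<star> D 1 i 0) = sH 0 0 (f 0) \<star> DX 1 0 \<boxplus> tH 0 (f 0) \<star> DY 1 0"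
      using D_column[where F = "hD 0 f" and n = 0 and j = 0, OF hc[OF fm[OF f]]] by (simp add: hD_0 hD_Suc D_diag degree_0)
    then show ?thesis using contraction_base[OF fm[OF f]] by simp
  qed
qed (use one_nontrivial D_D in auto)

end

section \<open>Complexes built from pairs of basis elements\<close>

text \<open>
  The labels \<open>x\<^sub>0\<close>, \<open>lo\<close> and \<open>hi\<close> describe a complex with one unpaired basis element and
  pairs \<open>hi \<rightarrow> lo\<close>. In the tensor product of two of these, the homology is spanned by the basis
  elements on which the whole differential vanishes.
\<close>

locale two_strands = field K for K :: "('k, 'e) ring_scheme" (structure) +
  fixes lo hi :: "'x => bool" and up dn :: "'x => 'x" and x0 :: 'x and lo' hi' :: "'y => bool" and up' dn' :: "'y => 'y" and y0 :: 'y
    and cx cy :: "'x => 'y => 'k" and sg :: "'x => 'k"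
  assumes lo: "lo X ==> hi (up X) & dn (up X) = X" and hi: "hi X ==> lo (dn X) & up (dn X) = X" and lohi: "~ (lo X & hi X)" "~ lo x0" "~ hi x0"
    and lo': "lo' Y ==> hi' (up' Y) & dn' (up' Y) = Y" and hi': "hi' Y ==> lo' (dn' Y) & up' (dn' Y) = Y" and lohi': "~ (lo' Y & hi' Y)" "~ lo' y0" "~ hi' y0"
    and cx: "cx X Y .: K" and cy: "cy X Y .: K" and sg: "sg X .: K" and cx_up: "lo X ==> cx (up X) Y = cx X Y" "lo' Y ==> cx X (up' Y) = cx X Y"
    and cy_up: "lo X ==> cy (up X) Y = cy X Y" "lo' Y ==> cy X (up' Y) = cy X Y" and sg_up: "lo X ==> sg (up X) = \<ominus> sg X" and sg0: "sg x0 = \<one>"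
    and cx_nonzero: "[|lo X | hi X; lo' Y | hi' Y|] ==> cx X Y ~= \<zero>"
begin

definition bd :: "('x \<times> 'y => 'k) => 'x \<times> 'y => 'k" where "bd F = (%(X, Y). (if lo X then cx X Y \<otimes> F (up X, Y) else \<zero>) \<oplus>
    (if lo' Y then sg X \<otimes> (cy X Y \<otimes> F (X, up' Y)) else \<zero>))"

definition surv :: "('x \<times> 'y) set" where "surv = {(X, Y). X = x0 & Y = y0 | (lo X | hi X) & Y = y0 & cx X Y = \<zero>
    | X = x0 & (lo' Y | hi' Y) & cy X Y = \<zero>}"

definition iv :: "'k => 'k" where "iv z = (if z = \<zero> then \<zero> else inv z)"

text \<open>Contracts along the X-arrows, and along the Y-arrows only over the unpaired
  \<open>x0\<close>. By \<open>cx_nonzero\<close> the X-arrows are invertible whenever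
  \<open>Y\<close> belongs to a pair. As \<open>iv\<close> sends 0 to 0, arrows with coefficient 0
  are skipped.\<close>

definition hb :: "('x \<times> 'y => 'k) => 'x \<times> 'y => 'k" where "hb F = (%(X, Y). if hi X then iv (cx X Y) \<otimes> F (dn X, Y)
    else if X = x0 & hi' Y then iv (cy X Y) \<otimes> F (X, dn' Y) else \<zero>)"

lemma iv: "z .: K ==> iv z .: K" "[|z .: K; z ~= \<zero>|] ==> z \<otimes> iv z = \<one>"
  by (auto simp: iv_def field_Units)

lemma iv_cancel:
  assumes "z .: K" "z ~= \<zero>" "w .: K" shows "z \<otimes> (iv z \<otimes> w) = w" "iv z \<otimes> (z \<otimes> w) = w"
proof -
  show "z \<otimes> (iv z \<otimes> w) = w" using assms iv[of z] by (simp add: m_assoc[symmetric])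
  then show "iv z \<otimes> (z \<otimes> w) = w" using assms iv[of z] by (simp add: m_lcomm)
qed

lemma hb_closed: "(!!P. F P .: K) ==> hb F P .: K"
  by (cases P) (simp add: hb_def iv cx cy)

lemma bd_surv: "[|!!P. F P .: K; P \<in> surv|] ==> bd F P = \<zero>"
  using lohi lohi' sg by (cases P) (auto simp: surv_def bd_def)

lemma bd_unit_surv:
  assumes "w \<in> surv" shows "bd (%P. if P = w then \<one> else \<zero>) P = \<zero>"
proof -
  obtain X Y X' Y' where P: "P = (X, Y)" "w = (X', Y')" by (cases P; cases w)
  have "cx X Y = \<zero>" if "lo X" "up X = X'" "Y = Y'" using assms that lo[of X] lohi cx_up(1)[of X Y] lohi' by (auto simp: surv_def P)
  moreover have "cy X Y = \<zero>" if "lo' Y" "up' Y = Y'" "X = X'" using assms that lo'[of Y] lohi' cy_up(2)[of Y X] lohi by (auto simp: surv_def P)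
  ultimately show ?thesis using cx cy sg by (auto simp: bd_def P)
qed

text \<open>At the lower end of an invertible X-arrow the identity is immediate. At the upper end
  \<open>F\<close> is determined by its neighbour through the cycle condition at
  \<open>(dn X, Y)\<close>. Over \<open>x0\<close> the same argument runs along the
  Y-arrows.\<close>

lemma bd_hb:
  assumes F: "!!P. F P .: K" and valid: "!!X Y. ~ (X = x0 | lo X | hi X) | ~ (Y = y0 | lo' Y | hi' Y) ==> F (X, Y) = \<zero>"
    and cyc: "!!P. bd F P = \<zero>" and 0: "!!P. P \<in> surv ==> F P = \<zero>" shows "bd (hb F) P = F P"
proof -
  obtain X Y where P: "P = (X, Y)" by (cases P)
  have ivF: "iv (cx X Y) \<otimes> F p .: K" "iv (cy X Y) \<otimes> F p .: K" for p X Y using iv cx cy F by auto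
  have cx0: "(Y = y0 | ~ (Y = y0 | lo' Y | hi' Y)) & F (X, Y) = \<zero>" if "lo X | hi X" "cx X Y = \<zero>"
    using that cx_nonzero[of X Y] valid[of X Y] 0[of "(X, Y)"] by (auto simp: surv_def)
  consider "lo X" | "hi X" | "X = x0" | "~ (X = x0 | lo X | hi X)" by blast
  then show ?thesis
  proof cases
    case 1
    then have "bd (hb F) P = cx X Y \<otimes> (iv (cx X Y) \<otimes> F (X, Y))"
      using lo[OF 1] lohi cx_up(1)[OF 1] ivF cx cy sg by (auto simp: bd_def hb_def P)
    then show ?thesis using cx0 1 F iv_cancel(1)[OF cx[of X Y] _ F] iv(1)[OF cx[of X Y]] by (cases "cx X Y = \<zero>") (auto simp: P)
  next
    case 2
    have d: "lo (dn X)" "up (dn X) = X" using hi[OF 2] by auto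
    have e: "cx (dn X) Y = cx X Y" "cy (dn X) Y = cy X Y" "sg X = \<ominus> sg (dn X)" using cx_up(1)[OF d(1)] cy_up(1)[OF d(1)] sg_up[OF d(1)] d(2) by auto
    let ?G = "F (dn X, up' Y)"
    have l: "bd (hb F) P = (if lo' Y then sg X \<otimes> (cy X Y \<otimes> (iv (cx X Y) \<otimes> ?G)) else \<zero>)"
      using 2 lohi cx_up(2)[of Y X] ivF cy sg by (auto simp: bd_def hb_def P)
    have c: "cx X Y \<otimes> F (X, Y) \<oplus> (if lo' Y then sg (dn X) \<otimes> (cy X Y \<otimes> ?G) else \<zero>) = \<zero>"
      using cyc[of "(dn X, Y)"] unfolding bd_def by (auto simp: d e(1,2) split: if_splits)
    show ?thesis
    proof (cases "cx X Y = \<zero>")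
      case True
      then show ?thesis using cx0 2 l lohi' by (auto simp: P)
    next
      case False
      have "cx X Y \<otimes> F (X, Y) = (if lo' Y then sg X \<otimes> (cy X Y \<otimes> ?G) else \<zero>)"
      proof (cases "lo' Y")
        case True
        have k: "cx X Y \<otimes> F (X, Y) .: K" "sg (dn X) \<otimes> (cy X Y \<otimes> ?G) .: K" using cx cy sg F by auto
        have "cx X Y \<otimes> F (X, Y) = \<ominus> (sg (dn X) \<otimes> (cy X Y \<otimes> ?G))" using minus_equality[OF _ k(2,1)] c True by simp
        then show ?thesis using True e(3) cx cy sg F by (simp add: l_minus)
      next
        case False
        then show ?thesis using c F cx by simp
      qed
      then have "iv (cx X Y) \<otimes> (cx X Y \<otimes> F (X, Y)) = bd (hb F) P" using l cx cy sg F iv by (auto simp: m_ac)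
      then show ?thesis using iv_cancel(2)[OF cx[of X Y] False F] P by simp
    qed
  next
    case 3
    have l: "bd (hb F) P = (if lo' Y then cy X Y \<otimes> (iv (cy X Y) \<otimes> F (X, Y)) else \<zero>)"
      using 3 lohi lo'[of Y] cy_up(2)[of Y X] ivF cy sg0 by (auto simp: bd_def hb_def P)
    show ?thesis
    proof (cases "lo' Y")
      case True
      then show ?thesis using 3 l F iv_cancel(1)[OF cy[of X Y] _ F] 0[of "(X, Y)"] iv(1)[OF cy[of X Y]] by (cases "cy X Y = \<zero>") (auto simp: P surv_def)
    next
      case False
      have "F (X, Y) = \<zero>"
      proof (cases "hi' Y")
        case True
        have d: "lo' (dn' Y)" "up' (dn' Y) = Y" using hi'[OF True] by auto
        have "cy X (dn' Y) \<otimes> F (X, Y) = \<zero>" using cyc[of "(X, dn' Y)"] d 3 lohi sg0 cy F by (simp add: bd_def)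
        then have "cy X Y = \<zero> | F (X, Y) = \<zero>" using cy_up(2)[OF d(1), of X] d(2) integral[OF _ cy F] by simp
        then show ?thesis using 0[of "(X, Y)"] True 3 by (auto simp: surv_def)
      next
        case h: False
        then show ?thesis using 0[of "(X, Y)"] valid[of X Y] False 3 by (cases "Y = y0") (auto simp: surv_def)
      qed
      then show ?thesis using l False P by simp
    qed
  next
    case 4
    then have "bd (hb F) P = \<zero>" using sg cy by (auto simp: bd_def hb_def P)
    then show ?thesis using valid[of X Y] 4 P by simp
  qed
qed

end

section \<open>Coordinates on the bar complex of the quantum complete intersection\<close>

text \<open>A label \<open>(i, u)\<close> stands for \<open>x^u\<close> in homological degree
  \<open>i\<close>. After tensoring with \<open>A\<close>, the differential from degree
  \<open>i + 1\<close> to \<open>i\<close> raises the exponent by \<open>st m i\<close>: by 1 for a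
  commutator, by \<open>m - 1\<close> for a norm element.\<close>

definition st :: "nat => nat => nat" where "st m i = (if even i then 1 else m - 1)"
definition slo :: "nat => nat \<times> nat => bool" where "slo m X \<longleftrightarrow> st m (fst X) <= snd X & snd X < m"
definition shi :: "nat => nat \<times> nat => bool" where "shi m X \<longleftrightarrow> fst X > 0 & snd X + st m (fst X - 1) < m"
definition sUp :: "nat => nat \<times> nat => nat \<times> nat" where "sUp m X = (Suc (fst X), snd X - st m (fst X))"
definition sDn :: "nat => nat \<times> nat => nat \<times> nat" where "sDn m X = (fst X - 1, snd X + st m (fst X - 1))"

text \<open>Consecutive step lengths add up to \<open>m\<close>, so a label in range other than
  \<open>(0, 0)\<close> is either the target or the source of exactly one arrow.\<close>

lemma strand_labels:
  assumes "m >= 2" shows "slo m X ==> shi m (sUp m X) & sDn m (sUp m X) = X" "shi m X ==> slo m (sDn m X) & sUp m (sDn m X) = X"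
    "~ (slo m X & shi m X)" "~ slo m (0, 0)" "~ shi m (0, 0)"
    "X = (0, 0) | slo m X | shi m X \<longleftrightarrow> snd X < m" using assms by (cases X; auto simp: slo_def shi_def sUp_def sDn_def st_def; presburger)+

text \<open>The degree of the lower end of the arrow through \<open>X\<close>; its parity decides
  between the two kinds of coefficients.\<close>

definition styp :: "nat => nat \<times> nat => nat" where "styp m X = (if slo m X then fst X else fst X - 1)"

lemma styp_up: "[|m >= 2; slo m X|] ==> styp m (sUp m X) = styp m X"
  using strand_labels(1)[of m X] strand_labels(3)[of m "sUp m X"] by (auto simp: styp_def) (simp add: sUp_def)

lemma styp_dn: "[|m >= 2; shi m X|] ==> styp m (sDn m X) = styp m X"
  using strand_labels(2)[of m X] strand_labels(3)[of m X] by (auto simp: styp_def) (simp add: sDn_def)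

lemma styp_even: "[|m >= 2; snd X < m; X ~= (0, 0)|] ==> even (styp m X) \<longleftrightarrow> (if even (fst X) then snd X ~= 0 else snd X ~= m - 1)"
  by (cases X) (auto simp: styp_def slo_def st_def)

context qalg
begin

definition wX :: "nat \<times> nat => nat" where "wX X = dX (fst X) + snd X"
definition wY :: "nat \<times> nat => nat" where "wY Y = dY (fst Y) + snd Y"

lemma weight_up: "slo a X ==> wX (sUp a X) = wX X" "slo b Y ==> wY (sUp b Y) = wY Y"
  by (auto simp: wX_def wY_def slo_def sUp_def st_def degree_Suc)

text \<open>Coefficients of X-arrows depend on the Y-weight and conversely, so by positivity a
  generic \<open>q\<close> makes every arrow off the axes invertible.\<close>

lemma weight_pos: "slo a X | shi a X ==> wX X > 0" "slo b Y | shi b Y ==> wY Y > 0"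
  using a2 b2 by (auto simp: wX_def wY_def slo_def shi_def st_def dX_def dY_def elim!: oddE split: if_splits)

definition kx :: "nat => nat => 'k"
  where "kx i t = (if even i then \<one>\<^sub>K \<ominus>\<^sub>K Q t else \<Oplus>\<^sub>K l\<in>{..<a}. Q (t * (a - 1 - l)))"
definition ky :: "nat => nat => 'k" where "ky j s = (if even j then Q s \<ominus>\<^sub>K \<one>\<^sub>K else \<Oplus>\<^sub>K l\<in>{..<b}. Q (s * l))"

lemma kx_closed: "kx i t .: K" and ky_closed: "ky j s .: K"
  using Q_closed by (auto simp: kx_def ky_def)

lemma ract_M_X1: "ract (M (u, v)) X1 = M (Suc u, v)"
  and ract_M_X2: "ract (M (u, v)) (Q d' \<bullet> X2) = Q (d' + v) \<odot> M (Suc u, v)"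
  and ract_M_Y1: "ract (M (u, v)) (Q d \<bullet> Y1) = Q (d + u) \<odot> M (u, Suc v)" and ract_M_Y2: "ract (M (u, v)) Y2 = M (u, Suc v)"
proof -
  have g: "M (1, 0) = x" "M (0, 1) = y" using x y by (simp_all add: M_def)
  have m: "M (u, v) \<otimes> x = M (Suc u, v)" "x \<otimes> M (u, v) = Q v \<odot> M (Suc u, v)"
    "M (u, v) \<otimes> y = Q u \<odot> M (u, Suc v)" "y \<otimes> M (u, v) = M (u, Suc v)"
    using M_mult[of u v 1 0] M_mult[of 1 0 u v] M_mult[of u v 0 1] M_mult[of 0 1 u v] M_closed unfolding g by simp_all
  note s = M_closed XY_closed x y Q_closed m ract_tt ract_smult V.smult_assoc1[symmetric] Q_add
  show "ract (M (u, v)) X1 = M (Suc u, v)" "ract (M (u, v)) (Q d' \<bullet> X2) = Q (d' + v) \<odot> M (Suc u, v)"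
    "ract (M (u, v)) (Q d \<bullet> Y1) = Q (d + u) \<odot> M (u, Suc v)" "ract (M (u, v)) Y2 = M (u, Suc v)" by (simp_all add: s)
qed

lemma ract_power:
  assumes U: "U .: Ae" and e: "!!n. ract (N n) U = Q t \<odot> N (Suc n)" and N: "!!n. N n .: A"
  shows "ract (N n) (U [^]\<^sub>Ae (l::nat)) = Q (t * l) \<odot> N (n + l)"
proof (induction l)
  case 0
  then show ?case using N by (simp add: ract_one)
next
  case (Suc l)
  then show ?case using U N Q_closed by (simp add: ract_mult ract_smult e V.smult_assoc1[symmetric] Q_add[symmetric] add.commute)
qed

lemma ract_finsum: "[|z .: A; !!i. i \<in> I ==> U i .: Ae|] ==> ract z (\<Oplus>\<^sub>Ae i\<in>I. U i) = (\<Oplus>i\<in>I. ract z (U i))"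
  by (rule additive_finsum[OF aE aA, where f = "ract z"]) (simp_all add: ract_closed ract_add)

lemma ract_diff: "[|z .: A; U .: Ae; V .: Ae|] ==> ract z (U \<boxminus> V) = ract z U \<ominus> ract z V"
  by (rule additive_diff[OF aE aA, where f = "ract z"]) (simp_all add: ract_closed ract_add)

lemma smult_diff: "[|c .: K; d .: K; z .: A|] ==> c \<odot> z \<ominus> d \<odot> z = (c \<ominus>\<^sub>K d) \<odot> z"
  by (simp add: a_minus_def V.smult_l_distr V.smult_l_minus)

lemma smult_finsum: "[|!!i. i \<in> I ==> c i .: K; z .: A|] ==> (\<Oplus>\<^sub>K i\<in>I. c i) \<odot> z = (\<Oplus>i\<in>I. c i \<odot> z)"
  by (rule additive_finsum[OF V.R.is_abelian_group aA, where f = "%c. c \<odot> z"]) (simp_all add: V.smult_l_distr)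

lemma ract_M_DX: "ract (M (u, v)) (DX (Suc i) d') = kx i (d' + v) \<odot> M (u + st a i, v)"
proof (cases "even i")
  case True
  have "ract (M (u, v)) (DX (Suc i) d') = \<one>\<^sub>K \<odot> M (Suc u, v) \<ominus> Q (d' + v) \<odot> M (Suc u, v)"
    using True M_closed XY_closed by (simp add: DX_def ract_diff ract_M_X1 ract_M_X2)
  then show ?thesis using True M_closed Q_closed by (simp only: smult_diff V.R.one_closed) (simp add: kx_def st_def)
next
  case False
  have 1: "ract (M (u, v)) (X1 [^]\<^sub>Ae l \<star> (Q d' \<bullet> X2) [^]\<^sub>Ae (a - 1 - l)) = Q ((d' + v) * (a - 1 - l)) \<odot> M (u + (a - 1), v)"
    if "l < a" for l using ract_power[where U = X1 and N = "%u. M (u, v)" and t = 0 and n = u and l = l]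
      ract_power[where U = "Q d' \<bullet> X2" and N = "%u. M (u, v)" and t = "d' + v" and n = "u + l" and l = "a - 1 - l"]
      that M_closed XY_closed by (simp add: ract_mult ract_M_X1 ract_M_X2)
  have "ract (M (u, v)) (DX (Suc i) d') = (\<Oplus>l\<in>{..<a}. ract (M (u, v)) (X1 [^]\<^sub>Ae l \<star> (Q d' \<bullet> X2) [^]\<^sub>Ae (a - 1 - l)))"
    using False M_closed XY_closed by (simp add: DX_def ract_finsum)
  also have "... = (\<Oplus>l\<in>{..<a}. Q ((d' + v) * (a - 1 - l)) \<odot> M (u + (a - 1), v))"
    using M_closed Q_closed 1 by (intro A.finsum_eqI) (simp_all only: lessThan_iff V.smult_closed)
  also have "... = kx i (d' + v) \<odot> M (u + st a i, v)" using False M_closed Q_closed by (simp add: smult_finsum kx_def st_def)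
  finally show ?thesis .
qed

lemma ract_M_DY: "ract (M (u, v)) (DY (Suc j) d) = ky j (d + u) \<odot> M (u, v + st b j)"
proof (cases "even j")
  case True
  have "ract (M (u, v)) (DY (Suc j) d) = Q (d + u) \<odot> M (u, Suc v) \<ominus> \<one>\<^sub>K \<odot> M (u, Suc v)"
    using True M_closed XY_closed by (simp add: DY_def ract_diff ract_M_Y1 ract_M_Y2)
  then show ?thesis using True M_closed Q_closed by (simp only: smult_diff V.R.one_closed) (simp add: ky_def st_def)
next
  case False
  have 1: "ract (M (u, v)) ((Q d \<bullet> Y1) [^]\<^sub>Ae l \<star> Y2 [^]\<^sub>Ae (b - 1 - l)) = Q ((d + u) * l) \<odot> M (u, v + (b - 1))"
    if "l < b" for l using ract_power[where U = "Q d \<bullet> Y1" and N = "%v. M (u, v)" and t = "d + u" and n = v and l = l]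
      ract_power[where U = Y2 and N = "%v. M (u, v)" and t = 0 and n = "v + l" and l = "b - 1 - l"]
      that M_closed XY_closed Q_closed by (simp add: ract_mult ract_smult ract_M_Y1 ract_M_Y2)
  have "ract (M (u, v)) (DY (Suc j) d) = (\<Oplus>l\<in>{..<b}. ract (M (u, v)) ((Q d \<bullet> Y1) [^]\<^sub>Ae l \<star> Y2 [^]\<^sub>Ae (b - 1 - l)))"
    using False M_closed XY_closed by (simp add: DY_def ract_finsum)
  also have "... = (\<Oplus>l\<in>{..<b}. Q ((d + u) * l) \<odot> M (u, v + (b - 1)))"
    using M_closed Q_closed 1 by (intro A.finsum_eqI) (simp_all only: lessThan_iff V.smult_closed)
  also have "... = ky j (d + u) \<odot> M (u, v + st b j)" using False M_closed Q_closed by (simp add: smult_finsum ky_def st_def)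
  finally show ?thesis .
qed

text \<open>Coordinates pull back along the shift of exponents: an exponent below the step length is
  not reached, hence the case distinction.\<close>

lemma cof_ract_shift:
  assumes U: "U .: Ae" and e: "!!u v. ract (M (u, v)) U = c u v \<odot> M (u + s, v + t)" and c: "!!u v. c u v .: K" and p: "u < a" "v < b" and z: "z .: A"
  shows "cof (u, v) (ract z U) = (if s <= u & t <= v then c (u - s) (v - t) \<otimes>\<^sub>K cof (u - s, v - t) z else \<zero>\<^sub>K)"
proof (rule linear_eqI[OF module_K _ _ _ _ _ _ _ z])
  fix p' assume "p' \<in> J"
  then obtain u' v' where p': "p' = (u', v')" "u' < a" "v' < b" by auto
  have "cof (u, v) (ract (M p') U) = c u' v' \<otimes>\<^sub>K cof (u, v) (M (u' + s, v' + t))" using c M_closed by (simp add: p' e cof_smult)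
  also have "cof (u, v) (M (u' + s, v' + t)) = (if u = u' + s & v = v' + t then \<one>\<^sub>K else \<zero>\<^sub>K)"
    using p p' cof_M[of "(u, v)" "(u' + s, v' + t)"] M_zero[of "u' + s" "v' + t"] by (cases "u' + s < a & v' + t < b") (auto simp: cof_zero not_less)
  finally show "cof (u, v) (ract (M p') U) = (if s <= u & t <= v then c (u - s) (v - t) \<otimes>\<^sub>K cof (u - s, v - t) (M p') else \<zero>\<^sub>K)"
    using p p' c cof_M[of "(u - s, v - t)" p'] less_imp_diff_less[OF p(1), of s] less_imp_diff_less[OF p(2), of t] by auto
qed (use U c in \<open>simp_all add: left_regular_def ract_closed ract_add_left ract_smult cof_closed cof_add cof_smult V.R.r_distr V.R.m_lcomm\<close>)

end

section \<open>Homology of the bar complex\<close>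

locale qalg_generic = qalg K A a b q x y cof
  for K :: "('k, 'e) ring_scheme" and A :: "('k, 'a) module" (structure) and a b q x y cof +
  assumes generic: "m > 0 ==> Q m ~= \<one>\<^sub>K"
begin

sublocale FR: frob_resolution K A J M Mdual lam Suc D hD by (rule frob_resolution)

lemma geometric:
  "(\<one>\<^sub>K \<ominus>\<^sub>K Q t) \<otimes>\<^sub>K (\<Oplus>\<^sub>K l\<in>{..<m}. Q (t * l)) = \<one>\<^sub>K \<ominus>\<^sub>K Q (t * m)"
proof -
  have "(\<one>\<^sub>K \<ominus>\<^sub>K Q t) \<otimes>\<^sub>K (\<Oplus>\<^sub>K l\<in>{..<m}. Q (t * l)) = (\<Oplus>\<^sub>K l\<in>{..<m}. (\<one>\<^sub>K \<ominus>\<^sub>K Q t) \<otimes>\<^sub>K Q (t * l))"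
    using Q_closed by (simp add: V.R.finsum_rdistr)
  also have "... = (\<Oplus>\<^sub>K l\<in>{..<m}. Q (t * l) \<ominus>\<^sub>K Q (t * Suc l))"
    using Q_closed by (intro V.R.finsum_eqI) (simp_all add: a_minus_def V.R.l_distr V.R.l_minus Q_add)
  also have "... = Q (t * 0) \<ominus>\<^sub>K Q (t * m)" by (rule V.R.finsum_telescope) (rule Q_closed)
  finally show ?thesis by simp
qed

lemma one_minus_Q: assumes "t > 0" shows "\<one>\<^sub>K \<ominus>\<^sub>K Q t ~= \<zero>\<^sub>K"
proof
  assume "\<one>\<^sub>K \<ominus>\<^sub>K Q t = \<zero>\<^sub>K"
  moreover have "(\<one>\<^sub>K \<ominus>\<^sub>K Q t) \<oplus>\<^sub>K Q t = \<one>\<^sub>K" using Q_closed by (simp add: a_minus_def V.R.a_assoc V.R.l_neg)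
  ultimately show False using generic[OF assms] Q_closed[of t] by simp
qed

lemma geometric_nonzero: "[|t > 0; m > 0|] ==> (\<Oplus>\<^sub>K l\<in>{..<m}. Q (t * l)) ~= \<zero>\<^sub>K"
proof
  assume t: "t > 0" "m > 0" and 0: "(\<Oplus>\<^sub>K l\<in>{..<m}. Q (t * l)) = \<zero>\<^sub>K"
  have "\<one>\<^sub>K \<ominus>\<^sub>K Q (t * m) = \<zero>\<^sub>K" using geometric[of t m] Q_closed[of t] unfolding 0 by simp
  then show False using one_minus_Q[of "t * m"] t by simp
qed

lemma kx_eq: "kx i t = (if even i then \<one>\<^sub>K \<ominus>\<^sub>K Q t else \<Oplus>\<^sub>K l\<in>{..<a}. Q (t * l))"
  using a2 Q_closed V.R.finsum_reverse[of "a - 1" "%l. Q (t * l)"] by (simp add: kx_def)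

lemma kx_nonzero: "t > 0 ==> kx i t ~= \<zero>\<^sub>K"
  using a2 one_minus_Q geometric_nonzero by (simp add: kx_eq)

lemma kx_0: "kx i 0 = (if even i then \<zero>\<^sub>K else [a] \<cdot>\<^sub>K \<one>\<^sub>K)"
  and ky_0: "ky j 0 = (if even j then \<zero>\<^sub>K else [b] \<cdot>\<^sub>K \<one>\<^sub>K)"
  by (simp_all add: kx_eq ky_def a_minus_def V.R.r_neg V.R.add.finprod_const)

definition cX :: "nat \<times> nat => nat \<times> nat => 'k" where "cX X Y = kx (styp a X) (wY Y)"
definition cY :: "nat \<times> nat => nat \<times> nat => 'k" where "cY X Y = ky (styp b Y) (wX X)"
definition sgn :: "nat \<times> nat => 'k" where "sgn X = (if even (fst X) then \<one>\<^sub>K else \<ominus>\<^sub>K \<one>\<^sub>K)"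

lemma weight_dn: "shi a X ==> wX (sDn a X) = wX X" "shi b Y ==> wY (sDn b Y) = wY Y"
  using weight_up strand_labels(2)[OF a2] strand_labels(2)[OF b2] by metis+

lemmas sl = strand_labels(1-5)[OF a2] strand_labels(1-5)[OF b2]

lemma cX_closed: "cX X Y .: K" and cY_closed: "cY X Y .: K" and sgn_closed: "sgn X .: K"
  by (simp_all add: cX_def cY_def sgn_def kx_closed ky_closed)

lemma cX_nonzero: "slo b Y | shi b Y ==> cX X Y ~= \<zero>\<^sub>K"
  unfolding cX_def by (intro kx_nonzero weight_pos)

sublocale P: two_strands K "slo a" "shi a" "sUp a" "sDn a" "(0, 0)" "slo b" "shi b" "sUp b" "sDn b" "(0, 0)" cX cY sgn
proof unfold_locales
  show "cX X Y ~= \<zero>\<^sub>K" if "slo b Y | shi b Y" for X Y using that by (rule cX_nonzero)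
  show "sgn (sUp a X) = \<ominus>\<^sub>K sgn X" for X by (simp add: sgn_def sUp_def)
qed (simp_all add: sl cX_closed cY_closed sgn_closed, simp_all add: cX_def cY_def sgn_def weight_up styp_up a2 b2)

text \<open>In negative degrees the differential is the transpose of the positive one: lower and
  upper ends trade places and the coefficients stay, so the survivors are the same.\<close>

sublocale N: two_strands K "shi a" "slo a" "sDn a" "sUp a" "(0, 0)" "shi b" "slo b" "sDn b" "sUp b" "(0, 0)" cX cY sgn
proof unfold_locales
  show "cX X Y ~= \<zero>\<^sub>K" if "shi b Y | slo b Y" for X Y using that cX_nonzero[of Y X] by blast
  show "sgn (sDn a X) = \<ominus>\<^sub>K sgn X" if "shi a X" for X using that by (cases X) (auto simp: sgn_def sDn_def shi_def)
  show "~ (shi a X & slo a X)" "~ (shi b Y & slo b Y)" for X Y using sl by blast+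
qed (simp_all add: sl cX_closed cY_closed sgn_closed, simp_all add: cX_def cY_def sgn_def weight_dn styp_dn a2 b2)

lemma surv_eq: "N.surv = P.surv" by (auto simp: N.surv_def P.surv_def)

section \<open>Coordinates in degrees n and -1 - n\<close>

definition lev :: "int => nat" where "lev n = nat (if n >= 0 then n else - 1 - n)"
abbreviation "C n == fmod A (Suc (lev n))"

lemma rk_lev: "FR.rk n = Suc (lev n)" by (simp add: FR.rk_def lev_def)

definition L :: "int => ((nat \<times> nat) \<times> nat \<times> nat) set"
  where "L n = {P. snd (fst P) < a & snd (snd P) < b & fst (fst P) + fst (snd P) = lev n}"

text \<open>Monomial coefficients in nonnegative degrees, but coordinates with respect to the dual
  basis \<open>Mdual\<close> in negative ones. With this choice the negative differentials are
  literal transposes.\<close>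

definition co :: "int => (nat => 'a) => (nat \<times> nat) \<times> nat \<times> nat => 'k" where "co n g P = (if P \<in> L n then
    if n >= 0 then cof (snd (fst P), snd (snd P)) (g (fst (fst P)))
    else lam (g (fst (fst P)) \<otimes> M (snd (fst P), snd (snd P))) else \<zero>\<^sub>K)"

definition vec :: "int => ((nat \<times> nat) \<times> nat \<times> nat => 'k) => nat => 'a" where "vec n F i = (if i <= lev n then
    \<Oplus>p\<in>J. F ((i, fst p), (lev n - i, snd p)) \<odot> (if n >= 0 then M p else Mdual p) else \<zero>)"

text \<open>The differential of \<open>A \<otimes> T\<close> for the explicit resolution, after
  identifying degree \<open>n\<close> with rows over \<open>A\<close>, on which the matrices act
  through the right action.\<close>

definition bar :: "int => (nat => 'a) => nat => 'a"
  where "bar n g j = (if j < Suc (lev (n - 1)) then \<Oplus>i\<in>{..<Suc (lev n)}. ract (g i) (FR.Dm n i j) else \<zero>)"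

lemma C_mem: "g .: (C n) ==> g i .: A"
  by (auto simp: free_module_carrier)

lemma C_iff: "g .: (C n) \<longleftrightarrow> (\<forall>i. g i .: A) & (\<forall>i>lev n. g i = \<zero>)"
  unfolding fmod_carrier[OF ring_A] by (metis A.zero_closed Suc_leI less_Suc_eq_le not_less)

lemma bar_closed: "g .: (C n) ==> bar n g .: (C (n - 1))"
  using C_mem by (auto simp: C_iff bar_def ract_closed FR.Dm_closed intro!: A.finsum_closed)

lemma vec_closed: "(!!P. F P .: K) ==> vec n F .: (C n)"
  using M_closed Mdual_closed by (auto simp: C_iff vec_def intro!: A.finsum_closed)

lemma co_closed: "g .: (C n) ==> co n g P .: K"
  using M_closed C_mem by (auto simp: co_def cof_closed lam_props)

lemma co_add: "[|g .: (C n); g' .: (C n)|] ==> co n (%i. g i \<oplus> g' i) P = co n g P \<oplus>\<^sub>K co n g' P"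
  using M_closed C_mem by (simp add: co_def cof_add lam_props A.l_distr)

lemma co_smult: "[|g .: (C n); c .: K|] ==> co n (%i. c \<odot> g i) P = c \<otimes>\<^sub>K co n g P"
  using M_closed C_mem by (simp add: co_def cof_smult lam_props smult_mult_left)

lemma lam_zero: "lam \<zero> = \<zero>\<^sub>K" by (simp add: lam_def cof_zero)

lemma co_zero: "co n (%i. \<zero>) P = \<zero>\<^sub>K"
  using M_closed by (simp add: co_def cof_zero lam_zero)

lemma vec_co: assumes g: "g .: (C n)" shows "vec n (co n g) = g"
proof
  fix i
  show "vec n (co n g) i = g i"
  proof (cases "i <= lev n")
    case True
    have "(\<Oplus>p\<in>J. co n g ((i, fst p), (lev n - i, snd p)) \<odot> (if n >= 0 then M p else Mdual p))
      = (\<Oplus>p\<in>J. if n >= 0 then cof p (g i) \<odot> M p else lam (g i \<otimes> M p) \<odot> Mdual p)" using True C_mem[OF g] M_closed Mdual_closed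
      by (intro A.finsum_eqI) (auto simp: co_def L_def cof_closed lam_props)
    also have "... = g i" using expand_M[OF C_mem[OF g]] FR.exp_right[OF C_mem[OF g]] by (cases "n >= 0") simp_all
    finally show ?thesis using True by (simp add: vec_def)
  qed (use g in \<open>simp add: vec_def C_iff\<close>)
qed

lemma cof_lincomb:
  assumes p: "p \<in> J" and c: "!!p. c p .: K"
  shows "cof p (\<Oplus>p\<in>J. c p \<odot> M p) = c p" and "lam ((\<Oplus>p\<in>J. c p \<odot> Mdual p) \<otimes> M p) = c p"
proof -
  have s: "(\<Oplus>\<^sub>K p'\<in>J. if p = p' then c p' else \<zero>\<^sub>K) = c p" using p c by (subst V.R.finsum_singleton) auto
  have "cof p (\<Oplus>p\<in>J. c p \<odot> M p) = (\<Oplus>\<^sub>K p'\<in>J. cof p (c p' \<odot> M p'))"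
    using c M_closed by (intro additive_finsum[OF aA V.R.is_abelian_group]) (simp_all add: cof_closed cof_add)
  also have "... = (\<Oplus>\<^sub>K p'\<in>J. if p = p' then c p' else \<zero>\<^sub>K)"
    using p c M_closed by (intro V.R.finsum_eqI) (auto simp: cof_smult cof_M)
  finally show "cof p (\<Oplus>p\<in>J. c p \<odot> M p) = c p" using s by simp
  have "lam ((\<Oplus>p\<in>J. c p \<odot> Mdual p) \<otimes> M p) = (\<Oplus>\<^sub>K p'\<in>J. lam ((c p' \<odot> Mdual p') \<otimes> M p))"
    using c M_closed Mdual_closed
    by (intro additive_finsum[OF aA V.R.is_abelian_group, where f = "%z. lam (z \<otimes> M p)"]) (simp_all add: lam_props A.l_distr)
  also have "... = (\<Oplus>\<^sub>K p'\<in>J. if p = p' then c p' else \<zero>\<^sub>K)"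
    using p c M_closed Mdual_closed by (intro V.R.finsum_eqI) (auto simp: lam_props smult_mult_left lam_dual)
  finally show "lam ((\<Oplus>p\<in>J. c p \<odot> Mdual p) \<otimes> M p) = c p" using s by simp
qed

lemma co_vec:
  assumes F: "!!P. F P .: K" and L: "!!P. P \<notin> L n ==> F P = \<zero>\<^sub>K" shows "co n (vec n F) = F"
proof
  fix P :: "(nat \<times> nat) \<times> nat \<times> nat"
  obtain i u j v where P: "P = ((i, u), (j, v))" by (metis surj_pair)
  show "co n (vec n F) P = F P"
  proof (cases "P \<in> L n")
    case True
    then have e: "i <= lev n" "lev n - i = j" "(u, v) \<in> J" by (auto simp: L_def P)
    show ?thesis using True e(1) cof_lincomb[OF e(3), of "%p. F ((i, fst p), (lev n - i, snd p))"] F e(2) by (simp add: co_def P vec_def)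
  qed (simp add: co_def L)
qed

lemma co_inj: "[|g .: (C n); g' .: (C n); co n g = co n g'|] ==> g = g'"
  by (metis vec_co)

lemma finsum_two:
  assumes "abelian_monoid G" "finite I" and "!!i. i \<in> I ==> f i .: G" and 0: "!!i. [|i \<in> I; i ~= s; i ~= t|] ==> f i = \<zero>\<^sub>G" and "s ~= t"
  shows "finsum G f I = (if s \<in> I then f s else \<zero>\<^sub>G) \<oplus>\<^sub>G (if t \<in> I then f t else \<zero>\<^sub>G)"
proof -
  interpret G: abelian_monoid G by fact
  have "finsum G f I = finsum G f (I \<inter> {s, t})" using assms by (intro G.add.finprod_mono_neutral_cong_right) auto
  also have "... = (if s \<in> I then f s else \<zero>\<^sub>G) \<oplus>\<^sub>G (if t \<in> I then f t else \<zero>\<^sub>G)"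
    using assms by (cases "s \<in> I"; cases "t \<in> I") (auto simp: Int_insert_right)
  finally show ?thesis .
qed

lemma ract_signed:
  "[|z .: A; U .: Ae|] ==> ract z (if even i then U else \<ominus>\<^sub>Ae U) = sgn (i, u) \<odot> ract z U"
  using additive_neg[OF aE aA, of "ract z" U] V.smult_l_minus[of "\<one>\<^sub>K" "ract z U"] by (simp add: sgn_def ract_closed ract_add)

lemma labels_eval:
  "styp m (i, u) = (if st m i <= u & u < m then i else i - 1)" "wX (i, u) = dX i + u" "wY (i, u) = dY i + u"
  "slo m (i, u) \<longleftrightarrow> st m i <= u & u < m" "sUp m (i, u) = (Suc i, u - st m i)"
  "shi m (i, u) \<longleftrightarrow> i > 0 & u + st m (i - 1) < m" "sDn m (i, u) = (i - 1, u + st m (i - 1))"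
  by (simp_all add: styp_def slo_def shi_def sUp_def sDn_def wX_def wY_def)

lemma co_bar_pos:
  assumes g: "g .: (C n)" and n: "n > 0" shows "co (n - 1) (bar n g) = P.bd (co n g)"
proof
  fix P :: "(nat \<times> nat) \<times> nat \<times> nat"
  obtain i u j v where P: "P = ((i, u), (j, v))" by (metis surj_pair)
  obtain m where m: "n = int (Suc m)" using n by (metis zero_less_imp_eq_int gr0_implies_Suc)
  have lv: "lev n = Suc m" "lev (n - 1) = m" by (simp_all add: lev_def m)
  note c = C_mem[OF g] DX_closed DY_closed kx_closed ky_closed sgn_closed
  show "co (n - 1) (bar n g) P = P.bd (co n g) P"
  proof (cases "P \<in> L (n - 1)")
    case True
    then have ij: "i + j = m" "u < a" "v < b" by (auto simp: L_def P lv)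
    have "bar n g i = (\<Oplus>k\<in>{..<Suc (Suc m)}. ract (g k) (D (Suc m) k i))" using ij by (simp add: bar_def lv) (simp only: m FR.Dm_pos)
    also have "... = ract (g (Suc i)) (D (Suc m) (Suc i) i) \<oplus> ract (g i) (D (Suc m) i i)" using ij c D_closed
      by (subst finsum_two[where s = "Suc i" and t = i]) (auto simp: ract_closed A.abelian_monoid_axioms D_def[of _ _ i] additive_zero[OF aE aA, of "ract _"] ract_add)
    also have "... = ract (g (Suc i)) (DX (Suc i) (dY j)) \<oplus> sgn (i, u) \<odot> ract (g i) (DY (Suc j) (dX i))"
    proof -
      have "m - i = j" "i <= m" using ij by auto
      then show ?thesis by (simp only: D_Suc D_diag ract_signed[of _ _ _ u] c)
    qed
    finally have "co (n - 1) (bar n g) P = cof (u, v) (ract (g (Suc i)) (DX (Suc i) (dY j))) \<oplus>\<^sub>K sgn (i, u) \<otimes>\<^sub>K cof (u, v) (ract (g i) (DY (Suc j) (dX i)))"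
      using True n c by (simp add: co_def P cof_add cof_smult ract_closed)
    moreover have "cof (u, v) (ract (g (Suc i)) (DX (Suc i) (dY j))) = (if st a i <= u then kx i (dY j + v) \<otimes>\<^sub>K cof (u - st a i, v) (g (Suc i)) else \<zero>\<^sub>K)"
      using cof_ract_shift[of "DX (Suc i) (dY j)" "%u v. kx i (dY j + v)" "st a i" 0 u v "g (Suc i)"] ij c by (simp add: ract_M_DX)
    moreover have "cof (u, v) (ract (g i) (DY (Suc j) (dX i))) = (if st b j <= v then ky j (dX i + u) \<otimes>\<^sub>K cof (u, v - st b j) (g i) else \<zero>\<^sub>K)"
      using cof_ract_shift[of "DY (Suc j) (dX i)" "%u v. ky j (dX i + u)" 0 "st b j" u v "g i"] ij c by (simp add: ract_M_DY)
    ultimately show ?thesis using ij n sgn_closed by (simp add: P.bd_def P co_def L_def lv labels_eval cX_def cY_def less_imp_diff_less)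
  next
    case False
    have "slo a (i, u) ==> co n g (sUp a (i, u), (j, v)) = \<zero>\<^sub>K" "slo b (j, v) ==> co n g ((i, u), sUp b (j, v)) = \<zero>\<^sub>K"
      using False by (auto simp: co_def L_def P lv labels_eval(4,5))
    then show ?thesis using False cX_closed cY_closed sgn_closed by (simp add: P.bd_def P co_def)
  qed
qed

text \<open>\<open>lam_ract_theta\<close> moves the matrix entry from the coefficient
  \<open>g k\<close> to the monomial \<open>M (u, v)\<close>, where its action is known from the
  positive half. In the entry \<open>D (Suc m) i k\<close> the target index \<open>i\<close> comes
  first, hence the reversed arrows.\<close>

lemma co_bar_neg:
  assumes g: "g .: (C n)" and n: "n < 0" shows "co (n - 1) (bar n g) = N.bd (co n g)"
proof
  fix P :: "(nat \<times> nat) \<times> nat \<times> nat"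
  obtain i u j v where P: "P = ((i, u), (j, v))" by (metis surj_pair)
  obtain m where m: "n = - int (Suc m)" using n by (metis zero_less_imp_eq_int gr0_implies_Suc neg_0_less_iff_less minus_minus)
  have lv: "lev n = m" "lev (n - 1) = Suc m" by (simp_all add: lev_def m)
  note c = C_mem[OF g] DX_closed DY_closed kx_closed ky_closed sgn_closed M_closed D_closed
  show "co (n - 1) (bar n g) P = N.bd (co n g) P"
  proof (cases "P \<in> L (n - 1)")
    case True
    then have ij: "i + j = Suc m" "u < a" "v < b" by (auto simp: L_def P lv)
    have s: "lam (g k \<otimes> ract (M (u, v)) (D (Suc m) i k)) = 
       (if i = Suc k then kx k (dY j + v) \<otimes>\<^sub>K lam (g k \<otimes> M (u + st a k, v))
        else if i = k then sgn (i, u) \<otimes>\<^sub>K (ky (j - 1) (dX i + u) \<otimes>\<^sub>K lam (g k \<otimes> M (u, v + st b (j - 1)))) else \<zero>\<^sub>K)" if k: "k < Suc m" for k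
    proof -
      consider "i = Suc k" | "i = k" | "i ~= Suc k" "i ~= k" by blast
      then show ?thesis
      proof cases
        case 1
        then have "m - k = j" using ij by auto
        then show ?thesis unfolding 1 D_Suc ract_M_DX using c by (simp add: smult_mult_right lam_props)
      next
        case 2
        then obtain j' where j: "j = Suc j'" "m - k = j'" using ij k by (cases j) auto
        have "D (Suc m) i k = (if even i then DY (Suc j') (dX i) else \<ominus>\<^sub>Ae DY (Suc j') (dX i))" using k by (simp add: 2 D_diag j(2))
        then show ?thesis using 2 c ract_signed[of "M (u, v)" "DY (Suc j') (dX i)" i u] by (simp add: ract_M_DY smult_mult_right lam_props j)
      next
        case 3
        then have "ract (M (u, v)) (D (Suc m) i k) = \<zero>"
          using additive_zero[OF aE aA, of "ract (M (u, v))"] M_closed by (simp add: D_def ract_closed ract_add)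
        then show ?thesis using 3 c lam_zero by simp
      qed
    qed
    have "bar n g i = (\<Oplus>k\<in>{..<Suc m}. ract (g k) (FR.theta (D (Suc m) i k)))" using ij by (simp add: bar_def lv) (simp only: m FR.Dm_neg)
    then have "co (n - 1) (bar n g) P = lam ((\<Oplus>k\<in>{..<Suc m}. ract (g k) (FR.theta (D (Suc m) i k))) \<otimes> M (u, v))"
      using True n by (simp add: co_def P)
    also have "... = (\<Oplus>\<^sub>K k\<in>{..<Suc m}. lam (ract (g k) (FR.theta (D (Suc m) i k)) \<otimes> M (u, v)))"
      using c by (intro additive_finsum[OF aA V.R.is_abelian_group, where f = "%z. lam (z \<otimes> M (u, v))"])
        (simp_all add: lam_props A.l_distr ract_closed FR.theta_closed)
    also have "... = (\<Oplus>\<^sub>K k\<in>{..<Suc m}. lam (g k \<otimes> ract (M (u, v)) (D (Suc m) i k)))"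
      using c by (intro V.R.finsum_eqI) (simp_all add: FR.lam_ract_theta lam_props ract_closed)
    also have "... = (if i > 0 then kx (i - 1) (dY j + v) \<otimes>\<^sub>K lam (g (i - 1) \<otimes> M (u + st a (i - 1), v)) else \<zero>\<^sub>K) \<oplus>\<^sub>K
       (if j > 0 then sgn (i, u) \<otimes>\<^sub>K (ky (j - 1) (dX i + u) \<otimes>\<^sub>K lam (g i \<otimes> M (u, v + st b (j - 1)))) else \<zero>\<^sub>K)"
    proof (cases i)
      case 0
      have "(\<Oplus>\<^sub>K k\<in>{..<Suc m}. lam (g k \<otimes> ract (M (u, v)) (D (Suc m) i k)))
        = (\<Oplus>\<^sub>K k\<in>{..<Suc m}. if i = k then sgn (i, u) \<otimes>\<^sub>K (ky (j - 1) (dX i + u) \<otimes>\<^sub>K lam (g k \<otimes> M (u, v + st b (j - 1)))) else \<zero>\<^sub>K)"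
        using c s 0 by (intro V.R.finsum_eqI) (auto simp: lam_props)
      also have "... = sgn (i, u) \<otimes>\<^sub>K (ky (j - 1) (dX i + u) \<otimes>\<^sub>K lam (g i \<otimes> M (u, v + st b (j - 1))))"
        using c 0 by (intro V.R.finsum_singleton) (auto simp: lam_props)
      finally show ?thesis using 0 ij c by (simp add: lam_props)
    next
      case (Suc i')
      have "(\<Oplus>\<^sub>K k\<in>{..<Suc m}. lam (g k \<otimes> ract (M (u, v)) (D (Suc m) i k)))
        = (if i' \<in> {..<Suc m} then lam (g i' \<otimes> ract (M (u, v)) (D (Suc m) i i')) else \<zero>\<^sub>K) \<oplus>\<^sub>K
          (if i \<in> {..<Suc m} then lam (g i \<otimes> ract (M (u, v)) (D (Suc m) i i)) else \<zero>\<^sub>K)"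
        using c s Suc V.R.abelian_monoid_axioms by (intro finsum_two) (auto simp: lam_props ract_closed)
      then show ?thesis using Suc ij s[of i'] s[of i] by auto
    qed
    finally have "co (n - 1) (bar n g) P = (if i > 0 then kx (i - 1) (dY j + v) \<otimes>\<^sub>K lam (g (i - 1) \<otimes> M (u + st a (i - 1), v)) else \<zero>\<^sub>K) \<oplus>\<^sub>K
       (if j > 0 then sgn (i, u) \<otimes>\<^sub>K (ky (j - 1) (dX i + u) \<otimes>\<^sub>K lam (g i \<otimes> M (u, v + st b (j - 1)))) else \<zero>\<^sub>K)" .
    \<comment> \<open>A label of positive degree that is not the source of an arrow leads to an
      exponent out of range, where the monomial is zero.\<close>
    moreover have z: "lam (g k \<otimes> M (u', v')) = \<zero>\<^sub>K" if "u' >= a | v' >= b" for k u' v'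
      using that M_zero[of u' v'] C_mem[OF g] lam_zero by simp
    moreover have "kx (i - 1) (dY j + v) \<otimes>\<^sub>K lam (g (i - 1) \<otimes> M (u + st a (i - 1), v))
        = cX (i, u) (j, v) \<otimes>\<^sub>K co n g (sDn a (i, u), (j, v))" if "shi a (i, u)"
      using that ij n sl(3)[of "(i, u)"] by (simp add: co_def L_def lv cX_def labels_eval(2,3,6,7) styp_def) 
    moreover have "ky (j - 1) (dX i + u) \<otimes>\<^sub>K lam (g i \<otimes> M (u, v + st b (j - 1)))
        = cY (i, u) (j, v) \<otimes>\<^sub>K co n g ((i, u), sDn b (j, v))" if "shi b (j, v)"
      using that ij n sl(8)[of "(j, v)"] by (simp add: co_def L_def lv cY_def labels_eval(2,3,6,7) styp_def)
    moreover have "i > 0 & ~ shi a (i, u) ==> u + st a (i - 1) >= a" "j > 0 & ~ shi b (j, v) ==> v + st b (j - 1) >= b"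
      "shi a (i, u) ==> i > 0" "shi b (j, v) ==> j > 0" by (auto simp: shi_def)
    ultimately show ?thesis by (cases "shi a (i, u)"; cases "shi b (j, v)"; cases "i > 0"; cases "j > 0")
        (simp_all only: N.bd_def P prod.case if_True if_False simp_thms,
         simp_all add: z kx_closed ky_closed sgn_closed)
  next
    case False
    have "shi a (i, u) ==> co n g (sDn a (i, u), (j, v)) = \<zero>\<^sub>K" "shi b (j, v) ==> co n g ((i, u), sDn b (j, v)) = \<zero>\<^sub>K"
      using False by (auto simp: co_def L_def P lv labels_eval(6,7))
    then show ?thesis using False cX_closed cY_closed sgn_closed by (simp add: N.bd_def P co_def)
  qed
qed

end

section \<open>The gluing map between degrees 0 and -1\<close>

context qalg_generic
begin

abbreviation "ab == [(a * b)] \<cdot>\<^sub>K \<one>\<^sub>K"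
abbreviation O0 :: "(nat \<times> nat) \<times> nat \<times> nat" where "O0 == ((0, 0), (0, 0))"

text \<open>Each of the \<open>a * b\<close> summands is a multiple of the monomial with exponents
  \<open>(a - 1 + u, b - 1 + v)\<close>, so it vanishes unless \<open>u = v = 0\<close>. Then it is
  the socle monomial with scalar 1, because \<open>lam\<close> is 1 on
  \<open>Mdual p \<otimes> M p\<close>.\<close>

lemma ract_M_Delta:
  assumes "(u, v) \<in> J" shows "ract (M (u, v)) FR.Delta = (if u = 0 & v = 0 then ab \<odot> M (a - 1, b - 1) else \<zero>)"
proof -
  let ?s = "if u = 0 & v = 0 then M (a - 1, b - 1) else \<zero>"
  have "ract (M (u, v)) FR.Delta = (\<Oplus>p\<in>J. ract (M (u, v)) (tt (M p) (Mdual p)))"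
    unfolding FR.Delta_def using M_closed Mdual_closed by (intro ract_finsum) (simp_all add: tt_closed)
  also have "... = (\<Oplus>p\<in>J. ?s)"
  proof (rule A.finsum_eqI)
    fix p assume p: "p \<in> J"
    obtain i j where ij: "p = (i, j)" "i < a" "j < b" using p by auto
    have "\<exists>c\<in>carrier K. Mdual p \<otimes> M (u, v) \<otimes> M p = c \<odot> M (a - 1 + u, b - 1 + v)"
    proof -
      have "M (cmp p) \<otimes> M (u, v) \<otimes> M p = Q ((a - 1 - i) * v) \<odot> (Q ((a - 1 - i + u) * j) \<odot> M (a - 1 + u, b - 1 + v))"
        using ij M_closed Q_closed by (simp add: cmp_def M_mult smult_mult_left)
      then show ?thesis using M_closed Q_closed invQ
        by (intro bexI[of _ "inv\<^bsub>K\<^esub> Q ((a - 1 - fst p) * snd p) \<otimes>\<^sub>K (Q ((a - 1 - i) * v) \<otimes>\<^sub>K Q ((a - 1 - i + u) * j))"])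
          (simp_all add: Mdual_def smult_mult_left V.smult_assoc1)
    qed
    then obtain c where c: "c .: K" "Mdual p \<otimes> M (u, v) \<otimes> M p = c \<odot> M (a - 1 + u, b - 1 + v)" by auto
    have "Mdual p \<otimes> M (u, v) \<otimes> M p = ?s"
    proof (cases "u = 0 & v = 0")
      case True
      have 1: "M (0, 0) = \<one>" by (simp add: M_def)
      have "c = lam (c \<odot> M (a - 1, b - 1))" using c M_closed by (simp add: lam_props lam_M)
      also have "... = lam (Mdual p \<otimes> M p)" using c(2) True Mdual_closed by (simp add: 1)
      also have "... = \<one>\<^sub>K" by (simp only: lam_dual[OF p p] simp_thms if_True)
      finally show ?thesis using c True M_closed by simp
    next
      case False
      then have "M (a - 1 + u, b - 1 + v) = \<zero>" using a2 b2 by (intro M_zero) auto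
      then show ?thesis using c False by auto
    qed
    then show "ract (M (u, v)) (tt (M p) (Mdual p)) = ?s" using M_closed Mdual_closed by (simp add: ract_tt)
  qed (simp add: M_closed)
  also have "... = [(a * b)] \<cdot> ?s" using M_closed by (subst A.add.finprod_const) (auto simp: card_cartesian_product)
  also have "... = (\<Oplus>i\<in>{..<a * b}. \<one>\<^sub>K \<odot> ?s)" using M_closed by (subst A.add.finprod_const) auto
  also have "... = ab \<odot> ?s" using M_closed by (subst smult_finsum[symmetric]) (auto simp: V.R.add.finprod_const)
  finally show ?thesis by (auto simp: M_closed)
qed

lemma ab_closed: "ab .: K" by simp

lemma ract_Delta:
  assumes z: "z .: A" shows "ract z FR.Delta = (ab \<otimes>\<^sub>K cof (0, 0) z) \<odot> M (a - 1, b - 1)"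
proof (rule linear_eqI[OF module_A _ _ _ _ _ _ _ z])
  fix p assume "p \<in> J"
  then obtain u v where p: "p = (u, v)" "(u, v) \<in> J" by (metis surj_pair)
  then show "ract (M p) FR.Delta = (ab \<otimes>\<^sub>K cof (0, 0) (M p)) \<odot> M (a - 1, b - 1)"
    using ract_M_Delta[OF p(2)] cof_M[of "(0, 0)" p] a2 b2 M_closed by (auto simp: p(1))
qed (simp_all add: ract_closed FR.Delta_closed M_closed cof_closed ract_add_left cof_add V.R.r_distr V.smult_l_distr
    ract_smult cof_smult V.smult_assoc1[symmetric] V.R.m_lcomm)

text \<open>In the dual coordinates of degree -1 the socle monomial has its only entry at exponent
  \<open>(0, 0)\<close>. The label \<open>O0\<close> thus means the unit in degree 0 and the socle
  in degree -1.\<close>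

lemma co_bar_zero:
  assumes g: "g .: (C 0)" shows "co (- 1) (bar 0 g) P = (if P = O0 then ab \<otimes>\<^sub>K co 0 g O0 else \<zero>\<^sub>K)"
proof -
  obtain i u j v where P: "P = ((i, u), (j, v))" by (metis surj_pair)
  have lv: "lev 0 = 0" "lev (- 1) = 0" by (simp_all add: lev_def)
  have 0: "bar 0 g 0 = ract (g 0) FR.Delta" using C_mem[OF g] by (simp add: bar_def lv FR.Dm_zero lessThan_Suc[of 0] ract_closed FR.Delta_closed)
  show ?thesis
  proof (cases "P \<in> L (- 1)")
    case True
    then have e: "i = 0" "j = 0" "u < a" "v < b" by (auto simp: L_def P lv)
    have "co (- 1) (bar 0 g) P = lam (ract (g 0) FR.Delta \<otimes> M (u, v))" using True by (simp add: co_def P e 0)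
    also have "... = (ab \<otimes>\<^sub>K cof (0, 0) (g 0)) \<otimes>\<^sub>K (Q ((a - 1) * v) \<otimes>\<^sub>K lam (M (a - 1 + u, b - 1 + v)))"
      using C_mem[OF g] M_closed Q_closed by (simp add: ract_Delta smult_mult_left lam_props cof_closed M_mult)
    finally show ?thesis using e a2 b2 C_mem[OF g] Q_closed by (auto simp: lam_M P co_def L_def lv cof_closed)
  next
    case False
    then show ?thesis using a2 b2 by (auto simp: co_def L_def lv)
  qed
qed

text \<open>If \<open>ab\<close> is nonzero, the gluing map pairs off the unit in degree 0 with the
  socle in degree -1, and both drop out of the homology.\<close>

definition W :: "int => ((nat \<times> nat) \<times> nat \<times> nat) set"
  where "W n = P.surv \<inter> L n - (if (n = 0 | n = - 1) & ab ~= \<zero>\<^sub>K then {O0} else {})"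

lemma co_outside: "P \<notin> L n ==> co n g P = \<zero>\<^sub>K" by (simp add: co_def)

lemma co_valid:
  "~ (X = (0, 0) | slo a X | shi a X) | ~ (Y = (0, 0) | slo b Y | shi b Y) ==> co n g (X, Y) = \<zero>\<^sub>K"
  unfolding strand_labels(6)[OF a2] strand_labels(6)[OF b2] by (intro co_outside) (auto simp: L_def)

lemma P_hb_support:
  assumes n: "n >= 0" and F: "!!P. F P .: K" "!!P. P \<notin> L n ==> F P = \<zero>\<^sub>K" and P: "P \<notin> L (n + 1)" shows "P.hb F P = \<zero>\<^sub>K"
proof -
  obtain i u j v where e: "P = ((i, u), (j, v))" by (metis surj_pair)
  have l: "lev (n + 1) = Suc (lev n)" using n by (simp add: lev_def nat_add_distrib)
  have "F (sDn a (i, u), (j, v)) = \<zero>\<^sub>K" if "shi a (i, u)" using that P by (intro F) (auto simp: L_def l e labels_eval(6,7))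
  moreover have "F ((i, u), sDn b (j, v)) = \<zero>\<^sub>K" if "shi b (j, v)" using that P by (intro F) (auto simp: L_def l e labels_eval(6,7))
  ultimately show ?thesis using P.iv(1)[OF cX_closed] P.iv(1)[OF cY_closed] by (auto simp: P.hb_def e)
qed

text \<open>In the negative half the contraction lowers the level. From degree -1, of level 0, it
  has nowhere to go and vanishes identically; the premise on \<open>P\<close> is phrased to cover
  this case.\<close>

lemma N_hb_support:
  assumes n: "n < 0" and F: "!!P. F P .: K" "!!P. P \<notin> L n ==> F P = \<zero>\<^sub>K" and P: "n ~= - 1 ==> P \<notin> L (n + 1)"
  shows "N.hb F P = \<zero>\<^sub>K"
proof -
  obtain i u j v where e: "P = ((i, u), (j, v))" by (metis surj_pair)
  have l: "lev n = 0 & n = - 1 | lev n = Suc (lev (n + 1)) & n ~= - 1" using n by (auto simp: lev_def)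
  have "F (sUp a (i, u), (j, v)) = \<zero>\<^sub>K" if "slo a (i, u)" using that P l by (intro F) (auto simp: L_def e labels_eval(4,5))
  moreover have "F ((i, u), sUp b (j, v)) = \<zero>\<^sub>K" if "slo b (j, v)" using that P l by (intro F) (auto simp: L_def e labels_eval(4,5))
  ultimately show ?thesis using N.iv(1)[OF cX_closed] N.iv(1)[OF cY_closed] by (auto simp: N.hb_def e)
qed

lemma zero_C: "(%i. \<zero>) .: (C n)" by (simp add: C_iff)

lemma bar_kernel_pos:
  assumes g: "g .: (C n)" and n: "n >= 0" and pbd: "!!P. P.bd (co n g) P = \<zero>\<^sub>K"
  shows "(\<exists>g'\<in>carrier (C (n + 1)). bar (n + 1) g' = g) \<longleftrightarrow> (\<forall>w\<in>P.surv \<inter> L n. co n g w = \<zero>\<^sub>K)"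
proof
  let ?F = "co n g"
  have Fc: "!!P. ?F P .: K" using g by (rule co_closed)
  { assume "\<exists>g'\<in>carrier (C (n + 1)). bar (n + 1) g' = g"
    then obtain g' where g': "g' .: (C (n + 1))" "bar (n + 1) g' = g" by auto
    then have "?F = P.bd (co (n + 1) g')" using co_bar_pos[OF g'(1)] n by simp
    then show "\<forall>w\<in>P.surv \<inter> L n. ?F w = \<zero>\<^sub>K" using P.bd_surv co_closed[OF g'(1)] by auto }
  assume w: "\<forall>w\<in>P.surv \<inter> L n. ?F w = \<zero>\<^sub>K"
  have F: "P.bd (P.hb ?F) P = ?F P" for P
  proof (rule P.bd_hb[OF Fc _ pbd])
    show "P \<in> P.surv ==> ?F P = \<zero>\<^sub>K" for P using w co_outside[of P n g] by auto
  qed (rule co_valid)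
  have Hc: "P.hb ?F P .: K" for P by (rule P.hb_closed[OF Fc])
  let ?G = "vec (n + 1) (P.hb ?F)"
  have h: "?G .: (C (n + 1))" "co (n + 1) ?G = P.hb ?F" using n Hc Fc co_outside by (auto intro!: vec_closed co_vec P_hb_support[of n])
  have "co n (bar (n + 1) ?G) = ?F" using co_bar_pos[OF h(1)] n h(2) F by auto
  then show "\<exists>g'\<in>carrier (C (n + 1)). bar (n + 1) g' = g" using g h(1) bar_closed[OF h(1)] by (intro bexI[OF _ h(1)] co_inj[of _ n]) auto
qed

text \<open>Away from degrees 0 and -1 this is the contraction of the strands. In degree 0 the
  strands impose no cycle condition; the gluing map does, by \<open>ab\<close> times the coordinate
  at \<open>O0\<close>. In degree -1 all boundaries come through the gluing map.\<close>

lemma bar_kernel: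
  assumes g: "g .: (C n)" and cyc: "bar n g = (%i. \<zero>)"
  shows "(\<exists>g'\<in>carrier (C (n + 1)). bar (n + 1) g' = g) \<longleftrightarrow> (\<forall>w\<in>W n. co n g w = \<zero>\<^sub>K)"
proof -
  let ?F = "co n g"
  have Fc: "!!P. ?F P .: K" using g by (rule co_closed)
  have bz: "co (n - 1) (bar n g) P = \<zero>\<^sub>K" for P by (simp add: cyc co_zero)
  consider "n > 0" | "n = 0" | "n = - 1" | "n < - 1" by linarith
  then show ?thesis
  proof cases
    case 3
    have nbd: "N.bd ?F P = \<zero>\<^sub>K" for P using co_bar_neg[OF g] bz[of P] 3 by simp
    \<comment> \<open>Splits off the coordinate at \<open>O0\<close>, the only one that the gluing
      map reaches. The rest must vanish, since its contraction is zero.\<close>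
    let ?F' = "%P. if P = O0 then \<zero>\<^sub>K else ?F P"
    have bar0: "co (- 1) (bar (n + 1) g') P = (if P = O0 then ab \<otimes>\<^sub>K co 0 g' O0 else \<zero>\<^sub>K)" if "g' .: (C 0)" for g' P
      using co_bar_zero[OF that] 3 by simp
    show ?thesis
    proof
      assume "\<exists>g'\<in>carrier (C (n + 1)). bar (n + 1) g' = g"
      then obtain g' where g': "g' .: (C 0)" "bar (n + 1) g' = g" using 3 by auto
      then have "?F P = (if P = O0 then ab \<otimes>\<^sub>K co 0 g' O0 else \<zero>\<^sub>K)" for P using bar0[OF g'(1), of P] 3 by simp
      then show "\<forall>w\<in>W n. co n g w = \<zero>\<^sub>K" using 3 co_closed[OF g'(1)] by (auto simp: W_def)
    next
      assume w: "\<forall>w\<in>W n. co n g w = \<zero>\<^sub>K"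
      have "N.bd (N.hb ?F') P = ?F' P" for P
      proof (rule N.bd_hb)
        show "N.bd ?F' P = \<zero>\<^sub>K" for P using nbd[of P] sl(2)[of "fst P"] sl(7)[of "snd P"] sl(4,9) by (cases P) (auto simp: N.bd_def)
        show "P \<in> N.surv ==> ?F' P = \<zero>\<^sub>K" for P using w co_outside[of P n g] unfolding surv_eq by (auto simp: W_def split: if_splits)
        show "?F' (X, Y) = \<zero>\<^sub>K" if "~ (X = (0, 0) | shi a X | slo a X) | ~ (Y = (0, 0) | shi b Y | slo b Y)" for X Y
          using that co_valid[of X Y n g] by auto
      qed (use Fc in simp)
      moreover have "N.hb ?F' P = \<zero>\<^sub>K" for P using 3 Fc co_outside by (intro N_hb_support[of n]) auto
      then have "N.hb ?F' = (%P. \<zero>\<^sub>K)" by (rule ext)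
      moreover have "N.bd (%P. \<zero>\<^sub>K) P = \<zero>\<^sub>K" for P using cX_closed cY_closed sgn_closed by (cases P) (simp add: N.bd_def)
      ultimately have "?F' P = \<zero>\<^sub>K" for P by metis
      then have F': "?F P = (if P = O0 then ?F O0 else \<zero>\<^sub>K)" for P by (metis (full_types))
      \<comment> \<open>The preimage in degree 0: divide by \<open>ab\<close>. If \<open>ab\<close>
        is zero, \<open>O0\<close> belongs to \<open>W n\<close> and the coordinate is zero by
        assumption.\<close>
      let ?H = "%P. if P = O0 then N.iv ab \<otimes>\<^sub>K ?F O0 else \<zero>\<^sub>K"
      have Hc: "?H P .: K" for P using N.iv(1)[OF ab_closed] Fc by simp
      have O0: "O0 \<in> L n" "O0 \<in> L 0" "O0 \<in> P.surv" using 3 a2 b2 by (auto simp: L_def lev_def P.surv_def)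
      have h: "vec 0 ?H .: (C 0)" "co 0 (vec 0 ?H) = ?H" using Hc O0 by (auto intro!: vec_closed co_vec)
      have "ab \<otimes>\<^sub>K (N.iv ab \<otimes>\<^sub>K ?F O0) = ?F O0"
      proof (cases "ab = \<zero>\<^sub>K")
        case True
        then show ?thesis using w O0 N.iv(1)[OF ab_closed] by (auto simp: W_def)
      qed (use N.iv_cancel(1)[OF ab_closed] Fc in auto)
      then have "co n (bar (n + 1) (vec 0 ?H)) P = ?F P" for P using bar0[OF h(1), of P] h(2) F'[of P] 3 by simp
      then have "bar (n + 1) (vec 0 ?H) = g" using g h(1) 3 bar_closed[of "vec 0 ?H" 0] by (intro co_inj[of _ n]) auto
      then show "\<exists>g'\<in>carrier (C (n + 1)). bar (n + 1) g' = g" using h(1) 3 by auto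
    qed
  next
    case 4
    have nbd: "N.bd ?F P = \<zero>\<^sub>K" for P using co_bar_neg[OF g] bz[of P] 4 by simp
    have Wn: "W n = P.surv \<inter> L n" using 4 by (auto simp: W_def)
    show ?thesis
    proof
      assume "\<exists>g'\<in>carrier (C (n + 1)). bar (n + 1) g' = g"
      then obtain g' where g': "g' .: (C (n + 1))" "bar (n + 1) g' = g" by auto
      then have "?F = N.bd (co (n + 1) g')" using co_bar_neg[OF g'(1)] 4 by simp
      then show "\<forall>w\<in>W n. co n g w = \<zero>\<^sub>K" using N.bd_surv co_closed[OF g'(1)] by (auto simp: Wn surv_eq)
    next
      assume w: "\<forall>w\<in>W n. co n g w = \<zero>\<^sub>K"
      have F: "N.bd (N.hb ?F) P = ?F P" for P
      proof (rule N.bd_hb[OF Fc _ nbd])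
        show "P \<in> N.surv ==> ?F P = \<zero>\<^sub>K" for P using w co_outside[of P n g] unfolding surv_eq by (auto simp: Wn)
      qed (rule co_valid, blast)
      have Hc: "N.hb ?F P .: K" for P by (rule N.hb_closed[OF Fc])
      let ?G = "vec (n + 1) (N.hb ?F)"
      have h: "?G .: (C (n + 1))" "co (n + 1) ?G = N.hb ?F" using 4 Hc Fc co_outside by (auto intro!: vec_closed co_vec N_hb_support[of n])
      have "co n (bar (n + 1) ?G) = ?F" using co_bar_neg[OF h(1)] 4 h(2) F by auto
      then show "\<exists>g'\<in>carrier (C (n + 1)). bar (n + 1) g' = g" using g h(1) bar_closed[OF h(1)] by (intro bexI[OF _ h(1)] co_inj[of _ n]) auto
    qed
  next
    case 1
    have pbd: "P.bd ?F P = \<zero>\<^sub>K" for P using co_bar_pos[OF g] bz[of P] 1 by simp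
    have "W n = P.surv \<inter> L n" using 1 by (auto simp: W_def)
    then show ?thesis using bar_kernel_pos[OF g _ pbd] 1 by simp
  next
    case 2
    have lv: "lev n = 0" using 2 by (simp add: lev_def)
    have "slo a X ==> ?F (sUp a X, Y) = \<zero>\<^sub>K" "slo b Y ==> ?F (X, sUp b Y) = \<zero>\<^sub>K" for X Y
      by (auto intro!: co_outside simp: L_def lv sUp_def)
    then have "P.bd ?F P = \<zero>\<^sub>K" for P using cX_closed cY_closed sgn_closed by (cases P) (simp add: P.bd_def)
    then have k: "(\<exists>g'\<in>carrier (C (n + 1)). bar (n + 1) g' = g) \<longleftrightarrow> (\<forall>w\<in>P.surv \<inter> L n. co n g w = \<zero>\<^sub>K)"
      using bar_kernel_pos[OF g] 2 by simp
    have "ab ~= \<zero>\<^sub>K ==> ?F O0 = \<zero>\<^sub>K" using bz[of O0] co_bar_zero[of g O0] g 2 KF.integral[OF _ ab_closed Fc[of O0]] by auto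
    then show ?thesis unfolding k by (auto simp: W_def split: if_splits)
  qed
qed

text \<open>The coefficients of all arrows at a surviving basis element vanish, so it is a cycle by
  itself. In degree 0 the removal of \<open>O0\<close> from \<open>W n\<close> for nonzero
  \<open>ab\<close> accounts for the gluing map.\<close>

lemma bar_dual:
  assumes w: "w \<in> W n"
  shows "\<exists>g\<in>carrier (C n). bar n g = (%i. \<zero>) & (\<forall>w'\<in>W n. co n g w' = (if w' = w then \<one>\<^sub>K else \<zero>\<^sub>K))"
proof -
  let ?F = "%P. if P = w then \<one>\<^sub>K else \<zero>\<^sub>K"
  have wL: "w \<in> L n" "w \<in> P.surv" "w \<in> N.surv" using w by (auto simp: W_def surv_eq)
  have g: "vec n ?F .: (C n)" "co n (vec n ?F) = ?F" using wL by (auto intro!: vec_closed co_vec)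
  have "co (n - 1) (bar n (vec n ?F)) = (%P. \<zero>\<^sub>K)"
  proof -
    consider "n > 0" | "n = 0" | "n < 0" by linarith
    then show ?thesis
    proof cases
      case 1
      then show ?thesis using co_bar_pos[OF g(1)] g(2) P.bd_unit_surv[OF wL(2)] by auto
    next
      case 2
      have g0: "vec 0 ?F .: (C 0)" "co 0 (vec 0 ?F) O0 = (if O0 = w then \<one>\<^sub>K else \<zero>\<^sub>K)" using g by (simp_all add: 2)
      have "co (0 - 1) (bar 0 (vec 0 ?F)) P = \<zero>\<^sub>K" for P using w co_bar_zero[OF g0(1), of P] ab_closed unfolding g0(2)
        by (cases "ab = \<zero>\<^sub>K"; cases "O0 = w") (simp_all add: W_def 2)
      then show ?thesis unfolding 2 by (rule ext)
    next
      case 3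
      then show ?thesis using co_bar_neg[OF g(1)] g(2) N.bd_unit_surv[OF wL(3)] by auto
    qed
  qed
  then have "bar n (vec n ?F) = (%i. \<zero>)" using bar_closed[OF g(1)] by (intro co_inj[of _ "n - 1"]) (auto simp: zero_C co_zero fun_eq_iff)
  then show ?thesis using g by (intro bexI[OF _ g(1)]) simp
qed

section \<open>Counting the survivors\<close>

lemma card_one_out: "c < m ==> card {u. u < m & (u = c --> P)} = (if P then m else m - 1)"
proof -
  assume c: "c < m"
  have "{u. u < m & (u = c --> P)} = (if P then {..<m} else {..<m} - {c})" by auto
  then show ?thesis using c by simp
qed

text \<open>On the axes an arrow of even type has coefficient 0 and one of odd type has coefficient
  \<open>a\<close> or \<open>b\<close>. On the X-axis in positive degree, the arrow through exponent
  0 in even degree and through exponent \<open>a - 1\<close> in odd degree is of odd type; these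
  elements survive precisely when \<open>p\<close> divides \<open>a\<close>, the others always. The
  Y-axis behaves in the same way with \<open>b\<close>.\<close>

lemma surv_level:
  assumes "has_characteristic K p"
  shows "P.surv \<inter> L n = (if lev n = 0 then insert O0 ((%u. ((0, u), (0, 0))) ` {1..<a} \<union> (%v. ((0, 0), (0, v))) ` {1..<b})
    else (%u. ((lev n, u), (0, 0))) ` {u. u < a & (u = (if even (lev n) then 0 else a - 1) --> p dvd a)} \<union>
      (%v. ((0, 0), (lev n, v))) ` {v. v < b & (v = (if even (lev n) then 0 else b - 1) --> p dvd b)})"
proof -
  have chi: "[a] \<cdot>\<^sub>K \<one>\<^sub>K = \<zero>\<^sub>K \<longleftrightarrow> p dvd a" "[b] \<cdot>\<^sub>K \<one>\<^sub>K = \<zero>\<^sub>K \<longleftrightarrow> p dvd b"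
    using assms by (auto simp: has_characteristic_def)
  have w0: "wX (0, 0) = 0" "wY (0, 0) = 0" by (simp_all add: wX_def wY_def degree_0)
  have X: "(slo a X | shi a X) & cX X (0, 0) = \<zero>\<^sub>K \<longleftrightarrow>
      X ~= (0, 0) & snd X < a & (snd X = (if even (fst X) then 0 else a - 1) --> p dvd a)" for X
  proof -
    have "slo a X | shi a X \<longleftrightarrow> X ~= (0, 0) & snd X < a" using strand_labels(4-6)[OF a2] by blast
    then show ?thesis using styp_even[OF a2, of X] by (auto simp: cX_def w0 kx_0 chi split: if_splits)
  qed
  have Y: "(slo b Y | shi b Y) & cY (0, 0) Y = \<zero>\<^sub>K \<longleftrightarrow>
      Y ~= (0, 0) & snd Y < b & (snd Y = (if even (fst Y) then 0 else b - 1) --> p dvd b)" for Y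
  proof -
    have "slo b Y | shi b Y \<longleftrightarrow> Y ~= (0, 0) & snd Y < b" using strand_labels(4-6)[OF b2] by blast
    then show ?thesis using styp_even[OF b2, of Y] by (auto simp: cY_def w0 ky_0 chi split: if_splits)
  qed
  have S: "P.surv = {(X, Y). X = (0, 0) & Y = (0, 0)
      | Y = (0, 0) & X ~= (0, 0) & snd X < a & (snd X = (if even (fst X) then 0 else a - 1) --> p dvd a)
      | X = (0, 0) & Y ~= (0, 0) & snd Y < b & (snd Y = (if even (fst Y) then 0 else b - 1) --> p dvd b)}"
    unfolding P.surv_def X[symmetric] Y[symmetric] by auto
  show ?thesis unfolding S L_def using a2 b2 by (cases "lev n = 0") (auto simp: image_iff split: if_splits)
qed

lemma card_W:
  assumes ch: "has_characteristic K p" shows "finite (W n)" and "card (W n) = (if n = 0 | n = - 1 then (if p dvd a | p dvd b then a + b - 1 else a + b - 2)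
    else (if p dvd a & p dvd b then a + b else if p dvd a | p dvd b then a + b - 1 else a + b - 2))"
proof -
  show fin: "finite (W n)" unfolding W_def surv_level[OF ch] by auto
  have inj: "inj_on (%u. ((i, u), z)) S" "inj_on (%u. (z, (i, u))) S" for i :: nat and z :: "nat \<times> nat" and S :: "nat set" by (auto simp: inj_on_def)
  show "card (W n) = (if n = 0 | n = - 1 then (if p dvd a | p dvd b then a + b - 1 else a + b - 2)
    else (if p dvd a & p dvd b then a + b else if p dvd a | p dvd b then a + b - 1 else a + b - 2))"
  proof (cases "n = 0 | n = - 1")
    case True
    then have l: "lev n = 0" by (auto simp: lev_def)
    let ?S = "(%u. ((0::nat, u), (0::nat, 0::nat))) ` {1..<a} \<union> (%v. ((0::nat, 0::nat), (0::nat, v))) ` {1..<b}"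
    have c: "card ?S = (a - 1) + (b - 1)" by (subst card_Un_disjoint) (auto simp: card_image inj)
    have O: "O0 \<notin> ?S" "finite ?S" by auto
    \<comment> \<open>As a field has no zero divisors, \<open>ab\<close> vanishes exactly when
      \<open>p\<close> divides \<open>a\<close> or \<open>b\<close>.\<close>
    have "ab = ([a] \<cdot>\<^sub>K \<one>\<^sub>K) \<otimes>\<^sub>K ([b] \<cdot>\<^sub>K \<one>\<^sub>K)"
      by (simp add: V.R.add_pow_ldistr V.R.add.nat_pow_pow mult.commute)
    then have "ab = \<zero>\<^sub>K \<longleftrightarrow> p dvd a | p dvd b"
      using ch KF.integral_iff[of "[a] \<cdot>\<^sub>K \<one>\<^sub>K" "[b] \<cdot>\<^sub>K \<one>\<^sub>K"] by (simp add: has_characteristic_def)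
    then have "W n = (if p dvd a | p dvd b then insert O0 ?S else ?S)" using True O(1) unfolding W_def surv_level[OF ch] l by auto
    moreover have "card (insert O0 ?S) = Suc (card ?S)" using O by (intro card_insert_disjoint)
    ultimately have "card (W n) = (if p dvd a | p dvd b then Suc ((a - 1) + (b - 1)) else (a - 1) + (b - 1))" using c by presburger
    then show ?thesis using True a2 b2 by auto
  next
    case False
    then have l: "lev n > 0" by (auto simp: lev_def)
    let ?U = "{u. u < a & (u = (if even (lev n) then 0 else a - 1) --> p dvd a)}"
    let ?V = "{v. v < b & (v = (if even (lev n) then 0 else b - 1) --> p dvd b)}"
    have "W n = (%u. ((lev n, u), (0, 0))) ` ?U \<union> (%v. ((0, 0), (lev n, v))) ` ?V" using False l unfolding W_def surv_level[OF ch] by simp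
    then have "card (W n) = card ?U + card ?V" using l by (simp only:) (subst card_Un_disjoint, auto simp: card_image inj)
    also have "... = (if p dvd a then a else a - 1) + (if p dvd b then b else b - 1)" using a2 b2 by (subst (1 2) card_one_out) auto
    finally show ?thesis using False a2 b2 by auto
  qed
qed

end

section \<open>Tensoring complexes with the regular bimodule\<close>

context envalg
begin

abbreviation "sc == %c b. (c \<odot> \<one>) \<odot>\<^sub>AA b"
abbreviation "BT N == tensor_space Ae sc (env_right AA) N"
abbreviation "BM == tensor_map_right Ae (env_right AA)"
abbreviation "pt == pure_tensor Ae (env_right AA)"

lemma sc_eq: "[|c .: K; b .: A|] ==> sc c b = c \<odot> b"
  by (simp add: reg_simps smult_mult_left)

lemma tensor_product_env: "left_module Ae N ==> tensor_product Ae (env_right AA) N"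
  by (intro tensor_product.intro abelian_group_right left_module_abelian)
    (auto simp: reg_simps ract_closed left_module.lsmult_closed)

lemma tensor_scalars_env:
  assumes N: "left_module Ae N" shows "tensor_scalars Ae (env_right AA) N K sc"
proof (intro tensor_scalars.intro tensor_scalars_axioms.intro tensor_product_env[OF N] V.R.is_cring)
qed (simp_all only: reg_simps(1-6) sc_eq V.smult_closed V.smult_r_distr V.smult_l_distr V.smult_assoc1 V.smult_one
    ract_smult ract_closed A.a_closed V.R.add.m_closed V.R.m_closed V.R.one_closed)

context
  fixes N :: "('a env, 'n) module"
  assumes N: "left_module Ae N"
begin

interpretation TS: tensor_scalars Ae "env_right AA" N K sc by (rule tensor_scalars_env[OF N])

lemmas BT_module = TS.module_tensor
  and BT_induct = TS.tensor_induct[where sc = sc] and BT_eqI = TS.tensor_hom_eqI[where sc = sc]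
  and BT_induced = TS.tensor_induced_hom(1,2)[where sc = sc, unfolded reg_simps(1-6)] TS.tensor_induced_hom(3)[unfolded reg_simps(1-6)]
  and BT_pure = TS.pure_closed[where sc = sc, unfolded reg_simps(1-6)]
    TS.pure_add_left[where sc = sc, unfolded reg_simps(1-6)] TS.pure_add_right[where sc = sc, unfolded reg_simps(1-6)]
    TS.pure_middle[unfolded reg_simps(1-6)] and BT_smult_add = TS.smult_add and BT_smult_closed = TS.smult_closed

lemma BT_abelian: "abelian_group (BT N)" by (rule TS.abelian_group_tensor)

lemma BT_smult_pure: "[|c .: K; b .: A; t .: N|] ==> c \<odot>\<^sub>(BT N) pt N b t = pt N (c \<odot> b) t"
  using TS.smult_pure[of c b t] by (simp only: reg_simps(1-6) sc_eq)

end

lemma BM: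
  fixes N :: "('a env, 'n1) module" and N' :: "('a env, 'n2) module"
  assumes N: "left_module Ae N" and N': "left_module Ae N'" and h: "h \<in> module_hom Ae N N'" shows BM_closed: "X .: (BT N) ==> BM N' h X .: (BT N')"
    and BM_add: "[|X .: (BT N); Y .: (BT N)|] ==> BM N' h (X \<oplus>\<^sub>(BT N) Y) = BM N' h X \<oplus>\<^sub>(BT N') BM N' h Y"
    and BM_pure: "[|b .: A; t .: N|] ==> BM N' h (pt N b t) = pt N' b (h t)" and BM_zero: "BM N' h \<zero>\<^sub>(BT N) = \<zero>\<^sub>(BT N')"
proof -
  interpret tensor_map Ae "env_right AA" N N' h by (intro tensor_map.intro tensor_map_axioms.intro tensor_product_env N N' h)
  show 1: "X .: (BT N) ==> BM N' h X .: (BT N')" for X by (rule map_right_closed)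
  show 2: "[|X .: (BT N); Y .: (BT N)|] ==> BM N' h (X \<oplus>\<^sub>(BT N) Y) = BM N' h X \<oplus>\<^sub>(BT N') BM N' h Y" for X Y by (rule map_right_add)
  show "[|b .: A; t .: N|] ==> BM N' h (pt N b t) = pt N' b (h t)" using map_right_pure[of b t] by (simp add: reg_simps)
  show "BM N' h \<zero>\<^sub>(BT N) = \<zero>\<^sub>(BT N')" by (rule additive_zero[OF BT_abelian[OF N] BT_abelian[OF N']]) (simp_all only: 1 2)
qed

lemma BM_smult:
  fixes N :: "('a env, 'n1) module" and N' :: "('a env, 'n2) module"
  assumes N: "left_module Ae N" and N': "left_module Ae N'" and h: "h \<in> module_hom Ae N N'" and c: "c .: K" and X: "X .: (BT N)"
  shows "BM N' h (c \<odot>\<^sub>(BT N) X) = c \<odot>\<^sub>(BT N') BM N' h X" using X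
proof (induction rule: BT_induct[OF N, consumes 1, case_names pure add])
  case (pure b t)
  then show ?case using c module_hom_mem[OF h] by (simp only: reg_simps(1-6) BT_smult_pure[OF N] BT_smult_pure[OF N'] BM_pure[OF N N' h] V.smult_closed)
next
  case (add X Y)
  then show ?case using c by (simp only: BT_smult_add[OF N] BT_smult_add[OF N'] BM_add[OF N N' h] BM_closed[OF N N' h] BT_smult_closed[OF N])
qed

text \<open>Functoriality in the form of commutative squares; with a zero map and an identity as the
  second path it also shows that a composite vanishes.\<close>

lemma BM_compose:
  fixes N :: "('a env, 'n1) module" and N' :: "('a env, 'n2) module" and L :: "('a env, 'n3) module" and N'' :: "('a env, 'n4) module"
  assumes N: "left_module Ae N" and N': "left_module Ae N'" and N'': "left_module Ae N''"
    and h: "h \<in> module_hom Ae N N'" and h': "h' \<in> module_hom Ae N' N''" and g: "g \<in> module_hom Ae N L"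
    and g': "g' \<in> module_hom Ae L N''" and L: "left_module Ae L" and e: "!!x. x .: N ==> h' (h x) = g' (g x)" and X: "X .: (BT N)"
  shows "BM N'' h' (BM N' h X) = BM N'' g' (BM L g X)" using X by (rule BT_eqI[OF N BT_abelian[OF N''], rotated 3])
    (simp_all only: reg_simps(1,2) BM_add[OF N N' h] BM_add[OF N' N'' h'] BM_add[OF N L g] BM_add[OF L N'' g'] BM_closed[OF N N' h]
      BM_closed[OF N L g] BM_pure[OF N N' h] BM_pure[OF N' N'' h'] BM_pure[OF N L g] BM_pure[OF L N'' g']
      module_hom_mem[OF h] module_hom_mem[OF g] e)

text \<open>The homotopy relation after tensoring, for an element killed by the outgoing
  differential \<open>t\<close>: the term \<open>t'\<close> after \<open>t\<close> drops out, and
  the round trip differs from the identity by a boundary.\<close>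

lemma BM_homotopy:
  fixes N :: "('a env, 'n1) module" and L :: "('a env, 'n2) module" and U :: "('a env, 'n3) module" and V :: "('a env, 'n4) module"
  assumes N: "left_module Ae N" and L: "left_module Ae L" and U: "left_module Ae U" and V: "left_module Ae V"
    and f: "f \<in> module_hom Ae N L" and g: "g \<in> module_hom Ae L N"
    and s: "s \<in> module_hom Ae N U" and s': "s' \<in> module_hom Ae U N" and t: "t \<in> module_hom Ae N V" and t': "t' \<in> module_hom Ae V N"
    and e: "!!x. x .: N ==> g (f x) \<ominus>\<^sub>N x = s' (s x) \<oplus>\<^sub>N t' (t x)" and X: "X .: (BT N)" and 0: "BM V t X = \<zero>\<^sub>(BT V)"
  shows "BM N g (BM L f X) = X \<oplus>\<^sub>(BT N) BM N s' (BM U s X)"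
proof -
  interpret N: abelian_group N by (rule left_module_abelian[OF N])
  interpret B: abelian_group "BT N" by (rule BT_abelian[OF N])
  have e': "g (f x) = x \<oplus>\<^sub>N (s' (s x) \<oplus>\<^sub>N t' (t x))" if x: "x .: N" for x
    using e[OF x, symmetric] x module_hom_mem[OF f x] module_hom_mem[OF g] by (simp add: N.add_diff_cancel)
  have "BM N g (BM L f X) = X \<oplus>\<^sub>(BT N) (BM N s' (BM U s X) \<oplus>\<^sub>(BT N) BM N t' (BM V t X))"
  proof (rule BT_eqI[OF N BT_abelian[OF N] _ _ _ X])
    fix b x assume "b .: (env_right AA)" and x: "x .: N"
    then have b: "b .: A" by (simp add: reg_simps)
    show "BM N g (BM L f (pt N b x)) = pt N b x \<oplus>\<^sub>(BT N) (BM N s' (BM U s (pt N b x)) \<oplus>\<^sub>(BT N) BM N t' (BM V t (pt N b x)))"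
      using b x module_hom_mem[OF f x] module_hom_mem[OF s x] module_hom_mem[OF t x] module_hom_mem[OF s'] module_hom_mem[OF t']
      by (simp only: BM_pure[OF N L f] BM_pure[OF L N g] BM_pure[OF N U s] BM_pure[OF U N s'] BM_pure[OF N V t] BM_pure[OF V N t']
        e' BT_pure(3)[OF N] N.a_closed)
  next
    fix X Y assume c: "X .: (BT N)" "Y .: (BT N)"
    show "BM N g (BM L f (X \<oplus>\<^sub>(BT N) Y)) = BM N g (BM L f X) \<oplus>\<^sub>(BT N) BM N g (BM L f Y)"
      using c by (simp only: BM_add[OF N L f] BM_add[OF L N g] BM_closed[OF N L f])
    show "(X \<oplus>\<^sub>(BT N) Y) \<oplus>\<^sub>(BT N) (BM N s' (BM U s (X \<oplus>\<^sub>(BT N) Y)) \<oplus>\<^sub>(BT N) BM N t' (BM V t (X \<oplus>\<^sub>(BT N) Y)))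
      = (X \<oplus>\<^sub>(BT N) (BM N s' (BM U s X) \<oplus>\<^sub>(BT N) BM N t' (BM V t X))) \<oplus>\<^sub>(BT N) (Y \<oplus>\<^sub>(BT N) (BM N s' (BM U s Y) \<oplus>\<^sub>(BT N) BM N t' (BM V t Y)))"
      using c by (simp only: BM_add[OF N U s] BM_add[OF U N s'] BM_add[OF N V t] BM_add[OF V N t'] BM_closed[OF N U s] BM_closed[OF U N s']
        BM_closed[OF N V t] BM_closed[OF V N t'] B.a_ac B.a_closed)
  qed
  then show ?thesis using X BM_closed[OF N U s X] BM_closed[OF U N s'] by (simp only: 0 BM_zero[OF V N t'] B.r_zero)
qed

text \<open>The homology for \<open>T\<close> is measured by functionals that live on another
  complete resolution \<open>S\<close>, pulled back along a comparison map. By the homotopy on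
  \<open>T\<close>, a cycle bounds there exactly when its image bounds for \<open>S\<close>. Dual
  vectors are carried back by the reverse map, and the homotopy on \<open>S\<close> shows that the
  functionals do not notice the detour.\<close>

theorem tate_hochschild_dimension:
  fixes T :: "int => ('a env, 't) module" and S :: "int => ('a env, 's) module"
  assumes K: "field K" and T: "complete_resolution Ae (env_left AA) T d" and S: "complete_resolution Ae (env_left AA) S d'" and W: "finite W"
    and pc: "!!w X. X .: (BT (S n)) ==> \<pi> w X .: K"
    and padd: "!!w X Y. [|X .: (BT (S n)); Y .: (BT (S n))|] ==> \<pi> w (X \<oplus>\<^sub>(BT (S n)) Y) = \<pi> w X \<oplus>\<^sub>K \<pi> w Y"
    and psm: "!!w c X. [|c .: K; X .: (BT (S n))|] ==> \<pi> w (c \<odot>\<^sub>(BT (S n)) X) = c \<otimes>\<^sub>K \<pi> w X"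
    and ker: "!!X. [|X .: (BT (S n)); BM (S (n - 1)) (d' n) X = \<zero>\<^sub>(BT (S (n - 1)))|]
      ==> (\<exists>Y\<in>carrier (BT (S (n + 1))). BM (S n) (d' (n + 1)) Y = X) \<longleftrightarrow> (\<forall>w\<in>W. \<pi> w X = \<zero>\<^sub>K)"
    and onto: "!!w. w \<in> W ==> \<exists>X\<in>carrier (BT (S n)). BM (S (n - 1)) (d' n) X = \<zero>\<^sub>(BT (S (n - 1))) \<and>
      (\<forall>w'\<in>W. \<pi> w' X = (if w' = w then \<one>\<^sub>K else \<zero>\<^sub>K))"
  shows "has_dimension K (tate_hochschild_homology K A AA T d n) (card W)"
proof -
  interpret KF: field K by (rule K)
  obtain eta where "cres Ae (env_left AA) T d eta" using complete_resolution_cres[OF left_module_A T] by blast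
  then interpret T: cres Ae "env_left AA" T d eta .
  obtain eta' where "cres Ae (env_left AA) S d' eta'" using complete_resolution_cres[OF left_module_A S] by blast
  then interpret S: cres Ae "env_left AA" S d' eta' .
  interpret TS: cres_pair Ae "env_left AA" T d eta S d' eta' ..
  interpret ST: cres_pair Ae "env_left AA" S d' eta' T d eta ..
  obtain \<phi> where \<phi>: "!!n. \<phi> n \<in> module_hom Ae (T n) (S n)"
      "!!n x. x .: (T (n + 1)) ==> \<phi> n (d (n + 1) x) = d' (n + 1) (\<phi> (n + 1) x)"
      "!!x. x .: (T 0) ==> eta' (\<phi> 0 x) = eta x" using TS.chain_map_exists by blast
  obtain \<psi> where \<psi>: "!!n. \<psi> n \<in> module_hom Ae (S n) (T n)"
      "!!n x. x .: (S (n + 1)) ==> \<psi> n (d' (n + 1) x) = d (n + 1) (\<psi> (n + 1) x)"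
      "!!x. x .: (S 0) ==> eta (\<psi> 0 x) = eta' x" using ST.chain_map_exists by blast
  note \<phi>m = module_hom_mem[OF \<phi>(1)] and \<psi>m = module_hom_mem[OF \<psi>(1)]
  obtain h where h: "!!n. h n \<in> module_hom Ae (T n) (T (n + 1))"
      "!!n x. x .: (T n) ==> \<psi> n (\<phi> n x) \<ominus>\<^sub>(T n) x = d (n + 1) (h n x) \<oplus>\<^sub>(T n) h (n - 1) (d n x)"
    using cres_homotopy[OF T.cres_axioms, of "%n x. \<psi> n (\<phi> n x)"] module_hom_compose[OF \<phi>(1) \<psi>(1)]
      \<phi>m \<psi>m T.d_mem' by (simp add: \<phi>(2,3) \<psi>(2,3)) blast
  obtain k where k: "!!n. k n \<in> module_hom Ae (S n) (S (n + 1))"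
      "!!n x. x .: (S n) ==> \<phi> n (\<psi> n x) \<ominus>\<^sub>(S n) x = d' (n + 1) (k n x) \<oplus>\<^sub>(S n) k (n - 1) (d' n x)"
    using cres_homotopy[OF S.cres_axioms, of "%n x. \<phi> n (\<psi> n x)"] module_hom_compose[OF \<psi>(1) \<phi>(1)]
      \<phi>m \<psi>m S.d_mem' by (simp add: \<phi>(2,3) \<psi>(2,3)) blast
  have h': "h (n - 1) \<in> module_hom Ae (T (n - 1)) (T n)" and k': "k (n - 1) \<in> module_hom Ae (S (n - 1)) (S n)" for n
    using h(1)[of "n - 1"] k(1)[of "n - 1"] by simp_all
  define dT where "dT n = BM (T (n - 1)) (d n)" for n
  define dS where "dS n = BM (S (n - 1)) (d' n)" for n
  define \<Phi> where "\<Phi> n = BM (S n) (\<phi> n)" for n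
  define \<Psi> where "\<Psi> n = BM (T n) (\<psi> n)" for n
  note cT = BM_closed[OF T.T T.T T.d, folded dT_def] and aT = BM_add[OF T.T T.T T.d, folded dT_def]
    and zT = BM_zero[OF T.T T.T T.d, folded dT_def] and sT = BM_smult[OF T.T T.T T.d, folded dT_def]
  note cP = BM_closed[OF T.T S.T \<phi>(1), folded \<Phi>_def] and aP = BM_add[OF T.T S.T \<phi>(1), folded \<Phi>_def]
    and zP = BM_zero[OF T.T S.T \<phi>(1), folded \<Phi>_def] and sP = BM_smult[OF T.T S.T \<phi>(1), folded \<Phi>_def]
  note cQ = BM_closed[OF S.T T.T \<psi>(1), folded \<Psi>_def] and zQ = BM_zero[OF S.T T.T \<psi>(1), folded \<Psi>_def]
  have dP: "dS n (\<Phi> n X) = \<Phi> (n - 1) (dT n X)" if "X .: (BT (T n))" for n X unfolding dS_def dT_def \<Phi>_def using \<phi>(2)[of _ "n - 1"] that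
    by (intro BM_compose[OF T.T S.T S.T \<phi>(1) S.d T.d \<phi>(1) T.T]) simp_all
  have dQ: "dT n (\<Psi> n X) = \<Psi> (n - 1) (dS n X)" if "X .: (BT (S n))" for n X unfolding dS_def dT_def \<Psi>_def using \<psi>(2)[of _ "n - 1"] that
    by (intro BM_compose[OF S.T T.T T.T \<psi>(1) T.d S.d \<psi>(1) S.T]) simp_all
  have dd: "dT n (dT (n + 1) X) = \<zero>\<^sub>(BT (T (n - 1)))" if X: "X \<in> carrier (BT (T (n + 1)))" for X
  proof -
    \<comment> \<open>The zero map is factored as zero followed by the identity, to fit the square
      in \<open>BM_compose\<close>.\<close>
    let ?z = "%x. \<zero>\<^sub>(T (n - 1))" and ?z' = "%x. x"
    have z: "?z \<in> module_hom Ae (T (n + 1)) (T (n - 1))" by (rule module_hom_const_zero[OF T.T])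
    have "dT n (dT (n + 1) X) = BM (T (n - 1)) ?z' (BM (T (n - 1)) ?z X)" unfolding dT_def using X T.dd T.d[of "n + 1"] T.d[of n]
      by (intro BM_compose[OF T.T T.T T.T _ _ z module_hom_id T.T]) simp_all
    moreover have "BM (T (n - 1)) ?z X = \<zero>\<^sub>(BT (T (n - 1)))"
    proof (rule BT_eqI[OF T.T BT_abelian[OF T.T] _ _ _ X])
      interpret B: abelian_group "BT (T (n - 1))" by (rule BT_abelian[OF T.T])
      interpret L: left_module Ae "T (n - 1)" by (rule T.T)
      show "\<zero>\<^sub>(BT (T (n - 1))) = \<zero>\<^sub>(BT (T (n - 1))) \<oplus>\<^sub>(BT (T (n - 1))) \<zero>\<^sub>(BT (T (n - 1)))" by simp
      fix b t assume bt: "b .: (env_right AA)" "t .: (T (n + 1))"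
      have "pt (T (n - 1)) b \<zero>\<^sub>(T (n - 1)) = \<zero>\<^sub>(BT (T (n - 1)))"
        by (rule additive_zero[OF left_module_abelian[OF T.T] BT_abelian[OF T.T]])
          (use bt in \<open>simp_all only: reg_simps(1-6) BT_pure[OF T.T]\<close>)
      then show "BM (T (n - 1)) ?z (pt (T (n + 1)) b t) = \<zero>\<^sub>(BT (T (n - 1)))" using bt by (simp only: reg_simps(1-6) BM_pure[OF T.T T.T z])
    qed (simp add: BM_add[OF T.T T.T z])
    ultimately show ?thesis by (simp add: BM_zero[OF T.T T.T module_hom_id])
  qed
  have hT: "\<exists>Y\<in>carrier (BT (T (n + 1))). \<Psi> n (\<Phi> n X) = X \<oplus>\<^sub>(BT (T n)) dT (n + 1) Y"
    if "X .: (BT (T n))" "dT n X = \<zero>\<^sub>(BT (T (n - 1)))" for X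
    using that BM_homotopy[OF T.T S.T T.T T.T \<phi>(1) \<psi>(1) h(1) T.d' T.d h' h(2)] BM_closed[OF T.T T.T h(1)]
    unfolding \<Psi>_def \<Phi>_def dT_def by auto
  have hS: "\<exists>Y\<in>carrier (BT (S (n + 1))). \<Phi> n (\<Psi> n X) = X \<oplus>\<^sub>(BT (S n)) dS (n + 1) Y"
    if "X .: (BT (S n))" "dS n X = \<zero>\<^sub>(BT (S (n - 1)))" for X
    using that BM_homotopy[OF S.T T.T S.T S.T \<psi>(1) \<phi>(1) k(1) S.d' S.d k' k(2)] BM_closed[OF S.T S.T k(1)]
    unfolding \<Psi>_def \<Phi>_def dS_def by auto
  let ?Z = "cycles (%n. BT (T n)) dT n" and ?B = "boundaries (%n. BT (T n)) dT n"
  have Z: "X \<in> ?Z \<longleftrightarrow> X .: (BT (T n)) & dT n X = \<zero>\<^sub>(BT (T (n - 1)))" for X by (auto simp: cycles_def)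
  interpret B: module K "BT (T n)" by (rule BT_module[OF T.T])
  interpret B': module K "BT (T (n - 1))" by (rule BT_module[OF T.T])
  have B: "X \<in> ?B \<longleftrightarrow> (\<exists>Y\<in>carrier (BT (S (n + 1))). dS (n + 1) Y = \<Phi> n X)" if X: "X \<in> ?Z" for X
  proof
    assume "X \<in> ?B"
    then obtain Y where Y: "Y \<in> carrier (BT (T (n + 1)))" "X = dT (n + 1) Y" by (auto simp: boundaries_def)
    then show "\<exists>Y\<in>carrier (BT (S (n + 1))). dS (n + 1) Y = \<Phi> n X"
      using dP[OF Y(1)] cP[OF Y(1)] by (intro bexI[of _ "\<Phi> (n + 1) Y"]) simp_all
  next
    assume "\<exists>Y\<in>carrier (BT (S (n + 1))). dS (n + 1) Y = \<Phi> n X"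
    then obtain Y where Y: "Y \<in> carrier (BT (S (n + 1)))" "dS (n + 1) Y = \<Phi> n X" by blast
    obtain P where P: "P \<in> carrier (BT (T (n + 1)))" "\<Psi> n (\<Phi> n X) = X \<oplus>\<^sub>(BT (T n)) dT (n + 1) P" using hT X Z by blast
    interpret B1: abelian_group "BT (T (n + 1))" by (rule BT_abelian[OF T.T])
    have c: "\<Psi> (n + 1) Y \<in> carrier (BT (T (n + 1)))" by (rule cQ[OF Y(1)])
    have dTc: "U \<in> carrier (BT (T (n + 1))) ==> dT (n + 1) U .: (BT (T n))" for U using cT[of U "n + 1"] by simp
    have q: "dT (n + 1) (\<Psi> (n + 1) Y) = X \<oplus>\<^sub>(BT (T n)) dT (n + 1) P" using dQ[OF Y(1)] Y(2) P(2) by simp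
    \<comment> \<open>\<open>\<Psi> (n + 1) Y\<close> bounds the round trip of \<open>X\<close>,
      which is off by the boundary of \<open>P\<close>; subtracting \<open>P\<close> corrects
      this.\<close>
    have "dT (n + 1) (\<Psi> (n + 1) Y \<ominus>\<^sub>(BT (T (n + 1))) P) = dT (n + 1) (\<Psi> (n + 1) Y) \<ominus>\<^sub>(BT (T n)) dT (n + 1) P"
      using c P(1) dTc aT[of _ "n + 1"] by (intro additive_diff[OF BT_abelian[OF T.T] BT_abelian[OF T.T]]) simp_all
    also have "... = X" unfolding q using X dTc[OF P(1)] by (simp add: Z a_minus_def B.a_assoc B.r_neg)
    finally have e: "dT (n + 1) (\<Psi> (n + 1) Y \<ominus>\<^sub>(BT (T (n + 1))) P) = X" .
    show "X \<in> ?B" unfolding boundaries_def by (rule image_eqI[where f = "dT (n + 1)", OF e[symmetric]]) (rule B1.minus_closed[OF c P(1)])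
  qed
  have \<Phi>Z: "\<Phi> n X .: (BT (S n)) & dS n (\<Phi> n X) = \<zero>\<^sub>(BT (S (n - 1)))" if "X \<in> ?Z" for X using that cP dP zP by (simp add: Z)
  have "has_dimension K (quotient_module ((BT (T n))\<lparr>carrier := ?Z\<rparr>) ?B) (card W)"
  proof (rule has_dimension_quotient[OF K BT_module[OF T.T] _ _ _ _ _ W, where \<pi> = "%w X. \<pi> w (\<Phi> n X)"])
    show "?Z \<subseteq> carrier (BT (T n))" by (auto simp: cycles_def)
    show "\<zero>\<^sub>(BT (T n)) \<in> ?Z" by (simp add: Z zT)
    show "X \<oplus>\<^sub>(BT (T n)) Y \<in> ?Z" if "X \<in> ?Z" "Y \<in> ?Z" for X Y using that by (simp add: Z aT)
    show "c \<odot>\<^sub>(BT (T n)) X \<in> ?Z" if "c .: K" "X \<in> ?Z" for c X using that by (simp add: Z sT B'.smult_r_null)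
    show "?B \<subseteq> ?Z"
    proof
      fix X assume "X \<in> ?B"
      then obtain Y where "Y \<in> carrier (BT (T (n + 1)))" "X = dT (n + 1) Y" by (auto simp: boundaries_def)
      then show "X \<in> ?Z" using dd cT[of Y "n + 1"] by (simp add: Z)
    qed
    show "\<pi> w (\<Phi> n X) .: K" if "X \<in> ?Z" for w X using that by (intro pc cP) (simp add: Z)
    show "\<pi> w (\<Phi> n (X \<oplus>\<^sub>(BT (T n)) Y)) = \<pi> w (\<Phi> n X) \<oplus>\<^sub>K \<pi> w (\<Phi> n Y)" if "X \<in> ?Z" "Y \<in> ?Z" for w X Y
      using that by (simp add: Z aP padd cP)
    show "\<pi> w (\<Phi> n (c \<odot>\<^sub>(BT (T n)) X)) = c \<otimes>\<^sub>K \<pi> w (\<Phi> n X)" if "c .: K" "X \<in> ?Z" for w c X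
      using that by (simp add: Z sP psm cP)
    show "X \<in> ?B \<longleftrightarrow> (\<forall>w\<in>W. \<pi> w (\<Phi> n X) = \<zero>\<^sub>K)" if "X \<in> ?Z" for X
      unfolding B[OF that] using \<Phi>Z[OF that] ker[of "\<Phi> n X"] by (simp add: dS_def)
    show "\<exists>X\<in>?Z. \<forall>w'\<in>W. \<pi> w' (\<Phi> n X) = (if w' = w then \<one>\<^sub>K else \<zero>\<^sub>K)" if w: "w \<in> W" for w
    proof -
      obtain X where X: "X .: (BT (S n))" "dS n X = \<zero>\<^sub>(BT (S (n - 1)))"
          "!!w'. w' \<in> W ==> \<pi> w' X = (if w' = w then \<one>\<^sub>K else \<zero>\<^sub>K)" using onto[OF w] by (auto simp: dS_def)
      obtain P where P: "P \<in> carrier (BT (S (n + 1)))" "\<Phi> n (\<Psi> n X) = X \<oplus>\<^sub>(BT (S n)) dS (n + 1) P" using hS[OF X(1,2)] by blast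
      have Q: "\<Psi> n X \<in> ?Z" using X(1,2) dQ[OF X(1)] zQ cQ by (simp add: Z)
      interpret C: abelian_group "BT (S n)" by (rule BT_abelian[OF S.T])
      have dP: "dS (n + 1) P .: (BT (S n))" unfolding dS_def using BM_closed[OF S.T S.T S.d[of "n + 1"] P(1)] by simp
      have aS: "dS n (X \<oplus>\<^sub>(BT (S n)) dS (n + 1) P) = dS n X \<oplus>\<^sub>(BT (S (n - 1))) dS n (dS (n + 1) P)"
        using BM_add[OF S.T S.T S.d[of n] X(1) dP] by (simp add: dS_def)
      interpret C': abelian_group "BT (S (n - 1))" by (rule BT_abelian[OF S.T])
      have "dS n (dS (n + 1) P) \<in> carrier (BT (S (n - 1)))" using BM_closed[OF S.T S.T S.d[of n] dP] by (simp add: dS_def)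
      \<comment> \<open>Both \<open>X\<close> and its round trip are cycles, so the correction term
        is one as well; being a boundary, it is invisible to the functionals.\<close>
      then have "dS n (dS (n + 1) P) = \<zero>\<^sub>(BT (S (n - 1)))" using \<Phi>Z[OF Q] aS X(2) by (simp add: P(2))
      then have "\<pi> w' (dS (n + 1) P) = \<zero>\<^sub>K" if "w' \<in> W" for w' using ker[OF dP] P(1) that by (auto simp: dS_def)
      then have "\<pi> w' (\<Phi> n (\<Psi> n X)) = (if w' = w then \<one>\<^sub>K else \<zero>\<^sub>K)" if "w' \<in> W" for w'
        using that X(3)[OF that] by (simp add: P(2) padd[OF X(1) dP])
      then show ?thesis using Q by blast
    qed
  qed
  then show ?thesis by (simp add: tate_hochschild_homology_def homology_def dT_def[abs_def])
qed

end

section \<open>The Tate-Hochschild homology of the quantum complete intersection\<close>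

context qalg_generic
begin

abbreviation "SM n == fmod Ae (FR.rk n)"
abbreviation "SD n == mat_map Ae (FR.rk n) (FR.rk (n - 1)) (FR.Dm n)"

lemma SM: "left_module Ae (SM n)" by (rule left_module_free[OF Ae.ring_A])

lemma SD: "SD n \<in> module_hom Ae (SM n) (SM (n - 1))" by (rule Ae.A.mat_map_hom[OF FR.Dm_closed])

lemma SM_mem: "f .: (SM n) ==> f i .: Ae" by (auto simp: free_module_carrier)

lemma abelian_C: "abelian_group (C n)" by (rule left_module_abelian[OF left_module_free[OF ring_A]])

text \<open>The isomorphism from \<open>A \<otimes> T\<close> in degree \<open>n\<close> to rows
  over \<open>A\<close>, by the right action on coordinates. \<open>Xi\<close> is its inverse and
  \<open>bar\<close> the transported differential.\<close>

definition Th :: "int => ('a \<times> (nat => 'a env) \<Rightarrow>\<^sub>0 int) set => nat => 'a"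
  where "Th n = tensor_induced (C n) (%(z, f) i. ract z (f i))"

lemma ract_zero: "z .: A ==> ract z \<zero>\<^sub>Ae = \<zero>"
  by (rule additive_zero[OF aE aA]) (simp_all add: ract_closed ract_add)

lemma Th:
  shows Th_closed: "X .: (BT (SM n)) ==> Th n X .: (C n)"
    and Th_add: "[|X .: (BT (SM n)); Y .: (BT (SM n))|] ==> Th n (X \<oplus>\<^sub>(BT (SM n)) Y) = (%i. Th n X i \<oplus> Th n Y i)"
    and Th_pure: "[|z .: A; f .: (SM n)|] ==> Th n (pt (SM n) z f) = (%i. ract z (f i))"
proof -
  have 1: "(%i. ract z (f i)) .: (C n)" if "z .: A" "f .: (SM n)" for z f
    using that SM_mem[OF that(2)] by (auto simp: C_iff ract_closed fmod_carrier[OF Ae.ring_A] rk_lev ract_zero)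
  note B = BT_induced[OF SM abelian_C[of n], where g = "%(z, f) i. ract z (f i)", folded Th_def, unfolded prod.case, of n]
  note p = 1 ract_add_left ract_add ract_mult SM_mem free_module_simps
  show "X .: (BT (SM n)) ==> Th n X .: (C n)" by (rule B(1)) (simp_all add: p)
  show "[|X .: (BT (SM n)); Y .: (BT (SM n))|] ==> Th n (X \<oplus>\<^sub>(BT (SM n)) Y) = (%i. Th n X i \<oplus> Th n Y i)"
    by (rule trans[OF B(2)]) (simp_all add: p)
  show "[|z .: A; f .: (SM n)|] ==> Th n (pt (SM n) z f) = (%i. ract z (f i))" by (rule B(3)) (simp_all add: p)
qed

lemma Th_smult:
  assumes X: "X .: (BT (SM n))" and c: "c .: K" shows "Th n (c \<odot>\<^sub>(BT (SM n)) X) = (%i. c \<odot> Th n X i)" using X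
proof (induction rule: BT_induct[OF SM, consumes 1, case_names pure add])
  case (pure z f)
  then have "z .: A" "f .: (SM n)" by (simp_all only: reg_simps(1-6))
  then show ?case using c SM_mem[of f n] by (simp only: BT_smult_pure[OF SM] Th_pure V.smult_closed ract_smult)
next
  case (add X Y)
  then show ?case using c C_mem[OF Th_closed] by (simp only: BT_smult_add[OF SM] BT_smult_closed[OF SM] Th_add V.smult_r_distr)
qed

lemma bar_add: "[|g .: (C n); g' .: (C n)|] ==> bar n (%i. g i \<oplus> g' i) = (%j. bar n g j \<oplus> bar n g' j)"
  using C_mem by (intro ext) (simp add: bar_def ract_add_left FR.Dm_closed ract_closed A.finsum_addf Pi_iff)

lemma Th_SD:
  assumes X: "X .: (BT (SM n))" shows "Th (n - 1) (BM (SM (n - 1)) (SD n) X) = bar n (Th n X)" using X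
proof (induction rule: BT_induct[OF SM, consumes 1, case_names pure add])
  case (pure z f)
  then have z: "z .: A" and f: "f .: (SM n)" by (simp_all only: reg_simps(1-6))
  have "ract z (SD n f j) = bar n (%i. ract z (f i)) j" for j using z SM_mem[OF f] FR.Dm_closed
    by (simp add: mat_map_def bar_def rk_lev ract_zero ract_finsum ract_mult)
  then show ?case using z f module_hom_mem[OF SD f] by (simp only: BM_pure[OF SM SM SD] Th_pure)
next
  case (add X Y)
  then show ?case by (simp only: BM_add[OF SM SM SD] BM_closed[OF SM SM SD] Th_add bar_add Th_closed)
qed

definition Xi :: "int => (nat => 'a) => ('a \<times> (nat => 'a env) \<Rightarrow>\<^sub>0 int) set"
  where "Xi n g = (\<Oplus>\<^sub>(BT (SM n))i\<in>{..<FR.rk n}. pt (SM n) (g i) (unit_vector Ae i))"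

lemma unit_closed: "i < FR.rk n ==> unit_vector Ae i .: (SM n)"
  by (intro unit_vector_closed Ae.ring_A) simp

lemma pt_unit: "[|i < FR.rk n; z .: A|] ==> pt (SM n) z (unit_vector Ae i) .: (BT (SM n))"
  by (intro BT_pure(1)[OF SM] unit_closed)

lemma Xi_closed: "g .: (C n) ==> Xi n g .: (BT (SM n))"
proof -
  assume g: "g .: (C n)"
  interpret B: abelian_group "BT (SM n)" by (rule BT_abelian[OF SM])
  show ?thesis unfolding Xi_def using C_mem[OF g] pt_unit by (intro B.finsum_closed) auto
qed

lemma Th_Xi: assumes g: "g .: (C n)" shows "Th n (Xi n g) = g"
proof -
  interpret C: abelian_group "C n" by (rule abelian_C)
  have e: "pt (SM n) (g i) (unit_vector Ae i) .: (BT (SM n))" if "i < FR.rk n" for i using that C_mem[OF g] by (rule pt_unit)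
  have c: "Th n (pt (SM n) (g i) (unit_vector Ae i)) .: (C n)" if "i \<in> {..<FR.rk n}" for i using that by (intro Th_closed e) simp
  have eval: "(\<Oplus>\<^sub>(C n)i\<in>I. u i) j = (\<Oplus>i\<in>I. u i j)" if "!!i. i \<in> I ==> u i .: (C n)" for I and u :: "nat => nat => 'a" and j
    using that C_mem by (intro additive_finsum[OF abelian_C aA, where f = "%g. g j"]) (auto simp: free_module_simps)
  have "Th n (Xi n g) = (\<Oplus>\<^sub>(C n)i\<in>{..<FR.rk n}. Th n (pt (SM n) (g i) (unit_vector Ae i)))" unfolding Xi_def using e
    by (intro additive_finsum[OF BT_abelian[OF SM] abelian_C]) (simp_all only: Th_closed Th_add free_module_simps lessThan_iff)
  then have "Th n (Xi n g) j = (\<Oplus>i\<in>{..<FR.rk n}. Th n (pt (SM n) (g i) (unit_vector Ae i)) j)" for j by (simp only: eval[OF c])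
  also have "... j = (\<Oplus>i\<in>{..<FR.rk n}. if j = i then g i else \<zero>)" for j using C_mem[OF g] unit_closed
    by (intro A.finsum_eqI) (auto simp: Th_pure unit_vector_def ract_one ract_zero)
  also have "... j = g j" for j
  proof (cases "j < FR.rk n")
    case True
    then show ?thesis using C_mem[OF g] by (subst A.finsum_singleton) auto
  next
    case False
    then have "(\<Oplus>i\<in>{..<FR.rk n}. if j = i then g i else \<zero>) = (\<Oplus>i\<in>{..<FR.rk n}. \<zero>)" by (intro A.finsum_eqI) auto
    then show ?thesis using False g by (simp add: C_iff rk_lev)
  qed
  finally show ?thesis by (rule ext)
qed

text \<open>The coefficients are moved across the tensor sign, after which the unit vectors
  reassemble to \<open>f\<close>.\<close>

lemma Xi_Th: assumes X: "X .: (BT (SM n))" shows "Xi n (Th n X) = X"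
proof -
  interpret B: abelian_group "BT (SM n)" by (rule BT_abelian[OF SM])
  interpret S: left_module Ae "SM n" by (rule SM)
  show ?thesis using X
  proof (induction rule: BT_induct[OF SM, consumes 1, case_names pure add])
    case (pure z f)
    then have z: "z .: A" and f: "f .: (SM n)" by (simp_all only: reg_simps(1-6))
    have c: "f i \<odot>\<^sub>(SM n) unit_vector Ae i .: (SM n)" if "i < FR.rk n" for i using SM_mem[OF f] unit_closed[OF that] by (rule S.lsmult_closed)
    have "Xi n (Th n (pt (SM n) z f)) = (\<Oplus>\<^sub>(BT (SM n))i\<in>{..<FR.rk n}. pt (SM n) (ract z (f i)) (unit_vector Ae i))"
      unfolding Xi_def by (simp only: Th_pure[OF z f])
    also have "... = (\<Oplus>\<^sub>(BT (SM n))i\<in>{..<FR.rk n}. pt (SM n) z (f i \<odot>\<^sub>(SM n) unit_vector Ae i))"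
      using z SM_mem[OF f] unit_closed c by (intro B.finsum_eqI) (simp_all only: lessThan_iff BT_pure(1,4)[OF SM])
    also have "... = pt (SM n) z (\<Oplus>\<^sub>(SM n)i\<in>{..<FR.rk n}. f i \<odot>\<^sub>(SM n) unit_vector Ae i)" using z c
      by (intro additive_finsum[OF left_module_abelian[OF SM] BT_abelian[OF SM], where f = "pt (SM n) z", symmetric])
        (simp_all only: lessThan_iff BT_pure(1,3)[OF SM])
    also have "(\<Oplus>\<^sub>(SM n)i\<in>{..<FR.rk n}. f i \<odot>\<^sub>(SM n) unit_vector Ae i) = f"
      using f by (intro free_module_hom_expansion[OF Ae.ring_A SM module_hom_id, symmetric]) (auto simp: free_module_carrier)
    finally show ?case .
  next
    case (add X Y)
    have c: "Th n X i .: A" "Th n Y i .: A" for i using add(1,2) by (auto intro: C_mem[OF Th_closed])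
    have "Xi n (Th n (X \<oplus>\<^sub>(BT (SM n)) Y))
        = (\<Oplus>\<^sub>(BT (SM n))i\<in>{..<FR.rk n}. pt (SM n) (Th n X i) (unit_vector Ae i) \<oplus>\<^sub>(BT (SM n)) pt (SM n) (Th n Y i) (unit_vector Ae i))"
      unfolding Xi_def Th_add[OF add(1,2)] using c unit_closed by (intro B.finsum_eqI) (simp_all only: lessThan_iff BT_pure(2)[OF SM] B.a_closed pt_unit)
    also have "... = Xi n (Th n X) \<oplus>\<^sub>(BT (SM n)) Xi n (Th n Y)" unfolding Xi_def using c pt_unit by (intro B.finsum_addf) auto
    finally show ?case by (simp only: add(3,4))
  qed
qed

lemma BM_SD_zero_iff:
  assumes X: "X .: (BT (SM n))" shows "BM (SM (n - 1)) (SD n) X = \<zero>\<^sub>(BT (SM (n - 1))) \<longleftrightarrow> bar n (Th n X) = (%i. \<zero>)"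
proof -
  have 0: "Th (n - 1) \<zero>\<^sub>(BT (SM (n - 1))) = (%i. \<zero>)" using additive_zero[where f = "Th (n - 1)", OF BT_abelian[OF SM] abelian_C[of "n - 1"]]
    by (simp only: Th_closed Th_add free_module_simps)
  interpret B: abelian_group "BT (SM (n - 1))" by (rule BT_abelian[OF SM])
  show ?thesis using Th_SD[OF X] 0 Xi_Th[OF BM_closed[OF SM SM SD X]] Xi_Th[OF B.zero_closed] by metis
qed

theorem tate_hochschild_dimension_generic:
  fixes T :: "int => ('a env, 't) module"
  assumes T: "complete_resolution Ae (env_left AA) T d" and ch: "has_characteristic K p"
  shows "has_dimension K (tate_hochschild_homology K A AA T d n) (card (W n))"
proof (rule tate_hochschild_dimension[OF field T FR.frob_complete_resolution card_W(1)[OF ch], where \<pi> = "%w X. co n (Th n X) w"])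
  show "co n (Th n X) w .: K" if "X .: (BT (SM n))" for w X using that by (intro co_closed Th_closed)
  show "co n (Th n (X \<oplus>\<^sub>(BT (SM n)) Y)) w = co n (Th n X) w \<oplus>\<^sub>K co n (Th n Y) w" if "X .: (BT (SM n))" "Y .: (BT (SM n))" for w X Y
    using that by (simp only: Th_add co_add Th_closed)
  show "co n (Th n (c \<odot>\<^sub>(BT (SM n)) X)) w = c \<otimes>\<^sub>K co n (Th n X) w" if "c .: K" "X .: (BT (SM n))" for w c X
    using that by (simp only: Th_smult co_smult Th_closed)
  have SD': "SD (n + 1) \<in> module_hom Ae (SM (n + 1)) (SM n)" using SD[of "n + 1"] by simp
  show "(\<exists>Y\<in>carrier (BT (SM (n + 1))). BM (SM n) (SD (n + 1)) Y = X) \<longleftrightarrow> (\<forall>w\<in>W n. co n (Th n X) w = \<zero>\<^sub>K)"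
    if X: "X .: (BT (SM n))" and 0: "BM (SM (n - 1)) (SD n) X = \<zero>\<^sub>(BT (SM (n - 1)))" for X
  proof -
    have cyc: "bar n (Th n X) = (%i. \<zero>)" using 0 BM_SD_zero_iff[OF X] by blast
    have TS: "Th n (BM (SM n) (SD (n + 1)) Y) = bar (n + 1) (Th (n + 1) Y)" if "Y \<in> carrier (BT (SM (n + 1)))" for Y using Th_SD[OF that] by simp
    have "(\<exists>Y\<in>carrier (BT (SM (n + 1))). BM (SM n) (SD (n + 1)) Y = X) \<longleftrightarrow> (\<exists>g\<in>carrier (C (n + 1)). bar (n + 1) g = Th n X)"
    proof
      assume "\<exists>Y\<in>carrier (BT (SM (n + 1))). BM (SM n) (SD (n + 1)) Y = X"
      then obtain Y where Y: "Y \<in> carrier (BT (SM (n + 1)))" "BM (SM n) (SD (n + 1)) Y = X" by blast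
      show "\<exists>g\<in>carrier (C (n + 1)). bar (n + 1) g = Th n X"
        using TS[OF Y(1), unfolded Y(2)] Th_closed[OF Y(1)] by (intro bexI[where x = "Th (n + 1) Y"]) simp_all
    next
      assume "\<exists>g\<in>carrier (C (n + 1)). bar (n + 1) g = Th n X"
      then obtain g where g: "g .: (C (n + 1))" "bar (n + 1) g = Th n X" by blast
      have "Xi n (Th n (BM (SM n) (SD (n + 1)) (Xi (n + 1) g))) = X" by (simp only: TS[OF Xi_closed[OF g(1)]] Th_Xi[OF g(1)] g(2) Xi_Th[OF X])
      then have "BM (SM n) (SD (n + 1)) (Xi (n + 1) g) = X" by (simp only: Xi_Th[OF BM_closed[OF SM SM SD' Xi_closed[OF g(1)]]])
      then show "\<exists>Y\<in>carrier (BT (SM (n + 1))). BM (SM n) (SD (n + 1)) Y = X" using Xi_closed[OF g(1)] by blast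
    qed
    then show ?thesis using bar_kernel[OF Th_closed[OF X] cyc] by simp
  qed
  show "\<exists>X\<in>carrier (BT (SM n)). BM (SM (n - 1)) (SD n) X = \<zero>\<^sub>(BT (SM (n - 1))) \<and>
      (\<forall>w'\<in>W n. co n (Th n X) w' = (if w' = w then \<one>\<^sub>K else \<zero>\<^sub>K))" if w: "w \<in> W n" for w
  proof -
    obtain g where g: "g .: (C n)" "bar n g = (%i. \<zero>)" "\<forall>w'\<in>W n. co n g w' = (if w' = w then \<one>\<^sub>K else \<zero>\<^sub>K)"
      using bar_dual[OF w] by blast
    show ?thesis using g BM_SD_zero_iff[OF Xi_closed[OF g(1)]] Xi_closed[OF g(1)] by (intro bexI[of _ "Xi n g"]) (simp_all only: Th_Xi)
  qed
qed

end

text \<open>The existence clause keeps the quantification over resolutions from being vacuous; the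
  dimension is claimed for resolutions of an arbitrary element type \<open>'t\<close>.\<close>

theorem theorem4p7:
  fixes K :: "('k, 'e) ring_scheme" and p a b :: nat and q :: 'k
  assumes "field K" and "has_characteristic K p"
    and "a \<ge> 2" and "b \<ge> 2"
    and "q \<in> carrier K" and "q \<noteq> \<zero>\<^bsub>K\<^esub>" and "\<forall>m :: nat. m > 0 \<longrightarrow> q [^]\<^bsub>K\<^esub> m \<noteq> \<one>\<^bsub>K\<^esub>"
  shows
    "let A = quantum_complete_intersection K a b q;
         Ae = enveloping K A;
         AA = regular_bimodule A
     in (\<exists>(T :: int \<Rightarrow> ('k qci env, nat \<Rightarrow> 'k qci env) module) d.
           complete_resolution Ae (env_left AA) T d) \<and>
        (\<forall>(T :: int \<Rightarrow> ('k qci env, 't) module) d. complete_resolution Ae (env_left AA) T d \<longrightarrow>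
          (\<forall>n. has_dimension K (tate_hochschild_homology K A AA T d n)
            (if n = 0 \<or> n = - 1 then
               (if p dvd a \<or> p dvd b then a + b - 1 else a + b - 2)
             else
               (if p dvd a \<and> p dvd b then a + b
                else if p dvd a \<or> p dvd b then a + b - 1
                else a + b - 2))))"
proof -
  interpret qci K a b q using assms by (intro qci.intro free_alg.intro qci_axioms.intro) auto
  interpret G: qalg_generic K QA a b q gx gy kap using assms(7) by (intro qalg_generic.intro qalg_QA qalg_generic_axioms.intro) auto
  show ?thesis unfolding Let_def
  proof (intro conjI allI impI)
    show "\<exists>(T :: int => ('k qci env, nat => 'k qci env) module) d.
        complete_resolution (enveloping K QA) (env_left (regular_bimodule QA)) T d" using G.FR.frob_complete_resolution by blast
  next
    fix T :: "int => ('k qci env, 't) module" and d and n :: int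
    assume "complete_resolution (enveloping K QA) (env_left (regular_bimodule QA)) T d"
    from G.tate_hochschild_dimension_generic[OF this assms(2), of n]
    show "has_dimension K (tate_hochschild_homology K QA (regular_bimodule QA) T d n)
        (if n = 0 | n = - 1 then (if p dvd a | p dvd b then a + b - 1 else a + b - 2)
         else (if p dvd a & p dvd b then a + b else if p dvd a | p dvd b then a + b - 1 else a + b - 2))" unfolding G.card_W(2)[OF assms(2)] .
  qed
qed

end
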